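(* For each $n$, let $A_1=A_1(n),\dots,A_k=A_k(n)$ and $B_1=B_1(n),\dots,B_\ell=B_\ell(n)$ be deterministic $n\times n$ complex matrices and let $U=U(n)$ be an $n\times n$ Haar unitary random matrix. Suppose that (1) $((A_1,\dots,A_k),\mathrm{Tr}_n)$ converges in distribution to a $k$-tuple of trace class operators as $n\to\infty$; (2) $((B_1,\dots,B_\ell),\mathrm{tr}_n)$ converges in distribution to an $\ell$-tuple of elements in a non-commutative probability space as $n\to\infty$. Then for any selfadjoint non-commutative $*$-polynomial $P(x_1,\dots,x_k,y_1,\dots,y_\ell)$ such that $P(0,\dots,0,y_1,\dots,y_\ell)=0$, the Hermitian random matrix $P(A_1,\dots,A_k,UB_1U^*,\dots,UB_\ell U^* )$ converges in eigenvalues to a selfadjoint Hilbert–Schmidt operator almost surely. The limiting eigenvalues can be computed by using cyclic monotone independence.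
   Context: $\mathrm{Tr}_n$ is the non-normalized trace on $M_n(\mathbb C)$ and $\mathrm{tr}_n=\frac1n\mathrm{Tr}_n$. A Haar unitary is a random matrix distributed according to normalized Haar measure on the unitary group. A non-commutative probability space $(\mathcal C,\tau)$ is a unital $*$-algebra over $\mathbb C$ with a linear functional $\tau$ satisfying $\tau(1)=1$, $\tau(c^*c)\ge0$, $\tau(c^* )=\overline{\tau(c)}$, $\tau(cd)=\tau(dc)$. A tracial weight $\omega$ on $\mathcal C$ is a linear map $\omega:\mathrm D(\omega)\to\mathbb C$ on a (possibly non-unital) $*$-subalgebra $\mathrm D(\omega)\subset\mathcal C$ satisfying the last three properties on $\mathrm D(\omega)$; then $(\mathcal C,\omega,\tau)$ is called a non-commutative probability space with a tracial weight. Convergence in distribution of a tuple $((x_1(n),\dots,x_k(n)),\omega_n)$ to $((x_1,\dots,x_k),\omega)$ means $\omega_n(x_{i_1}(n)^{\varepsilon_1}\cdots x_{i_p}(n)^{\varepsilon_p})\to\omega(x_{i_1}^{\varepsilon_1}\cdots x_{i_p}^{\varepsilon_p})$ for all $p\ge1$, $1\le i_1,\dots,i_p\le k$, $\varepsilon_1,\dots,\varepsilon_p\in\{1,*\}$. For trace class operators on a separable Hilbert space $H$ the functional is the trace $\mathrm{Tr}_H$. Cyclic monotone independence: for $*$-subalgebras $\mathcal A,\mathcal B$ of $\mathcal C$ with $1_{\mathcal C}\in\mathcal B$, the pair $(\mathcal A,\mathcal B)$ is cyclically monotonically independent with respect to $(\omega,\tau)$ if all products $\beta_0\alpha_1\beta_1\cdots\alpha_m\beta_m$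 ($m\ge1$, $\alpha_i\in\mathcal A$, $\beta_i\in\mathcal B$) lie in $\mathrm D(\omega)$ and $\omega(\alpha_1\beta_1\cdots\alpha_m\beta_m)=\omega(\alpha_1\cdots\alpha_m)\tau(\beta_1)\cdots\tau(\beta_m)$ for all such elements. For families of elements $\{a_i\}\subset\mathrm D(\omega)$, $\{b_j\}\subset\mathcal C$ it is required of the (not necessarily unital) $*$-algebra generated by the $a_i$ and the unital $*$-algebra generated by the $b_j$ and $1_{\mathcal C}$. Convergence in eigenvalues: for a selfadjoint compact operator $a$ on a separable Hilbert space, let $\lambda_1^+(a)\ge\lambda_2^+(a)\ge\cdots\ge0$ be its nonnegative eigenvalues (with multiplicity) in nonincreasing order and $\lambda_1^-(a)\le\lambda_2^-(a)\le\cdots\le0$ its nonpositive eigenvalues in nondecreasing order, finite lists being padded with infinitely many zeros. Then $a_n$ converges to $a$ in eigenvalues if $\lambda_i^{u}(a_n)\to\lambda_i^{u}(a)$ for all $i\ge1$ and $u\in\{+,-\}$ (the underlying Hilbert spaces may differ). *)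

theory Defs
  imports
    "HOL-Probability.Probability"
    "HOL-Library.Poly_Mapping"
    "HOL-Library.Nonpos_Ints"
    "Jordan_Normal_Form.Char_Poly"
    "Jordan_Normal_Form.Schur_Decomposition"
begin

section \<open>Complex vector spaces, star-algebras and Hilbert spaces\<close>

class complex_vector = ab_group_add +
  fixes scaleC :: "complex \<Rightarrow> 'a \<Rightarrow> 'a"  (infixr "*\<^sub>C" 75)
  assumes scaleC_add_right: "c *\<^sub>C (x + y) = c *\<^sub>C x + c *\<^sub>C y"
    and scaleC_add_left: "(c + d) *\<^sub>C x = c *\<^sub>C x + d *\<^sub>C x"
    and scaleC_scaleC: "c *\<^sub>C (d *\<^sub>C x) = (c * d) *\<^sub>C x"
    and scaleC_one: "1 *\<^sub>C x = x"

lemma vector_space_scaleC: "vector_space (scaleC :: complex \<Rightarrow> 'a \<Rightarrow> 'a::complex_vector)"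
  by standard (simp_all add: scaleC_add_right scaleC_add_left scaleC_scaleC scaleC_one)

definition cspan :: "'a::complex_vector set \<Rightarrow> 'a set" where
  "cspan = Modules.module.span scaleC"

definition cdim :: "'a::complex_vector set \<Rightarrow> nat" where
  "cdim = Vector_Spaces.vector_space.dim scaleC"

class complex_star_algebra = complex_vector + ring_1 +
  fixes star :: "'a \<Rightarrow> 'a"
  assumes mult_scaleC_left: "(c *\<^sub>C x) * y = c *\<^sub>C (x * y)"
    and mult_scaleC_right: "x * (c *\<^sub>C y) = c *\<^sub>C (x * y)"
    and star_add: "star (x + y) = star x + star y"
    and star_scaleC: "star (c *\<^sub>C x) = cnj c *\<^sub>C star x"
    and star_mult: "star (x * y) = star y * star x"
    and star_star: "star (star x) = x"

text \<open>The inner product is linear in its second argument.  Norm, topology and completeness are those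
  of the underlying real Hilbert space, whose inner product is the real part.\<close>

class complex_hilbert_space = complex_vector + real_inner + complete_space +
  fixes cinner :: "'a \<Rightarrow> 'a \<Rightarrow> complex"
  assumes scaleR_eq_scaleC: "r *\<^sub>R x = complex_of_real r *\<^sub>C x"
    and cinner_add_right: "cinner x (y + z) = cinner x y + cinner x z"
    and cinner_scaleC_right: "cinner x (c *\<^sub>C y) = c * cinner x y"
    and cinner_commute: "cinner x y = cnj (cinner y x)"
    and inner_eq_Re_cinner: "inner x y = Re (cinner x y)"

subsection \<open>The sequence space\<close>

typedef ell2 = "{x :: nat \<Rightarrow> complex. summable (\<lambda>n. (cmod (x n))\<^sup>2)}"
  morphisms ell2_nth Abs_ell2
  by (rule exI[of _ "\<lambda>_. 0"]) simp

setup_lifting type_definition_ell2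

lemma ell2_summable: "summable (\<lambda>n. (cmod (ell2_nth x n))\<^sup>2)"
  using ell2_nth[of x] by simp

lemma ell2_summable_add:
  assumes "summable (\<lambda>n. (cmod (f n))\<^sup>2)" "summable (\<lambda>n. (cmod (g n))\<^sup>2)"
  shows "summable (\<lambda>n. (cmod (f n + g n))\<^sup>2)"
proof (rule summable_comparison_test')
  show "summable (\<lambda>n. 2 * (cmod (f n))\<^sup>2 + 2 * (cmod (g n))\<^sup>2)"
    using assms by (intro summable_add summable_mult)
  fix n
  have "(cmod (f n + g n))\<^sup>2 \<le> (cmod (f n) + cmod (g n))\<^sup>2"
    by (intro power_mono norm_triangle_ineq) auto
  also have "\<dots> \<le> 2 * (cmod (f n))\<^sup>2 + 2 * (cmod (g n))\<^sup>2"
    using sum_squares_bound[of "cmod (f n)" "cmod (g n)"] by (simp add: power2_sum)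
  finally show "norm ((cmod (f n + g n))\<^sup>2) \<le> 2 * (cmod (f n))\<^sup>2 + 2 * (cmod (g n))\<^sup>2"
    by simp
qed

lemma ell2_summable_scale:
  assumes "summable (\<lambda>n. (cmod (f n))\<^sup>2)"
  shows "summable (\<lambda>n. (cmod (c * f n))\<^sup>2)"
  using summable_mult[OF assms, of "(cmod c)\<^sup>2"] by (simp add: norm_mult power_mult_distrib)

lemma ell2_summable_cinner:
  "summable (\<lambda>n. cnj (ell2_nth x n) * ell2_nth y n)"
proof (rule summable_comparison_test')
  show "summable (\<lambda>n. (cmod (ell2_nth x n))\<^sup>2 + (cmod (ell2_nth y n))\<^sup>2)"
    by (intro summable_add ell2_summable)
  fix n
  have "2 * (cmod (ell2_nth x n) * cmod (ell2_nth y n))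
      \<le> (cmod (ell2_nth x n))\<^sup>2 + (cmod (ell2_nth y n))\<^sup>2"
    using sum_squares_bound[of "cmod (ell2_nth x n)" "cmod (ell2_nth y n)"] by simp
  moreover have "0 \<le> cmod (ell2_nth x n) * cmod (ell2_nth y n)" by simp
  ultimately show "norm (cnj (ell2_nth x n) * ell2_nth y n)
      \<le> (cmod (ell2_nth x n))\<^sup>2 + (cmod (ell2_nth y n))\<^sup>2"
    unfolding norm_mult complex_mod_cnj by linarith
qed

instantiation ell2 :: real_inner
begin

lift_definition zero_ell2 :: ell2 is "\<lambda>_. 0" by simp
lift_definition plus_ell2 :: "ell2 \<Rightarrow> ell2 \<Rightarrow> ell2" is "\<lambda>x y n. x n + y n"
  by (rule ell2_summable_add)
lift_definition uminus_ell2 :: "ell2 \<Rightarrow> ell2" is "\<lambda>x n. - x n" by simp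
lift_definition minus_ell2 :: "ell2 \<Rightarrow> ell2 \<Rightarrow> ell2" is "\<lambda>x y n. x n - y n"
  subgoal for x y using ell2_summable_add[of x "\<lambda>n. - y n"] by simp
  done
lift_definition scaleR_ell2 :: "real \<Rightarrow> ell2 \<Rightarrow> ell2" is "\<lambda>r x n. complex_of_real r * x n"
  by (rule ell2_summable_scale)

definition inner_ell2 :: "ell2 \<Rightarrow> ell2 \<Rightarrow> real" where
  "inner_ell2 x y = Re (suminf (\<lambda>n. cnj (ell2_nth x n) * ell2_nth y n))"
definition norm_ell2 :: "ell2 \<Rightarrow> real" where "norm_ell2 x = sqrt (inner x x)"
definition sgn_ell2 :: "ell2 \<Rightarrow> ell2" where "sgn_ell2 x = scaleR (inverse (norm x)) x"
definition dist_ell2 :: "ell2 \<Rightarrow> ell2 \<Rightarrow> real" where "dist_ell2 x y = norm (x - y)"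
definition uniformity_ell2 :: "(ell2 \<times> ell2) filter" where
  "uniformity_ell2 = (INF e\<in>{0<..}. principal {(x, y). dist x y < e})"
definition open_ell2 :: "ell2 set \<Rightarrow> bool" where
  "open_ell2 S = (\<forall>x\<in>S. \<forall>\<^sub>F (x', y) in uniformity. x' = x \<longrightarrow> y \<in> S)"

lemma inner_ell2_alt: "inner x y = suminf (\<lambda>n. Re (cnj (ell2_nth x n) * ell2_nth y n))"
  unfolding inner_ell2_def by (rule Re_suminf[OF ell2_summable_cinner])

lemma summable_inner_ell2: "summable (\<lambda>n. Re (cnj (ell2_nth x n) * ell2_nth y n))"
  by (rule summable_Re[OF ell2_summable_cinner])

lemma inner_ell2_self: "inner x x = suminf (\<lambda>n. (cmod (ell2_nth x n))\<^sup>2)" for x :: ell2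
proof -
  have "Re (cnj z * z) = (cmod z)\<^sup>2" for z
    unfolding cmod_power2 by (simp add: power2_eq_square)
  then show ?thesis unfolding inner_ell2_alt by simp
qed

instance
proof
  fix a b c :: ell2 and r s :: real
  show "a + b + c = a + (b + c)" "a + b = b + a" "0 + a = a" "- a + a = 0" "a - b = a + - b"
    by (transfer; simp add: fun_eq_iff algebra_simps)+
  show "r *\<^sub>R (a + b) = r *\<^sub>R a + r *\<^sub>R b" "(r + s) *\<^sub>R a = r *\<^sub>R a + s *\<^sub>R a"
    "r *\<^sub>R s *\<^sub>R a = (r * s) *\<^sub>R a" "1 *\<^sub>R a = a"
    by (transfer; simp add: fun_eq_iff algebra_simps)+
  show "sgn a = scaleR (inverse (norm a)) a" by (rule sgn_ell2_def)
  show "dist a b = norm (a - b)" by (rule dist_ell2_def)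
  show "uniformity = (INF e\<in>{0<..}. principal {(x :: ell2, y). dist x y < e})"
    by (rule uniformity_ell2_def)
  show "open U = (\<forall>x\<in>U. \<forall>\<^sub>F (x', y) in uniformity. x' = x \<longrightarrow> y \<in> U)" for U :: "ell2 set"
    by (rule open_ell2_def)
  show "inner a b = inner b a"
    unfolding inner_ell2_alt by (simp add: mult.commute)
  show "inner (a + b) c = inner a c + inner b c"
    unfolding inner_ell2_alt
    by (subst suminf_add[OF summable_inner_ell2 summable_inner_ell2])
      (simp add: plus_ell2.rep_eq algebra_simps)
  show "inner (r *\<^sub>R a) b = r * inner a b"
    unfolding inner_ell2_alt
    by (subst suminf_mult[OF summable_inner_ell2, symmetric])
      (simp add: scaleR_ell2.rep_eq algebra_simps)
  show "0 \<le> inner a a"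
    unfolding inner_ell2_self by (intro suminf_nonneg ell2_summable) simp
  show "(inner a a = 0) = (a = 0)"
    unfolding inner_ell2_self
    by (subst suminf_eq_zero_iff[OF ell2_summable])
      (auto simp: ell2_nth_inject[symmetric] zero_ell2.rep_eq fun_eq_iff)
  show "norm a = sqrt (inner a a)" by (rule norm_ell2_def)
qed

end

lemma norm_ell2_sq: "(norm x)\<^sup>2 = suminf (\<lambda>n. (cmod (ell2_nth x n))\<^sup>2)" for x :: ell2
  by (metis inner_ell2_self power2_norm_eq_inner)

lemma sum_le_norm_ell2: "(\<Sum>n<K. (cmod (ell2_nth x n))\<^sup>2) \<le> (norm x)\<^sup>2"
  unfolding norm_ell2_sq by (intro sum_le_suminf ell2_summable) auto

lemma ell2_nth_le_norm: "cmod (ell2_nth x n) \<le> norm x"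
proof (rule power2_le_imp_le)
  have "(cmod (ell2_nth x n))\<^sup>2 \<le> (\<Sum>k<Suc n. (cmod (ell2_nth x k))\<^sup>2)"
    by (rule member_le_sum) auto
  also have "\<dots> \<le> (norm x)\<^sup>2" by (rule sum_le_norm_ell2)
  finally show "(cmod (ell2_nth x n))\<^sup>2 \<le> (norm x)\<^sup>2" .
qed simp

lemma summable_sq_boundI:
  fixes f :: "nat \<Rightarrow> complex"
  assumes "\<And>K. (\<Sum>n<K. (cmod (f n))\<^sup>2) \<le> C"
  shows "summable (\<lambda>n. (cmod (f n))\<^sup>2)"
proof (rule bounded_imp_summable[where B = C])
  show "(\<Sum>k\<le>n. (cmod (f k))\<^sup>2) \<le> C" for n
    using assms[of "Suc n"] by (simp only: lessThan_Suc_atMost)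
qed simp

instance ell2 :: complete_space
proof
  fix X :: "nat \<Rightarrow> ell2" assume X: "Cauchy X"
  have "Cauchy (\<lambda>n. ell2_nth (X n) k)" for k
  proof (rule metric_CauchyI)
    fix e :: real assume "e > 0"
    then obtain N where N: "\<And>m n. m \<ge> N \<Longrightarrow> n \<ge> N \<Longrightarrow> dist (X m) (X n) < e"
      using metric_CauchyD[OF X] by blast
    have "dist (ell2_nth (X m) k) (ell2_nth (X n) k) < e" if "m \<ge> N" "n \<ge> N" for m n
      using N[OF that] ell2_nth_le_norm[of "X m - X n" k]
      by (simp add: dist_norm minus_ell2.rep_eq)
    then show "\<exists>N. \<forall>m\<ge>N. \<forall>n\<ge>N. dist (ell2_nth (X m) k) (ell2_nth (X n) k) < e" by blast
  qed
  then have "\<forall>k. \<exists>l. (\<lambda>n. ell2_nth (X n) k) \<longlonglongrightarrow> l"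
    using Cauchy_convergent convergent_def by blast
  then obtain f where f: "\<And>k. (\<lambda>n. ell2_nth (X n) k) \<longlonglongrightarrow> f k" by metis
  have bound: "\<exists>N. \<forall>m\<ge>N. \<forall>K. (\<Sum>k<K. (cmod (ell2_nth (X m) k - f k))\<^sup>2) \<le> e\<^sup>2"
    if e: "e > 0" for e :: real
  proof -
    obtain N where N: "\<And>m n. m \<ge> N \<Longrightarrow> n \<ge> N \<Longrightarrow> dist (X m) (X n) < e"
      using metric_CauchyD[OF X e] by blast
    have "(\<Sum>k<K. (cmod (ell2_nth (X m) k - f k))\<^sup>2) \<le> e\<^sup>2" if m: "m \<ge> N" for m K
    proof (rule tendsto_upperbound)
      show "((\<lambda>n. \<Sum>k<K. (cmod (ell2_nth (X m) k - ell2_nth (X n) k))\<^sup>2) \<longlongrightarrow>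
          (\<Sum>k<K. (cmod (ell2_nth (X m) k - f k))\<^sup>2)) sequentially"
        by (intro tendsto_intros f)
      show "\<forall>\<^sub>F n in sequentially.
          (\<Sum>k<K. (cmod (ell2_nth (X m) k - ell2_nth (X n) k))\<^sup>2) \<le> e\<^sup>2"
      proof (rule eventually_sequentiallyI[of N])
        fix n assume n: "N \<le> n"
        have "(\<Sum>k<K. (cmod (ell2_nth (X m) k - ell2_nth (X n) k))\<^sup>2) \<le> (norm (X m - X n))\<^sup>2"
          using sum_le_norm_ell2[of "X m - X n" K] by (simp add: minus_ell2.rep_eq)
        also have "\<dots> \<le> e\<^sup>2"
          using N[OF m n] by (intro power_mono) (auto simp: dist_norm)
        finally show "(\<Sum>k<K. (cmod (ell2_nth (X m) k - ell2_nth (X n) k))\<^sup>2) \<le> e\<^sup>2" .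
      qed
    qed simp
    then show ?thesis by blast
  qed
  obtain N where N: "\<And>K. (\<Sum>k<K. (cmod (ell2_nth (X N) k - f k))\<^sup>2) \<le> 1\<^sup>2"
    using bound[of 1] by auto
  have "summable (\<lambda>k. (cmod (ell2_nth (X N) k - f k))\<^sup>2)"
    by (rule summable_sq_boundI[OF N])
  then have "summable (\<lambda>k. (cmod (- (ell2_nth (X N) k - f k)))\<^sup>2)"
    by (simp only: norm_minus_cancel)
  from ell2_summable_add[OF this ell2_summable[of "X N"]]
  have sf: "summable (\<lambda>k. (cmod (f k))\<^sup>2)" by simp
  define L where "L = Abs_ell2 f"
  have L: "ell2_nth L = f" unfolding L_def using sf by (simp add: Abs_ell2_inverse)
  have "X \<longlonglongrightarrow> L"
  proof (rule metric_LIMSEQ_I)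
    fix r :: real assume r: "r > 0"
    then obtain N where
      N: "\<And>m K. m \<ge> N \<Longrightarrow> (\<Sum>k<K. (cmod (ell2_nth (X m) k - f k))\<^sup>2) \<le> (r/2)\<^sup>2"
      using bound[of "r/2"] by auto
    have "dist (X m) L < r" if m: "m \<ge> N" for m
    proof -
      have "(norm (X m - L))\<^sup>2 \<le> (r/2)\<^sup>2"
        unfolding norm_ell2_sq using N[OF m]
        by (intro suminf_le_const ell2_summable) (simp add: minus_ell2.rep_eq L)
      then have "norm (X m - L) \<le> r/2"
        by (rule power2_le_imp_le) (use r in simp)
      then show ?thesis using r by (simp add: dist_norm)
    qed
    then show "\<exists>N. \<forall>m\<ge>N. dist (X m) L < r" by blast
  qed
  then show "convergent X" by (rule convergentI)
qed

instantiation ell2 :: complex_hilbert_space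
begin

lift_definition scaleC_ell2 :: "complex \<Rightarrow> ell2 \<Rightarrow> ell2" is "\<lambda>c x n. c * x n"
  by (rule ell2_summable_scale)

definition cinner_ell2 :: "ell2 \<Rightarrow> ell2 \<Rightarrow> complex" where
  "cinner_ell2 x y = suminf (\<lambda>n. cnj (ell2_nth x n) * ell2_nth y n)"

instance
proof
  fix x y z :: ell2 and c d :: complex and r :: real
  show "c *\<^sub>C (x + y) = c *\<^sub>C x + c *\<^sub>C y" "(c + d) *\<^sub>C x = c *\<^sub>C x + d *\<^sub>C x"
    "c *\<^sub>C d *\<^sub>C x = (c * d) *\<^sub>C x" "1 *\<^sub>C x = x" "r *\<^sub>R x = complex_of_real r *\<^sub>C x"
    by (transfer; simp add: fun_eq_iff algebra_simps)+
  show "cinner x (y + z) = cinner x y + cinner x z"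
    unfolding cinner_ell2_def
    by (subst suminf_add[OF ell2_summable_cinner ell2_summable_cinner])
      (simp add: plus_ell2.rep_eq algebra_simps)
  show "cinner x (c *\<^sub>C y) = c * cinner x y"
    unfolding cinner_ell2_def
    by (subst suminf_mult[OF ell2_summable_cinner, symmetric])
      (simp add: scaleC_ell2.rep_eq algebra_simps)
  show "cinner x y = cnj (cinner y x)"
    unfolding cinner_ell2_def
    using sums_cnj[THEN iffD2, OF summable_sums[OF ell2_summable_cinner[of y x]]]
    by (simp add: sums_iff mult.commute)
  show "inner x y = Re (cinner x y)"
    unfolding cinner_ell2_def inner_ell2_def ..
qed

end

lemma ell2_separable:
  obtains D :: "ell2 set" where "countable D" "\<And>x e. e > 0 \<Longrightarrow> \<exists>d\<in>D. dist d x < e"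
proof -
  obtain Q :: "complex set" where Q: "countable Q" "\<And>X. open X \<Longrightarrow> X \<noteq> {} \<Longrightarrow> \<exists>d\<in>Q. d \<in> X"
    using countable_dense_setE by blast
  have Q': "\<exists>d\<in>Q. cmod (z - d) < e" if "e > 0" for z e
    using Q(2)[of "ball z e"] that by (auto simp: dist_norm)
  define F where "F l n = (if n < length l then l ! n else 0)" for l :: "complex list" and n
  have F: "summable (\<lambda>n. (cmod (F l n))\<^sup>2)" for l
    by (rule summable_finite[of "{..<length l}"]) (auto simp: F_def)
  define D where "D = (\<lambda>l. Abs_ell2 (F l)) ` lists Q"
  have nthF: "ell2_nth (Abs_ell2 (F l)) = F l" for l
    using F[of l] by (simp add: Abs_ell2_inverse)
  have dense: "\<exists>d\<in>D. dist d x < e" if e: "e > 0" for x :: ell2 and e :: real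
  proof -
    let ?t = "\<lambda>n. (cmod (ell2_nth x n))\<^sup>2"
    have "(\<lambda>K. suminf (\<lambda>n. ?t (n + K))) \<longlonglongrightarrow> 0"
      by (rule suminf_exist_split2[OF ell2_summable])
    then obtain K where K: "(suminf (\<lambda>n. ?t (n + K))) < e\<^sup>2 / 2"
      using e by (metis (no_types, lifting) LIMSEQ_D abs_ge_self diff_zero half_gt_zero
          order_le_less_trans order_refl real_norm_def zero_less_power)
    define \<delta> where "\<delta> = e / (2 * sqrt (real K + 1))"
    have \<delta>: "\<delta> > 0" using e by (simp add: \<delta>_def)
    obtain q where q: "\<And>n. q n \<in> Q" "\<And>n. cmod (ell2_nth x n - q n) < \<delta>"
    proof -
      have "\<forall>n. \<exists>d. d \<in> Q \<and> cmod (ell2_nth x n - d) < \<delta>" using Q'[OF \<delta>] by blast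
      then show ?thesis using that by metis
    qed
    define d where "d = Abs_ell2 (F (map q [0..<K]))"
    have dn: "ell2_nth d n = (if n < K then q n else 0)" for n
      by (simp add: d_def nthF F_def)
    have "(norm (x - d))\<^sup>2 = (suminf (\<lambda>n. (cmod (ell2_nth (x - d) (n + K)))\<^sup>2))
        + (\<Sum>n<K. (cmod (ell2_nth (x - d) n))\<^sup>2)"
      unfolding norm_ell2_sq by (rule suminf_split_initial_segment[OF ell2_summable])
    also have "(\<lambda>n. (cmod (ell2_nth (x - d) (n + K)))\<^sup>2) = (\<lambda>n. ?t (n + K))"
      by (simp add: minus_ell2.rep_eq dn)
    also have "(\<Sum>n<K. (cmod (ell2_nth (x - d) n))\<^sup>2) \<le> (\<Sum>n<K. \<delta>\<^sup>2)"
      by (intro sum_mono power_mono) (auto simp: minus_ell2.rep_eq dn less_imp_le[OF q(2)])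
    also have "\<dots> \<le> e\<^sup>2 / 2"
    proof -
      have "real K * \<delta>\<^sup>2 \<le> (real K + 1) * \<delta>\<^sup>2"
        by (intro mult_right_mono) auto
      also have "\<dots> = e\<^sup>2 / 4"
        by (simp add: \<delta>_def power_divide power_mult_distrib field_simps)
      also have "\<dots> \<le> e\<^sup>2 / 2" by simp
      finally show ?thesis by simp
    qed
    finally have "(norm (x - d))\<^sup>2 < e\<^sup>2" using K by linarith
    then have "norm (x - d) < e" by (rule power2_less_imp_less) (use e in simp)
    moreover have "d \<in> D" unfolding D_def d_def
      by (rule imageI) (use q(1) in auto)
    ultimately show ?thesis by (metis dist_norm dist_commute)
  qed
  have "countable D" unfolding D_def using Q(1) by (intro countable_image countable_lists)
  from that[OF this dense] show thesis by blast
qed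

instance ell2 :: second_countable_topology
proof
  obtain D :: "ell2 set" where
    D: "countable D" "\<And>x e. e > 0 \<Longrightarrow> \<exists>d\<in>D. dist d x < e" by (rule ell2_separable) blast
  define B where "B = (\<lambda>(d, m). ball d (1 / real (Suc m))) ` (D \<times> (UNIV :: nat set))"
  have "topological_basis B"
  proof (rule topological_basisI)
    show "open b" if "b \<in> B" for b using that by (auto simp: B_def)
    fix O' and x :: ell2 assume "open O'" "x \<in> O'"
    then obtain e where e: "e > 0" "ball x e \<subseteq> O'" by (meson open_contains_ball)
    obtain m where m: "1 / real (Suc m) < e / 2"
      using e(1) nat_approx_posE[of "e/2"] by auto
    obtain d where d: "d \<in> D" "dist d x < 1 / real (Suc m)"
      using D(2)[of "1 / real (Suc m)" x] by auto
    have "ball d (1 / real (Suc m)) \<subseteq> ball x e"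
    proof
      fix y assume "y \<in> ball d (1 / real (Suc m))"
      then have "dist x y < 1 / real (Suc m) + 1 / real (Suc m)"
        using d(2) dist_triangle[of x y d] by (simp add: dist_commute)
      then show "y \<in> ball x e" using m by simp
    qed
    moreover have "x \<in> ball d (1 / real (Suc m))" using d(2) by simp
    moreover have "ball d (1 / real (Suc m)) \<in> B"
      using d(1) by (auto simp: B_def)
    ultimately show "\<exists>B'\<in>B. x \<in> B' \<and> B' \<subseteq> O'" using e(2) by blast
  qed
  moreover have "countable B" unfolding B_def using D(1) by simp
  ultimately show "\<exists>B :: ell2 set set. countable B \<and> open = generate_topology B"
    using topological_basis_imp_subbasis by blast
qed

subsection \<open>Operators\<close>

definition bounded_clinear :: "('h::complex_hilbert_space \<Rightarrow> 'h) \<Rightarrow> bool" where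
  "bounded_clinear T \<longleftrightarrow> bounded_linear T \<and> (\<forall>c x. T (c *\<^sub>C x) = c *\<^sub>C T x)"

definition cadjoint :: "('h::complex_hilbert_space \<Rightarrow> 'h) \<Rightarrow> 'h \<Rightarrow> 'h" where
  "cadjoint T = (THE S. \<forall>x y. cinner (T x) y = cinner x (S y))"

definition selfadjoint_op :: "('h::complex_hilbert_space \<Rightarrow> 'h) \<Rightarrow> bool" where
  "selfadjoint_op T \<longleftrightarrow> bounded_clinear T \<and> cadjoint T = T"

definition positive_op :: "('h::complex_hilbert_space \<Rightarrow> 'h) \<Rightarrow> bool" where
  "positive_op T \<longleftrightarrow> bounded_clinear T \<and> (\<forall>x. cinner x (T x) \<in> \<real>\<^sub>\<ge>\<^sub>0)"

definition orthonormal_basis :: "'h::complex_hilbert_space set \<Rightarrow> bool" where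
  "orthonormal_basis E \<longleftrightarrow>
     (\<forall>e\<in>E. \<forall>f\<in>E. cinner e f = (if e = f then 1 else 0)) \<and> closure (cspan E) = UNIV"

definition hilbert_schmidt :: "('h::complex_hilbert_space \<Rightarrow> 'h) \<Rightarrow> bool" where
  "hilbert_schmidt T \<longleftrightarrow> bounded_clinear T \<and>
     (\<exists>E. orthonormal_basis E \<and> (\<lambda>e. (norm (T e))\<^sup>2) summable_on E)"

text \<open>In \<open>trace_class\<close>, \<open>R\<close> is the absolute value of \<open>T\<close>.  Here, as for \<open>hilbert_schmidt\<close>,
  summability does not depend on the orthonormal basis; neither does the trace of a
  trace class operator.\<close>

definition trace_class :: "('h::complex_hilbert_space \<Rightarrow> 'h) \<Rightarrow> bool" where
  "trace_class T \<longleftrightarrow> bounded_clinear T \<and>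
     (\<exists>R E. positive_op R \<and> R \<circ> R = cadjoint T \<circ> T \<and>
        orthonormal_basis E \<and> (\<lambda>e. cinner e (R e)) summable_on E)"

definition op_trace :: "('h::complex_hilbert_space \<Rightarrow> 'h) \<Rightarrow> complex" where
  "op_trace T = infsum (\<lambda>e. cinner e (T e)) (SOME E. orthonormal_basis E)"

section \<open>Non-commutative star-polynomials\<close>

datatype 'v letter = Var 'v | Adj 'v

datatype 'v nc_word = Word (letters: "'v letter list")

primrec flip_letter :: "'v letter \<Rightarrow> 'v letter" where
  "flip_letter (Var v) = Adj v"
| "flip_letter (Adj v) = Var v"

class involutive_monoid_add = monoid_add +
  fixes invol :: "'a \<Rightarrow> 'a"
  assumes invol_add: "invol (x + y) = invol y + invol x"
    and invol_invol: "invol (invol x) = x"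

text \<open>Words form a monoid under concatenation, written additively to match the convolution product
  of \<open>poly_mapping\<close>; the empty word is \<open>0\<close>.\<close>

instantiation nc_word :: (type) involutive_monoid_add
begin

definition zero_nc_word :: "'a nc_word" where "0 = Word []"
definition plus_nc_word :: "'a nc_word \<Rightarrow> 'a nc_word \<Rightarrow> 'a nc_word" where
  "u + w = Word (letters u @ letters w)"
definition invol_nc_word :: "'a nc_word \<Rightarrow> 'a nc_word" where
  "invol w = Word (rev (map flip_letter (letters w)))"

instance
proof
  fix x y z :: "'a nc_word"
  have "flip_letter \<circ> flip_letter = (id :: 'a letter \<Rightarrow> 'a letter)"
  proof
    show "(flip_letter \<circ> flip_letter) l = id l" for l :: "'a letter" by (cases l) simp_all
  qed
  then show "invol (invol x) = x"
    by (simp add: invol_nc_word_def rev_map)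
qed (simp_all add: zero_nc_word_def plus_nc_word_def invol_nc_word_def)

end

instantiation complex :: complex_star_algebra
begin

definition scaleC_complex :: "complex \<Rightarrow> complex \<Rightarrow> complex" where "scaleC_complex c z = c * z"
definition star_complex :: "complex \<Rightarrow> complex" where "star_complex = cnj"

instance
  by standard (simp_all add: scaleC_complex_def star_complex_def algebra_simps)

end

lemma complex_star_algebra_simps:
  shows star_zero: "star (0 :: 'a::complex_star_algebra) = 0"
    and scaleC_zero: "c *\<^sub>C (0 :: 'b::complex_vector) = 0"
    and scaleC_zero_left: "0 *\<^sub>C (x :: 'b) = 0"
proof -
  show "star (0 :: 'a) = 0" using star_add[of "0 :: 'a" 0] by simp
  show "c *\<^sub>C (0 :: 'b) = 0" using scaleC_add_right[of c 0 "0 :: 'b"] by simp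
  show "0 *\<^sub>C x = 0" using scaleC_add_left[of 0 0 x] by simp
qed

instantiation poly_mapping :: (type, complex_vector) complex_vector
begin

lift_definition scaleC_poly_mapping :: "complex \<Rightarrow> ('a \<Rightarrow>\<^sub>0 'b) \<Rightarrow> 'a \<Rightarrow>\<^sub>0 'b"
  is "\<lambda>c p k. c *\<^sub>C p k"
  by (erule finite_subset[rotated]) (auto simp: scaleC_zero)

instance
  by standard (transfer; simp add: fun_eq_iff scaleC_add_right scaleC_add_left scaleC_scaleC
      scaleC_one)+

end

lemma scaleC_single: "c *\<^sub>C Poly_Mapping.single k v = Poly_Mapping.single k (c *\<^sub>C v)"
  by transfer (auto simp: fun_eq_iff when_def scaleC_zero)

lemma poly_mapping_single_induct [case_names single add]:
  fixes p :: "'a \<Rightarrow>\<^sub>0 'b::monoid_add"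
  assumes single: "\<And>k v. Q (Poly_Mapping.single k v)"
    and add: "\<And>p q. Q p \<Longrightarrow> Q q \<Longrightarrow> Q (p + q)"
  shows "Q p"
proof (induction p rule: update_induct)
  case const
  show ?case using single[of undefined 0] by simp
next
  case (update f a b)
  have "Poly_Mapping.update a b f = f + Poly_Mapping.single a b"
    using update(1) by (transfer) (auto simp: fun_eq_iff when_def)
  then show ?case using add[OF update.IH single] by simp
qed

instantiation poly_mapping :: (involutive_monoid_add, complex_star_algebra) complex_star_algebra
begin

lift_definition star_poly_mapping :: "('a \<Rightarrow>\<^sub>0 'b) \<Rightarrow> 'a \<Rightarrow>\<^sub>0 'b" is "\<lambda>p k. star (p (invol k))"
proof -
  fix p :: "'a \<Rightarrow> 'b" assume "finite {k. p k \<noteq> 0}"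
  then have "finite (invol ` {k. p k \<noteq> 0})" by simp
  moreover have "{k. star (p (invol k)) \<noteq> 0} \<subseteq> invol ` {k. p k \<noteq> 0}"
  proof
    fix k assume "k \<in> {k. star (p (invol k)) \<noteq> 0}"
    then have "p (invol k) \<noteq> 0" using star_zero by auto
    then show "k \<in> invol ` {k. p k \<noteq> 0}"
      by (intro image_eqI[of _ _ "invol k"]) (auto simp: invol_invol)
  qed
  ultimately show "finite {k. star (p (invol k)) \<noteq> 0}" by (rule finite_subset[rotated])
qed

lemma star_single: "star (Poly_Mapping.single k v) = Poly_Mapping.single (invol k) (star v)"
  for k :: 'a and v :: 'b
proof (rule poly_mapping_eqI)
  fix j
  have "invol j = k \<longleftrightarrow> j = invol k" using invol_invol by metis
  then show "Poly_Mapping.lookup (star (Poly_Mapping.single k v)) j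
      = Poly_Mapping.lookup (Poly_Mapping.single (invol k) (star v)) j"
    by (auto simp: star_poly_mapping.rep_eq lookup_single when_def star_zero)
qed

instance
proof
  fix x y :: "'a \<Rightarrow>\<^sub>0 'b" and c :: complex
  have add: "star (p + q) = star p + star q" for p q :: "'a \<Rightarrow>\<^sub>0 'b"
    by transfer (simp add: fun_eq_iff star_add)
  have scale_add: "c *\<^sub>C (p + q) = c *\<^sub>C p + c *\<^sub>C q" for p q :: "'a \<Rightarrow>\<^sub>0 'b"
    by (rule scaleC_add_right)
  show "star (x + y) = star x + star y" by (rule add)
  show "star (c *\<^sub>C x) = cnj c *\<^sub>C star x"
    by transfer (simp add: fun_eq_iff star_scaleC)
  show "star (star x) = x"
    by transfer (simp add: fun_eq_iff star_star invol_invol)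
  show "(c *\<^sub>C x) * y = c *\<^sub>C (x * y)"
  proof (induction x rule: poly_mapping_single_induct)
    case (single k v)
    show ?case
      by (induction y rule: poly_mapping_single_induct)
        (simp_all add: scaleC_single mult_single mult_scaleC_left distrib_left scale_add)
  qed (simp add: distrib_right scale_add)
  show "x * (c *\<^sub>C y) = c *\<^sub>C (x * y)"
  proof (induction x rule: poly_mapping_single_induct)
    case (single k v)
    show ?case
      by (induction y rule: poly_mapping_single_induct)
        (simp_all add: scaleC_single mult_single mult_scaleC_right distrib_left scale_add)
  qed (simp add: distrib_right scale_add)
  show "star (x * y) = star y * star x"
  proof (induction x rule: poly_mapping_single_induct)
    case (single k v)
    show ?case
      by (induction y rule: poly_mapping_single_induct)
        (simp_all add: star_single mult_single star_mult invol_add distrib_left distrib_right add)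
  qed (simp add: distrib_left distrib_right add)
qed

end

text \<open>The free unital star-algebra over the complex numbers on the variables \<open>'v\<close>.\<close>

type_synonym 'v nc_poly = "'v nc_word \<Rightarrow>\<^sub>0 complex"

definition nc_var :: "'v \<Rightarrow> 'v nc_poly" where
  "nc_var v = Poly_Mapping.single (Word [Var v]) 1"

text \<open>Value of a word when \<open>Var v\<close> and \<open>Adj v\<close> are replaced by \<open>f v\<close> and its adjoint, for given
  multiplication, unit and adjoint.\<close>

definition word_value ::
  "('a \<Rightarrow> 'a \<Rightarrow> 'a) \<Rightarrow> 'a \<Rightarrow> ('a \<Rightarrow> 'a) \<Rightarrow> ('v \<Rightarrow> 'a) \<Rightarrow> 'v nc_word \<Rightarrow> 'a" where
  "word_value mul unit adj f w =
     foldr mul (map (\<lambda>l. case l of Var v \<Rightarrow> f v | Adj v \<Rightarrow> adj (f v)) (letters w)) unit"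

definition alg_word :: "('v \<Rightarrow> 'a::complex_star_algebra) \<Rightarrow> 'v nc_word \<Rightarrow> 'a" where
  "alg_word = word_value (*) 1 star"

definition mat_word :: "nat \<Rightarrow> ('v \<Rightarrow> complex mat) \<Rightarrow> 'v nc_word \<Rightarrow> complex mat" where
  "mat_word n = word_value (*) (1\<^sub>m n) mat_adjoint"

definition op_word :: "('v \<Rightarrow> 'h \<Rightarrow> 'h::complex_hilbert_space) \<Rightarrow> 'v nc_word \<Rightarrow> 'h \<Rightarrow> 'h" where
  "op_word = word_value (\<circ>) id cadjoint"

definition alg_eval :: "('v \<Rightarrow> 'a::complex_star_algebra) \<Rightarrow> 'v nc_poly \<Rightarrow> 'a" where
  "alg_eval f P = (\<Sum>w\<in>Poly_Mapping.keys P. Poly_Mapping.lookup P w *\<^sub>C alg_word f w)"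

definition mat_eval :: "nat \<Rightarrow> ('v \<Rightarrow> complex mat) \<Rightarrow> 'v nc_poly \<Rightarrow> complex mat" where
  "mat_eval n f P = Matrix.mat n n (\<lambda>ij.
     \<Sum>w\<in>Poly_Mapping.keys P. Poly_Mapping.lookup P w * (mat_word n f w $$ ij))"

section \<open>Non-commutative probability\<close>

definition star_subalgebra :: "'a::complex_star_algebra set \<Rightarrow> bool" where
  "star_subalgebra S \<longleftrightarrow> 0 \<in> S \<and> (\<forall>x\<in>S. \<forall>y\<in>S. x + y \<in> S \<and> x * y \<in> S) \<and>
     (\<forall>c. \<forall>x\<in>S. c *\<^sub>C x \<in> S) \<and> (\<forall>x\<in>S. star x \<in> S)"

definition generated_star_algebra :: "'a::complex_star_algebra set \<Rightarrow> 'a set" where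
  "generated_star_algebra X = \<Inter>{S. star_subalgebra S \<and> X \<subseteq> S}"

definition tracial_weight :: "'a::complex_star_algebra set \<Rightarrow> ('a \<Rightarrow> complex) \<Rightarrow> bool" where
  "tracial_weight D \<omega> \<longleftrightarrow> star_subalgebra D \<and>
     (\<forall>x\<in>D. \<forall>y\<in>D. \<omega> (x + y) = \<omega> x + \<omega> y) \<and> (\<forall>c. \<forall>x\<in>D. \<omega> (c *\<^sub>C x) = c * \<omega> x) \<and>
     (\<forall>x\<in>D. \<omega> (star x * x) \<in> \<real>\<^sub>\<ge>\<^sub>0) \<and> (\<forall>x\<in>D. \<omega> (star x) = cnj (\<omega> x)) \<and>
     (\<forall>x\<in>D. \<forall>y\<in>D. \<omega> (x * y) = \<omega> (y * x))"

definition nc_probability_space :: "('a::complex_star_algebra \<Rightarrow> complex) \<Rightarrow> bool" where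
  "nc_probability_space \<tau> \<longleftrightarrow> tracial_weight UNIV \<tau> \<and> \<tau> 1 = 1"

text \<open>A product \<open>\<alpha>\<^sub>1 \<beta>\<^sub>1 \<dots> \<alpha>\<^sub>m \<beta>\<^sub>m\<close> is given by the list of pairs \<open>(\<alpha>\<^sub>i, \<beta>\<^sub>i)\<close>.\<close>

definition cyclically_monotone ::
  "'a::complex_star_algebra set \<Rightarrow> ('a \<Rightarrow> complex) \<Rightarrow> ('a \<Rightarrow> complex) \<Rightarrow> 'a set \<Rightarrow> 'a set \<Rightarrow> bool" where
  "cyclically_monotone D \<omega> \<tau> \<A> \<B> \<longleftrightarrow> star_subalgebra \<A> \<and> star_subalgebra \<B> \<and> 1 \<in> \<B> \<and>
     (\<forall>\<beta>0\<in>\<B>. \<forall>ps. ps \<noteq> [] \<and> set ps \<subseteq> \<A> \<times> \<B> \<longrightarrow>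
        \<beta>0 * prod_list (map (\<lambda>(\<alpha>, \<beta>). \<alpha> * \<beta>) ps) \<in> D \<and>
        \<omega> (prod_list (map (\<lambda>(\<alpha>, \<beta>). \<alpha> * \<beta>) ps)) =
          \<omega> (prod_list (map fst ps)) * prod_list (map (\<lambda>(\<alpha>, \<beta>). \<tau> \<beta>) ps))"

definition cyclically_monotone_families ::
  "'a::complex_star_algebra set \<Rightarrow> ('a \<Rightarrow> complex) \<Rightarrow> ('a \<Rightarrow> complex) \<Rightarrow>
     ('k \<Rightarrow> 'a) \<Rightarrow> ('l \<Rightarrow> 'a) \<Rightarrow> bool" where
  "cyclically_monotone_families D \<omega> \<tau> a b \<longleftrightarrow> range a \<subseteq> D \<and>
     cyclically_monotone D \<omega> \<tau> (generated_star_algebra (range a))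
       (generated_star_algebra (insert 1 (range b)))"

text \<open>The distribution of a tuple is the family of its star-moments; only nonempty words matter.\<close>

definition alg_moments :: "('a::complex_star_algebra \<Rightarrow> complex) \<Rightarrow> ('v \<Rightarrow> 'a) \<Rightarrow> 'v nc_word \<Rightarrow> complex"
  where "alg_moments \<phi> f w = \<phi> (alg_word f w)"

definition op_moments :: "('v \<Rightarrow> 'h \<Rightarrow> 'h::complex_hilbert_space) \<Rightarrow> 'v nc_word \<Rightarrow> complex" where
  "op_moments f w = op_trace (op_word f w)"

definition mat_Tr :: "complex mat \<Rightarrow> complex" where
  "mat_Tr X = (\<Sum>i<dim_row X. X $$ (i, i))"

definition mat_tr :: "complex mat \<Rightarrow> complex" where
  "mat_tr X = mat_Tr X / of_nat (dim_row X)"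

definition mat_moments ::
  "(complex mat \<Rightarrow> complex) \<Rightarrow> nat \<Rightarrow> ('v \<Rightarrow> complex mat) \<Rightarrow> 'v nc_word \<Rightarrow> complex" where
  "mat_moments \<phi> n f w = \<phi> (mat_word n f w)"

definition converges_in_distribution ::
  "(nat \<Rightarrow> 'v nc_word \<Rightarrow> complex) \<Rightarrow> ('v nc_word \<Rightarrow> complex) \<Rightarrow> bool" where
  "converges_in_distribution m m' \<longleftrightarrow> (\<forall>w. w \<noteq> 0 \<longrightarrow> (\<lambda>n. m n w) \<longlonglongrightarrow> m' w)"

text \<open>\<open>(a, b)\<close> is cyclically monotonically independent, and has the prescribed marginal
  distributions \<open>mA\<close> with respect to \<open>\<omega>\<close> and \<open>mB\<close> with respect to \<open>\<tau>\<close>.\<close>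

definition cyclic_monotone_model ::
  "('k nc_word \<Rightarrow> complex) \<Rightarrow> ('l nc_word \<Rightarrow> complex) \<Rightarrow> 'a::complex_star_algebra set \<Rightarrow>
     ('a \<Rightarrow> complex) \<Rightarrow> ('a \<Rightarrow> complex) \<Rightarrow> ('k \<Rightarrow> 'a) \<Rightarrow> ('l \<Rightarrow> 'a) \<Rightarrow> bool" where
  "cyclic_monotone_model mA mB D \<omega> \<tau> a b \<longleftrightarrow>
     nc_probability_space \<tau> \<and> tracial_weight D \<omega> \<and> cyclically_monotone_families D \<omega> \<tau> a b \<and>
     (\<forall>w. w \<noteq> 0 \<longrightarrow> alg_moments \<omega> a w = mA w) \<and> (\<forall>w. w \<noteq> 0 \<longrightarrow> alg_moments \<tau> b w = mB w)"

section \<open>Convergence in eigenvalues\<close>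

text \<open>A selfadjoint compact operator enters through the multiplicity of each of its nonzero
  eigenvalues.  The enumerations below start at index \<open>0\<close>; since zero entries are unconstrained, they
  are exactly the sorted lists of nonnegative (nonpositive) eigenvalues, padded with zeros.\<close>

definition enumerates_nonneg_eigenvalues :: "(real \<Rightarrow> nat) \<Rightarrow> (nat \<Rightarrow> real) \<Rightarrow> bool" where
  "enumerates_nonneg_eigenvalues m l \<longleftrightarrow> decseq l \<and> (\<forall>i. 0 \<le> l i) \<and>
     (\<forall>t>0. finite {i. l i = t} \<and> card {i. l i = t} = m t)"

definition enumerates_nonpos_eigenvalues :: "(real \<Rightarrow> nat) \<Rightarrow> (nat \<Rightarrow> real) \<Rightarrow> bool" where
  "enumerates_nonpos_eigenvalues m l \<longleftrightarrow> incseq l \<and> (\<forall>i. l i \<le> 0) \<and>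
     (\<forall>t<0. finite {i. l i = t} \<and> card {i. l i = t} = m t)"

definition nonneg_eigenvalues :: "(real \<Rightarrow> nat) \<Rightarrow> nat \<Rightarrow> real" where
  "nonneg_eigenvalues m = (THE l. enumerates_nonneg_eigenvalues m l)"

definition nonpos_eigenvalues :: "(real \<Rightarrow> nat) \<Rightarrow> nat \<Rightarrow> real" where
  "nonpos_eigenvalues m = (THE l. enumerates_nonpos_eigenvalues m l)"

definition converges_in_eigenvalues :: "(nat \<Rightarrow> real \<Rightarrow> nat) \<Rightarrow> (real \<Rightarrow> nat) \<Rightarrow> bool" where
  "converges_in_eigenvalues m m' \<longleftrightarrow>
     (\<forall>i. (\<lambda>n. nonneg_eigenvalues (m n) i) \<longlonglongrightarrow> nonneg_eigenvalues m' i) \<and>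
     (\<forall>i. (\<lambda>n. nonpos_eigenvalues (m n) i) \<longlonglongrightarrow> nonpos_eigenvalues m' i)"

definition mat_multiplicity :: "complex mat \<Rightarrow> real \<Rightarrow> nat" where
  "mat_multiplicity X t = Polynomial.order (complex_of_real t) (char_poly X)"

definition op_multiplicity :: "('h::complex_hilbert_space \<Rightarrow> 'h) \<Rightarrow> real \<Rightarrow> nat" where
  "op_multiplicity T t = cdim {x. T x = complex_of_real t *\<^sub>C x}"

section \<open>Haar unitary random matrices\<close>

definition unitary_mats :: "nat \<Rightarrow> complex mat set" where
  "unitary_mats n = {V \<in> carrier_mat n n. V * mat_adjoint V = 1\<^sub>m n \<and> mat_adjoint V * V = 1\<^sub>m n}"

text \<open>The Borel sets of the unitary group, as a subspace of the \<open>n\<^sup>2\<close>-dimensional space of matrices,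
  are generated by the matrix entries.\<close>

definition unitary_borel :: "nat \<Rightarrow> complex mat measure" where
  "unitary_borel n = vimage_algebra (unitary_mats n)
     (\<lambda>V. \<lambda>ij\<in>{..<n} \<times> {..<n}. V $$ ij) (Pi\<^sub>M ({..<n} \<times> {..<n}) (\<lambda>_. borel))"

definition normalized_haar_measure :: "nat \<Rightarrow> complex mat measure \<Rightarrow> bool" where
  "normalized_haar_measure n \<mu> \<longleftrightarrow> sets \<mu> = sets (unitary_borel n) \<and> prob_space \<mu> \<and>
     (\<forall>V\<in>unitary_mats n. distr \<mu> (unitary_borel n) (\<lambda>W. V * W) = \<mu>)"

definition haar_unitary :: "'w measure \<Rightarrow> nat \<Rightarrow> ('w \<Rightarrow> complex mat) \<Rightarrow> bool" where
  "haar_unitary M n U \<longleftrightarrow> U \<in> measurable M (unitary_borel n) \<and>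
     normalized_haar_measure n (distr M (unitary_borel n) U)"

end

theory Submission imports Defs "HOL-Library.Diagonal_Subsequence" begin

text \<open>The fourth moments of \<open>\<langle>u, U b U\<^sup>* v\<rangle>\<close> for traceless \<open>b\<close> are of order \<open>(\<parallel>b\<parallel>\<^sub>2 / n)\<^sup>4\<close>.  By left invariance the
  moment for a unit vector \<open>u = v\<close> does not depend on \<open>u\<close>, so one may average over the vectors with
  entries \<open>\<plusminus>1 / \<surd>n\<close> and apply hypercontractivity for each fixed \<open>U\<close>; polarization gives the rest.  As these bounds
  are summable in \<open>n\<close>, almost surely \<open>Tr (a \<beta> a') \<rightarrow> 0\<close> and \<open>\<parallel>a \<beta> a'\<parallel>\<^sub>2 \<rightarrow> 0\<close> whenever \<open>a, a'\<close> are words in the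
  \<open>A\<^sub>i\<close> and \<open>\<beta>\<close> is a centered word in the \<open>U B\<^sub>j U\<^sup>*\<close>.  For such realizations the traces of all words with at
  least two letters \<open>A\<^sub>i\<close> converge to the values dictated by cyclic monotone independence; a lone letter
  is first replaced by a product, using that a trace class operator is a Hilbert-Schmidt limit of
  products \<open>Y Z\<close> of polynomials in it and its adjoint.

  Hence \<open>Tr (X\<^sub>n\<^sup>p)\<close> converges for \<open>p \<ge> 2\<close>, where \<open>X\<^sub>n\<close> is the matrix of \<open>P\<close>.  The moments with \<open>p \<ge> 3\<close>
  determine the limits of the eigenvalues.  That no Hilbert-Schmidt mass escapes into many small
  eigenvalues is the statement that the limit of \<open>Tr (X\<^sub>n\<^sup>2 (1 - X\<^sub>n\<^sup>2 / C)\<^sup>J)\<close> vanishes as \<open>J \<rightarrow> \<infinity>\<close>, and this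
  again follows from approximating \<open>P\<close> by sums of products.\<close>

subsection \<open>Matrices with the Hilbert-Schmidt norm\<close>

text \<open>The moments bound neither the operator norms of the \<open>B\<close> matrices nor the
  trace norms of the \<open>A\<close> matrices. They do bound the Hilbert-Schmidt norm of words in
  \<open>A\<close>, and that of words in \<open>B\<close> by a multiple of sqrt n. Every estimate
  therefore runs through this norm: \<open>a * b\<close> is controlled by the trace of
  \<open>a * (b * star b) * star a\<close>, with the inner factor centered. The identity too has
  norm sqrt n, so a centered word needs a word in \<open>A\<close> on either side; this is why a
  lone letter is troublesome, and why limits are taken only at words with two such letters, which is
  all that the powers P^p with p >= 2 contain. Matrices of different sizes are compared on the fixed
  free star-algebra, where only trace and norm vary with n. The limit functional on it, taken along
  one realization, is itself a cyclically monotone model: positivity and the trace property pass to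
  the limit. Since the limits depend on the given moments alone, the eigenvalues found from one
  realization serve almost all of them, and their power sums agree with the values in any other
  model.\<close>

lemma mat_adjoint_dim [simp]: "dim_row (mat_adjoint X) = dim_col X" "dim_col (mat_adjoint X) = dim_row X"
  by (simp_all add: mat_adjoint_def)

lemma mat_adjoint_carrier [simp, intro]: "X \<in> carrier_mat n m \<Longrightarrow> mat_adjoint X \<in> carrier_mat m n"
  by (metis carrier_matD carrier_matI mat_adjoint_dim)

lemma mat_adjoint_index [simp]:
  "i < dim_col X \<Longrightarrow> j < dim_row X \<Longrightarrow> mat_adjoint X $$ (i, j) = cnj (X $$ (j, i))"
  for X :: "complex mat"
  by (simp add: mat_adjoint_def mat_of_rows_index conjugate_complex_def)

lemma mat_adjoint_adjoint [simp]: "mat_adjoint (mat_adjoint X) = X" for X :: "complex mat"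
  by (rule eq_matI) auto

lemma mat_mult_index:
  "X \<in> carrier_mat n m \<Longrightarrow> Y \<in> carrier_mat m k \<Longrightarrow> i < n \<Longrightarrow> j < k \<Longrightarrow>
    (X * Y) $$ (i, j) = (\<Sum>l<m. X $$ (i, l) * Y $$ (l, j))"
  by (auto simp: scalar_prod_def lessThan_atLeast0)

lemma mat_adjoint_mult:
  fixes X :: "complex mat"
  assumes "X \<in> carrier_mat n m" "Y \<in> carrier_mat m k"
  shows "mat_adjoint (X * Y) = mat_adjoint Y * mat_adjoint X"
proof (rule eq_matI)
  show "dim_row (mat_adjoint (X * Y)) = dim_row (mat_adjoint Y * mat_adjoint X)"
    "dim_col (mat_adjoint (X * Y)) = dim_col (mat_adjoint Y * mat_adjoint X)" using assms by auto
  fix i j assume "i < dim_row (mat_adjoint Y * mat_adjoint X)" "j < dim_col (mat_adjoint Y * mat_adjoint X)"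
  then have ij: "i < k" "j < n" using assms by auto
  have "(mat_adjoint Y * mat_adjoint X) $$ (i,j) = (\<Sum>l<m. cnj (Y $$ (l,i)) * cnj (X $$ (j,l)))"
    using assms ij by (subst mat_mult_index[of _ k m _ n]) auto
  then show "mat_adjoint (X * Y) $$ (i, j) = (mat_adjoint Y * mat_adjoint X) $$ (i, j)"
    using assms ij by (simp add: mat_mult_index[of X n m Y k] mult.commute del: index_mult_mat(1))
qed

lemma mat_adjoint_one [simp]: "mat_adjoint (1\<^sub>m n) = (1\<^sub>m n :: complex mat)"
  by (rule eq_matI) auto

lemma mat_Tr_mult:
  "X \<in> carrier_mat n m \<Longrightarrow> Y \<in> carrier_mat m n \<Longrightarrow>
    mat_Tr (X * Y) = (\<Sum>i<n. \<Sum>j<m. X $$ (i, j) * Y $$ (j, i))"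
  by (simp add: mat_Tr_def mat_mult_index[of X n m Y n] del: index_mult_mat(1))

lemma mat_Tr_commute:
  assumes "X \<in> carrier_mat n m" "Y \<in> carrier_mat m n"
  shows "mat_Tr (X * Y) = mat_Tr (Y * X)"
  unfolding mat_Tr_mult[OF assms] mat_Tr_mult[OF assms(2,1)]
  by (subst sum.swap) (simp add: mult.commute)

text \<open>The Hilbert-Schmidt (Frobenius) norm. Writing it as \<open>L2_set\<close> over index
  pairs makes the triangle and Cauchy-Schwarz inequalities available at once.\<close>

definition hs_norm :: "complex mat \<Rightarrow> real" where
  "hs_norm X = L2_set (\<lambda>ij. cmod (X $$ ij)) ({..<dim_row X} \<times> {..<dim_col X})"

lemma hs_norm_nonneg [simp]: "0 \<le> hs_norm X"
  by (simp add: hs_norm_def)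

lemma hs_norm_power2:
  "X \<in> carrier_mat n m \<Longrightarrow> (hs_norm X)\<^sup>2 = (\<Sum>i<n. \<Sum>j<m. (cmod (X $$ (i, j)))\<^sup>2)"
  by (auto simp: hs_norm_def L2_set_def sum.cartesian_product sum_nonneg intro!: real_sqrt_pow2)

lemma hs_norm_add:
  assumes "X \<in> carrier_mat n m" "Y \<in> carrier_mat n m"
  shows "hs_norm (X + Y) \<le> hs_norm X + hs_norm Y"
proof -
  have "hs_norm (X + Y) \<le> L2_set (\<lambda>ij. cmod (X $$ ij) + cmod (Y $$ ij)) ({..<n} \<times> {..<m})"
    unfolding hs_norm_def using assms by (auto intro!: L2_set_mono norm_triangle_ineq)
  also have "\<dots> \<le> hs_norm X + hs_norm Y"
    unfolding hs_norm_def using assms by (auto intro!: L2_set_triangle_ineq)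
  finally show ?thesis .
qed

lemma hs_norm_smult: "hs_norm (c \<cdot>\<^sub>m X) = cmod c * hs_norm X"
  unfolding hs_norm_def
  by (subst L2_set_right_distrib) (auto simp: norm_mult intro!: L2_set_cong)

lemma hs_norm_adjoint [simp]: "hs_norm (mat_adjoint X) = hs_norm X"
proof -
  have "(hs_norm (mat_adjoint X))\<^sup>2 = (hs_norm X)\<^sup>2"
    by (subst (1 2) hs_norm_power2, (rule carrier_matI; simp)+)
      (subst sum.swap, simp)
  then show ?thesis by (simp add: power2_eq_iff_nonneg)
qed

lemma mat_Tr_adjoint_mult:
  "X \<in> carrier_mat n m \<Longrightarrow> mat_Tr (mat_adjoint X * X) = complex_of_real ((hs_norm X)\<^sup>2)"
proof -
  assume X: "X \<in> carrier_mat n m"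
  have sq: "cnj z * z = complex_of_real ((cmod z)\<^sup>2)" for z
    by (metis complex_norm_square mult.commute)
  show ?thesis
    unfolding mat_Tr_mult[OF mat_adjoint_carrier[OF X] X] hs_norm_power2[OF X] of_real_sum
    by (subst sum.swap) (use X in \<open>simp add: sq\<close>)
qed

lemma mat_Tr_mult_le:
  assumes "X \<in> carrier_mat n m" "Y \<in> carrier_mat m n"
  shows "cmod (mat_Tr (X * Y)) \<le> hs_norm X * hs_norm Y"
proof -
  have "cmod (mat_Tr (X * Y)) \<le> (\<Sum>i<n. \<Sum>j<m. cmod (X $$ (i, j)) * cmod (Y $$ (j, i)))"
    unfolding mat_Tr_mult[OF assms] norm_mult[symmetric] by (intro sum_norm_le) simp
  also have "\<dots> = (\<Sum>ij\<in>{..<n} \<times> {..<m}. \<bar>cmod (X $$ ij)\<bar> * \<bar>cmod (mat_adjoint Y $$ ij)\<bar>)"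
    unfolding sum.cartesian_product using assms by (auto intro!: sum.cong)
  also have "\<dots> \<le> hs_norm X * hs_norm (mat_adjoint Y)"
    unfolding hs_norm_def using assms L2_set_mult_ineq[of "\<lambda>ij. cmod (X $$ ij)" "\<lambda>ij. cmod (mat_adjoint Y $$ ij)"]
    by simp
  finally show ?thesis by simp
qed

text \<open>Cauchy-Schwarz in each entry. Submultiplicativity takes the place of operator norm
  bounds throughout.\<close>

lemma hs_norm_mult:
  assumes "X \<in> carrier_mat n m" "Y \<in> carrier_mat m k"
  shows "hs_norm (X * Y) \<le> hs_norm X * hs_norm Y"
proof (rule power2_le_imp_le)
  have *: "(cmod ((X * Y) $$ (i, j)))\<^sup>2
      \<le> (\<Sum>l<m. (cmod (X $$ (i, l)))\<^sup>2) * (\<Sum>l<m. (cmod (Y $$ (l, j)))\<^sup>2)" if "i < n" "j < k" for i j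
  proof -
    have "cmod ((X * Y) $$ (i, j)) \<le> (\<Sum>l<m. cmod (X $$ (i, l)) * cmod (Y $$ (l, j)))"
      unfolding mat_mult_index[OF assms that] norm_mult[symmetric] by (rule norm_sum)
    then have "(cmod ((X * Y) $$ (i, j)))\<^sup>2 \<le> (\<Sum>l<m. cmod (X $$ (i, l)) * cmod (Y $$ (l, j)))\<^sup>2"
      by (intro power_mono) auto
    also have "\<dots> \<le> (\<Sum>l<m. (cmod (X $$ (i, l)))\<^sup>2) * (\<Sum>l<m. (cmod (Y $$ (l, j)))\<^sup>2)"
      by (rule Cauchy_Schwarz_ineq_sum)
    finally show ?thesis .
  qed
  have "(hs_norm (X * Y))\<^sup>2
    \<le> (\<Sum>i<n. \<Sum>j<k. (\<Sum>l<m. (cmod (X $$ (i, l)))\<^sup>2) * (\<Sum>l<m. (cmod (Y $$ (l, j)))\<^sup>2))"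
    unfolding hs_norm_power2[OF mult_carrier_mat[OF assms]]
    by (intro sum_mono *) auto
  also have "\<dots> = (hs_norm X)\<^sup>2 * (\<Sum>j<k. \<Sum>l<m. (cmod (Y $$ (l, j)))\<^sup>2)"
    unfolding hs_norm_power2[OF assms(1)] sum_product ..
  also have "(\<Sum>j<k. \<Sum>l<m. (cmod (Y $$ (l, j)))\<^sup>2) = (hs_norm Y)\<^sup>2"
    unfolding hs_norm_power2[OF assms(2)] by (rule sum.swap)
  finally show "(hs_norm (X * Y))\<^sup>2 \<le> (hs_norm X * hs_norm Y)\<^sup>2" by (simp add: power_mult_distrib)
qed simp

subsection \<open>Evaluation of star-polynomials at matrices\<close>

text \<open>Linear extension from words to polynomials. Matrix entries, inner products, moments and
  limit values are all treated as such extensions, so linearity is proved only once.\<close>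

definition nc_lin :: "('v nc_word \<Rightarrow> complex) \<Rightarrow> 'v nc_poly \<Rightarrow> complex" where
  "nc_lin \<phi> p = (\<Sum>w\<in>Poly_Mapping.keys p. Poly_Mapping.lookup p w * \<phi> w)"

lemma nc_lin_superset:
  "finite S \<Longrightarrow> Poly_Mapping.keys p \<subseteq> S \<Longrightarrow> nc_lin \<phi> p = (\<Sum>w\<in>S. Poly_Mapping.lookup p w * \<phi> w)"
  unfolding nc_lin_def by (intro sum.mono_neutral_left) (auto simp: in_keys_iff)

lemma nc_lin_add: "nc_lin \<phi> (p + q) = nc_lin \<phi> p + nc_lin \<phi> q"
proof -
  let ?S = "Poly_Mapping.keys p \<union> Poly_Mapping.keys q"
  have "Poly_Mapping.keys (p + q) \<subseteq> ?S" by (rule Poly_Mapping.keys_add)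
  then show ?thesis
    by (simp add: nc_lin_superset[of ?S] lookup_add distrib_right sum.distrib)
qed

lemma lookup_scaleC: "Poly_Mapping.lookup (c *\<^sub>C p) w = c *\<^sub>C Poly_Mapping.lookup p w"
  by (simp add: scaleC_poly_mapping.rep_eq)

lemma keys_scaleC: "Poly_Mapping.keys (c *\<^sub>C p) \<subseteq> Poly_Mapping.keys p"
  by (auto simp: in_keys_iff lookup_scaleC scaleC_zero)

lemma nc_lin_scaleC: "nc_lin \<phi> (c *\<^sub>C p) = c * nc_lin \<phi> p"
  by (subst nc_lin_superset[OF _ keys_scaleC])
    (simp_all add: nc_lin_def lookup_scaleC scaleC_complex_def sum_distrib_left mult.assoc)

lemma nc_lin_single [simp]: "nc_lin \<phi> (Poly_Mapping.single w c) = c * \<phi> w"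
  by (simp add: nc_lin_def)

lemma nc_lin_zero [simp]: "nc_lin \<phi> 0 = 0"
  by (simp add: nc_lin_def)

lemma word_value_add:
  assumes "\<And>a b c. mul a (mul b c) = mul (mul a b) c" "\<And>a. mul unit a = a"
  shows "word_value mul unit adj f (u + w) = mul (word_value mul unit adj f u) (word_value mul unit adj f w)"
proof -
  have "foldr mul xs (foldr mul ys unit) = mul (foldr mul xs unit) (foldr mul ys unit)" for xs ys
    by (induction xs) (simp_all add: assms(2) assms(1)[symmetric])
  then show ?thesis by (simp add: word_value_def plus_nc_word_def)
qed

context
  fixes n :: nat and f :: "'v \<Rightarrow> complex mat"
  assumes f: "\<And>v. f v \<in> carrier_mat n n"
begin

lemma mat_word_zero [simp]: "mat_word n f 0 = 1\<^sub>m n"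
  by (simp add: mat_word_def word_value_def zero_nc_word_def)

lemma mat_word_Cons: "mat_word n f (Word (l # ls)) =
    (case l of Var v \<Rightarrow> f v | Adj v \<Rightarrow> mat_adjoint (f v)) * mat_word n f (Word ls)"
  by (simp add: mat_word_def word_value_def)

lemma mat_letter_carrier [simp]: "(case l of Var v \<Rightarrow> f v | Adj v \<Rightarrow> mat_adjoint (f v)) \<in> carrier_mat n n"
  using f by (auto split: letter.split)

lemma mat_word_carrier [simp]: "mat_word n f w \<in> carrier_mat n n"
proof (cases w)
  case (Word ls)
  show ?thesis unfolding Word
  proof (induction ls)
    case Nil then show ?case using mat_word_zero by (simp add: zero_nc_word_def)
  next
    case (Cons l ls) then show ?case unfolding mat_word_Cons by (intro mult_carrier_mat[of _ n n]) simp
  qed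
qed

lemma mat_word_add: "mat_word n f (u + w) = mat_word n f u * mat_word n f w"
proof (cases u)
  case (Word ls)
  show ?thesis unfolding Word
  proof (induction ls)
    case Nil
    have "Word [] + w = w" "Word [] = (0 :: 'v nc_word)" by (simp_all add: zero_nc_word_def[symmetric])
    then show ?case using left_mult_one_mat[OF mat_word_carrier[of w]] by simp
  next
    case (Cons l ls)
    have "Word (l # ls) + w = Word (l # letters (Word ls + w))" by (simp add: plus_nc_word_def)
    then have "mat_word n f (Word (l # ls) + w) =
        (case l of Var v \<Rightarrow> f v | Adj v \<Rightarrow> mat_adjoint (f v)) * mat_word n f (Word ls + w)"
      by (simp add: mat_word_Cons)
    then show ?case unfolding Cons mat_word_Cons
      using assoc_mult_mat[OF mat_letter_carrier mat_word_carrier mat_word_carrier] by simp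
  qed
qed

lemma mat_word_invol: "mat_word n f (invol w) = mat_adjoint (mat_word n f w)"
proof (cases w)
  case (Word ls)
  show ?thesis unfolding Word
  proof (induction ls)
    case Nil
    then show ?case using mat_word_zero by (simp add: zero_nc_word_def invol_nc_word_def)
  next
    case (Cons l ls)
    have "invol (Word (l # ls)) = invol (Word ls) + Word [flip_letter l]"
      by (simp add: invol_nc_word_def plus_nc_word_def)
    moreover have "mat_word n f (Word [flip_letter l]) =
        mat_adjoint (case l of Var v \<Rightarrow> f v | Adj v \<Rightarrow> mat_adjoint (f v))"
      using mat_word_Cons[of "flip_letter l" "[]"] right_mult_one_mat[OF mat_letter_carrier[of "flip_letter l"]]
        mat_word_zero by (cases l) (simp_all add: zero_nc_word_def[symmetric])
    ultimately show ?case
      by (simp add: mat_word_add Cons mat_word_Cons mat_adjoint_mult[OF mat_letter_carrier mat_word_carrier])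
  qed
qed

lemma mat_eval_carrier [simp]: "mat_eval n f p \<in> carrier_mat n n"
  by (simp add: mat_eval_def)

lemma mat_eval_index:
  "i < n \<Longrightarrow> j < n \<Longrightarrow> mat_eval n f p $$ (i, j) = nc_lin (\<lambda>w. mat_word n f w $$ (i, j)) p"
  by (simp add: mat_eval_def nc_lin_def)

lemma mat_eval_add: "mat_eval n f (p + q) = mat_eval n f p + mat_eval n f q"
  by (rule eq_matI) (simp_all add: mat_eval_index nc_lin_add carrier_matD[OF mat_eval_carrier])

lemma mat_eval_scaleC: "mat_eval n f (c *\<^sub>C p) = c \<cdot>\<^sub>m mat_eval n f p"
  by (rule eq_matI) (simp_all add: mat_eval_index nc_lin_scaleC carrier_matD[OF mat_eval_carrier])

lemma mat_eval_single: "mat_eval n f (Poly_Mapping.single w c) = c \<cdot>\<^sub>m mat_word n f w"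
  by (rule eq_matI)
    (simp_all add: mat_eval_index carrier_matD[OF mat_eval_carrier] carrier_matD[OF mat_word_carrier])

lemma mat_eval_mult: "mat_eval n f (p * q) = mat_eval n f p * mat_eval n f q"
proof (induction p rule: poly_mapping_single_induct)
  case (single u a)
  show ?case
  proof (induction q rule: poly_mapping_single_induct)
    case (single w b)
    have "mat_eval n f (Poly_Mapping.single u a * Poly_Mapping.single w b)
      = (a * b) \<cdot>\<^sub>m (mat_word n f u * mat_word n f w)"
      by (simp add: mult_single mat_eval_single mat_word_add)
    also have "\<dots> = (a \<cdot>\<^sub>m mat_word n f u) * (b \<cdot>\<^sub>m mat_word n f w)"
      by (subst mult_smult_assoc_mat[OF mat_word_carrier], rule smult_carrier_mat, rule mat_word_carrier)
        (subst mult_smult_distrib[OF mat_word_carrier mat_word_carrier], rule eq_matI, simp_all)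
    finally show ?case by (simp add: mat_eval_single)
  next
    case (add p q)
    then show ?case
      by (simp add: distrib_left mat_eval_add mult_add_distrib_mat[OF mat_eval_carrier mat_eval_carrier mat_eval_carrier])
  qed
next
  case (add p q)
  then show ?case
    by (simp add: distrib_right mat_eval_add add_mult_distrib_mat[OF mat_eval_carrier mat_eval_carrier mat_eval_carrier])
qed

lemma mat_eval_one: "mat_eval n f 1 = 1\<^sub>m n"
  unfolding single_one[symmetric] mat_eval_single mat_word_zero by (rule eq_matI) auto

lemma mat_eval_star: "mat_eval n f (star p) = mat_adjoint (mat_eval n f p)"
proof (induction p rule: poly_mapping_single_induct)
  case (single w a)
  show ?case
    unfolding star_single mat_eval_single mat_word_invol
    by (rule eq_matI) (auto simp: star_complex_def carrier_matD[OF mat_word_carrier])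
next
  case (add p q)
  then show ?case
    unfolding star_add mat_eval_add
    by (intro eq_matI) (auto simp: carrier_matD[OF mat_eval_carrier])
qed

lemma mat_eval_pow: "mat_eval n f (p ^ k) = mat_eval n f p ^\<^sub>m k"
proof (induction k)
  case 0
  then show ?case using mat_eval_one carrier_matD[OF mat_eval_carrier[of p]] by simp
next
  case (Suc k)
  then show ?case by (simp add: power_Suc2 mat_eval_mult del: power_Suc)
qed

lemma mat_Tr_mat_eval: "mat_Tr (mat_eval n f p) = nc_lin (\<lambda>w. mat_Tr (mat_word n f w)) p"
proof -
  have "mat_Tr (mat_eval n f p) = (\<Sum>i<n. nc_lin (\<lambda>w. mat_word n f w $$ (i, i)) p)"
    unfolding mat_Tr_def by (intro sum.cong) (auto simp: mat_eval_index carrier_matD[OF mat_eval_carrier])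
  also have "\<dots> = nc_lin (\<lambda>w. mat_Tr (mat_word n f w)) p"
    unfolding nc_lin_def by (subst sum.swap)
      (simp add: mat_Tr_def sum_distrib_left carrier_matD[OF mat_word_carrier])
  finally show ?thesis .
qed

end

subsection \<open>Quadratic forms in random signs\<close>

text \<open>A sign pattern is encoded by the set of its positive positions, so that expectations
  over independent signs become sums over \<open>Pow {..<n}\<close> (up to the factor 2^n) and
  induction on \<open>n\<close> adds one sign at a time.\<close>

definition sign_vec :: "nat set \<Rightarrow> nat \<Rightarrow> real" where
  "sign_vec S i = (if i \<in> S then 1 else -1)"

definition chaos1 :: "nat \<Rightarrow> (nat \<Rightarrow> real) \<Rightarrow> nat set \<Rightarrow> real" where
  "chaos1 n a S = (\<Sum>i<n. a i * sign_vec S i)"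

text \<open>Each pair i < j is listed at its larger index: the last sign then multiplies a linear
  form in the earlier ones, which is the shape that the induction needs.\<close>

definition chaos2 :: "nat \<Rightarrow> (nat \<Rightarrow> nat \<Rightarrow> real) \<Rightarrow> nat set \<Rightarrow> real" where
  "chaos2 n s S = (\<Sum>j<n. sign_vec S j * chaos1 j (\<lambda>i. s i j) S)"

lemma sum_Pow_lessThan_Suc:
  fixes f :: "nat set \<Rightarrow> 'a::comm_monoid_add"
  shows "(\<Sum>S\<in>Pow {..<Suc n}. f S) = (\<Sum>S\<in>Pow {..<n}. f S + f (insert n S))"
proof -
  have "(\<Sum>S\<in>Pow {..<Suc n}. f S) = (\<Sum>S\<in>Pow {..<n}. f S) + (\<Sum>S\<in>insert n ` Pow {..<n}. f S)"
    unfolding lessThan_Suc Pow_insert by (rule sum.union_disjoint) auto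
  also have "(\<Sum>S\<in>insert n ` Pow {..<n}. f S) = (\<Sum>S\<in>Pow {..<n}. f (insert n S))"
  proof (rule sum.reindex_cong[where l = "insert n"])
    show "inj_on (insert n) (Pow {..<n})"
      by (rule inj_onI) (metis Pow_iff insert_ident lessThan_iff less_irrefl subsetD)
  qed auto
  finally show ?thesis by (simp add: sum.distrib)
qed

lemma chaos1_insert: "m \<le> n \<Longrightarrow> chaos1 m a (insert n S) = chaos1 m a S"
  unfolding chaos1_def by (intro sum.cong) (auto simp: sign_vec_def)

lemma chaos2_insert: "m \<le> n \<Longrightarrow> chaos2 m a (insert n S) = chaos2 m a S"
  unfolding chaos2_def by (intro sum.cong) (auto simp: sign_vec_def chaos1_insert)

text \<open>The two values of the new sign shift the form by its new coefficient in either
  direction. The function \<open>h\<close> is left open to serve second and fourth powers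
  alike.\<close>

lemma sum_chaos1_Suc:
  fixes h :: "real \<Rightarrow> real"
  shows "(\<Sum>S\<in>Pow {..<Suc n}. h (chaos1 (Suc n) a S)) =
    (\<Sum>S\<in>Pow {..<n}. h (chaos1 n a S - a n) + h (chaos1 n a S + a n))"
proof -
  have "chaos1 (Suc n) a S = chaos1 n a S - a n" "chaos1 (Suc n) a (insert n S) = chaos1 n a S + a n"
    if "S \<in> Pow {..<n}" for S
    using that chaos1_insert[of n n a S] by (auto simp: chaos1_def sign_vec_def)
  then show ?thesis unfolding sum_Pow_lessThan_Suc by (intro sum.cong) auto
qed

lemma sum_chaos2_Suc:
  fixes h :: "real \<Rightarrow> real"
  shows "(\<Sum>S\<in>Pow {..<Suc n}. h (chaos2 (Suc n) s S)) =
    (\<Sum>S\<in>Pow {..<n}. h (chaos2 n s S - chaos1 n (\<lambda>i. s i n) S) + h (chaos2 n s S + chaos1 n (\<lambda>i. s i n) S))"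
proof -
  have "chaos2 (Suc n) s S = chaos2 n s S - chaos1 n (\<lambda>i. s i n) S"
    "chaos2 (Suc n) s (insert n S) = chaos2 n s S + chaos1 n (\<lambda>i. s i n) S"
    if "S \<in> Pow {..<n}" for S
    using that chaos2_insert[of n n s S] chaos1_insert[of n n _ S]
    by (auto simp: chaos2_def sign_vec_def)
  then show ?thesis unfolding sum_Pow_lessThan_Suc by (intro sum.cong) auto
qed

lemma sum_chaos1_power2: "(\<Sum>S\<in>Pow {..<n}. (chaos1 n a S)\<^sup>2) = 2 ^ n * (\<Sum>i<n. (a i)\<^sup>2)"
proof (induction n)
  case 0 then show ?case by (simp add: chaos1_def)
next
  case (Suc n)
  have "(x - y)\<^sup>2 + (x + y)\<^sup>2 = 2 * x\<^sup>2 + 2 * y\<^sup>2" for x y :: real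
    by (simp add: power2_eq_square algebra_simps)
  then have "(\<Sum>S\<in>Pow {..<Suc n}. (chaos1 (Suc n) a S)\<^sup>2)
      = 2 * (\<Sum>S\<in>Pow {..<n}. (chaos1 n a S)\<^sup>2) + 2 ^ n * (2 * (a n)\<^sup>2)"
    unfolding sum_chaos1_Suc[of "\<lambda>x. x\<^sup>2"] by (simp add: sum.distrib sum_distrib_left card_Pow)
  then show ?case unfolding Suc by (simp add: algebra_simps)
qed

lemma power4_sum_diff: "(x - y)^4 + (x + y)^4 = 2 * x^4 + 12 * (x\<^sup>2 * y\<^sup>2) + 2 * y^4" for x y :: real
  by (simp add: power4_eq_xxxx power2_eq_square algebra_simps)

text \<open>Khintchine's inequality for fourth moments with the constant 3. Odd powers of the new
  coefficient cancel, and the cross term needs only the exact second moment.\<close>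

lemma sum_chaos1_power4: "(\<Sum>S\<in>Pow {..<n}. (chaos1 n a S)^4) \<le> 3 * 2 ^ n * (\<Sum>i<n. (a i)\<^sup>2)\<^sup>2"
proof (induction n)
  case 0 then show ?case by (simp add: chaos1_def)
next
  case (Suc n)
  let ?q = "\<Sum>i<n. (a i)\<^sup>2"
  have "(\<Sum>S\<in>Pow {..<Suc n}. (chaos1 (Suc n) a S)^4)
      = 2 * (\<Sum>S\<in>Pow {..<n}. (chaos1 n a S)^4) + 12 * (a n)\<^sup>2 * (\<Sum>S\<in>Pow {..<n}. (chaos1 n a S)\<^sup>2)
        + 2 ^ n * (2 * (a n)^4)"
    unfolding sum_chaos1_Suc[of "\<lambda>x. x ^ 4"] power4_sum_diff
    by (simp add: sum.distrib sum_distrib_left card_Pow algebra_simps)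
  also have "\<dots> \<le> 2 * (3 * 2 ^ n * ?q\<^sup>2) + 12 * (a n)\<^sup>2 * (2 ^ n * ?q) + 2 ^ n * (2 * (a n)^4)"
    using Suc unfolding sum_chaos1_power2 by simp
  also have "\<dots> = 2 ^ n * (6 * ?q\<^sup>2 + 12 * (a n)\<^sup>2 * ?q + 2 * (a n)^4)" by (simp add: algebra_simps)
  \<comment> \<open>Raising the last coefficient from 2 to 6 completes the square 6 (q +
    a^2)^2.\<close>
  also have "\<dots> \<le> 2 ^ n * (6 * ?q\<^sup>2 + 12 * (a n)\<^sup>2 * ?q + 6 * (a n)^4)"
    by (intro mult_left_mono) auto
  also have "\<dots> = 3 * 2 ^ Suc n * (\<Sum>i<Suc n. (a i)\<^sup>2)\<^sup>2"
    by (simp add: power2_eq_square power4_eq_xxxx algebra_simps)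
  finally show ?case .
qed

text \<open>Hypercontractivity in degree two: 81 = 3^4 is Bonami's constant for comparing the fourth
  moment with the squared second moment. The last sign is split off; the cross term follows by
  Cauchy-Schwarz from the induction hypothesis and the bound in degree one.\<close>

lemma sum_chaos2_power4:
  "(\<Sum>S\<in>Pow {..<n}. (chaos2 n s S)^4) \<le> 81 * 2 ^ n * (\<Sum>j<n. \<Sum>i<j. (s i j)\<^sup>2)\<^sup>2"
proof (induction n)
  case 0 then show ?case by (simp add: chaos2_def)
next
  case (Suc n)
  let ?q = "\<Sum>j<n. \<Sum>i<j. (s i j)\<^sup>2" and ?r = "\<Sum>i<n. (s i n)\<^sup>2"
  let ?f = "\<lambda>S. chaos2 n s S" and ?g = "\<lambda>S. chaos1 n (\<lambda>i. s i n) S"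
  have q0: "0 \<le> ?q" "0 \<le> ?r" by (auto intro!: sum_nonneg)
  have cross: "(\<Sum>S\<in>Pow {..<n}. (?f S)\<^sup>2 * (?g S)\<^sup>2) \<le> 16 * 2 ^ n * ?q * ?r"
  proof (rule power2_le_imp_le)
    have "(\<Sum>S\<in>Pow {..<n}. (?f S)\<^sup>2 * (?g S)\<^sup>2)\<^sup>2
        \<le> (\<Sum>S\<in>Pow {..<n}. ((?f S)\<^sup>2)\<^sup>2) * (\<Sum>S\<in>Pow {..<n}. ((?g S)\<^sup>2)\<^sup>2)"
      by (rule Cauchy_Schwarz_ineq_sum)
    also have "\<dots> \<le> (81 * 2 ^ n * ?q\<^sup>2) * (3 * 2 ^ n * ?r\<^sup>2)"
      using Suc sum_chaos1_power4[of n "\<lambda>i. s i n"] by (intro mult_mono) (auto intro!: sum_nonneg)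
    also have "\<dots> \<le> (16 * 2 ^ n * ?q * ?r)\<^sup>2"
    proof -
      \<comment> \<open>The product 81 * 3 = 243 is rounded up to 256 = 16^2 to obtain a
        square.\<close>
      have "243 * (2 ^ n * ?q * ?r)\<^sup>2 \<le> 256 * (2 ^ n * ?q * ?r)\<^sup>2" by (intro mult_right_mono) auto
      then show ?thesis by (simp add: power2_eq_square algebra_simps)
    qed
    finally show "(\<Sum>S\<in>Pow {..<n}. (?f S)\<^sup>2 * (?g S)\<^sup>2)\<^sup>2 \<le> (16 * 2 ^ n * ?q * ?r)\<^sup>2" .
  qed (use q0 in auto)
  have "(\<Sum>S\<in>Pow {..<Suc n}. (chaos2 (Suc n) s S)^4)
      = 2 * (\<Sum>S\<in>Pow {..<n}. (?f S)^4) + 12 * (\<Sum>S\<in>Pow {..<n}. (?f S)\<^sup>2 * (?g S)\<^sup>2)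
        + 2 * (\<Sum>S\<in>Pow {..<n}. (?g S)^4)"
    unfolding sum_chaos2_Suc[of "\<lambda>x. x ^ 4"] power4_sum_diff by (simp add: sum.distrib sum_distrib_left)
  also have "\<dots> \<le> 2 * (81 * 2 ^ n * ?q\<^sup>2) + 12 * (16 * 2 ^ n * ?q * ?r) + 2 * (3 * 2 ^ n * ?r\<^sup>2)"
    using Suc cross sum_chaos1_power4[of n "\<lambda>i. s i n"] by (intro add_mono mult_left_mono) auto
  also have "\<dots> = 2 ^ n * (162 * ?q\<^sup>2 + 192 * (?q * ?r) + 6 * ?r\<^sup>2)" by (simp add: algebra_simps)
  \<comment> \<open>Enlarging 192 to 324 and 6 to 162 completes the square 162 (q + r)^2.\<close>
  also have "\<dots> \<le> 2 ^ n * (162 * ?q\<^sup>2 + 324 * (?q * ?r) + 162 * ?r\<^sup>2)"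
    using q0 by (intro mult_left_mono add_mono mult_right_mono) auto
  also have "\<dots> = 81 * 2 ^ Suc n * (\<Sum>j<Suc n. \<Sum>i<j. (s i j)\<^sup>2)\<^sup>2"
    by (simp add: power2_eq_square algebra_simps)
  finally show ?case .
qed

lemma sum_square_split:
  fixes h :: "nat \<Rightarrow> nat \<Rightarrow> 'a::comm_monoid_add"
  shows "(\<Sum>i<n. \<Sum>j<n. h i j) = (\<Sum>j<n. h j j) + (\<Sum>j<n. \<Sum>i<j. h i j + h j i)"
  by (induction n) (simp_all add: sum.distrib ac_simps)

text \<open>Signs square to 1, so the diagonal contributes the trace, which vanishes; what remains
  is a chaos of degree two with coefficients m i j + m j i. The constant is 2 * (324 + 324): real
  and imaginary part each cost 324 = 81 * 4, where 4 is the square of the factor 2 lost in bounding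
  these coefficients by the entries, and the outer 2 pays for separating the two parts.\<close>

lemma sum_sign_form_power4:
  fixes m :: "nat \<Rightarrow> nat \<Rightarrow> complex"
  assumes "(\<Sum>i<n. m i i) = 0"
  shows "(\<Sum>S\<in>Pow {..<n}. cmod (\<Sum>i<n. \<Sum>j<n. m i j * of_real (sign_vec S i * sign_vec S j)) ^ 4)
    \<le> 1296 * 2 ^ n * (\<Sum>i<n. \<Sum>j<n. (cmod (m i j))\<^sup>2)\<^sup>2"
proof -
  let ?H = "\<Sum>i<n. \<Sum>j<n. (cmod (m i j))\<^sup>2"
  let ?z = "\<lambda>S. \<Sum>i<n. \<Sum>j<n. m i j * of_real (sign_vec S i * sign_vec S j)"
  let ?re = "\<lambda>i j. Re (m i j + m j i)" and ?im = "\<lambda>i j. Im (m i j + m j i)"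
  have z: "?z S = (\<Sum>j<n. \<Sum>i<j. (m i j + m j i) * of_real (sign_vec S i * sign_vec S j))" for S
  proof -
    have "sign_vec S j * sign_vec S j = 1" for j by (simp add: sign_vec_def)
    then show ?thesis unfolding sum_square_split using assms by (simp add: algebra_simps)
  qed
  have re: "Re (?z S) = chaos2 n ?re S" and im: "Im (?z S) = chaos2 n ?im S" for S
    unfolding z chaos2_def chaos1_def by (simp_all add: sum_distrib_left ac_simps)
  have "(\<Sum>j<n. \<Sum>i<j. (cmod (m i j + m j i))\<^sup>2) \<le> (\<Sum>j<n. \<Sum>i<j. 2 * ((cmod (m i j))\<^sup>2 + (cmod (m j i))\<^sup>2))"
  proof (intro sum_mono)
    fix i j
    have "(cmod (m i j + m j i))\<^sup>2 \<le> (cmod (m i j) + cmod (m j i))\<^sup>2"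
      by (intro power_mono norm_triangle_ineq) auto
    also have "\<dots> \<le> 2 * ((cmod (m i j))\<^sup>2 + (cmod (m j i))\<^sup>2)"
      using sum_squares_bound[of "cmod (m i j)" "cmod (m j i)"] by (simp add: power2_sum)
    finally show "(cmod (m i j + m j i))\<^sup>2 \<le> 2 * ((cmod (m i j))\<^sup>2 + (cmod (m j i))\<^sup>2)" .
  qed
  also have "\<dots> \<le> 2 * ?H"
    unfolding sum_distrib_left[symmetric] sum_square_split[of "\<lambda>i j. (cmod (m i j))\<^sup>2"]
    by (simp add: sum_nonneg)
  finally have H: "(\<Sum>j<n. \<Sum>i<j. (cmod (m i j + m j i))\<^sup>2) \<le> 2 * ?H" .
  have *: "81 * 2 ^ n * (\<Sum>j<n. \<Sum>i<j. (s i j)\<^sup>2)\<^sup>2 \<le> 324 * 2 ^ n * ?H\<^sup>2"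
    if "\<And>i j. \<bar>s i j\<bar> \<le> cmod (m i j + m j i)" for s :: "nat \<Rightarrow> nat \<Rightarrow> real"
  proof -
    have "(\<Sum>j<n. \<Sum>i<j. (s i j)\<^sup>2) \<le> (\<Sum>j<n. \<Sum>i<j. (cmod (m i j + m j i))\<^sup>2)"
      using that by (intro sum_mono) (metis abs_ge_zero power2_abs power_mono)
    also note H
    finally have "(\<Sum>j<n. \<Sum>i<j. (s i j)\<^sup>2)\<^sup>2 \<le> (2 * ?H)\<^sup>2" by (intro power_mono) (auto intro!: sum_nonneg)
    then show ?thesis by (simp add: power_mult_distrib)
  qed
  have "cmod z ^ 4 \<le> 2 * (Re z ^ 4 + Im z ^ 4)" for z
  proof -
    have "cmod z ^ 4 = ((Re z)\<^sup>2 + (Im z)\<^sup>2)\<^sup>2" unfolding cmod_power2[symmetric] by simp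
    also have "\<dots> \<le> 2 * (Re z ^ 4 + Im z ^ 4)"
      using sum_squares_bound[of "(Re z)\<^sup>2" "(Im z)\<^sup>2"] by (simp add: power2_sum)
    finally show ?thesis .
  qed
  then have "(\<Sum>S\<in>Pow {..<n}. cmod (?z S) ^ 4) \<le> (\<Sum>S\<in>Pow {..<n}. 2 * (Re (?z S) ^ 4 + Im (?z S) ^ 4))"
    by (intro sum_mono)
  also have "\<dots> = 2 * ((\<Sum>S\<in>Pow {..<n}. chaos2 n ?re S ^ 4) + (\<Sum>S\<in>Pow {..<n}. chaos2 n ?im S ^ 4))"
    unfolding re im by (simp add: sum.distrib sum_distrib_left)
  also have "\<dots> \<le> 2 * (324 * 2 ^ n * ?H\<^sup>2 + 324 * 2 ^ n * ?H\<^sup>2)"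
    by (intro mult_left_mono add_mono order_trans[OF sum_chaos2_power4 *])
      (simp_all add: abs_Re_le_cmod abs_Im_le_cmod del: plus_complex.sel)
  finally show ?thesis by simp
qed

section \<open>Sesquilinear forms and transitivity of the unitary group on unit vectors\<close>

definition sq_norm :: "nat \<Rightarrow> (nat \<Rightarrow> complex) \<Rightarrow> real" where
  "sq_norm n u = (\<Sum>i<n. (cmod (u i))\<^sup>2)"

definition mat_form :: "nat \<Rightarrow> complex mat \<Rightarrow> (nat \<Rightarrow> complex) \<Rightarrow> (nat \<Rightarrow> complex) \<Rightarrow> complex" where
  "mat_form n X u v = (\<Sum>i<n. \<Sum>j<n. cnj (u i) * X $$ (i, j) * v j)"

text \<open>The adjoint of \<open>W\<close> applied to \<open>u\<close>. Vectors are functions on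
  \<open>nat\<close> of which only the values below \<open>n\<close> matter.\<close>

definition adj_act :: "nat \<Rightarrow> complex mat \<Rightarrow> (nat \<Rightarrow> complex) \<Rightarrow> nat \<Rightarrow> complex" where
  "adj_act n W u = (\<lambda>a. \<Sum>i<n. cnj (W $$ (i, a)) * u i)"

lemma sq_norm_nonneg [simp]: "0 \<le> sq_norm n u"
  by (simp add: sq_norm_def sum_nonneg)

lemma sq_norm_scale: "sq_norm n (\<lambda>i. c * u i) = (cmod c)\<^sup>2 * sq_norm n u"
  by (simp add: sq_norm_def norm_mult power_mult_distrib sum_distrib_left)

lemma sq_norm_eq_0: "sq_norm n u = 0 \<Longrightarrow> i < n \<Longrightarrow> u i = 0"
  by (simp add: sq_norm_def sum_nonneg_eq_0_iff)

lemma sq_norm_add: "sq_norm n (\<lambda>i. u i + v i) \<le> 2 * (sq_norm n u + sq_norm n v)"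
proof -
  have "(cmod (u i + v i))\<^sup>2 \<le> 2 * ((cmod (u i))\<^sup>2 + (cmod (v i))\<^sup>2)" for i
  proof -
    have "(cmod (u i + v i))\<^sup>2 \<le> (cmod (u i) + cmod (v i))\<^sup>2"
      by (intro power_mono norm_triangle_ineq) auto
    also have "\<dots> \<le> 2 * ((cmod (u i))\<^sup>2 + (cmod (v i))\<^sup>2)"
      using sum_squares_bound[of "cmod (u i)" "cmod (v i)"] by (simp add: power2_sum)
    finally show ?thesis .
  qed
  then show ?thesis
    unfolding sq_norm_def sum.distrib[symmetric] sum_distrib_left by (intro sum_mono) auto
qed

lemma mat_form_scale:
  "mat_form n X (\<lambda>i. a * u i) (\<lambda>i. b * v i) = cnj a * b * mat_form n X u v"
  by (simp add: mat_form_def sum_distrib_left ac_simps)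

lemma mat_form_add:
  "mat_form n X (\<lambda>i. u i + u' i) (\<lambda>i. v i + v' i) =
    mat_form n X u v + mat_form n X u v' + mat_form n X u' v + mat_form n X u' v'"
  by (simp add: mat_form_def algebra_simps sum.distrib)

lemma mat_form_cong:
  "(\<And>i. i < n \<Longrightarrow> u i = u' i) \<Longrightarrow> (\<And>i. i < n \<Longrightarrow> v i = v' i) \<Longrightarrow> mat_form n X u v = mat_form n X u' v'"
  by (simp add: mat_form_def)

lemma mat_form_mult_left:
  assumes "W \<in> carrier_mat n n" "Y \<in> carrier_mat n n"
  shows "mat_form n (W * Y) u v = mat_form n Y (adj_act n W u) v"
proof -
  have "mat_form n (W * Y) u v = (\<Sum>i<n. \<Sum>j<n. \<Sum>a<n. cnj (u i) * W $$ (i, a) * Y $$ (a, j) * v j)"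
    unfolding mat_form_def
    by (intro sum.cong refl)
      (simp add: mat_mult_index[OF assms] sum_distrib_left sum_distrib_right mult.assoc del: index_mult_mat(1))
  also have "\<dots> = (\<Sum>i<n. \<Sum>a<n. \<Sum>j<n. cnj (u i) * W $$ (i, a) * Y $$ (a, j) * v j)"
    by (rule sum.cong[OF refl], rule sum.swap)
  also have "\<dots> = (\<Sum>a<n. \<Sum>i<n. \<Sum>j<n. cnj (u i) * W $$ (i, a) * Y $$ (a, j) * v j)"
    by (rule sum.swap)
  also have "\<dots> = (\<Sum>a<n. \<Sum>j<n. \<Sum>i<n. cnj (u i) * W $$ (i, a) * Y $$ (a, j) * v j)"
    by (rule sum.cong[OF refl], rule sum.swap)
  also have "\<dots> = mat_form n Y (adj_act n W u) v"
    unfolding mat_form_def adj_act_def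
    by (simp add: sum_distrib_left sum_distrib_right cnj_sum mult_ac)
  finally show ?thesis .
qed

lemma mat_form_adjoint:
  assumes "X \<in> carrier_mat n n"
  shows "mat_form n (mat_adjoint X) u v = cnj (mat_form n X v u)"
  unfolding mat_form_def using assms
  by (simp add: cnj_sum, subst sum.swap) (simp add: mult_ac)

text \<open>The right-hand unitary is moved to \<open>v\<close> by taking adjoints twice and reusing
  \<open>mat_form_mult_left\<close>.\<close>

lemma mat_form_conj:
  assumes "W \<in> carrier_mat n n" "b \<in> carrier_mat n n"
  shows "mat_form n (W * b * mat_adjoint W) u v = mat_form n b (adj_act n W u) (adj_act n W v)"
proof -
  have "W * b * mat_adjoint W = W * (b * mat_adjoint W)"
    by (rule assoc_mult_mat) (use assms in auto)
  then have "mat_form n (W * b * mat_adjoint W) u v = mat_form n (b * mat_adjoint W) (adj_act n W u) v"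
    using assms by (simp add: mat_form_mult_left)
  also have "b * mat_adjoint W = mat_adjoint (W * mat_adjoint b)"
    using assms mat_adjoint_mult[of W n n "mat_adjoint b" n] by simp
  also have "mat_form n \<dots> (adj_act n W u) v = cnj (mat_form n (mat_adjoint b) (adj_act n W v) (adj_act n W u))"
    using assms mat_form_mult_left[of W n "mat_adjoint b" v "adj_act n W u"]
    by (subst mat_form_adjoint) (auto simp del: mat_adjoint_carrier intro!: mult_carrier_mat[of _ n n] mat_adjoint_carrier)
  also have "\<dots> = mat_form n b (adj_act n W u) (adj_act n W v)"
    using assms by (simp add: mat_form_adjoint)
  finally show ?thesis .
qed

lemma adj_act_mult:
  assumes "V \<in> carrier_mat n n" "W \<in> carrier_mat n n" "a < n"
  shows "adj_act n (V * W) u a = adj_act n W (adj_act n V u) a"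
proof -
  have "adj_act n (V * W) u a = (\<Sum>i<n. \<Sum>l<n. cnj (V $$ (i, l)) * cnj (W $$ (l, a)) * u i)"
    unfolding adj_act_def using assms
    by (intro sum.cong refl)
      (simp add: mat_mult_index[OF assms(1,2)] cnj_sum sum_distrib_right del: index_mult_mat(1))
  also have "\<dots> = adj_act n W (adj_act n V u) a"
    unfolding adj_act_def by (subst sum.swap) (simp add: sum_distrib_left mult_ac)
  finally show ?thesis .
qed

text \<open>A complex Householder reflection; the phase \<open>c\<close> makes the inner product of the two vectors
  real, without which no reflection exchanges them.\<close>

lemma unitary_transitive:
  assumes u: "sq_norm n u = 1" and v: "sq_norm n v = 1"
  shows "\<exists>V\<in>unitary_mats n. \<exists>c. cmod c = 1 \<and> (\<forall>i<n. adj_act n V u i = c * v i)"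
proof -
  define z where "z = (\<Sum>i<n. cnj (v i) * u i)"
  define c where "c = (if z = 0 then 1 else z / of_real (cmod z))"
  have c1: "cmod c = 1" by (simp add: c_def norm_divide)
  then have cc: "cnj c * c = 1" by (metis complex_norm_square mult.commute of_real_1 power_one)
  have cz: "cnj c * z = of_real (cmod z)"
  proof (cases "z = 0")
    case False
    have "cnj z * z = of_real (cmod z) * of_real (cmod z)"
      by (metis complex_norm_square mult.commute power2_eq_square of_real_mult)
    then show ?thesis using False by (simp add: c_def)
  qed simp
  have un: "(\<Sum>i<n. cnj (u i) * u i) = 1" and vn: "(\<Sum>i<n. cnj (v i) * v i) = 1"
  proof -
    have "(\<Sum>i<n. cnj (x i) * x i) = of_real (sq_norm n x)" for x
      unfolding sq_norm_def of_real_sum complex_norm_square by (simp add: mult.commute)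
    then show "(\<Sum>i<n. cnj (u i) * u i) = 1" "(\<Sum>i<n. cnj (v i) * v i) = 1" using u v by simp_all
  qed
  define w where "w = (\<lambda>i. u i - c * v i)"
  define k where "k = (\<Sum>i<n. cnj (w i) * w i)"
  have uz: "(\<Sum>i<n. cnj (u i) * v i) = cnj z" by (simp add: z_def cnj_sum mult.commute)
  have wu: "(\<Sum>i<n. cnj (w i) * u i) = 1 - of_real (cmod z)"
  proof -
    have "(\<Sum>i<n. cnj (w i) * u i) = (\<Sum>i<n. cnj (u i) * u i) - cnj c * (\<Sum>i<n. cnj (v i) * u i)"
      by (simp add: w_def algebra_simps sum_subtractf sum_distrib_left)
    then show ?thesis using un cz by (simp add: z_def)
  qed
  have k2: "k = 2 * (1 - of_real (cmod z))"
  proof -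
    have "k = (\<Sum>i<n. cnj (w i) * u i) - c * (\<Sum>i<n. cnj (u i) * v i) + cnj c * c * (\<Sum>i<n. cnj (v i) * v i)"
      by (simp add: k_def w_def algebra_simps sum_subtractf sum_distrib_left sum.distrib)
    also have "c * (\<Sum>i<n. cnj (u i) * v i) = cnj (cnj c * z)" by (simp add: uz)
    finally show ?thesis unfolding wu vn cc cz by simp
  qed
  \<comment> \<open>If k = 0, the quotient 2 / k is 0 and \<open>V\<close> is the identity; this is
    the case \<open>w = 0\<close>, in which \<open>u\<close> already is \<open>c\<close> times
    \<open>v\<close>. The computation of \<open>V * V\<close> covers it without a case
    distinction.\<close>
  define V where "V = Matrix.mat n n (\<lambda>(i, j). (if i = j then 1 else 0) - 2 / k * (w i * cnj (w j)))"
  have kr: "cnj k = k" by (simp add: k2)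
  have V: "V \<in> carrier_mat n n" by (simp add: V_def)
  have Vherm: "mat_adjoint V = V"
    by (rule eq_matI) (auto simp: V_def kr mult.commute)
  have VV: "V * V = 1\<^sub>m n"
  proof (rule eq_matI)
    fix i j assume "i < dim_row (1\<^sub>m n :: complex mat)" "j < dim_col (1\<^sub>m n :: complex mat)"
    then have ij: "i < n" "j < n" by auto
    have "(V * V) $$ (i, j) = (\<Sum>l<n. ((if i = l then 1 else 0) - 2 / k * (w i * cnj (w l))) *
        ((if l = j then 1 else 0) - 2 / k * (w l * cnj (w j))))"
      using ij by (simp add: mat_mult_index[OF V V] del: index_mult_mat(1)) (simp add: V_def)
    also have "\<dots> = (\<Sum>l<n. (if i = l then (if l = j then 1 else 0) else 0)) -
        (\<Sum>l<n. if i = l then 2 / k * (w l * cnj (w j)) else 0) -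
        (\<Sum>l<n. if l = j then 2 / k * (w i * cnj (w l)) else 0) +
        (2 / k)\<^sup>2 * w i * cnj (w j) * k"
      unfolding k_def sum_distrib_left sum_subtractf[symmetric] sum.distrib[symmetric]
      by (intro sum.cong refl) (simp add: algebra_simps power2_eq_square)
    also have "\<dots> = (if i = j then 1 else 0) - 2 / k * (w i * cnj (w j)) - 2 / k * (w i * cnj (w j))
        + (2 / k)\<^sup>2 * w i * cnj (w j) * k"
      using ij by (simp add: sum.delta sum.delta')
    also have "\<dots> = (if i = j then 1 else 0)"
      by (simp add: power2_eq_square field_simps)
    finally show "(V * V) $$ (i, j) = 1\<^sub>m n $$ (i, j)" using ij by simp
  qed (use V in auto)
  have "V \<in> unitary_mats n" using V Vherm VV by (simp add: unitary_mats_def)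
  moreover have "adj_act n V u i = c * v i" if i: "i < n" for i
  proof -
    have "adj_act n V u i = (\<Sum>j<n. (if j = i then u j else 0) - 2 / k * w i * (cnj (w j) * u j))"
      unfolding adj_act_def by (intro sum.cong refl) (use i in \<open>auto simp: V_def kr algebra_simps\<close>)
    also have "\<dots> = u i - 2 / k * w i * (1 - of_real (cmod z))"
      unfolding sum_subtractf sum_distrib_left[symmetric] wu using i by simp
    also have "\<dots> = c * v i"
    proof (cases "k = 0")
      case True
      have "of_real (sq_norm n w) = k"
        unfolding sq_norm_def of_real_sum k_def complex_norm_square by (simp add: mult.commute)
      then have "w i = 0" using True i sq_norm_eq_0[of n w i] by simp
      then show ?thesis by (simp add: w_def)
    next
      case False
      \<comment> \<open>Since k is twice the inner product of \<open>w\<close> and \<open>u\<close>,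
        the reflection subtracts exactly \<open>w\<close> from \<open>u\<close>.\<close>
      then have "2 / k * (1 - of_real (cmod z)) = 1" by (simp add: k2)
      then have "2 / k * w i * (1 - of_real (cmod z)) = w i" by (metis mult.commute mult.left_commute mult.right_neutral)
      then show ?thesis by (simp add: w_def)
    qed
    finally show ?thesis .
  qed
  ultimately show ?thesis using c1 by blast
qed

subsection \<open>Left invariance\<close>

lemma space_unitary_borel [simp]: "space (unitary_borel n) = unitary_mats n"
  by (simp add: unitary_borel_def)

lemma measurable_unitary_entry:
  assumes "i < n" "j < n"
  shows "(\<lambda>W. W $$ (i, j)) \<in> borel_measurable (unitary_borel n)"
proof -
  have "(\<lambda>V. \<lambda>ij\<in>{..<n} \<times> {..<n}. V $$ ij) \<in> measurable (unitary_borel n) (Pi\<^sub>M ({..<n} \<times> {..<n}) (\<lambda>_. borel))"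
    unfolding unitary_borel_def by (rule measurable_vimage_algebra1) (auto simp: space_PiM)
  from measurable_compose[OF this measurable_component_singleton[of "(i, j)"]] assms
  show ?thesis by simp
qed

text \<open>The sigma-algebra is generated by the entries, and those of \<open>V * W\<close> are
  linear combinations of those of \<open>W\<close>; the rest is closure of the unitary group under
  products.\<close>

lemma measurable_unitary_mult_left:
  assumes V: "V \<in> unitary_mats n"
  shows "(\<lambda>W. V * W) \<in> measurable (unitary_borel n) (unitary_borel n)"
proof -
  have VC: "V \<in> carrier_mat n n" using V by (simp add: unitary_mats_def)
  have clos: "V * W \<in> unitary_mats n" if W: "W \<in> unitary_mats n" for W
  proof -
    have WC: "W \<in> carrier_mat n n" using W by (simp add: unitary_mats_def)
    have adj: "mat_adjoint (V * W) = mat_adjoint W * mat_adjoint V" by (rule mat_adjoint_mult[OF VC WC])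
    have uV: "V * mat_adjoint V = 1\<^sub>m n" "mat_adjoint V * V = 1\<^sub>m n"
      and uW: "W * mat_adjoint W = 1\<^sub>m n" "mat_adjoint W * W = 1\<^sub>m n"
      using V W by (auto simp: unitary_mats_def)
    note c = VC WC mat_adjoint_carrier[OF VC] mat_adjoint_carrier[OF WC]
    have "V * W * mat_adjoint (V * W) = V * (W * (mat_adjoint W * mat_adjoint V))"
      unfolding adj by (rule assoc_mult_mat[OF c(1,2) mult_carrier_mat[OF c(4,3)]])
    also have "W * (mat_adjoint W * mat_adjoint V) = W * mat_adjoint W * mat_adjoint V"
      by (rule assoc_mult_mat[OF c(2,4,3), symmetric])
    finally have "V * W * mat_adjoint (V * W) = 1\<^sub>m n"
      unfolding uW left_mult_one_mat[OF c(3)] uV .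
    moreover have "mat_adjoint (V * W) * (V * W) = 1\<^sub>m n"
    proof -
      have "mat_adjoint (V * W) * (V * W) = mat_adjoint W * (mat_adjoint V * (V * W))"
        unfolding adj by (rule assoc_mult_mat[OF c(4,3) mult_carrier_mat[OF c(1,2)]])
      also have "mat_adjoint V * (V * W) = mat_adjoint V * V * W"
        by (rule assoc_mult_mat[OF c(3,1,2), symmetric])
      finally show ?thesis unfolding uV left_mult_one_mat[OF c(2)] uW .
    qed
    ultimately show ?thesis using mult_carrier_mat[OF VC WC] by (simp add: unitary_mats_def)
  qed
  show ?thesis
    unfolding unitary_borel_def[of n]
  proof (rule measurable_vimage_algebra2)
    show "(\<lambda>W. V * W) \<in> space (vimage_algebra (unitary_mats n) (\<lambda>V. restrict ((\<lambda>ij. V $$ ij)) ({..<n} \<times> {..<n}))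
      (Pi\<^sub>M ({..<n} \<times> {..<n}) (\<lambda>_. borel))) \<rightarrow> unitary_mats n"
      using clos by auto
    have "(\<lambda>W. \<lambda>ij\<in>{..<n} \<times> {..<n}. (V * W) $$ ij) \<in> measurable (unitary_borel n) (Pi\<^sub>M ({..<n} \<times> {..<n}) (\<lambda>_. borel))"
    proof (rule measurable_restrict)
      fix ij assume "ij \<in> {..<n} \<times> {..<n}"
      then obtain i j where ij: "ij = (i, j)" "i < n" "j < n" by auto
      have "(\<lambda>W. \<Sum>l<n. V $$ (i, l) * W $$ (l, j)) \<in> borel_measurable (unitary_borel n)"
        using ij by (intro borel_measurable_sum borel_measurable_times measurable_unitary_entry) auto
      then show "(\<lambda>W. (V * W) $$ ij) \<in> borel_measurable (unitary_borel n)"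
        by (rule measurable_cong[THEN iffD2, rotated])
          (use ij VC in \<open>auto simp: unitary_mats_def mat_mult_index[OF VC] simp del: index_mult_mat(1)\<close>)
    qed
    then show "(\<lambda>W. \<lambda>ij\<in>{..<n} \<times> {..<n}. (V * W) $$ ij) \<in> measurable (vimage_algebra (unitary_mats n)
        (\<lambda>V. restrict ((\<lambda>ij. V $$ ij)) ({..<n} \<times> {..<n})) (Pi\<^sub>M ({..<n} \<times> {..<n}) (\<lambda>_. borel)))
        (Pi\<^sub>M ({..<n} \<times> {..<n}) (\<lambda>_. borel))"
      unfolding unitary_borel_def .
  qed
qed

lemma haar_unitary_nn_integral:
  assumes U: "haar_unitary M n U" and V: "V \<in> unitary_mats n"
    and f: "f \<in> borel_measurable (unitary_borel n)"
  shows "(\<integral>\<^sup>+\<xi>. f (V * U \<xi>) \<partial>M) = (\<integral>\<^sup>+\<xi>. f (U \<xi>) \<partial>M)"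
proof -
  let ?m = "distr M (unitary_borel n) U"
  have Um: "U \<in> measurable M (unitary_borel n)" and inv: "distr ?m (unitary_borel n) (\<lambda>W. V * W) = ?m"
    using U V by (auto simp: haar_unitary_def normalized_haar_measure_def)
  have Vm: "(\<lambda>W. V * W) \<in> measurable ?m (unitary_borel n)"
    using measurable_unitary_mult_left[OF V] by simp
  have fV: "(\<lambda>W. f (V * W)) \<in> borel_measurable (unitary_borel n)"
    by (rule measurable_compose[OF measurable_unitary_mult_left[OF V] f])
  have "(\<integral>\<^sup>+\<xi>. f (V * U \<xi>) \<partial>M) = (\<integral>\<^sup>+W. f (V * W) \<partial>?m)"
    using fV by (subst nn_integral_distr[OF Um]) simp_all
  also have "\<dots> = (\<integral>\<^sup>+W. f W \<partial>distr ?m (unitary_borel n) (\<lambda>W. V * W))"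
    using f by (subst nn_integral_distr[OF Vm]) simp_all
  also have "\<dots> = (\<integral>\<^sup>+\<xi>. f (U \<xi>) \<partial>M)"
    unfolding inv using f by (subst nn_integral_distr[OF Um]) simp_all
  finally show ?thesis .
qed

lemma haar_unitary_mem:
  "haar_unitary M n U \<Longrightarrow> \<xi> \<in> space M \<Longrightarrow> U \<xi> \<in> unitary_mats n"
  by (metis haar_unitary_def measurable_space space_unitary_borel)

text \<open>Jensen's inequality for the convex even power, with weights r k / R at the points p k /
  r k.\<close>

lemma sum_power_le_weighted:
  fixes p r :: "'i \<Rightarrow> real"
  assumes I: "finite I" and r: "\<And>k. k \<in> I \<Longrightarrow> 0 < r k" and m: "even m" and ne: "I \<noteq> {}"
  defines "R \<equiv> \<Sum>k\<in>I. r k"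
  shows "(\<Sum>k\<in>I. p k) ^ m \<le> (\<Sum>k\<in>I. R ^ m * (r k / R) / r k ^ m * p k ^ m)"
proof -
  have R: "R > 0" unfolding R_def using assms by (intro sum_pos) auto
  have "(\<Sum>k\<in>I. (r k / R) *\<^sub>R (p k / r k)) ^ m \<le> (\<Sum>k\<in>I. (r k / R) * (p k / r k) ^ m)"
  proof (rule convex_on_sum[OF I ne convex_power_even[OF m]])
    show "(\<Sum>k\<in>I. r k / R) = 1" using R by (simp add: sum_divide_distrib[symmetric] R_def[symmetric])
  qed (use r R in \<open>auto simp: less_imp_le\<close>)
  also have "(\<Sum>k\<in>I. (r k / R) *\<^sub>R (p k / r k)) = (\<Sum>k\<in>I. p k) / R"
    unfolding sum_divide_distrib by (intro sum.cong refl) (use r in \<open>force simp: less_imp_neq\<close>)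
  finally have "R ^ m * ((\<Sum>k\<in>I. p k) / R) ^ m \<le> R ^ m * (\<Sum>k\<in>I. (r k / R) * (p k / r k) ^ m)"
    using R by (intro mult_left_mono) auto
  then show ?thesis using R by (simp add: power_divide sum_distrib_left mult.assoc)
qed

text \<open>Minkowski's inequality in L^m: if each \<open>p k\<close> has norm at most K^(1/m) times
  \<open>r k\<close>, the norms add up. The scales vary from term to term, so equal weights would
  lose too much. The weights divide by \<open>r k\<close>, hence terms of scale zero are removed
  beforehand by \<open>zero\<close>.\<close>

lemma nn_integral_sum_power_le:
  fixes p :: "'i \<Rightarrow> 'w \<Rightarrow> real"
  assumes I: "finite I" and m: "even m" "m > 0" and K: "0 \<le> K"
    and meas: "\<And>k. k \<in> I \<Longrightarrow> p k \<in> borel_measurable M"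
    and r: "\<And>k. k \<in> I \<Longrightarrow> 0 \<le> r k"
    and zero: "\<And>k \<xi>. k \<in> I \<Longrightarrow> r k = 0 \<Longrightarrow> \<xi> \<in> space M \<Longrightarrow> p k \<xi> = 0"
    and le: "\<And>k. k \<in> I \<Longrightarrow> (\<integral>\<^sup>+\<xi>. ennreal (p k \<xi> ^ m) \<partial>M) \<le> ennreal (K * r k ^ m)"
  shows "(\<integral>\<^sup>+\<xi>. ennreal ((\<Sum>k\<in>I. p k \<xi>) ^ m) \<partial>M) \<le> ennreal (K * (\<Sum>k\<in>I. r k) ^ m)"
proof -
  define J where "J = {k \<in> I. 0 < r k}"
  have J: "finite J" "\<And>k. k \<in> J \<Longrightarrow> 0 < r k" "J \<subseteq> I" using I by (auto simp: J_def)
  have sp: "(\<Sum>k\<in>I. p k \<xi>) = (\<Sum>k\<in>J. p k \<xi>)" if "\<xi> \<in> space M" for \<xi>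
    using zero that r I by (intro sum.mono_neutral_right) (auto simp: J_def less_le)
  have sr: "(\<Sum>k\<in>I. r k) = (\<Sum>k\<in>J. r k)"
    using r I by (intro sum.mono_neutral_right) (auto simp: J_def less_le)
  show ?thesis
  proof (cases "J = {}")
    case True
    then have "(\<integral>\<^sup>+\<xi>. ennreal ((\<Sum>k\<in>I. p k \<xi>) ^ m) \<partial>M) = (\<integral>\<^sup>+\<xi>. 0 \<partial>M)"
      using m by (intro nn_integral_cong) (simp add: sp)
    then show ?thesis by simp
  next
    case False
    define R where "R = (\<Sum>k\<in>J. r k)"
    have R: "R > 0" unfolding R_def using J False by (intro sum_pos) auto
    define c where "c k = R ^ m * (r k / R) / r k ^ m" for k
    have c: "0 \<le> c k" if "k \<in> J" for k using J(2)[OF that] R by (simp add: c_def)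
    have p0: "0 \<le> p k \<xi> ^ m" for k \<xi> using m by (simp add: zero_le_even_power)
    have "(\<integral>\<^sup>+\<xi>. ennreal ((\<Sum>k\<in>I. p k \<xi>) ^ m) \<partial>M)
        \<le> (\<integral>\<^sup>+\<xi>. (\<Sum>k\<in>J. ennreal (c k) * ennreal (p k \<xi> ^ m)) \<partial>M)"
    proof (rule nn_integral_mono)
      fix \<xi> assume x: "\<xi> \<in> space M"
      have "(\<Sum>k\<in>J. p k \<xi>) ^ m \<le> (\<Sum>k\<in>J. c k * p k \<xi> ^ m)"
        unfolding c_def R_def by (rule sum_power_le_weighted) (use J False m in auto)
      then have "ennreal ((\<Sum>k\<in>I. p k \<xi>) ^ m) \<le> ennreal (\<Sum>k\<in>J. c k * p k \<xi> ^ m)"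
        using sp[OF x] by (simp add: ennreal_leI)
      also have "\<dots> = (\<Sum>k\<in>J. ennreal (c k) * ennreal (p k \<xi> ^ m))"
        using c p0 by (subst sum_ennreal[symmetric]) (auto simp: ennreal_mult intro!: sum.cong)
      finally show "ennreal ((\<Sum>k\<in>I. p k \<xi>) ^ m) \<le> (\<Sum>k\<in>J. ennreal (c k) * ennreal (p k \<xi> ^ m))" .
    qed
    also have "\<dots> = (\<Sum>k\<in>J. ennreal (c k) * (\<integral>\<^sup>+\<xi>. ennreal (p k \<xi> ^ m) \<partial>M))"
      using meas J(3) by (subst nn_integral_sum) (auto intro!: sum.cong nn_integral_cmult)
    also have "\<dots> \<le> (\<Sum>k\<in>J. ennreal (c k) * ennreal (K * r k ^ m))"
      using le J(3) by (intro sum_mono mult_left_mono) auto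
    also have "\<dots> = ennreal (\<Sum>k\<in>J. c k * (K * r k ^ m))"
      using c K J by (subst sum_ennreal[symmetric]) (auto simp: ennreal_mult less_imp_le intro!: sum.cong)
    also have "(\<Sum>k\<in>J. c k * (K * r k ^ m)) = (\<Sum>k\<in>J. K * R ^ m / R * r k)"
      by (intro sum.cong refl) (use J(2) in \<open>force simp: c_def field_simps less_imp_neq\<close>)
    also have "\<dots> = K * R ^ m / R * R" unfolding R_def sum_distrib_left ..
    finally show ?thesis using R unfolding sr R_def by simp
  qed
qed

section \<open>Fourth moments of forms in a randomly conjugated matrix\<close>

text \<open>By \<open>mat_form_conj\<close> this is the form of the conjugated matrix. With the
  unitary moved to the vectors it is visibly a polynomial in the entries of \<open>W\<close> and
  their conjugates, and left multiplication of \<open>W\<close> acts on \<open>u\<close> and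
  \<open>v\<close>.\<close>

definition conj_form :: "nat \<Rightarrow> complex mat \<Rightarrow> (nat \<Rightarrow> complex) \<Rightarrow> (nat \<Rightarrow> complex) \<Rightarrow> complex mat \<Rightarrow> complex" where
  "conj_form n b u v W = mat_form n b (adj_act n W u) (adj_act n W v)"

lemma adj_act_scale: "adj_act n W (\<lambda>i. c * u i) a = c * adj_act n W u a"
  by (simp add: adj_act_def sum_distrib_left mult_ac)

lemma adj_act_add: "adj_act n W (\<lambda>i. u i + v i) a = adj_act n W u a + adj_act n W v a"
  by (simp add: adj_act_def sum.distrib algebra_simps)

lemma conj_form_scale:
  "conj_form n b (\<lambda>i. c * u i) (\<lambda>i. d * v i) W = cnj c * d * conj_form n b u v W"
  unfolding conj_form_def adj_act_scale[abs_def] mat_form_scale ..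

lemma conj_form_add:
  "conj_form n b (\<lambda>i. u i + u' i) (\<lambda>i. v i + v' i) W =
    conj_form n b u v W + conj_form n b u v' W + conj_form n b u' v W + conj_form n b u' v' W"
  unfolding conj_form_def adj_act_add[abs_def] mat_form_add ..

lemma conj_form_polarization:
  "conj_form n b u v W = (\<Sum>k<4. cnj (\<i> ^ k) *
     conj_form n b (\<lambda>i. u i + \<i> ^ k * v i) (\<lambda>i. u i + \<i> ^ k * v i) W) / 4"
proof -
  have 1: "conj_form n b u (\<lambda>i. d * v i) W = d * conj_form n b u v W" for u v d
    using conj_form_scale[of n b 1 u d v W] by simp
  have 2: "conj_form n b (\<lambda>i. d * v i) u W = cnj d * conj_form n b v u W" for u v d
    using conj_form_scale[of n b d v 1 u W] by simp
  have *: "(\<Sum>k<4. f k) = f 0 + f 1 + f 2 + f 3" for f :: "nat \<Rightarrow> complex"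
    by (simp add: eval_nat_numeral)
  show ?thesis
    unfolding * conj_form_add 1 2 by (simp add: power3_eq_cube algebra_simps)
qed

lemma conj_form_zero: "sq_norm n u = 0 \<or> sq_norm n v = 0 \<Longrightarrow> conj_form n b u v W = 0"
proof -
  have "adj_act n W u = (\<lambda>a. 0)" if "sq_norm n u = 0" for u
    unfolding adj_act_def using sq_norm_eq_0[OF that] by simp
  moreover assume "sq_norm n u = 0 \<or> sq_norm n v = 0"
  ultimately show ?thesis by (auto simp: conj_form_def mat_form_def)
qed

lemma measurable_conj_form:
  "conj_form n b u v \<in> borel_measurable (unitary_borel n)"
proof -
  have cnj: "(\<lambda>W. cnj (g W)) \<in> borel_measurable (unitary_borel n)"
    if "g \<in> borel_measurable (unitary_borel n)" for g
    by (rule borel_measurable_continuous_on[OF _ that]) (intro continuous_intros)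
  have "(\<lambda>W. mat_form n b (adj_act n W u) (adj_act n W v)) \<in> borel_measurable (unitary_borel n)"
    unfolding mat_form_def adj_act_def
    by (intro borel_measurable_sum borel_measurable_times cnj measurable_unitary_entry borel_measurable_const) auto
  then show ?thesis unfolding conj_form_def[abs_def] .
qed

lemma mat_Tr_unitary_conj:
  assumes W: "W \<in> unitary_mats n" and b: "b \<in> carrier_mat n n"
  shows "mat_Tr (W * b * mat_adjoint W) = mat_Tr b"
proof -
  have c: "W \<in> carrier_mat n n" "mat_adjoint W \<in> carrier_mat n n" "mat_adjoint W * W = 1\<^sub>m n"
    using W by (auto simp: unitary_mats_def)
  have "mat_Tr (W * b * mat_adjoint W) = mat_Tr (mat_adjoint W * (W * b))"
    by (rule mat_Tr_commute[OF mult_carrier_mat[OF c(1) b] c(2)])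
  also have "mat_adjoint W * (W * b) = mat_adjoint W * W * b"
    by (rule assoc_mult_mat[OF c(2,1) b, symmetric])
  finally show ?thesis unfolding c(3) left_mult_one_mat[OF b] .
qed

lemma unitary_conj_mult:
  assumes W: "W \<in> unitary_mats n" and b: "b \<in> carrier_mat n n" "b' \<in> carrier_mat n n"
  shows "(W * b * mat_adjoint W) * (W * b' * mat_adjoint W) = W * (b * b') * mat_adjoint W"
proof -
  have c: "W \<in> carrier_mat n n" "mat_adjoint W \<in> carrier_mat n n" "mat_adjoint W * W = 1\<^sub>m n"
    using W by (auto simp: unitary_mats_def)
  note m = mult_carrier_mat
  have 1: "W * b' * mat_adjoint W = W * (b' * mat_adjoint W)"
    by (rule assoc_mult_mat[OF c(1) b(2) c(2)])
  have "mat_adjoint W * (W * (b' * mat_adjoint W)) = mat_adjoint W * W * (b' * mat_adjoint W)"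
    by (rule assoc_mult_mat[OF c(2,1) m[OF b(2) c(2)], symmetric])
  then have 2: "mat_adjoint W * (W * b' * mat_adjoint W) = b' * mat_adjoint W"
    unfolding 1 c(3) left_mult_one_mat[OF m[OF b(2) c(2)]] .
  have "(W * b * mat_adjoint W) * (W * b' * mat_adjoint W) = W * b * (mat_adjoint W * (W * b' * mat_adjoint W))"
    by (rule assoc_mult_mat[OF m[OF c(1) b(1)] c(2) m[OF m[OF c(1) b(2)] c(2)]])
  also have "\<dots> = W * b * b' * mat_adjoint W"
    unfolding 2 by (rule assoc_mult_mat[OF m[OF c(1) b(1)] b(2) c(2), symmetric])
  also have "W * b * b' = W * (b * b')" by (rule assoc_mult_mat[OF c(1) b])
  finally show ?thesis .
qed

lemma unitary_conj_adjoint: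
  fixes W :: "complex mat"
  assumes W: "W \<in> carrier_mat n n" and b: "b \<in> carrier_mat n n"
  shows "mat_adjoint (W * b * mat_adjoint W) = W * mat_adjoint b * mat_adjoint W"
  using assms mat_adjoint_mult[OF mult_carrier_mat[OF W b] mat_adjoint_carrier[OF W]]
    mat_adjoint_mult[OF W b] assoc_mult_mat[OF W mat_adjoint_carrier[OF b] mat_adjoint_carrier[OF W]]
  by simp

lemma hs_norm_unitary_conj:
  assumes W: "W \<in> unitary_mats n" and b: "b \<in> carrier_mat n n"
  shows "hs_norm (W * b * mat_adjoint W) = hs_norm b"
proof -
  have c: "W \<in> carrier_mat n n" using W by (auto simp: unitary_mats_def)
  then have c': "W * b * mat_adjoint W \<in> carrier_mat n n"
    using b by (intro mult_carrier_mat[of _ n n]) auto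
  have "complex_of_real ((hs_norm (W * b * mat_adjoint W))\<^sup>2) = complex_of_real ((hs_norm b)\<^sup>2)"
    unfolding mat_Tr_adjoint_mult[OF c', symmetric] mat_Tr_adjoint_mult[OF b, symmetric]
      unitary_conj_adjoint[OF c b] unitary_conj_mult[OF W mat_adjoint_carrier[OF b] b]
    using b by (intro mat_Tr_unitary_conj[OF W]) auto
  then show ?thesis by (simp only: of_real_eq_iff power2_eq_iff_nonneg hs_norm_nonneg)
qed

context
  fixes M :: "'w measure" and n :: nat and U :: "'w \<Rightarrow> complex mat" and b :: "complex mat"
  assumes M: "prob_space M" and U: "haar_unitary M n U" and b: "b \<in> carrier_mat n n"
    and Tr: "mat_Tr b = 0" and n: "n > 0"
begin

lemma measurable_conj_form_haar: "(\<lambda>\<xi>. conj_form n b u v (U \<xi>)) \<in> borel_measurable M"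
  using U measurable_compose[OF _ measurable_conj_form] by (auto simp: haar_unitary_def)

text \<open>Some unitary \<open>V\<close> carries \<open>u\<close> to \<open>v\<close> up to a
  phase. Replacing \<open>U\<close> by \<open>V * U\<close> preserves the integral, and the phase
  cancels because it occurs in both arguments of the form.\<close>

lemma nn_integral_form_unit_eq:
  assumes u: "sq_norm n u = 1" and v: "sq_norm n v = 1"
  shows "(\<integral>\<^sup>+\<xi>. ennreal (cmod (conj_form n b u u (U \<xi>)) ^ 4) \<partial>M) =
    (\<integral>\<^sup>+\<xi>. ennreal (cmod (conj_form n b v v (U \<xi>)) ^ 4) \<partial>M)"
proof -
  obtain V c where V: "V \<in> unitary_mats n" and c: "cmod c = 1"
    and eq: "\<And>i. i < n \<Longrightarrow> adj_act n V u i = c * v i"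
    using unitary_transitive[OF u v] by blast
  have VC: "V \<in> carrier_mat n n" using V by (simp add: unitary_mats_def)
  have "(\<lambda>W. ennreal (cmod (conj_form n b u u W) ^ 4)) \<in> borel_measurable (unitary_borel n)"
    using measurable_conj_form[of n b u u] by measurable
  from haar_unitary_nn_integral[OF U V this]
  have "(\<integral>\<^sup>+\<xi>. ennreal (cmod (conj_form n b u u (U \<xi>)) ^ 4) \<partial>M)
    = (\<integral>\<^sup>+\<xi>. ennreal (cmod (conj_form n b u u (V * U \<xi>)) ^ 4) \<partial>M)" by simp
  also have "\<dots> = (\<integral>\<^sup>+\<xi>. ennreal (cmod (conj_form n b v v (U \<xi>)) ^ 4) \<partial>M)"
  proof (rule nn_integral_cong)
    fix \<xi> assume "\<xi> \<in> space M"
    then have UC: "U \<xi> \<in> carrier_mat n n"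
      using haar_unitary_mem[OF U] by (auto simp: unitary_mats_def)
    have *: "adj_act n (V * U \<xi>) u a = c * adj_act n (U \<xi>) v a" if "a < n" for a
    proof -
      have "adj_act n (V * U \<xi>) u a = adj_act n (U \<xi>) (adj_act n V u) a"
        by (rule adj_act_mult[OF VC UC that])
      also have "\<dots> = adj_act n (U \<xi>) (\<lambda>i. c * v i) a"
        unfolding adj_act_def[of n "U \<xi>"] using eq by simp
      finally show ?thesis by (simp add: adj_act_scale)
    qed
    have "conj_form n b u u (V * U \<xi>) = cnj c * c * conj_form n b v v (U \<xi>)"
      unfolding conj_form_def mat_form_scale[symmetric] using * by (intro mat_form_cong) auto
    then show "ennreal (cmod (conj_form n b u u (V * U \<xi>)) ^ 4) = ennreal (cmod (conj_form n b v v (U \<xi>)) ^ 4)"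
      using c by (simp add: norm_mult)
  qed
  finally show ?thesis .
qed

lemma nn_integral_form_unit_le:
  assumes u: "sq_norm n u = 1"
  shows "(\<integral>\<^sup>+\<xi>. ennreal (cmod (conj_form n b u u (U \<xi>)) ^ 4) \<partial>M) \<le> ennreal (1296 * (hs_norm b / n) ^ 4)"
proof -
  interpret prob_space M by (rule M)
  define e where "e S i = complex_of_real (sign_vec S i / sqrt n)" for S i
  have e1: "sq_norm n (e S) = 1" for S
  proof -
    have "(cmod (e S i))\<^sup>2 = 1 / n" for i
      by (simp add: e_def sign_vec_def norm_divide power_divide)
    then show ?thesis using n by (simp add: sq_norm_def)
  qed
  let ?G = "\<lambda>u. \<integral>\<^sup>+\<xi>. ennreal (cmod (conj_form n b u u (U \<xi>)) ^ 4) \<partial>M"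
  \<comment> \<open>All \<open>e S\<close> are unit vectors, so each of the 2^n terms on the right
    equals the moment at \<open>u\<close>. The sum is then estimated pointwise, for fixed
    \<open>U\<close>.\<close>
  have "ennreal (2 ^ n) * ?G u = (\<Sum>S\<in>Pow {..<n}. ?G (e S))"
    using nn_integral_form_unit_eq[OF e1 u]
    by (simp add: card_Pow ennreal_power[symmetric])
  also have "\<dots> = (\<integral>\<^sup>+\<xi>. (\<Sum>S\<in>Pow {..<n}. ennreal (cmod (conj_form n b (e S) (e S) (U \<xi>)) ^ 4)) \<partial>M)"
    by (subst nn_integral_sum) (use measurable_conj_form_haar in measurable)
  also have "\<dots> \<le> (\<integral>\<^sup>+\<xi>. ennreal (2 ^ n * (1296 * (hs_norm b / n) ^ 4)) \<partial>M)"
  proof (rule nn_integral_mono)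
    fix \<xi> assume "\<xi> \<in> space M"
    then have Ux: "U \<xi> \<in> unitary_mats n" by (rule haar_unitary_mem[OF U])
    then have UC: "U \<xi> \<in> carrier_mat n n" by (auto simp: unitary_mats_def)
    define X where "X = U \<xi> * b * mat_adjoint (U \<xi>)"
    have X: "X \<in> carrier_mat n n"
      using UC b unfolding X_def by (intro mult_carrier_mat[of _ n n]) auto
    have "mat_Tr X = 0" unfolding X_def mat_Tr_unitary_conj[OF Ux b] by (rule Tr)
    then have tr: "(\<Sum>i<n. X $$ (i, i)) = 0" using X by (simp add: mat_Tr_def)
    have hs: "(\<Sum>i<n. \<Sum>j<n. (cmod (X $$ (i, j)))\<^sup>2) = (hs_norm b)\<^sup>2"
      unfolding hs_norm_power2[OF X, symmetric] by (simp add: X_def hs_norm_unitary_conj[OF Ux b])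
    let ?s = "\<lambda>S. \<Sum>i<n. \<Sum>j<n. X $$ (i, j) * of_real (sign_vec S i * sign_vec S j)"
    have cf: "conj_form n b (e S) (e S) (U \<xi>) = ?s S / n" for S
    proof -
      have "conj_form n b (e S) (e S) (U \<xi>) = mat_form n X (e S) (e S)"
        unfolding conj_form_def X_def mat_form_conj[OF UC b] ..
      also have "\<dots> = ?s S / n"
        unfolding mat_form_def e_def sum_divide_distrib
        by (intro sum.cong refl) (simp add: field_simps power2_eq_square[symmetric] of_real_power[symmetric] del: of_real_power)
      finally show ?thesis .
    qed
    have "(\<Sum>S\<in>Pow {..<n}. cmod (conj_form n b (e S) (e S) (U \<xi>)) ^ 4) = (\<Sum>S\<in>Pow {..<n}. cmod (?s S) ^ 4) / n ^ 4"
      by (simp only: cf norm_divide power_divide) (simp add: sum_divide_distrib)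
    also have "\<dots> \<le> 1296 * 2 ^ n * ((hs_norm b)\<^sup>2)\<^sup>2 / n ^ 4"
      using sum_sign_form_power4[of "\<lambda>i j. X $$ (i, j)" n] tr unfolding hs by (intro divide_right_mono) auto
    also have "\<dots> = 2 ^ n * (1296 * (hs_norm b / n) ^ 4)" by (simp add: power_divide)
    finally show "(\<Sum>S\<in>Pow {..<n}. ennreal (cmod (conj_form n b (e S) (e S) (U \<xi>)) ^ 4))
        \<le> ennreal (2 ^ n * (1296 * (hs_norm b / n) ^ 4))"
      by (subst sum_ennreal) (auto intro: ennreal_leI)
  qed
  also have "\<dots> = ennreal (2 ^ n) * ennreal (1296 * (hs_norm b / n) ^ 4)"
    by (simp add: emeasure_space_1 ennreal_mult)
  finally show ?thesis
    by (subst (asm) ennreal_mult_le_mult_iff) auto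
qed

lemma nn_integral_form_diag_le:
  "(\<integral>\<^sup>+\<xi>. ennreal (cmod (conj_form n b u u (U \<xi>)) ^ 4) \<partial>M) \<le> ennreal (1296 * (hs_norm b / n) ^ 4 * sq_norm n u ^ 4)"
proof (cases "sq_norm n u = 0")
  case True
  then show ?thesis by (simp add: conj_form_zero)
next
  case False
  define s where "s = sqrt (sq_norm n u)"
  have s: "s > 0" "s\<^sup>2 = sq_norm n u" using False by (simp_all add: s_def less_le)
  define u' where "u' = (\<lambda>i. of_real (1 / s) * u i)"
  have "sq_norm n u' = (1 / s)\<^sup>2 * sq_norm n u"
    unfolding u'_def sq_norm_scale using s by (simp add: norm_divide)
  then have u': "sq_norm n u' = 1" using s False by (simp add: power_divide)
  have "conj_form n b u u W = of_real (s\<^sup>2) * conj_form n b u' u' W" for W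
    unfolding u'_def conj_form_scale using s(1) by (simp add: power2_eq_square)
  then have "ennreal (cmod (conj_form n b u u (U \<xi>)) ^ 4) =
      ennreal (sq_norm n u ^ 4) * ennreal (cmod (conj_form n b u' u' (U \<xi>)) ^ 4)" for \<xi>
    unfolding s(2) by (simp add: norm_mult power_mult_distrib ennreal_mult)
  then have "(\<integral>\<^sup>+\<xi>. ennreal (cmod (conj_form n b u u (U \<xi>)) ^ 4) \<partial>M)
      = ennreal (sq_norm n u ^ 4) * (\<integral>\<^sup>+\<xi>. ennreal (cmod (conj_form n b u' u' (U \<xi>)) ^ 4) \<partial>M)"
    using measurable_conj_form_haar[of u' u'] by (subst nn_integral_cmult[symmetric]) auto
  also have "\<dots> \<le> ennreal (sq_norm n u ^ 4) * ennreal (1296 * (hs_norm b / n) ^ 4)"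
    by (intro mult_left_mono nn_integral_form_unit_le u') auto
  also have "\<dots> = ennreal (1296 * (hs_norm b / n) ^ 4 * sq_norm n u ^ 4)"
    by (simp add: ennreal_mult[symmetric] mult.commute)
  finally show ?thesis .
qed

text \<open>The constant is 256 * 1296. For unit vectors, polarization writes the form as an average
  of four diagonal ones at vectors of squared norm at most 4. Fourth moments of diagonal forms scale
  with the fourth power of the squared norm, which gives 4^4 = 256; the averaging itself costs
  nothing.\<close>

lemma nn_integral_form_le:
  "(\<integral>\<^sup>+\<xi>. ennreal (cmod (conj_form n b u v (U \<xi>)) ^ 4) \<partial>M)
    \<le> ennreal (331776 * (hs_norm b / n) ^ 4 * (sq_norm n u * sq_norm n v)\<^sup>2)"
proof -
  let ?C = "1296 * (hs_norm b / n) ^ 4"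
  have unit: "(\<integral>\<^sup>+\<xi>. ennreal (cmod (conj_form n b u v (U \<xi>)) ^ 4) \<partial>M) \<le> ennreal (256 * ?C)"
    if u: "sq_norm n u = 1" and v: "sq_norm n v = 1" for u v
  proof -
    define w where "w k i = u i + \<i> ^ k * v i" for k i
    have w: "sq_norm n (w k) \<le> 4" for k
    proof -
      have "sq_norm n (\<lambda>i. \<i> ^ k * v i) = 1" by (simp add: sq_norm_scale v norm_power)
      then show ?thesis using sq_norm_add[of n u "\<lambda>i. \<i> ^ k * v i"] u by (simp add: w_def[abs_def])
    qed
    let ?p = "\<lambda>k \<xi>. cmod (conj_form n b (w k) (w k) (U \<xi>)) / 4"
    have le: "cmod (conj_form n b u v W) \<le> (\<Sum>k<4::nat. cmod (conj_form n b (w k) (w k) W) / 4)" for W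
    proof -
      have "cmod (\<Sum>k<4. cnj (\<i> ^ k) * conj_form n b (w k) (w k) W)
          \<le> (\<Sum>k<4. cmod (cnj (\<i> ^ k) * conj_form n b (w k) (w k) W))" by (rule norm_sum)
      also have "\<dots> = (\<Sum>k<4. cmod (conj_form n b (w k) (w k) W))"
        by (intro sum.cong refl) (simp add: norm_mult norm_power)
      finally have *: "cmod (\<Sum>k<4. cnj (\<i> ^ k) * conj_form n b (w k) (w k) W)
          \<le> (\<Sum>k<4. cmod (conj_form n b (w k) (w k) W))" .
      have pol: "conj_form n b u v W = (\<Sum>k<4. cnj (\<i> ^ k) * conj_form n b (w k) (w k) W) / 4"
        unfolding w_def[abs_def] by (rule conj_form_polarization)
      show ?thesis
        unfolding pol norm_divide sum_divide_distrib[symmetric] using * by simp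
    qed
    have "(\<integral>\<^sup>+\<xi>. ennreal (cmod (conj_form n b u v (U \<xi>)) ^ 4) \<partial>M)
        \<le> (\<integral>\<^sup>+\<xi>. ennreal ((\<Sum>k<4::nat. ?p k \<xi>) ^ 4) \<partial>M)"
      using le by (intro nn_integral_mono ennreal_leI power_mono) auto
    also have "\<dots> \<le> ennreal (256 * ?C * (\<Sum>k<4::nat. 1 / 4) ^ 4)"
    proof (rule nn_integral_sum_power_le)
      show "?p k \<in> borel_measurable M" for k using measurable_conj_form_haar[of "w k" "w k"] by measurable
      fix k :: nat
      have "(\<integral>\<^sup>+\<xi>. ennreal (?p k \<xi> ^ 4) \<partial>M)
          = (\<integral>\<^sup>+\<xi>. ennreal (1 / 256) * ennreal (cmod (conj_form n b (w k) (w k) (U \<xi>)) ^ 4) \<partial>M)"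
        by (intro nn_integral_cong) (simp add: power_divide ennreal_mult[symmetric])
      also have "\<dots> = ennreal (1 / 256) * (\<integral>\<^sup>+\<xi>. ennreal (cmod (conj_form n b (w k) (w k) (U \<xi>)) ^ 4) \<partial>M)"
        using measurable_conj_form_haar[of "w k" "w k"] by (intro nn_integral_cmult) measurable
      also have "\<dots> \<le> ennreal (1 / 256) * ennreal (?C * sq_norm n (w k) ^ 4)"
        by (intro mult_left_mono nn_integral_form_diag_le) auto
      also have "\<dots> \<le> ennreal (1 / 256) * ennreal (?C * 4 ^ 4)"
        using w[of k] by (intro mult_left_mono ennreal_leI power_mono) auto
      also have "\<dots> = ennreal (256 * ?C * (1 / 4) ^ 4)"
        by (simp add: ennreal_mult[symmetric] power_divide)
      finally show "(\<integral>\<^sup>+\<xi>. ennreal (?p k \<xi> ^ 4) \<partial>M) \<le> ennreal (256 * ?C * (1 / 4) ^ 4)" .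
    qed auto
    finally show ?thesis by simp
  qed
  show ?thesis
  proof (cases "sq_norm n u = 0 \<or> sq_norm n v = 0")
    case True
    then show ?thesis by (auto simp: conj_form_zero)
  next
    case False
    define s t where "s = sqrt (sq_norm n u)" and "t = sqrt (sq_norm n v)"
    have st: "s > 0" "s\<^sup>2 = sq_norm n u" "t > 0" "t\<^sup>2 = sq_norm n v"
      using False by (simp_all add: s_def t_def less_le)
    define u' v' where "u' = (\<lambda>i. of_real (1 / s) * u i)" and "v' = (\<lambda>i. of_real (1 / t) * v i)"
    have "sq_norm n u' = (1 / s)\<^sup>2 * sq_norm n u" "sq_norm n v' = (1 / t)\<^sup>2 * sq_norm n v"
      unfolding u'_def v'_def sq_norm_scale using st by (simp_all add: norm_divide)
    then have u': "sq_norm n u' = 1" "sq_norm n v' = 1" using st False by (auto simp: power_divide)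
    have "conj_form n b u v W = of_real (s * t) * conj_form n b u' v' W" for W
      unfolding u'_def v'_def conj_form_scale using st by simp
    then have "ennreal (cmod (conj_form n b u v (U \<xi>)) ^ 4) =
        ennreal ((s * t) ^ 4) * ennreal (cmod (conj_form n b u' v' (U \<xi>)) ^ 4)" for \<xi>
      using st by (simp add: norm_mult power_mult_distrib ennreal_mult)
    then have "(\<integral>\<^sup>+\<xi>. ennreal (cmod (conj_form n b u v (U \<xi>)) ^ 4) \<partial>M)
        = ennreal ((s * t) ^ 4) * (\<integral>\<^sup>+\<xi>. ennreal (cmod (conj_form n b u' v' (U \<xi>)) ^ 4) \<partial>M)"
      using measurable_conj_form_haar[of u' v'] by (subst nn_integral_cmult[symmetric]) auto
    also have "\<dots> \<le> ennreal ((s * t) ^ 4) * ennreal (256 * ?C)"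
      by (intro mult_left_mono unit u') auto
    also have "\<dots> = ennreal (331776 * (hs_norm b / n) ^ 4 * (s\<^sup>2 * t\<^sup>2)\<^sup>2)"
      by (simp add: ennreal_mult[symmetric] power_mult_distrib mult.commute)
    finally show ?thesis unfolding st(2,4) .
  qed
qed

text \<open>The entries of the product are forms between conjugated rows of \<open>z\<close> and
  columns of \<open>y\<close>. Minkowski's inequality adds their moments: for the trace with m = 4
  and scales summed by Cauchy-Schwarz, for the squared norm with m = 2 and scales whose sum
  factorizes. Neither sum introduces a further factor depending on \<open>n\<close>.\<close>

lemma
  assumes z: "z \<in> carrier_mat n n" and y: "y \<in> carrier_mat n n"
  shows nn_integral_Tr_le: "(\<integral>\<^sup>+\<xi>. ennreal (cmod (mat_Tr (z * (U \<xi> * b * mat_adjoint (U \<xi>)) * y)) ^ 4) \<partial>M)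
      \<le> ennreal (331776 * (hs_norm b / n) ^ 4 * (hs_norm z * hs_norm y) ^ 4)" (is ?A)
    and nn_integral_hs_le: "(\<integral>\<^sup>+\<xi>. ennreal (hs_norm (z * (U \<xi> * b * mat_adjoint (U \<xi>)) * y) ^ 4) \<partial>M)
      \<le> ennreal (331776 * (hs_norm b / n) ^ 4 * (hs_norm z * hs_norm y) ^ 4)" (is ?B)
    and measurable_Tr: "(\<lambda>\<xi>. mat_Tr (z * (U \<xi> * b * mat_adjoint (U \<xi>)) * y)) \<in> borel_measurable M" (is ?C)
    and measurable_hs: "(\<lambda>\<xi>. hs_norm (z * (U \<xi> * b * mat_adjoint (U \<xi>)) * y)) \<in> borel_measurable M" (is ?D)
proof -
  let ?X = "\<lambda>\<xi>. z * (U \<xi> * b * mat_adjoint (U \<xi>)) * y"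
  define u v where "u k i = cnj (z $$ (k, i))" and "v l j = y $$ (j, l)" for k l i j
  let ?q = "\<lambda>k l \<xi>. conj_form n b (u k) (v l) (U \<xi>)"
  have X: "?X \<xi> \<in> carrier_mat n n" and ent: "k < n \<Longrightarrow> l < n \<Longrightarrow> ?X \<xi> $$ (k, l) = ?q k l \<xi>"
    if "\<xi> \<in> space M" for \<xi> k l
  proof -
    have UC: "U \<xi> \<in> carrier_mat n n" using haar_unitary_mem[OF U that] by (auto simp: unitary_mats_def)
    let ?Y = "U \<xi> * b * mat_adjoint (U \<xi>)"
    have Y: "?Y \<in> carrier_mat n n"
      by (rule mult_carrier_mat[OF mult_carrier_mat[OF UC b] mat_adjoint_carrier[OF UC]])
    show X: "?X \<xi> \<in> carrier_mat n n" by (rule mult_carrier_mat[OF mult_carrier_mat[OF z Y] y])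
    assume kl: "k < n" "l < n"
    have "?X \<xi> $$ (k, l) = (\<Sum>j<n. (\<Sum>i<n. z $$ (k, i) * ?Y $$ (i, j)) * y $$ (j, l))"
      using kl by (subst mat_mult_index[OF mult_carrier_mat[OF z Y] y])
        (auto simp: mat_mult_index[OF z Y] simp del: index_mult_mat(1) intro!: sum.cong)
    also have "\<dots> = mat_form n ?Y (u k) (v l)"
      unfolding mat_form_def u_def v_def sum_distrib_right by (subst sum.swap) simp
    finally show "?X \<xi> $$ (k, l) = ?q k l \<xi>"
      unfolding conj_form_def mat_form_conj[OF UC b] .
  qed
  have su: "(\<Sum>k<n. sq_norm n (u k)) = (hs_norm z)\<^sup>2" and sv: "(\<Sum>l<n. sq_norm n (v l)) = (hs_norm y)\<^sup>2"
    unfolding hs_norm_power2[OF z] hs_norm_power2[OF y] sq_norm_def u_def v_def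
    by (simp, rule sum.swap)
  have Tr: "mat_Tr (?X \<xi>) = (\<Sum>k<n. ?q k k \<xi>)" if "\<xi> \<in> space M" for \<xi>
    using X[OF that] ent[OF that] by (auto simp: mat_Tr_def)
  have hs: "(hs_norm (?X \<xi>))\<^sup>2 = (\<Sum>kl\<in>{..<n} \<times> {..<n}. (cmod (?q (fst kl) (snd kl) \<xi>))\<^sup>2)" if "\<xi> \<in> space M" for \<xi>
    unfolding hs_norm_power2[OF X[OF that]] sum.cartesian_product
    by (intro sum.cong refl) (auto simp: ent[OF that])
  let ?K = "331776 * (hs_norm b / n) ^ 4"
  show ?C
    by (rule measurable_cong[THEN iffD2, OF Tr borel_measurable_sum[OF measurable_conj_form_haar]])
  show ?D
  proof -
    have 1: "hs_norm (?X \<xi>) = sqrt (\<Sum>kl\<in>{..<n} \<times> {..<n}. (cmod (?q (fst kl) (snd kl) \<xi>))\<^sup>2)" if "\<xi> \<in> space M" for \<xi>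
      unfolding hs[OF that, symmetric] by simp
    have 2: "(\<lambda>\<xi>. sqrt (\<Sum>kl\<in>{..<n} \<times> {..<n}. (cmod (?q (fst kl) (snd kl) \<xi>))\<^sup>2)) \<in> borel_measurable M"
      using measurable_conj_form_haar by measurable
    show ?thesis by (rule measurable_cong[THEN iffD2, OF 1 2])
  qed
  have "(\<integral>\<^sup>+\<xi>. ennreal (cmod (mat_Tr (?X \<xi>)) ^ 4) \<partial>M)
      \<le> (\<integral>\<^sup>+\<xi>. ennreal ((\<Sum>k<n. cmod (?q k k \<xi>)) ^ 4) \<partial>M)"
    by (intro nn_integral_mono ennreal_leI power_mono) (auto simp: Tr intro: norm_sum)
  also have "\<dots> \<le> ennreal (?K * (\<Sum>k<n. sqrt (sq_norm n (u k)) * sqrt (sq_norm n (v k))) ^ 4)"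
  proof (rule nn_integral_sum_power_le)
    show "(\<lambda>\<xi>. cmod (?q k k \<xi>)) \<in> borel_measurable M" for k
      using measurable_conj_form_haar by measurable
    show "(\<integral>\<^sup>+\<xi>. ennreal (cmod (?q k k \<xi>) ^ 4) \<partial>M)
        \<le> ennreal (?K * (sqrt (sq_norm n (u k)) * sqrt (sq_norm n (v k))) ^ 4)" for k
    proof -
      have "(sqrt (sq_norm n (u k)) * sqrt (sq_norm n (v k))) ^ 4 =
          ((sqrt (sq_norm n (u k)) * sqrt (sq_norm n (v k)))\<^sup>2)\<^sup>2" by simp
      also have "\<dots> = (sq_norm n (u k) * sq_norm n (v k))\<^sup>2" by (simp only: power_mult_distrib real_sqrt_pow2 sq_norm_nonneg)
      finally show ?thesis using nn_integral_form_le[of "u k" "v k"] by simp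
    qed
  qed (auto simp: conj_form_zero)
  also have "\<dots> \<le> ennreal (?K * (hs_norm z * hs_norm y) ^ 4)"
  proof -
    have "(\<Sum>k<n. sqrt (sq_norm n (u k)) * sqrt (sq_norm n (v k)))\<^sup>2 \<le> (hs_norm z * hs_norm y)\<^sup>2"
      using Cauchy_Schwarz_ineq_sum[of "\<lambda>k. sqrt (sq_norm n (u k))" "\<lambda>k. sqrt (sq_norm n (v k))" "{..<n}"]
      by (simp add: su sv power_mult_distrib)
    then have "(\<Sum>k<n. sqrt (sq_norm n (u k)) * sqrt (sq_norm n (v k))) \<le> hs_norm z * hs_norm y"
      by (rule power2_le_imp_le) simp
    then show ?thesis by (intro ennreal_leI mult_left_mono power_mono) (auto intro!: sum_nonneg)
  qed
  finally show ?A .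
  have "(\<integral>\<^sup>+\<xi>. ennreal (hs_norm (?X \<xi>) ^ 4) \<partial>M)
      = (\<integral>\<^sup>+\<xi>. ennreal ((\<Sum>kl\<in>{..<n} \<times> {..<n}. (cmod (?q (fst kl) (snd kl) \<xi>))\<^sup>2)\<^sup>2) \<partial>M)"
    by (intro nn_integral_cong) (simp add: hs[symmetric])
  also have "\<dots> \<le> ennreal (?K * (\<Sum>kl\<in>{..<n} \<times> {..<n}. sq_norm n (u (fst kl)) * sq_norm n (v (snd kl)))\<^sup>2)"
  proof (rule nn_integral_sum_power_le)
    show "(\<lambda>\<xi>. (cmod (?q (fst kl) (snd kl) \<xi>))\<^sup>2) \<in> borel_measurable M" for kl
      using measurable_conj_form_haar by measurable
    show "(\<integral>\<^sup>+\<xi>. ennreal (((cmod (?q (fst kl) (snd kl) \<xi>))\<^sup>2)\<^sup>2) \<partial>M)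
        \<le> ennreal (?K * (sq_norm n (u (fst kl)) * sq_norm n (v (snd kl)))\<^sup>2)" for kl
      using nn_integral_form_le[of "u (fst kl)" "v (snd kl)"] by simp
  qed (auto simp: conj_form_zero)
  also have "(\<Sum>kl\<in>{..<n} \<times> {..<n}. sq_norm n (u (fst kl)) * sq_norm n (v (snd kl))) = (hs_norm z * hs_norm y)\<^sup>2"
    unfolding power_mult_distrib su[symmetric] sv[symmetric] sum_product sum.cartesian_product
    by (intro sum.cong refl) auto
  finally show ?B by simp
qed

end

text \<open>The sum of the fourth powers has finite integral, so it is finite almost everywhere and
  its terms tend to zero. The joint law of the variables does not matter.\<close>

lemma AE_tendsto_zero_power4:
  fixes X :: "nat \<Rightarrow> 'w \<Rightarrow> real"
  assumes meas: "\<And>n. X n \<in> borel_measurable M"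
    and le: "\<And>n. (\<integral>\<^sup>+\<xi>. ennreal (X n \<xi> ^ 4) \<partial>M) \<le> ennreal (c n)"
    and c: "summable c" "\<And>n. 0 \<le> c n"
  shows "AE \<xi> in M. (\<lambda>n. X n \<xi>) \<longlonglongrightarrow> 0"
proof -
  have "(\<integral>\<^sup>+\<xi>. suminf (\<lambda>n. ennreal (X n \<xi> ^ 4)) \<partial>M) = suminf (\<lambda>n. \<integral>\<^sup>+\<xi>. ennreal (X n \<xi> ^ 4) \<partial>M)"
    using meas by (intro nn_integral_suminf) measurable
  also have "\<dots> \<le> suminf (\<lambda>n. ennreal (c n))" by (intro suminf_le le) auto
  also have "\<dots> = ennreal (suminf c)" using c by (intro suminf_ennreal2) auto
  finally have "(\<integral>\<^sup>+\<xi>. suminf (\<lambda>n. ennreal (X n \<xi> ^ 4)) \<partial>M) \<noteq> \<infinity>"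
    by (auto simp: top_unique)
  then have "AE \<xi> in M. suminf (\<lambda>n. ennreal (X n \<xi> ^ 4)) \<noteq> \<infinity>"
    by (intro nn_integral_PInf_AE) (use meas in measurable)
  then show ?thesis
  proof eventually_elim
    case (elim \<xi>)
    then have "summable (\<lambda>n. X n \<xi> ^ 4)"
      by (intro summable_suminf_not_top) auto
    then have "(\<lambda>n. X n \<xi> ^ 4) \<longlonglongrightarrow> 0" by (rule summable_LIMSEQ_zero)
    then have "(\<lambda>n. root 4 (\<bar>X n \<xi>\<bar> ^ 4)) \<longlonglongrightarrow> root 4 0"
      by (intro tendsto_real_root) simp
    then have "(\<lambda>n. \<bar>X n \<xi>\<bar>) \<longlonglongrightarrow> 0" by (simp only: real_root_power_cancel real_root_zero)
    then show ?case by (rule tendsto_rabs_zero_cancel)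
  qed
qed

lemma haar_centered_AE_tendsto:
  fixes U :: "nat \<Rightarrow> 'w \<Rightarrow> complex mat"
  assumes M: "prob_space M" and U: "\<And>n. haar_unitary M (Suc n) (U n)"
    and b: "\<And>n. b n \<in> carrier_mat (Suc n) (Suc n)" "\<And>n. mat_Tr (b n) = 0"
    and z: "\<And>n. z n \<in> carrier_mat (Suc n) (Suc n)" and y: "\<And>n. y n \<in> carrier_mat (Suc n) (Suc n)"
    and bd: "\<And>n. hs_norm (z n) \<le> C" "\<And>n. hs_norm (y n) \<le> C" "\<And>n. (hs_norm (b n))\<^sup>2 \<le> C * Suc n"
  shows "AE \<xi> in M. (\<lambda>n. mat_Tr (z n * (U n \<xi> * b n * mat_adjoint (U n \<xi>)) * y n)) \<longlonglongrightarrow> 0 \<and>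
    (\<lambda>n. hs_norm (z n * (U n \<xi> * b n * mat_adjoint (U n \<xi>)) * y n)) \<longlonglongrightarrow> 0"
proof -
  have C: "0 \<le> C" using bd(1)[of 0] hs_norm_nonneg[of "z 0"] by linarith
  \<comment> \<open>As the squared norm of \<open>b n\<close> is of order n, the factor (norm / n)^4
    is at most a multiple of 1 / n^2. Second moments would give only 1 / n, which is not
    summable.\<close>
  let ?c = "\<lambda>n. 331776 * C ^ 2 * (C * C) ^ 4 * (1 / real (Suc n) ^ 2)"
  have le: "ennreal (331776 * (hs_norm (b n) / Suc n) ^ 4 * (hs_norm (z n) * hs_norm (y n)) ^ 4) \<le> ennreal (?c n)" for n
  proof -
    have "(hs_norm (b n) / Suc n) ^ 4 = ((hs_norm (b n))\<^sup>2 / (Suc n)\<^sup>2)\<^sup>2" by (simp add: power_divide)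
    also have "\<dots> \<le> (C * Suc n / (Suc n)\<^sup>2)\<^sup>2"
      using bd(3)[of n] by (intro power_mono divide_right_mono) auto
    also have "\<dots> = C ^ 2 * (1 / real (Suc n) ^ 2)"
    proof -
      have "(C * N / N\<^sup>2)\<^sup>2 = C ^ 2 * (1 / N ^ 2)" if "N > 0" for N :: real
        using that by (simp add: power2_eq_square field_simps)
      then show ?thesis by simp
    qed
    finally have 1: "(hs_norm (b n) / Suc n) ^ 4 \<le> C ^ 2 * (1 / real (Suc n) ^ 2)" .
    have 2: "(hs_norm (z n) * hs_norm (y n)) ^ 4 \<le> (C * C) ^ 4"
      using bd(1,2)[of n] C by (intro power_mono mult_mono) auto
    have "(hs_norm (b n) / Suc n) ^ 4 * (hs_norm (z n) * hs_norm (y n)) ^ 4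
        \<le> C ^ 2 * (1 / real (Suc n) ^ 2) * (C * C) ^ 4"
      using 1 2 by (intro mult_mono) auto
    from mult_left_mono[OF this, of 331776] show ?thesis
      by (intro ennreal_leI) (simp only: mult.assoc mult.commute mult.left_commute zero_le_numeral)
  qed
  have "summable (\<lambda>n. 1 / real n ^ 2)" by (rule inverse_power_summable[of 2, simplified inverse_eq_divide]) simp
  then have "summable (\<lambda>n. 1 / real (Suc n) ^ 2)" by (rule summable_Suc_iff[THEN iffD2])
  then have sm: "summable ?c" by (rule summable_mult)
  have c0: "0 \<le> ?c n" for n using C by simp
  note h = M U b(1) b(2) zero_less_Suc z y
  have "AE \<xi> in M. (\<lambda>n. cmod (mat_Tr (z n * (U n \<xi> * b n * mat_adjoint (U n \<xi>)) * y n))) \<longlonglongrightarrow> 0"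
    by (rule AE_tendsto_zero_power4[OF _ order_trans[OF nn_integral_Tr_le[OF h] le] sm c0])
      (rule measurable_compose[OF measurable_Tr[OF h]], measurable)
  moreover have "AE \<xi> in M. (\<lambda>n. hs_norm (z n * (U n \<xi> * b n * mat_adjoint (U n \<xi>)) * y n)) \<longlonglongrightarrow> 0"
    by (rule AE_tendsto_zero_power4[OF measurable_hs[OF h] order_trans[OF nn_integral_hs_le[OF h] le] sm c0])
  ultimately show ?thesis
    by eventually_elim (use tendsto_norm_zero_cancel in auto)
qed

section \<open>Inner products on complex Hilbert spaces\<close>

interpretation cvs: vector_space "scaleC :: complex \<Rightarrow> 'a \<Rightarrow> 'a::complex_vector"
  by (rule vector_space_scaleC)

lemma has_sum_sum_finite:
  fixes f :: "'i \<Rightarrow> 'a \<Rightarrow> 'b::topological_comm_monoid_add"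
  assumes "finite I" "\<And>i. i \<in> I \<Longrightarrow> (f i has_sum s i) A"
  shows "((\<lambda>x. \<Sum>i\<in>I. f i x) has_sum (\<Sum>i\<in>I. s i)) A"
  using assms by (induction I rule: finite_induct) (auto intro: has_sum_add)

lemma cinner_add_left: "cinner (x + y) z = cinner x z + cinner y z"
  by (metis cinner_add_right cinner_commute complex_cnj_add)

lemma cinner_scaleC_left: "cinner (c *\<^sub>C x) y = cnj c * cinner x y"
  by (metis cinner_scaleC_right cinner_commute complex_cnj_mult)

lemma cinner_zero_right [simp]: "cinner x 0 = 0" for x :: "'h::complex_hilbert_space"
  using cinner_add_right[of x 0 0] by simp

lemma cinner_zero_left [simp]: "cinner 0 x = 0" for x :: "'h::complex_hilbert_space"
  using cinner_add_left[of 0 0 x] by simp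

lemma cinner_minus_right: "cinner x (- y) = - cinner x y"
  using cinner_add_right[of x y "- y"] by (simp add: eq_neg_iff_add_eq_0 add.commute)

lemma cinner_diff_right: "cinner x (y - z) = cinner x y - cinner x z"
  using cinner_add_right[of x y "- z"] by (simp add: cinner_minus_right)

lemma cinner_diff_left: "cinner (x - y) z = cinner x z - cinner y z"
  by (metis cinner_commute cinner_diff_right complex_cnj_diff)

lemma cinner_sum_right: "cinner x (\<Sum>i\<in>I. f i) = (\<Sum>i\<in>I. cinner x (f i))"
  by (induction I rule: infinite_finite_induct) (simp_all add: cinner_add_right)

lemma cinner_sum_left: "cinner (\<Sum>i\<in>I. f i) x = (\<Sum>i\<in>I. cinner (f i) x)"
  by (induction I rule: infinite_finite_induct) (simp_all add: cinner_add_left)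

lemma cinner_self: "cinner x x = complex_of_real ((norm x)\<^sup>2)"
proof (rule complex_eqI)
  show "Re (cinner x x) = Re (complex_of_real ((norm x)\<^sup>2))"
    by (simp add: inner_eq_Re_cinner[symmetric] power2_norm_eq_inner)
  show "Im (cinner x x) = Im (complex_of_real ((norm x)\<^sup>2))"
    using arg_cong[OF cinner_commute[of x x], of Im] by simp
qed

lemma norm_scaleC: "norm (c *\<^sub>C x) = cmod c * norm x" for x :: "'h::complex_hilbert_space"
proof -
  have "complex_of_real ((norm (c *\<^sub>C x))\<^sup>2) = complex_of_real ((cmod c * norm x)\<^sup>2)"
    unfolding cinner_self[symmetric] cinner_scaleC_left cinner_scaleC_right
    by (simp add: cinner_self power_mult_distrib complex_norm_square mult_ac del: of_real_power)
  then show ?thesis by (simp only: of_real_eq_iff power2_eq_iff_nonneg norm_ge_zero mult_nonneg_nonneg)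
qed

lemma cinner_norm_le: "cmod (cinner x y) \<le> norm x * norm y"
proof (cases "cinner x y = 0")
  case False
  define c where "c = cnj (cinner x y) / of_real (cmod (cinner x y))"
  have c: "cmod c = 1" using False by (simp add: c_def norm_divide)
  have "c * cinner x y = of_real (cmod (cinner x y))"
  proof -
    have "cnj (cinner x y) * cinner x y = of_real (cmod (cinner x y)) * of_real (cmod (cinner x y))"
      by (metis complex_norm_square mult.commute power2_eq_square of_real_mult)
    then show ?thesis using False by (simp add: c_def)
  qed
  then have "cmod (cinner x y) = Re (cinner x (c *\<^sub>C y))" by (simp add: cinner_scaleC_right)
  also have "\<dots> \<le> norm x * norm (c *\<^sub>C y)"
    unfolding inner_eq_Re_cinner[symmetric] by (rule norm_cauchy_schwarz)
  finally show ?thesis by (simp add: norm_scaleC c)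
qed simp

lemma cinner_ext: "(\<And>x. cinner x y = cinner x z) \<Longrightarrow> y = z"
proof -
  assume "\<And>x. cinner x y = cinner x z"
  then have "cinner (y - z) (y - z) = 0" by (simp add: cinner_diff_right)
  then show "y = z" by (simp add: cinner_self)
qed

lemma bounded_linear_cinner_left: "bounded_linear (\<lambda>x. cinner x y)"
  by (rule bounded_linear_intro[where K = "norm y"])
    (auto simp: cinner_add_left scaleR_eq_scaleC cinner_scaleC_left scaleR_conv_of_real cinner_norm_le)

lemma bounded_linear_cinner_right: "bounded_linear (\<lambda>x. cinner y x)"
  by (rule bounded_linear_intro[where K = "norm y"])
    (auto simp: cinner_add_right scaleR_eq_scaleC cinner_scaleC_right scaleR_conv_of_real mult.commute[of _ "norm y"] cinner_norm_le)

subsection \<open>Orthonormal bases\<close>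

definition orthonormal :: "'h::complex_hilbert_space set \<Rightarrow> bool" where
  "orthonormal E \<longleftrightarrow> (\<forall>e\<in>E. \<forall>f\<in>E. cinner e f = (if e = f then 1 else 0))"

lemma orthonormalD: "orthonormal E \<Longrightarrow> e \<in> E \<Longrightarrow> f \<in> E \<Longrightarrow> cinner e f = (if e = f then 1 else 0)"
  by (simp add: orthonormal_def)

lemma orthonormal_basis_orthonormal: "orthonormal_basis E \<Longrightarrow> orthonormal E"
  by (simp add: orthonormal_basis_def orthonormal_def)

lemma cinner_orthonormal_sum:
  assumes "orthonormal E" "finite F" "F \<subseteq> E" "e \<in> E"
  shows "cinner e (\<Sum>f\<in>F. c f *\<^sub>C f) = (if e \<in> F then c e else 0)"
proof -
  have "cinner e (\<Sum>f\<in>F. c f *\<^sub>C f) = (\<Sum>f\<in>F. if e = f then c f else 0)"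
    unfolding cinner_sum_right cinner_scaleC_right
    by (intro sum.cong refl) (use assms in \<open>auto simp: orthonormalD subset_iff\<close>)
  then show ?thesis using assms by simp
qed

lemma norm_orthonormal_sum:
  assumes "orthonormal E" "finite F" "F \<subseteq> E"
  shows "(norm (\<Sum>f\<in>F. c f *\<^sub>C f))\<^sup>2 = (\<Sum>f\<in>F. (cmod (c f))\<^sup>2)"
proof -
  have "complex_of_real ((norm (\<Sum>f\<in>F. c f *\<^sub>C f))\<^sup>2) = (\<Sum>f\<in>F. cnj (c f) * c f)"
    unfolding cinner_self[symmetric] cinner_sum_left[of _ F] cinner_scaleC_left
    by (intro sum.cong refl) (use assms in \<open>auto simp: cinner_orthonormal_sum subset_iff\<close>)
  also have "\<dots> = complex_of_real (\<Sum>f\<in>F. (cmod (c f))\<^sup>2)"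
    unfolding of_real_sum complex_norm_square by (simp add: mult.commute)
  finally show ?thesis by (simp only: of_real_eq_iff)
qed

text \<open>Completing the square in the coefficients. The choice c f = cinner f v yields Bessel's
  inequality; that no other choice does better yields Parseval's identity.\<close>

lemma norm_diff_orthonormal_sum:
  assumes "orthonormal E" "finite F" "F \<subseteq> E"
  shows "(norm (v - (\<Sum>f\<in>F. c f *\<^sub>C f)))\<^sup>2 =
    (norm v)\<^sup>2 - (\<Sum>f\<in>F. (cmod (cinner f v))\<^sup>2) + (\<Sum>f\<in>F. (cmod (cinner f v - c f))\<^sup>2)"
proof -
  let ?w = "\<Sum>f\<in>F. c f *\<^sub>C f"
  have sq: "z * cnj z = of_real ((cmod z)\<^sup>2)" for z by (rule complex_norm_square[symmetric])
  have "complex_of_real ((norm (v - ?w))\<^sup>2) =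
      cinner v v - cinner v ?w - cinner ?w v + cinner ?w ?w"
    unfolding cinner_self[symmetric] by (simp add: cinner_diff_left cinner_diff_right)
  also have vw: "cinner v ?w = (\<Sum>f\<in>F. c f * cnj (cinner f v))"
    unfolding cinner_sum_right cinner_scaleC_right by (intro sum.cong refl) (metis cinner_commute)
  also have "cinner v v - (\<Sum>f\<in>F. c f * cnj (cinner f v)) - cinner ?w v + cinner ?w ?w =
      cinner v v - (\<Sum>f\<in>F. c f * cnj (cinner f v)) - (\<Sum>f\<in>F. cnj (c f) * cinner f v)
      + (\<Sum>f\<in>F. c f * cnj (c f))"
    unfolding cinner_self[of ?w] norm_orthonormal_sum[OF assms] of_real_sum sq[symmetric]
    by (simp add: cinner_sum_left cinner_scaleC_left)
  also have "\<dots> = cinner v v - (\<Sum>f\<in>F. cinner f v * cnj (cinner f v))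
      + (\<Sum>f\<in>F. (cinner f v - c f) * cnj (cinner f v - c f))"
    by (simp add: algebra_simps sum.distrib sum_subtractf)
  also have "\<dots> = complex_of_real ((norm v)\<^sup>2 - (\<Sum>f\<in>F. (cmod (cinner f v))\<^sup>2) + (\<Sum>f\<in>F. (cmod (cinner f v - c f))\<^sup>2))"
    unfolding sq by (simp add: cinner_self)
  finally show ?thesis by (simp only: of_real_eq_iff)
qed

lemma bessel:
  assumes "orthonormal E" "finite F" "F \<subseteq> E"
  shows "(\<Sum>f\<in>F. (cmod (cinner f v))\<^sup>2) \<le> (norm v)\<^sup>2"
  using norm_diff_orthonormal_sum[OF assms, of v "\<lambda>f. cinner f v"]
    zero_le_power2[of "norm (v - (\<Sum>f\<in>F. cinner f v *\<^sub>C f))"] by simp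

lemma cspan_finite:
  assumes "w \<in> cspan E"
  obtains F c where "finite F" "F \<subseteq> E" "w = (\<Sum>f\<in>F. c f *\<^sub>C f)"
  using assms unfolding cspan_def cvs.span_explicit by blast

lemma parseval:
  assumes E: "orthonormal_basis E"
  shows "((\<lambda>e. (cmod (cinner e v))\<^sup>2) has_sum (norm v)\<^sup>2) E"
proof -
  note on = orthonormal_basis_orthonormal[OF E]
  have "(sum (\<lambda>e. (cmod (cinner e v))\<^sup>2) \<longlongrightarrow> (norm v)\<^sup>2) (finite_subsets_at_top E)"
  proof (rule order_tendstoI)
    fix a assume "(norm v)\<^sup>2 < a"
    then show "\<forall>\<^sub>F F in finite_subsets_at_top E. (\<Sum>e\<in>F. (cmod (cinner e v))\<^sup>2) < a"
      using bessel[OF on] by (intro eventually_finite_subsets_at_top_weakI) (meson order_le_less_trans)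
  next
    fix a assume a: "a < (norm v)\<^sup>2"
    define d where "d = sqrt ((norm v)\<^sup>2 - a)"
    have d: "d > 0" "d\<^sup>2 = (norm v)\<^sup>2 - a" using a by (simp_all add: d_def)
    \<comment> \<open>Some finite combination of basis vectors is close to \<open>v\<close>. On the
      same finite set the coefficients of \<open>v\<close> itself do at least as well, so they carry
      almost all of the squared norm.\<close>
    have "v \<in> closure (cspan E)" using E by (simp add: orthonormal_basis_def)
    then obtain w where w: "w \<in> cspan E" "dist w v < d"
      using d(1) by (meson closure_approachable)
    obtain F c where F: "finite F" "F \<subseteq> E" "w = (\<Sum>f\<in>F. c f *\<^sub>C f)" using cspan_finite[OF w(1)] .
    have "a < (\<Sum>f\<in>F. (cmod (cinner f v))\<^sup>2)"
    proof -
      have "(norm v)\<^sup>2 - (\<Sum>f\<in>F. (cmod (cinner f v))\<^sup>2) \<le> (norm (v - w))\<^sup>2"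
        unfolding F(3) norm_diff_orthonormal_sum[OF on F(1,2)] by (simp add: sum_nonneg)
      also have "\<dots> < d\<^sup>2" using w(2) by (intro power_strict_mono) (auto simp: dist_norm norm_minus_commute)
      finally show ?thesis using d(2) by simp
    qed
    moreover have "(\<Sum>f\<in>F. (cmod (cinner f v))\<^sup>2) \<le> (\<Sum>f\<in>Y. (cmod (cinner f v))\<^sup>2)" if "finite Y" "F \<subseteq> Y" for Y
      using that by (intro sum_mono2) auto
    ultimately show "\<forall>\<^sub>F F in finite_subsets_at_top E. a < (\<Sum>e\<in>F. (cmod (cinner e v))\<^sup>2)"
      unfolding eventually_finite_subsets_at_top using F(1,2) by (meson order_less_le_trans)
  qed
  then show ?thesis by (simp add: has_sum_def)
qed

subsection \<open>Adjoints\<close>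

lemma bounded_clinear_bounded: "bounded_clinear T \<Longrightarrow> \<exists>K>0. \<forall>x. norm (T x) \<le> K * norm x"
  unfolding bounded_clinear_def using bounded_linear.pos_bounded[of T] by (metis mult.commute)

lemma bounded_clinear_add: "bounded_clinear T \<Longrightarrow> T (x + y) = T x + T y"
  unfolding bounded_clinear_def using linear_add bounded_linear.linear by blast

lemma bounded_clinear_diff: "bounded_clinear T \<Longrightarrow> T (x - y) = T x - T y"
  unfolding bounded_clinear_def using linear_diff bounded_linear.linear by blast

lemma bounded_clinear_scaleC: "bounded_clinear T \<Longrightarrow> T (c *\<^sub>C x) = c *\<^sub>C T x"
  unfolding bounded_clinear_def by blast

lemma bounded_clinear_sum: "bounded_clinear T \<Longrightarrow> T (\<Sum>i\<in>I. f i) = (\<Sum>i\<in>I. T (f i))"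
  unfolding bounded_clinear_def using linear_sum bounded_linear.linear by blast

lemma bounded_clinearI:
  assumes "\<And>x y. T (x + y) = T x + T y" "\<And>c x. T (c *\<^sub>C x) = c *\<^sub>C T x" "\<And>x. norm (T x) \<le> K * norm x"
  shows "bounded_clinear T"
  unfolding bounded_clinear_def
  by (intro conjI allI bounded_linear_intro[where K = K] assms)
    (auto simp: scaleR_eq_scaleC assms mult.commute)

lemma cinner_eq_on_basis:
  fixes x :: "'h::complex_hilbert_space"
  assumes E: "orthonormal_basis E" and f: "bounded_linear f" "\<And>c x. f (c *\<^sub>C x) = cnj c * f x"
    and g: "bounded_linear g" "\<And>c x. g (c *\<^sub>C x) = cnj c * g x" and eq: "\<And>e. e \<in> E \<Longrightarrow> f e = g e"
  shows "f x = g x"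
proof -
  have "closed {x. f x = g x}"
    by (intro closed_Collect_eq linear_continuous_on f(1) g(1))
  moreover have "cspan E \<subseteq> {x. f x = g x}"
  proof
    fix w assume "w \<in> cspan E"
    then obtain F c where F: "finite F" "F \<subseteq> E" "w = (\<Sum>f\<in>F. c f *\<^sub>C f)" by (rule cspan_finite)
    show "w \<in> {x. f x = g x}"
      unfolding F(3) using F(2) eq
      by (auto simp: linear_sum[OF bounded_linear.linear[OF f(1)]] linear_sum[OF bounded_linear.linear[OF g(1)]]
          f(2) g(2) intro!: sum.cong)
  qed
  ultimately have "closure (cspan E) \<subseteq> {x. f x = g x}" by (intro closure_minimal)
  then show ?thesis using E by (auto simp: orthonormal_basis_def)
qed

text \<open>The vector is the orthonormal series with coefficients \<open>c\<close>. As
  \<open>E\<close> may be uncountable, the series is summed along finite sets whose square sums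
  approach the supremum; an index outside all of them has coefficient zero, since adding it would
  exceed the supremum.\<close>

lemma riesz_basis:
  fixes c :: "'h::complex_hilbert_space \<Rightarrow> complex"
  assumes E: "orthonormal E" and bd: "\<And>F. finite F \<Longrightarrow> F \<subseteq> E \<Longrightarrow> (\<Sum>e\<in>F. (cmod (c e))\<^sup>2) \<le> B"
  shows "\<exists>w. \<forall>e\<in>E. cinner e w = c e"
proof -
  define \<F> where "\<F> = {F. finite F \<and> F \<subseteq> E}"
  define q where "q F = (\<Sum>e\<in>F. (cmod (c e))\<^sup>2)" for F
  define s where "s = (SUP F\<in>\<F>. q F)"
  have ne: "{} \<in> \<F>" by (simp add: \<F>_def)
  have bdd: "bdd_above (q ` \<F>)" by (rule bdd_aboveI2[where M = B]) (use bd in \<open>auto simp: \<F>_def q_def\<close>)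
  have qs: "q F \<le> s" if "F \<in> \<F>" for F unfolding s_def by (rule cSUP_upper[OF that bdd])
  have "\<exists>F\<in>\<F>. s - (1/2)^n < q F" for n :: nat
  proof -
    have "s - (1/2)^n < s" by simp
    then show ?thesis using less_cSUP_iff[OF _ bdd, of "s - (1/2)^n"] ne unfolding s_def by blast
  qed
  then obtain F where F: "\<And>n. F n \<in> \<F>" "\<And>n. s - (1/2)^n < q (F n)" by metis
  \<comment> \<open>Unions make the finite sets increasing, so that differences of partial sums are
    orthonormal sums over \<open>G n - G m\<close>.\<close>
  define G where "G n = (\<Union>i\<le>n. F i)" for n :: nat
  have G: "G n \<in> \<F>" for n using F(1) by (auto simp: G_def \<F>_def)
  have Gm: "G m \<subseteq> G n" if "m \<le> n" for m n using that by (auto simp: G_def intro: order_trans)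
  have qm: "q A \<le> q B" if "A \<subseteq> B" "B \<in> \<F>" for A B
    unfolding q_def by (rule sum_mono2) (use that in \<open>auto simp: \<F>_def\<close>)
  have Gq: "s - (1/2)^n < q (G n)" for n
    using F(2)[of n] qm[of "F n" "G n", OF _ G] by (force simp: G_def)
  define w where "w n = (\<Sum>e\<in>G n. c e *\<^sub>C e)" for n
  have diff: "(norm (w n - w m))\<^sup>2 < (1/2)^m" if "m \<le> n" for m n
  proof -
    have fin: "finite (G n)" "G n \<subseteq> E" using G[of n] by (auto simp: \<F>_def)
    have "w n - w m = (\<Sum>e\<in>G n - G m. c e *\<^sub>C e)"
      unfolding w_def by (rule sum_diff[OF fin(1) Gm[OF that], symmetric])
    then have "(norm (w n - w m))\<^sup>2 = q (G n - G m)"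
      unfolding q_def using norm_orthonormal_sum[OF E, of "G n - G m" c] fin by auto
    also have "\<dots> = q (G n) - q (G m)" unfolding q_def by (rule sum_diff[OF fin(1) Gm[OF that]])
    finally show ?thesis using qs[OF G[of n]] Gq[of m] by linarith
  qed
  have "Cauchy w"
  proof (rule metric_CauchyI)
    fix e :: real assume e: "e > 0"
    then obtain N where N: "(1/2::real)^N < (e/2)\<^sup>2"
      using real_arch_pow_inv[of "(e/2)\<^sup>2" "1/2"] by auto
    have *: "norm (w n - w N) < e / 2" if "N \<le> n" for n
      using diff[OF that] N e by (intro power2_less_imp_less[of _ "e/2"]) auto
    have "dist (w m) (w n) < e" if "m \<ge> N" "n \<ge> N" for m n
      using dist_triangle_half_l[of "w m" "w N" e "w n"] *[OF that(1)] *[OF that(2)] by (simp only: dist_norm)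
    then show "\<exists>N. \<forall>m\<ge>N. \<forall>n\<ge>N. dist (w m) (w n) < e" by blast
  qed
  then obtain w0 where w0: "w \<longlonglongrightarrow> w0" using Cauchy_convergent convergent_def by blast
  have "cinner e w0 = c e" if e: "e \<in> E" for e
  proof -
    have lim: "(\<lambda>n. cinner e (w n)) \<longlonglongrightarrow> cinner e w0"
      by (rule bounded_linear.tendsto[OF bounded_linear_cinner_right w0])
    have wn: "cinner e (w n) = (if e \<in> G n then c e else 0)" for n
      unfolding w_def using G[of n] by (intro cinner_orthonormal_sum[OF E _ _ e]) (auto simp: \<F>_def)
    show ?thesis
    proof (cases "\<exists>N. e \<in> G N")
      case True
      then obtain N where "e \<in> G N" by blast
      then have "\<forall>n\<ge>N. cinner e (w n) = c e" using Gm wn by auto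
      then have "(\<lambda>n. cinner e (w n)) \<longlonglongrightarrow> c e"
        by (intro tendsto_eventually) (auto simp: eventually_sequentially)
      then show ?thesis using lim LIMSEQ_unique by blast
    next
      case False
      have "(cmod (c e))\<^sup>2 \<le> (1/2)^n" for n
      proof -
        have "q (insert e (G n)) = (cmod (c e))\<^sup>2 + q (G n)"
          unfolding q_def using False G[of n] by (intro sum.insert) (auto simp: \<F>_def)
        moreover have "insert e (G n) \<in> \<F>" using G[of n] e by (auto simp: \<F>_def)
        ultimately show ?thesis using qs[of "insert e (G n)"] Gq[of n] by linarith
      qed
      moreover have "(\<lambda>n. (1/2::real)^n) \<longlonglongrightarrow> 0" by (intro LIMSEQ_power_zero) simp
      ultimately have "(cmod (c e))\<^sup>2 \<le> 0" by (meson LIMSEQ_le_const)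
      then have "c e = 0" by simp
      moreover have "(\<lambda>n. cinner e (w n)) = (\<lambda>n. 0)" using wn False by auto
      ultimately show ?thesis using lim LIMSEQ_unique[of "\<lambda>n. 0" 0] tendsto_const by auto
    qed
  qed
  then show ?thesis by blast
qed

context
  fixes E :: "'h::complex_hilbert_space set"
  assumes E: "orthonormal_basis E"
begin

text \<open>Testing \<open>T\<close> on the finite sum with coefficients cinner (T e) y bounds the
  squared norm of that sum by K times its norm times that of \<open>y\<close>, hence bounds the
  coefficients in square sum. Then \<open>riesz_basis\<close> applies, and density of the span
  extends the identity beyond basis vectors.\<close>

lemma adjoint_ex:
  assumes T: "bounded_clinear (T :: 'h \<Rightarrow> 'h)"
  shows "\<exists>S. \<forall>x y. cinner (T x) y = cinner x (S y)"
proof -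
  note on = orthonormal_basis_orthonormal[OF E]
  obtain K where K: "K > 0" "\<And>x. norm (T x) \<le> K * norm x" using bounded_clinear_bounded[OF T] by blast
  have "\<exists>w. \<forall>x. cinner (T x) y = cinner x w" for y
  proof -
    have "\<exists>w. \<forall>e\<in>E. cinner e w = cinner (T e) y"
    proof (rule riesz_basis[OF on])
      fix F assume F: "finite F" "F \<subseteq> E"
      let ?c = "\<lambda>e. cinner (T e) y"
      let ?w = "\<Sum>e\<in>F. ?c e *\<^sub>C e"
      have nw: "(norm ?w)\<^sup>2 = (\<Sum>e\<in>F. (cmod (?c e))\<^sup>2)" by (rule norm_orthonormal_sum[OF on F])
      have "cinner (T ?w) y = (\<Sum>e\<in>F. cnj (?c e) * ?c e)"
        by (simp add: bounded_clinear_sum[OF T] bounded_clinear_scaleC[OF T] cinner_sum_left cinner_scaleC_left)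
      also have "\<dots> = of_real ((norm ?w)\<^sup>2)"
        unfolding nw of_real_sum complex_norm_square by (simp add: mult.commute)
      finally have "(norm ?w)\<^sup>2 = cmod (cinner (T ?w) y)" by (simp del: of_real_power)
      also have "\<dots> \<le> norm (T ?w) * norm y" by (rule cinner_norm_le)
      also have "\<dots> \<le> K * norm ?w * norm y" using K(2) by (intro mult_right_mono) auto
      finally have "norm ?w * norm ?w \<le> norm ?w * (K * norm y)" by (simp add: power2_eq_square mult_ac)
      then have "norm ?w \<le> K * norm y" using K(1) by (cases "norm ?w = 0") auto
      then show "(\<Sum>e\<in>F. (cmod (?c e))\<^sup>2) \<le> (K * norm y)\<^sup>2"
        unfolding nw[symmetric] by (intro power_mono) auto
    qed
    then obtain w where w: "\<And>e. e \<in> E \<Longrightarrow> cinner e w = cinner (T e) y" by blast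
    have "bounded_linear (\<lambda>x. cinner (T x) y)"
      using bounded_linear_compose[OF bounded_linear_cinner_left, of T] T by (auto simp: bounded_clinear_def)
    then have "cinner (T x) y = cinner x w" for x
      by (rule cinner_eq_on_basis[OF E _ _ bounded_linear_cinner_left])
        (auto simp: bounded_clinear_scaleC[OF T] cinner_scaleC_left w)
    then show ?thesis by blast
  qed
  then show ?thesis by metis
qed

lemma cadjoint_unique:
  fixes T :: "'h \<Rightarrow> 'h"
  assumes S: "\<And>x y. cinner (T x) y = cinner x (S y)"
  shows "cadjoint T = S"
  unfolding cadjoint_def
proof (rule the_equality)
  fix S' assume "\<forall>x y. cinner (T x) y = cinner x (S' y)"
  then have "cinner x (S' y) = cinner x (S y)" for x y using S by metis
  then show "S' = S" by (intro ext cinner_ext)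
qed (use S in blast)

lemma cadjoint:
  assumes T: "bounded_clinear (T :: 'h \<Rightarrow> 'h)"
  shows "cinner (T x) y = cinner x (cadjoint T y)"
proof -
  obtain S where "\<And>x y. cinner (T x) y = cinner x (S y)" using adjoint_ex[OF T] by blast
  with cadjoint_unique[of T S] show ?thesis by simp
qed

lemma cadjoint':
  assumes T: "bounded_clinear (T :: 'h \<Rightarrow> 'h)"
  shows "cinner (cadjoint T x) y = cinner x (T y)"
  by (metis T cadjoint cinner_commute)

lemma bounded_clinear_cadjoint:
  assumes T: "bounded_clinear (T :: 'h \<Rightarrow> 'h)"
  shows "bounded_clinear (cadjoint T)"
proof -
  obtain K where K: "K > 0" "\<And>x. norm (T x) \<le> K * norm x" using bounded_clinear_bounded[OF T] by blast
  show ?thesis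
  proof (rule bounded_clinearI[where K = K])
    show "cadjoint T (x + y) = cadjoint T x + cadjoint T y" for x y
      by (rule cinner_ext) (simp add: cadjoint[OF T, symmetric] cinner_add_right)
    show "cadjoint T (c *\<^sub>C x) = c *\<^sub>C cadjoint T x" for c x
      by (rule cinner_ext) (simp add: cadjoint[OF T, symmetric] cinner_scaleC_right)
    fix x
    have "complex_of_real ((norm (cadjoint T x))\<^sup>2) = cinner (T (cadjoint T x)) x"
      by (simp add: cinner_self cadjoint[OF T])
    then have "(norm (cadjoint T x))\<^sup>2 = cmod (cinner (T (cadjoint T x)) x)"
      by (metis abs_power2 norm_of_real)
    also have "\<dots> \<le> norm (T (cadjoint T x)) * norm x" by (rule cinner_norm_le)
    also have "\<dots> \<le> K * norm (cadjoint T x) * norm x" using K(2) by (intro mult_right_mono) auto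
    finally have "norm (cadjoint T x) * norm (cadjoint T x) \<le> norm (cadjoint T x) * (K * norm x)"
      by (simp add: power2_eq_square mult_ac)
    then show "norm (cadjoint T x) \<le> K * norm x" using K(1) by (cases "norm (cadjoint T x) = 0") auto
  qed
qed

lemma cadjoint_cadjoint:
  assumes T: "bounded_clinear (T :: 'h \<Rightarrow> 'h)"
  shows "cadjoint (cadjoint T) = T"
  by (rule cadjoint_unique) (rule cadjoint'[OF T])

text \<open>One double sum of squared matrix coefficients in two orders: Parseval over
  \<open>E\<close>, then Bessel over \<open>F\<close>. Keeping \<open>F\<close> finite makes the
  exchange of sums trivial.\<close>

lemma hs_adjoint_le:
  assumes T: "bounded_clinear (T :: 'h \<Rightarrow> 'h)" and s: "(\<lambda>e. (norm (T e))\<^sup>2) summable_on E"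
    and F: "orthonormal F" "finite F"
  shows "(\<Sum>f\<in>F. (norm (cadjoint T f))\<^sup>2) \<le> infsum (\<lambda>e. (norm (T e))\<^sup>2) E"
proof (rule has_sum_mono)
  show "((\<lambda>e. \<Sum>f\<in>F. (cmod (cinner e (cadjoint T f)))\<^sup>2) has_sum (\<Sum>f\<in>F. (norm (cadjoint T f))\<^sup>2)) E"
    by (intro has_sum_sum_finite F parseval[OF E])
  show "((\<lambda>e. (norm (T e))\<^sup>2) has_sum infsum (\<lambda>e. (norm (T e))\<^sup>2) E) E" using s by simp
  fix e
  have "(\<Sum>f\<in>F. (cmod (cinner e (cadjoint T f)))\<^sup>2) = (\<Sum>f\<in>F. (cmod (cinner f (T e)))\<^sup>2)"
    unfolding cadjoint[OF T, symmetric] by (intro sum.cong refl) (subst cinner_commute, simp)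
  also have "\<dots> \<le> (norm (T e))\<^sup>2" by (rule bessel[OF F order_refl])
  finally show "(\<Sum>f\<in>F. (cmod (cinner e (cadjoint T f)))\<^sup>2) \<le> (norm (T e))\<^sup>2" .
qed

lemma hs_adjoint_summable:
  assumes T: "bounded_clinear (T :: 'h \<Rightarrow> 'h)" and s: "(\<lambda>e. (norm (T e))\<^sup>2) summable_on E"
    and F: "orthonormal F"
  shows "(\<lambda>e. (norm (cadjoint T e))\<^sup>2) summable_on F"
proof (rule nonneg_bdd_above_summable_on)
  show "bdd_above (sum (\<lambda>e. (norm (cadjoint T e))\<^sup>2) ` {G. G \<subseteq> F \<and> finite G})"
  proof (rule bdd_aboveI2)
    fix G assume G: "G \<in> {G. G \<subseteq> F \<and> finite G}"
    then have "orthonormal G" using F unfolding orthonormal_def by blast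
    then show "(\<Sum>e\<in>G. (norm (cadjoint T e))\<^sup>2) \<le> infsum (\<lambda>e. (norm (T e))\<^sup>2) E"
      by (rule hs_adjoint_le[OF T s]) (use G in blast)
  qed
qed auto

end

text \<open>The adjoint is taken twice: first \<open>cadjoint T\<close> is summable along
  \<open>E\<close>, then its adjoint \<open>T\<close> along \<open>F\<close>.\<close>

lemma hs_summable_any_basis:
  assumes T: "bounded_clinear T" and E: "orthonormal_basis E" "(\<lambda>e. (norm (T e))\<^sup>2) summable_on E"
    and F: "orthonormal_basis F"
  shows "(\<lambda>e. (norm (T e))\<^sup>2) summable_on F"
  using hs_adjoint_summable[OF E(1) bounded_clinear_cadjoint[OF E(1) T]
      hs_adjoint_summable[OF E(1) T E(2) orthonormal_basis_orthonormal[OF E(1)]] orthonormal_basis_orthonormal[OF F]]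
  unfolding cadjoint_cadjoint[OF E(1) T] .

text \<open>A sesquilinear form with real diagonal is Hermitian: compare imaginary parts at x + y
  and at x + i y.\<close>

lemma positive_op_hermitian:
  assumes R: "positive_op R"
  shows "cinner (R x) y = cinner x (R y)"
proof -
  have Rl: "bounded_clinear R" and pos: "\<And>x. cinner x (R x) \<in> \<real>\<^sub>\<ge>\<^sub>0"
    using R by (auto simp: positive_op_def)
  have im: "Im (cinner x (R x)) = 0" for x using pos[of x] by (auto simp: nonneg_Reals_def)
  have 1: "Im (cinner x (R y) + cinner y (R x)) = 0"
    using im[of "x + y"] im[of x] im[of y]
    by (simp add: bounded_clinear_add[OF Rl] cinner_add_left cinner_add_right)
  have 2: "Re (cinner x (R y)) = Re (cinner y (R x))"
    using im[of "x + \<i> *\<^sub>C y"] im[of x] im[of y]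
    by (simp add: bounded_clinear_add[OF Rl] bounded_clinear_scaleC[OF Rl] cinner_add_left cinner_add_right
        cinner_scaleC_left cinner_scaleC_right)
  have "cinner x (R y) = cnj (cinner y (R x))"
    by (rule complex_eqI) (use 1 2 in auto)
  then show ?thesis by (metis cinner_commute)
qed

text \<open>With \<open>R\<close> the absolute value of \<open>T\<close>, the norms of T x and R x
  agree, and R^2 is at most K R for a bound K of \<open>R\<close>; thus the trace of
  \<open>R\<close> dominates the sum of squares.\<close>

lemma trace_class_hs_summable:
  assumes T: "trace_class T" and F: "orthonormal_basis F"
  shows "(\<lambda>e. (norm (T e))\<^sup>2) summable_on F"
proof -
  obtain R E where Tb: "bounded_clinear T" and R: "positive_op R" "R \<circ> R = cadjoint T \<circ> T"
    and E: "orthonormal_basis E" "(\<lambda>e. cinner e (R e)) summable_on E"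
    using T unfolding trace_class_def by blast
  have Rl: "bounded_clinear R" and pos: "\<And>x. cinner x (R x) \<in> \<real>\<^sub>\<ge>\<^sub>0"
    using R(1) by (auto simp: positive_op_def)
  obtain K where K: "K > 0" "\<And>x. norm (R x) \<le> K * norm x" using bounded_clinear_bounded[OF Rl] by blast
  have TR: "norm (T x) = norm (R x)" for x
  proof -
    have "complex_of_real ((norm (T x))\<^sup>2) = cinner x (R (R x))"
      using fun_cong[OF R(2), of x] by (simp add: cinner_self[symmetric] cadjoint[OF E(1) Tb] del: of_real_power)
    also have "\<dots> = complex_of_real ((norm (R x))\<^sup>2)"
      by (simp add: positive_op_hermitian[OF R(1), symmetric] cinner_self del: of_real_power)
    finally show ?thesis by (simp only: of_real_eq_iff power2_eq_iff_nonneg norm_ge_zero)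
  qed
  have bound: "(norm (R v))\<^sup>2 \<le> K * Re (cinner v (R v))" for v
  proof -
    let ?t = "complex_of_real (1 / K)"
    \<comment> \<open>Positivity of \<open>R\<close> at v - R v / K proves the inequality between
      R^2 and K R without any spectral theorem.\<close>
    let ?u = "v - ?t *\<^sub>C R v"
    have "Re (cinner (R v) (R (R v))) \<le> norm (R v) * norm (R (R v))"
      using cinner_norm_le complex_Re_le_cmod order_trans by blast
    also have "\<dots> \<le> norm (R v) * (K * norm (R v))" using K(2) by (intro mult_left_mono) auto
    finally have c: "Re (cinner (R v) (R (R v))) \<le> K * (norm (R v))\<^sup>2" by (simp add: power2_eq_square mult_ac)
    have "0 \<le> Re (cinner ?u (R ?u))" using pos[of ?u] by (auto simp: nonneg_Reals_def)
    also have "cinner ?u (R ?u) = cinner v (R v) - ?t * cinner v (R (R v)) - ?t * cinner (R v) (R v)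
        + ?t * ?t * cinner (R v) (R (R v))"
      by (simp add: bounded_clinear_diff[OF Rl] bounded_clinear_scaleC[OF Rl] cinner_diff_left cinner_diff_right
          cinner_scaleC_left cinner_scaleC_right algebra_simps)
    also have "cinner v (R (R v)) = cinner (R v) (R v)" by (simp add: positive_op_hermitian[OF R(1)])
    finally have "0 \<le> Re (cinner v (R v)) - 2 / K * (norm (R v))\<^sup>2 + 1 / K * (1 / K) * Re (cinner (R v) (R (R v)))"
      unfolding cinner_self by (simp flip: of_real_mult of_real_divide of_real_power)
    also have "1 / K * (1 / K) * Re (cinner (R v) (R (R v))) \<le> 1 / K * (1 / K) * (K * (norm (R v))\<^sup>2)"
      using c K(1) by (intro mult_left_mono) auto
    finally have "1 / K * (norm (R v))\<^sup>2 \<le> Re (cinner v (R v))" using K(1) by (simp add: field_simps)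
    then show ?thesis using K(1) by (simp add: field_simps)
  qed
  have "(\<lambda>e. (norm (T e))\<^sup>2) summable_on E"
  proof (rule summable_on_comparison_test)
    show "(\<lambda>e. K * Re (cinner e (R e))) summable_on E"
      using E(2) by (intro summable_on_cmult_right summable_on_Re)
  qed (use bound TR in auto)
  then show ?thesis by (rule hs_summable_any_basis[OF Tb E(1) _ F])
qed

section \<open>Polynomials supported on a set of words\<close>

definition polys_on :: "'v nc_word set \<Rightarrow> 'v nc_poly set" where
  "polys_on S = {p. Poly_Mapping.keys p \<subseteq> S}"

lemma polys_onI: "Poly_Mapping.keys p \<subseteq> S \<Longrightarrow> p \<in> polys_on S"
  by (simp add: polys_on_def)

lemma polys_on_zero [simp]: "0 \<in> polys_on S"
  by (simp add: polys_on_def)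

lemma polys_on_add: "p \<in> polys_on S \<Longrightarrow> q \<in> polys_on S \<Longrightarrow> p + q \<in> polys_on S"
  unfolding polys_on_def using Poly_Mapping.keys_add[of p q] by blast

lemma polys_on_scaleC: "p \<in> polys_on S \<Longrightarrow> c *\<^sub>C p \<in> polys_on S"
  unfolding polys_on_def using keys_scaleC[of c p] by blast

lemma polys_on_uminus: "p \<in> polys_on S \<Longrightarrow> - p \<in> polys_on S"
  by (simp add: polys_on_def)

lemma polys_on_diff: "p \<in> polys_on S \<Longrightarrow> q \<in> polys_on S \<Longrightarrow> p - q \<in> polys_on S"
  using polys_on_add[of p S "- q"] polys_on_uminus by fastforce

lemma polys_on_mult:
  "p \<in> polys_on S \<Longrightarrow> q \<in> polys_on T \<Longrightarrow> (\<And>u v. u \<in> S \<Longrightarrow> v \<in> T \<Longrightarrow> u + v \<in> R) \<Longrightarrow> p * q \<in> polys_on R"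
  unfolding polys_on_def using Poly_Mapping.keys_mult[of p q] by blast

lemma polys_on_single: "w \<in> S \<Longrightarrow> Poly_Mapping.single w c \<in> polys_on S"
  by (simp add: polys_on_def)

lemma polys_on_star: "p \<in> polys_on S \<Longrightarrow> (\<And>u. u \<in> S \<Longrightarrow> invol u \<in> S) \<Longrightarrow> star p \<in> polys_on S"
proof -
  assume p: "p \<in> polys_on S" and S: "\<And>u. u \<in> S \<Longrightarrow> invol u \<in> S"
  show "star p \<in> polys_on S"
    unfolding polys_on_def
  proof safe
    fix w assume "w \<in> Poly_Mapping.keys (star p)"
    then have "star (Poly_Mapping.lookup p (invol w)) \<noteq> 0"
      by (simp add: in_keys_iff star_poly_mapping.rep_eq)
    then have "invol w \<in> Poly_Mapping.keys p" using star_zero by (auto simp: in_keys_iff)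
    then show "w \<in> S" using p S[of "invol w"] by (auto simp: polys_on_def invol_invol)
  qed
qed

lemma polys_on_mono: "p \<in> polys_on S \<Longrightarrow> S \<subseteq> T \<Longrightarrow> p \<in> polys_on T"
  by (auto simp: polys_on_def)

lemma nc_poly_sum_single: "p = (\<Sum>w\<in>Poly_Mapping.keys p. Poly_Mapping.single w (Poly_Mapping.lookup p w))"
  by (rule poly_mapping_eqI)
    (simp add: lookup_sum lookup_single when_def if_distrib in_keys_iff cong: if_cong)

lemma polys_on_induct [consumes 1, case_names single add zero]:
  assumes p: "p \<in> polys_on S"
    and single: "\<And>w c. w \<in> S \<Longrightarrow> Q (Poly_Mapping.single w c)"
    and add: "\<And>p q. Q p \<Longrightarrow> Q q \<Longrightarrow> Q (p + q)" and zero: "Q 0"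
  shows "Q p"
proof -
  have "Q (\<Sum>w\<in>I. Poly_Mapping.single w (Poly_Mapping.lookup p w))" if "I \<subseteq> S" for I
    using that by (induction I rule: infinite_finite_induct) (auto simp: zero intro: add single)
  then have "Q (\<Sum>w\<in>Poly_Mapping.keys p. Poly_Mapping.single w (Poly_Mapping.lookup p w))"
    using p by (simp add: polys_on_def)
  then show ?thesis unfolding nc_poly_sum_single[of p, symmetric] .
qed

lemma nc_word_add_eq_0: "u + w = 0 \<longleftrightarrow> u = 0 \<and> w = (0 :: 'v nc_word)"
  by (cases u; cases w) (auto simp: plus_nc_word_def zero_nc_word_def)

lemma invol_nc_word_eq_0: "invol w = 0 \<longleftrightarrow> w = (0 :: 'v nc_word)"
  by (cases w) (auto simp: invol_nc_word_def zero_nc_word_def)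

lemma invol_0_nc_word [simp]: "invol 0 = (0 :: 'v nc_word)"
  by (simp add: invol_nc_word_eq_0)

text \<open>Polynomials without constant term: the empty word stands for the identity operator,
  whose trace is not part of the data.\<close>

abbreviation nonconst_polys :: "'v nc_poly set" where
  "nonconst_polys \<equiv> polys_on (- {0})"

lemma nonconst_polys_mult:
  "p \<in> nonconst_polys \<Longrightarrow> p * q \<in> nonconst_polys" "p \<in> nonconst_polys \<Longrightarrow> q * p \<in> nonconst_polys"
  by (rule polys_on_mult[of _ "- {0}" _ UNIV]; auto simp: nc_word_add_eq_0 polys_on_def)
    (rule polys_on_mult[of _ UNIV _ "- {0}"]; auto simp: nc_word_add_eq_0 polys_on_def)

lemma nonconst_polys_star: "p \<in> nonconst_polys \<Longrightarrow> star p \<in> nonconst_polys"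
  by (rule polys_on_star) (auto simp: invol_nc_word_eq_0)

lemma nc_var_nonconst: "nc_var v \<in> nonconst_polys"
  by (simp add: nc_var_def polys_on_def zero_nc_word_def)

subsection \<open>Words in trace class operators\<close>

lemma bounded_clinear_comp: "bounded_clinear S \<Longrightarrow> bounded_clinear T \<Longrightarrow> bounded_clinear (S \<circ> T)"
  unfolding bounded_clinear_def comp_def by (auto intro: bounded_linear_compose)

lemma bounded_clinear_id: "bounded_clinear id"
  unfolding bounded_clinear_def id_def by (auto intro: bounded_linear_ident)

lemma bounded_clinear_plus:
  "bounded_clinear S \<Longrightarrow> bounded_clinear T \<Longrightarrow> bounded_clinear (\<lambda>v. S v + T v)"
  unfolding bounded_clinear_def by (auto intro: bounded_linear_add simp: scaleC_add_right)

lemma bounded_clinear_scale: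
  assumes T: "bounded_clinear T"
  shows "bounded_clinear (\<lambda>v. c *\<^sub>C T v)"
proof -
  obtain K where K: "\<And>x. norm (T x) \<le> K * norm x" using bounded_clinear_bounded[OF T] by blast
  show ?thesis
  proof (rule bounded_clinearI[where K = "cmod c * K"])
    show "norm (c *\<^sub>C T x) \<le> cmod c * K * norm x" for x
      using K[of x] by (simp add: norm_scaleC mult_left_mono mult.assoc)
  qed (simp_all add: bounded_clinear_add[OF T] bounded_clinear_scaleC[OF T] scaleC_add_right scaleC_scaleC mult.commute)
qed

definition letter_op :: "('v \<Rightarrow> 'h \<Rightarrow> 'h::complex_hilbert_space) \<Rightarrow> 'v letter \<Rightarrow> 'h \<Rightarrow> 'h" where
  "letter_op x l = (case l of Var v \<Rightarrow> x v | Adj v \<Rightarrow> cadjoint (x v))"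

lemma op_word_0 [simp]: "op_word x 0 = id"
  by (simp add: op_word_def word_value_def zero_nc_word_def)

lemma op_word_Cons: "op_word x (Word (l # ls)) = letter_op x l \<circ> op_word x (Word ls)"
  by (simp add: op_word_def word_value_def letter_op_def)

lemma op_word_add: "op_word x (u + w) = op_word x u \<circ> op_word x w"
  unfolding op_word_def by (rule word_value_add) auto

lemma op_word_letter: "op_word x (Word [l]) = letter_op x l"
  using op_word_Cons[of x l "[]"] op_word_0[of x] by (simp add: zero_nc_word_def)

definition op_eval :: "('v \<Rightarrow> 'h \<Rightarrow> 'h::complex_hilbert_space) \<Rightarrow> 'v nc_poly \<Rightarrow> 'h \<Rightarrow> 'h" where
  "op_eval x p v = (\<Sum>w\<in>Poly_Mapping.keys p. Poly_Mapping.lookup p w *\<^sub>C op_word x w v)"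

lemma cinner_op_eval: "cinner u (op_eval x p v) = nc_lin (\<lambda>w. cinner u (op_word x w v)) p"
  by (simp add: op_eval_def nc_lin_def cinner_sum_right cinner_scaleC_right)

lemma op_eval_add: "op_eval x (p + q) v = op_eval x p v + op_eval x q v"
  by (rule cinner_ext) (simp add: cinner_op_eval cinner_add_right nc_lin_add)

lemma op_eval_scaleC: "op_eval x (c *\<^sub>C p) v = c *\<^sub>C op_eval x p v"
  by (rule cinner_ext) (simp add: cinner_op_eval cinner_scaleC_right nc_lin_scaleC)

lemma op_eval_single: "op_eval x (Poly_Mapping.single w c) v = c *\<^sub>C op_word x w v"
  by (rule cinner_ext) (simp add: cinner_op_eval cinner_scaleC_right)

lemma op_eval_one: "op_eval x 1 v = v"
  unfolding single_one[symmetric] op_eval_single by (simp add: scaleC_one)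

lemma op_eval_diff: "op_eval x (p - q) v = op_eval x p v - op_eval x q v"
  using op_eval_add[of x "p - q" q v] by simp

text \<open>\<open>E\<close> is the very basis that \<open>op_trace\<close> selects, so sums over it
  are the given moments and a change of basis in a trace is never called for.\<close>

locale trace_class_tuple =
  fixes x :: "'k \<Rightarrow> 'h \<Rightarrow> 'h::complex_hilbert_space" and E :: "'h set"
  assumes tc: "\<And>i. trace_class (x i)"
    and E: "orthonormal_basis E" and E_some: "E = (SOME E. orthonormal_basis E)"
begin

lemma bounded_x: "bounded_clinear (x i)"
  using tc[of i] by (simp add: trace_class_def)

lemma bounded_letter_op: "bounded_clinear (letter_op x l)"
  unfolding letter_op_def using bounded_x bounded_clinear_cadjoint[OF E bounded_x] by (auto split: letter.split)

lemma bounded_op_word: "bounded_clinear (op_word x w)"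
proof (cases w)
  case (Word ls)
  show ?thesis unfolding Word
  proof (induction ls)
    case Nil
    then show ?case using bounded_clinear_id op_word_0[of x] unfolding zero_nc_word_def by metis
  next
    case (Cons l ls)
    then show ?case unfolding op_word_Cons by (intro bounded_clinear_comp bounded_letter_op)
  qed
qed

lemma cinner_letter_op: "cinner (letter_op x l a) b = cinner a (letter_op x (flip_letter l) b)"
  by (cases l) (simp_all add: letter_op_def cadjoint[OF E bounded_x] cadjoint'[OF E bounded_x])

lemma cinner_op_word: "cinner (op_word x w a) b = cinner a (op_word x (invol w) b)"
proof (cases w)
  case (Word ls)
  have "cinner (op_word x (Word ls) a) b = cinner a (op_word x (invol (Word ls)) b)" for b
  proof (induction ls arbitrary: b)
    case Nil
    then show ?case by (simp add: zero_nc_word_def[symmetric])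
  next
    case (Cons l ls)
    have "invol (Word (l # ls)) = invol (Word ls) + Word [flip_letter l]"
      by (simp add: invol_nc_word_def plus_nc_word_def)
    then show ?case by (simp add: op_word_Cons[of x l ls] op_word_add op_word_letter cinner_letter_op Cons)
  qed
  then show ?thesis unfolding Word .
qed

lemma bounded_op_eval: "bounded_clinear (op_eval x p)"
proof (induction p rule: poly_mapping_single_induct)
  case (single w c)
  then show ?case
    unfolding op_eval_single[abs_def] by (intro bounded_clinear_scale bounded_op_word)
next
  case (add p q)
  then show ?case unfolding op_eval_add[abs_def] by (rule bounded_clinear_plus)
qed

lemma op_eval_mult: "op_eval x (p * q) v = op_eval x p (op_eval x q v)"
proof (induction p rule: poly_mapping_single_induct)
  case (single u a)
  show ?case
  proof (induction q rule: poly_mapping_single_induct)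
    case (single w b)
    show ?case
      by (simp add: mult_single op_eval_single op_word_add bounded_clinear_scaleC[OF bounded_op_word] scaleC_scaleC)
  next
    case (add p q)
    then show ?case
      by (simp add: distrib_left op_eval_add bounded_clinear_add[OF bounded_op_eval])
  qed
next
  case (add p q)
  then show ?case by (simp add: distrib_right op_eval_add)
qed

lemma cinner_op_eval_star: "cinner (op_eval x p a) b = cinner a (op_eval x (star p) b)"
proof (induction p rule: poly_mapping_single_induct)
  case (single w c)
  show ?case
    by (simp add: star_single op_eval_single cinner_scaleC_left cinner_scaleC_right cinner_op_word star_complex_def)
next
  case (add p q)
  then show ?case by (simp add: star_add op_eval_add cinner_add_left cinner_add_right)
qed

lemma hs_letter_op: "(\<lambda>e. (norm (letter_op x l e))\<^sup>2) summable_on E"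
  using trace_class_hs_summable[OF tc E]
    hs_adjoint_summable[OF E bounded_x trace_class_hs_summable[OF tc E] orthonormal_basis_orthonormal[OF E]]
  by (cases l) (simp_all add: letter_op_def)

lemma hs_op_word:
  assumes "w \<noteq> 0"
  shows "(\<lambda>e. (norm (op_word x w e))\<^sup>2) summable_on E"
proof -
  obtain ls l where w: "w = Word ls + Word [l]"
  proof (cases w)
    case (Word ks)
    then have "ks \<noteq> []" using assms by (auto simp: zero_nc_word_def)
    then show thesis using that[of "butlast ks" "last ks"] Word by (simp add: plus_nc_word_def)
  qed
  obtain K where K: "K > 0" "\<And>v. norm (op_word x (Word ls) v) \<le> K * norm v"
    using bounded_clinear_bounded[OF bounded_op_word] by blast
  show ?thesis
  proof (rule summable_on_comparison_test)
    show "(\<lambda>e. K\<^sup>2 * (norm (letter_op x l e))\<^sup>2) summable_on E"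
      by (intro summable_on_cmult_right hs_letter_op)
    show "(norm (op_word x w e))\<^sup>2 \<le> K\<^sup>2 * (norm (letter_op x l e))\<^sup>2" for e
      unfolding w op_word_add op_word_letter comp_def power_mult_distrib[symmetric]
      by (intro power_mono K) auto
  qed auto
qed

text \<open>Both parts are Hilbert-Schmidt, and Cauchy-Schwarz bounds the diagonal entries of the
  product by the sum of the squared norms.\<close>

lemma summable_op_word_add:
  assumes "u \<noteq> 0" "v \<noteq> 0"
  shows "(\<lambda>e. cinner e (op_word x (u + v) e)) summable_on E"
proof (rule abs_summable_summable, rule Infinite_Sum.abs_summable_on_comparison_test')
  show "(\<lambda>e. (norm (op_word x (invol u) e))\<^sup>2 + (norm (op_word x v e))\<^sup>2) summable_on E"
    using assms by (intro summable_on_add hs_op_word) (simp_all add: invol_nc_word_eq_0)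
  fix e
  have "cmod (cinner e (op_word x (u + v) e)) = cmod (cinner (op_word x (invol u) e) (op_word x v e))"
    by (simp add: op_word_add cinner_op_word invol_invol)
  also have "\<dots> \<le> norm (op_word x (invol u) e) * norm (op_word x v e)" by (rule cinner_norm_le)
  also have "\<dots> \<le> (norm (op_word x (invol u) e))\<^sup>2 + (norm (op_word x v e))\<^sup>2"
  proof -
    have "a * b \<le> a\<^sup>2 + b\<^sup>2" if "0 \<le> a" "0 \<le> b" for a b :: real
      using sum_squares_bound[of a b] mult_nonneg_nonneg[OF that] by linarith
    then show ?thesis by simp
  qed
  finally show "norm (cinner e (op_word x (u + v) e)) \<le> (norm (op_word x (invol u) e))\<^sup>2 + (norm (op_word x v e))\<^sup>2" .
qed

lemma nc_lin_op_moments: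
  assumes "p \<in> polys_on {u + v | u v. u \<noteq> 0 \<and> v \<noteq> 0}"
  shows "((\<lambda>e. cinner e (op_eval x p e)) has_sum nc_lin (op_moments x) p) E"
  unfolding cinner_op_eval nc_lin_def
proof (intro has_sum_sum_finite has_sum_cmult_right)
  fix w assume "w \<in> Poly_Mapping.keys p"
  then have "(\<lambda>e. cinner e (op_word x w e)) summable_on E"
    using assms summable_op_word_add by (fastforce simp: polys_on_def)
  then show "((\<lambda>e. cinner e (op_word x w e)) has_sum op_moments x w) E"
    unfolding op_moments_def op_trace_def E_some[symmetric] by simp
qed simp

lemma nc_lin_op_moments_star_mult:
  assumes "q \<in> nonconst_polys"
  shows "((\<lambda>e. (norm (op_eval x q e))\<^sup>2) has_sum Re (nc_lin (op_moments x) (star q * q))) E"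
proof -
  have "star q * q \<in> polys_on {u + v | u v. u \<noteq> 0 \<and> v \<noteq> 0}"
    by (rule polys_on_mult[OF nonconst_polys_star[OF assms] assms]) auto
  from has_sum_Re[OF nc_lin_op_moments[OF this]] show ?thesis
    by (simp add: op_eval_mult cinner_op_eval_star[symmetric] cinner_self)
qed

text \<open>With \<open>T = 1 - x\<^sup>* x / C\<close> the vectors \<open>x T\<^sup>J e\<close> are square summable over \<open>J\<close>, because each factor
  \<open>T\<close> lowers the squared norm by at least \<open>\<parallel>x e\<parallel>\<^sup>2 / C\<close>; hence \<open>x T\<^sup>J\<close> vanishes in the
  Hilbert-Schmidt norm, and \<open>x - x T\<^sup>J\<close> is a product of two polynomials in \<open>x\<close> and \<open>x\<^sup>*\<close>.\<close>

lemma nc_var_approx: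
  assumes e: "e > 0"
  shows "\<exists>Y\<in>nonconst_polys. \<exists>Z\<in>nonconst_polys.
    Re (nc_lin (op_moments x) (star (nc_var i - Y * Z) * (nc_var i - Y * Z))) < e"
proof -
  let ?a = "nc_var i :: 'k nc_poly"
  let ?x = "op_eval x ?a" and ?y = "op_eval x (star ?a)"
  note adj = cinner_op_eval_star[of ?a]
  have adj': "cinner (?y u) v = cinner u (?x v)" for u v
    using cinner_op_eval_star[of "star ?a"] by (simp add: star_star)
  obtain K1 where K1: "K1 > 0" "\<And>v. norm (?x v) \<le> K1 * norm v" using bounded_clinear_bounded[OF bounded_op_eval] by blast
  obtain K2 where K2: "K2 > 0" "\<And>v. norm (?y v) \<le> K2 * norm v" using bounded_clinear_bounded[OF bounded_op_eval] by blast
  \<comment> \<open>\<open>C\<close> bounds the squared norms of both \<open>?x\<close> and its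
    adjoint, so that \<open>drop\<close> below can be used with the two in either order.\<close>
  define C where "C = K1\<^sup>2 + K2\<^sup>2"
  have C: "C > 0" using K1(1) by (simp add: C_def add_pos_nonneg)
  have bx: "(norm (?x v))\<^sup>2 \<le> C * (norm v)\<^sup>2" for v
  proof -
    have "(norm (?x v))\<^sup>2 \<le> (K1 * norm v)\<^sup>2" by (intro power_mono K1) auto
    also have "\<dots> \<le> C * (norm v)\<^sup>2" by (simp add: C_def power_mult_distrib distrib_right)
    finally show ?thesis .
  qed
  have bY: "(norm (?y v))\<^sup>2 \<le> C * (norm v)\<^sup>2" for v
  proof -
    have "(norm (?y v))\<^sup>2 \<le> (K2 * norm v)\<^sup>2" by (intro power_mono K2) auto
    also have "\<dots> \<le> C * (norm v)\<^sup>2" by (simp add: C_def power_mult_distrib distrib_right)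
    finally show ?thesis .
  qed
  let ?c = "complex_of_real (1 / C)"
  \<comment> \<open>Expanding the square, the linear term contributes -2 / C and the quadratic term
    at most 1 / C times the squared norm of \<open>f v\<close>.\<close>
  have drop: "(norm (v - ?c *\<^sub>C g (f v)))\<^sup>2 \<le> (norm v)\<^sup>2 - 1 / C * (norm (f v))\<^sup>2"
    if fg: "\<And>u v. cinner (f u) v = cinner u (g v)" and gb: "\<And>v. (norm (g v))\<^sup>2 \<le> C * (norm v)\<^sup>2" for f g v
  proof -
    have 1: "cinner v (g (f v)) = of_real ((norm (f v))\<^sup>2)" by (simp only: fg[symmetric] cinner_self)
    then have 2: "cinner (g (f v)) v = of_real ((norm (f v))\<^sup>2)" by (metis cinner_commute complex_cnj_complex_of_real)
    have "complex_of_real ((norm (v - ?c *\<^sub>C g (f v)))\<^sup>2) = cinner (v - ?c *\<^sub>C g (f v)) (v - ?c *\<^sub>C g (f v))"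
      by (simp only: cinner_self)
    also have "\<dots> = of_real ((norm v)\<^sup>2 - 2 / C * (norm (f v))\<^sup>2 + 1 / C * (1 / C) * (norm (g (f v)))\<^sup>2)"
      unfolding cinner_diff_left cinner_diff_right cinner_scaleC_left cinner_scaleC_right 1 2
      by (simp add: cinner_self algebra_simps)
    finally have "(norm (v - ?c *\<^sub>C g (f v)))\<^sup>2 = (norm v)\<^sup>2 - 2 / C * (norm (f v))\<^sup>2 + 1 / C * (1 / C) * (norm (g (f v)))\<^sup>2"
      by (simp only: of_real_eq_iff)
    also have "1 / C * (1 / C) * (norm (g (f v)))\<^sup>2 \<le> 1 / C * (1 / C) * (C * (norm (f v))\<^sup>2)"
      using C gb by (intro mult_left_mono) auto
    finally show ?thesis using C by (simp add: field_simps)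
  qed
  define T where "T = 1 - ?c *\<^sub>C (star ?a * ?a)"
  have Tv: "op_eval x T v = v - ?c *\<^sub>C ?y (?x v)" for v
    by (simp add: T_def op_eval_diff op_eval_one op_eval_scaleC op_eval_mult)
  define q where "q J = ?a * T ^ J" for J
  have TJ: "op_eval x (T ^ Suc J) v = op_eval x T (op_eval x (T ^ J) v)" for J v
    by (simp add: op_eval_mult)
  have qv: "op_eval x (q J) v = ?x (op_eval x (T ^ J) v)" for J v
    by (simp add: q_def op_eval_mult)
  have q_nc: "q J \<in> nonconst_polys" for J
    unfolding q_def by (intro nonconst_polys_mult nc_var_nonconst)
  \<comment> \<open>Writing y for the adjoint of x, one has x T = (1 - x y / C) x, so
    \<open>drop\<close> with the roles exchanged shows that the norm does not grow with
    \<open>J\<close>. This supplies the majorant for the tail of the sum over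
    \<open>E\<close>.\<close>
  have q_le: "(norm (op_eval x (q J) v))\<^sup>2 \<le> (norm (?x v))\<^sup>2" for J v
  proof (induction J)
    case 0
    then show ?case by (simp add: q_def)
  next
    case (Suc J)
    let ?w = "op_eval x (T ^ J) v"
    have "op_eval x (q (Suc J)) v = ?x ?w - ?c *\<^sub>C ?x (?y (?x ?w))"
      by (simp only: qv TJ Tv bounded_clinear_diff[OF bounded_op_eval] bounded_clinear_scaleC[OF bounded_op_eval])
    then have "(norm (op_eval x (q (Suc J)) v))\<^sup>2 \<le> (norm (?x ?w))\<^sup>2 - 1 / C * (norm (?y (?x ?w)))\<^sup>2"
      using drop[of ?y ?x "?x ?w", OF adj' bx] by simp
    also have "\<dots> \<le> (norm (?x ?w))\<^sup>2" using C by simp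
    finally show ?case using Suc by (simp add: qv)
  qed
  have q_lim: "(\<lambda>J. (norm (op_eval x (q J) v))\<^sup>2) \<longlonglongrightarrow> 0" for v
  proof -
    define f where "f J = (norm (op_eval x (T ^ J) v))\<^sup>2" for J
    have fq: "f (Suc J) \<le> f J - 1 / C * (norm (op_eval x (q J) v))\<^sup>2" for J
      unfolding f_def TJ Tv qv by (rule drop[of ?x ?y, OF adj bY])
    have "f (Suc J) \<le> f J" for J
      using fq[of J] C by (smt (verit) divide_nonneg_nonneg mult_nonneg_nonneg zero_le_power2)
    then have "decseq f" by (rule decseq_SucI)
    moreover have "\<And>J. 0 \<le> f J" by (simp add: f_def)
    ultimately obtain l where l: "f \<longlonglongrightarrow> l" using decseq_convergent by blast
    then have "(\<lambda>J. f (Suc J)) \<longlonglongrightarrow> l" by (rule LIMSEQ_Suc)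
    then have "(\<lambda>J. C * (f J - f (Suc J))) \<longlonglongrightarrow> C * (l - l)" using l by (intro tendsto_intros)
    then have "(\<lambda>J. C * (f J - f (Suc J))) \<longlonglongrightarrow> 0" by simp
    then show ?thesis
    proof (rule tendsto_sandwich[rotated 3])
      have "(norm (op_eval x (q J) v))\<^sup>2 \<le> C * (f J - f (Suc J))" for J
        using fq[of J] C by (simp add: field_simps)
      then show "\<forall>\<^sub>F J in sequentially. (norm (op_eval x (q J) v))\<^sup>2 \<le> C * (f J - f (Suc J))" by simp
    qed auto
  qed
  have s0: "(\<lambda>e. (norm (?x e))\<^sup>2) summable_on E"
    using nc_lin_op_moments_star_mult[OF nc_var_nonconst] by (rule has_sum_imp_summable)
  define s where "s = infsum (\<lambda>e. (norm (?x e))\<^sup>2) E"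
  have sh: "((\<lambda>e. (norm (?x e))\<^sup>2) has_sum s) E" unfolding s_def using s0 by simp
  \<comment> \<open>Dominated convergence by hand: outside the finite set \<open>F\<close> the
    majorant leaves at most e / 3, and on \<open>F\<close> a large \<open>J\<close> makes the sum
    small.\<close>
  obtain F where F: "finite F" "F \<subseteq> E" "dist (\<Sum>e\<in>F. (norm (?x e))\<^sup>2) s \<le> e / 3"
    using has_sum_finite_approximation[OF sh, of "e / 3"] e by auto
  have "(\<lambda>J. \<Sum>v\<in>F. (norm (op_eval x (q J) v))\<^sup>2) \<longlonglongrightarrow> (\<Sum>v\<in>F. 0)"
    by (intro tendsto_sum q_lim)
  then have "\<forall>\<^sub>F J in sequentially. (\<Sum>v\<in>F. (norm (op_eval x (q J) v))\<^sup>2) < e / 3"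
    using e by (intro order_tendstoD) auto
  then obtain J where J: "(\<Sum>v\<in>F. (norm (op_eval x (q J) v))\<^sup>2) < e / 3"
    by (meson eventually_happens' sequentially_bot)
  have small: "Re (nc_lin (op_moments x) (star (q J) * q J)) < e"
  proof -
    have 1: "((\<lambda>v. (norm (op_eval x (q J) v))\<^sup>2) has_sum Re (nc_lin (op_moments x) (star (q J) * q J))) E"
      by (rule nc_lin_op_moments_star_mult[OF q_nc])
    have tail: "((\<lambda>v. (norm (op_eval x (q J) v))\<^sup>2) has_sum
        (Re (nc_lin (op_moments x) (star (q J) * q J)) - (\<Sum>v\<in>F. (norm (op_eval x (q J) v))\<^sup>2))) (E - F)"
      by (rule has_sum_Diff[OF 1 has_sum_finite[OF F(1)] F(2)])
    have tail': "((\<lambda>e. (norm (?x e))\<^sup>2) has_sum (s - (\<Sum>v\<in>F. (norm (?x v))\<^sup>2))) (E - F)"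
      by (rule has_sum_Diff[OF sh has_sum_finite[OF F(1)] F(2)])
    have "Re (nc_lin (op_moments x) (star (q J) * q J)) - (\<Sum>v\<in>F. (norm (op_eval x (q J) v))\<^sup>2)
        \<le> s - (\<Sum>v\<in>F. (norm (?x v))\<^sup>2)"
      by (rule has_sum_mono[OF tail tail']) (rule q_le)
    then show ?thesis using J F(3) e unfolding dist_real_def abs_le_iff by linarith
  qed
  \<comment> \<open>A geometric sum. Since \<open>1 - T\<close> is a multiple of
    \<open>star ?a * ?a\<close>, it turns \<open>?a - q J\<close> into a product that ends in
    \<open>?a\<close>.\<close>
  have "\<exists>G. 1 - T ^ J = G * (1 - T)" for J
  proof (induction J)
    case 0
    then show ?case by (intro exI[of _ 0]) simp
  next
    case (Suc J)
    then obtain G where G: "1 - T ^ J = G * (1 - T)" by blast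
    have "1 - T ^ Suc J = (1 - T ^ J) + T ^ J * (1 - T)" by (simp add: algebra_simps power_commutes)
    then show ?case unfolding G by (intro exI[of _ "G + T ^ J"]) (simp add: algebra_simps)
  qed
  then obtain G where G: "1 - T ^ J = G * (1 - T)" by blast
  define Y where "Y = ?c *\<^sub>C (?a * G * star ?a)"
  have "?a - q J = ?a * (1 - T ^ J)" by (simp add: q_def algebra_simps)
  also have "\<dots> = Y * ?a"
    unfolding G by (simp add: T_def Y_def mult_scaleC_left mult_scaleC_right mult.assoc)
  finally have "?a - Y * ?a = q J" by (simp add: algebra_simps)
  moreover have "Y \<in> nonconst_polys"
    unfolding Y_def by (intro polys_on_scaleC nonconst_polys_mult nc_var_nonconst)
  ultimately show ?thesis using small nc_var_nonconst by metis
qed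

end

section \<open>Asymptotic factorization of traces\<close>

lemma tendsto_zero_eventually_le:
  fixes f :: "nat \<Rightarrow> 'b::real_normed_vector"
  assumes "\<And>e. e > 0 \<Longrightarrow> \<forall>\<^sub>F n in sequentially. norm (f n) \<le> K * e" and K: "0 \<le> K"
  shows "f \<longlonglongrightarrow> 0"
proof (rule tendstoI)
  fix e :: real assume e: "e > 0"
  have "K * (e / (K + 1)) < e"
    using K e by (simp add: field_simps)
  moreover have "\<forall>\<^sub>F n in sequentially. norm (f n) \<le> K * (e / (K + 1))"
    using e K by (intro assms(1)) auto
  ultimately show "\<forall>\<^sub>F n in sequentially. dist (f n) 0 < e"
    by (auto elim!: eventually_mono)
qed

lemma tendsto_cmod_bounded: "X \<longlonglongrightarrow> l \<Longrightarrow> \<exists>C. \<forall>n. cmod (X n) \<le> C" for X :: "nat \<Rightarrow> complex"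
  using convergent_imp_Bseq[OF convergentI[of X l]] by (auto simp: Bseq_def)

lemma diff_scaleC_eq: "p - c *\<^sub>C q = p + (- c) *\<^sub>C (q :: 'a::complex_star_algebra)"
  using scaleC_add_left[of c "- c" q] scaleC_zero_left[of q]
  by (metis add.right_inverse add_uminus_conv_diff neg_eq_iff_add_eq_0)

abbreviation pair_prod :: "('a \<times> 'a) list \<Rightarrow> 'a::monoid_mult" where
  "pair_prod ps \<equiv> prod_list (map (\<lambda>(\<alpha>, \<beta>). \<alpha> * \<beta>) ps)"

definition sum_products :: "('a \<times> 'a) list \<Rightarrow> 'a::ring_1" where
  "sum_products l = sum_list (map (\<lambda>(y, z). y * z) l)"

text \<open>One fixed algebra, with traces and Hilbert-Schmidt seminorms that change with
  \<open>n\<close>: they stand for evaluation at the matrices of stage \<open>n\<close>. All limits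
  are then limits of numbers.\<close>

locale trace_hs_sequence =
  fixes t :: "nat \<Rightarrow> 'a::complex_star_algebra \<Rightarrow> complex" and h :: "nat \<Rightarrow> 'a \<Rightarrow> real"
  assumes t_add: "t n (p + q) = t n p + t n q"
    and t_scaleC: "t n (c *\<^sub>C p) = c * t n p"
    and t_commute: "t n (p * q) = t n (q * p)"
    and t_mult_le: "cmod (t n (p * q)) \<le> h n p * h n q"
    and h_nonneg: "0 \<le> h n p"
    and h_mult_le: "h n (p * q) \<le> h n p * h n q"
    and h_add_le: "h n (p + q) \<le> h n p + h n q"
    and h_scaleC: "h n (c *\<^sub>C p) = cmod c * h n p"
    and h_star: "h n (star p) = h n p"
    and t_star_mult: "t n (star p * p) = complex_of_real ((h n p)\<^sup>2)"
begin

lemma t_zero [simp]: "t n 0 = 0"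
  using t_add[of n 0 0] by simp

lemma t_minus: "t n (- p) = - t n p"
  using t_add[of n p "- p"] by (simp add: eq_neg_iff_add_eq_0 add.commute)

lemma t_diff: "t n (p - q) = t n p - t n q"
  using t_add[of n p "- q"] by (simp add: t_minus)

lemma h_diff_scale_le: "h n (p - c *\<^sub>C q) \<le> h n p + cmod c * h n q"
  using h_add_le[of n p "(- c) *\<^sub>C q"] by (simp only: diff_scaleC_eq h_scaleC norm_minus_cancel)

end

text \<open>\<open>A\<close> stands for the polynomials without constant term in the first family,
  \<open>B\<close> for the polynomials in the conjugated second family. Centering divides by
  \<open>Suc n\<close>, the matrix size at stage \<open>n\<close>. \<open>A_approx\<close> makes up
  for the missing control of trace norms.\<close>

locale asymptotically_cyclic_monotone = trace_hs_sequence t h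
  for t :: "nat \<Rightarrow> 'a::complex_star_algebra \<Rightarrow> complex" and h +
  fixes A B :: "'a set"
  assumes A_mult: "a \<in> A \<Longrightarrow> a' \<in> A \<Longrightarrow> a * a' \<in> A"
    and A_diff: "a \<in> A \<Longrightarrow> a' \<in> A \<Longrightarrow> a - a' \<in> A" and A_zero: "0 \<in> A"
    and A_star: "a \<in> A \<Longrightarrow> star a \<in> A"
    and B_mult: "b \<in> B \<Longrightarrow> b' \<in> B \<Longrightarrow> b * b' \<in> B" and B_star: "b \<in> B \<Longrightarrow> star b \<in> B"
    and h_bounded: "a \<in> A \<Longrightarrow> \<exists>C. \<forall>n. h n a \<le> C"
    and t_bounded: "b \<in> B \<Longrightarrow> \<exists>C. \<forall>n. cmod (t n b / of_nat (Suc n)) \<le> C"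
    and t_centered: "a \<in> A \<Longrightarrow> a' \<in> A \<Longrightarrow> b \<in> B \<Longrightarrow>
      (\<lambda>n. t n (a * (b - (t n b / of_nat (Suc n)) *\<^sub>C 1) * a')) \<longlonglongrightarrow> 0"
    and h_centered: "a \<in> A \<Longrightarrow> a' \<in> A \<Longrightarrow> b \<in> B \<Longrightarrow>
      (\<lambda>n. h n (a * (b - (t n b / of_nat (Suc n)) *\<^sub>C 1) * a')) \<longlonglongrightarrow> 0"
    and A_approx: "a \<in> A \<Longrightarrow> e > 0 \<Longrightarrow> \<exists>l. set l \<subseteq> A \<times> A \<and>
      (\<forall>\<^sub>F n in sequentially. h n (a - sum_products l) \<le> e)"
begin

definition nt :: "nat \<Rightarrow> 'a \<Rightarrow> complex" where
  "nt n b = t n b / of_nat (Suc n)"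

definition cen :: "nat \<Rightarrow> 'a \<Rightarrow> 'a" where
  "cen n b = b - nt n b *\<^sub>C 1"

lemma split_cen: "p * b * q = p * cen n b * q + nt n b *\<^sub>C (p * q)"
  by (simp add: cen_def algebra_simps mult_scaleC_left mult_scaleC_right)

text \<open>Centering \<open>b * star b\<close> between \<open>a\<close> and \<open>star a\<close>
  splits the squared norm into a vanishing term and a bounded multiple of the squared norm of
  \<open>a\<close>. In this sense \<open>b\<close> acts on \<open>A\<close> as if its operator norm
  were bounded.\<close>

lemma h_mult_B:
  assumes "a \<in> A" "b \<in> B"
  shows "(h n (a * b))\<^sup>2 \<le> cmod (t n (a * cen n (b * star b) * star a)) + cmod (nt n (b * star b)) * (h n a)\<^sup>2"
proof -
  have "complex_of_real ((h n (a * b))\<^sup>2) = t n (star b * star a * (a * b))"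
    by (simp add: t_star_mult[symmetric] star_mult del: of_real_power)
  also have "\<dots> = t n (a * b * (star b * star a))" by (rule t_commute)
  also have "\<dots> = t n (a * (b * star b) * star a)" by (simp add: mult.assoc)
  also have "\<dots> = t n (a * cen n (b * star b) * star a) + nt n (b * star b) * t n (a * star a)"
    by (subst split_cen) (simp add: t_add t_scaleC)
  also have "t n (a * star a) = complex_of_real ((h n a)\<^sup>2)"
    by (simp only: t_commute[of n a] t_star_mult)
  finally have "complex_of_real ((h n (a * b))\<^sup>2) =
      t n (a * cen n (b * star b) * star a) + nt n (b * star b) * complex_of_real ((h n a)\<^sup>2)" .
  then have "(h n (a * b))\<^sup>2 = cmod (t n (a * cen n (b * star b) * star a) + nt n (b * star b) * complex_of_real ((h n a)\<^sup>2))"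
    by (metis abs_power2 norm_of_real)
  also have "\<dots> \<le> cmod (t n (a * cen n (b * star b) * star a)) + cmod (nt n (b * star b)) * (h n a)\<^sup>2"
    by (rule order_trans[OF norm_triangle_ineq]) (simp add: norm_mult norm_power)
  finally show ?thesis .
qed

lemma t_cen: "a \<in> A \<Longrightarrow> a' \<in> A \<Longrightarrow> b \<in> B \<Longrightarrow> (\<lambda>n. t n (a * cen n b * a')) \<longlonglongrightarrow> 0"
  unfolding cen_def nt_def by (rule t_centered)

lemma h_cen: "a \<in> A \<Longrightarrow> a' \<in> A \<Longrightarrow> b \<in> B \<Longrightarrow> (\<lambda>n. h n (a * cen n b * a')) \<longlonglongrightarrow> 0"
  unfolding cen_def nt_def by (rule h_centered)

lemma nt_bounded: "b \<in> B \<Longrightarrow> \<exists>C\<ge>0. \<forall>n. cmod (nt n b) \<le> C"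
  unfolding nt_def using t_bounded by (meson norm_ge_zero order_trans)

lemma h_bounded': "a \<in> A \<Longrightarrow> \<exists>C\<ge>0. \<forall>n. h n a \<le> C"
  using h_bounded h_nonneg by (meson order_trans)

lemma h_mult_B_bounded:
  assumes a: "a \<in> A" and b: "b \<in> B"
  shows "\<exists>C\<ge>0. \<forall>n. h n (a * b) \<le> C"
proof -
  have bb: "b * star b \<in> B" by (intro B_mult B_star b)
  obtain C1 where C1: "\<And>n. cmod (t n (a * cen n (b * star b) * star a)) \<le> C1"
    using convergent_imp_Bseq[OF convergentI[OF t_cen[OF a A_star[OF a] bb]]] by (auto simp: Bseq_def)
  obtain C2 where C2: "C2 \<ge> 0" "\<And>n. cmod (nt n (b * star b)) \<le> C2" using nt_bounded[OF bb] by blast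
  obtain C3 where C3: "C3 \<ge> 0" "\<And>n. h n a \<le> C3" using h_bounded'[OF a] by blast
  have "(h n (a * b))\<^sup>2 \<le> C1 + C2 * C3\<^sup>2" for n
  proof -
    have "(h n (a * b))\<^sup>2 \<le> cmod (t n (a * cen n (b * star b) * star a)) + cmod (nt n (b * star b)) * (h n a)\<^sup>2"
      by (rule h_mult_B[OF a b])
    also have "\<dots> \<le> C1 + C2 * C3\<^sup>2"
      using C1[of n] C2 C3 h_nonneg by (intro add_mono mult_mono power_mono) auto
    finally show ?thesis .
  qed
  then have "h n (a * b) \<le> sqrt (C1 + C2 * C3\<^sup>2)" for n by (rule real_le_rsqrt)
  moreover have "0 \<le> C1" using C1[of 0] norm_ge_zero order_trans by blast
  ultimately show ?thesis using C2 by (intro exI[of _ "sqrt (C1 + C2 * C3\<^sup>2)"]) auto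
qed

lemma pair_prod_bounded:
  assumes "ps \<noteq> []" "set ps \<subseteq> A \<times> B"
  shows "\<exists>C\<ge>0. \<forall>n. h n (pair_prod ps) \<le> C"
  using assms
proof (induction ps)
  case (Cons ab ps)
  obtain a b where ab: "ab = (a, b)" by fastforce
  have "a \<in> A" "b \<in> B" using Cons.prems ab by auto
  then obtain C1 where C1: "C1 \<ge> 0" "\<And>n. h n (a * b) \<le> C1" using h_mult_B_bounded by blast
  show ?case
  proof (cases "ps = []")
    case True
    then show ?thesis using C1 by (auto simp: ab)
  next
    case False
    then obtain C2 where C2: "C2 \<ge> 0" "\<And>n. h n (pair_prod ps) \<le> C2" using Cons by auto
    have "h n (pair_prod (ab # ps)) \<le> C1 * C2" for n
      using order_trans[OF h_mult_le[of n "a * b" "pair_prod ps"] mult_mono[OF C1(2) C2(2) C1(1) h_nonneg]]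
      by (simp add: ab mult.assoc)
    then show ?thesis using C1(1) C2(1) by (intro exI[of _ "C1 * C2"]) auto
  qed
qed simp

lemma sum_products_mem: "set l \<subseteq> A \<times> A \<Longrightarrow> sum_products l \<in> A"
proof (induction l)
  case (Cons yz l)
  then obtain y z where yz: "yz = (y, z)" "y \<in> A" "z \<in> A" by auto
  have "y * z - (0 - sum_products l) \<in> A" using Cons yz by (intro A_diff A_mult A_zero) auto
  then show ?case using yz by (simp add: sum_products_def)
qed (simp add: sum_products_def A_zero)

text \<open>Let \<open>x\<close>, \<open>c\<close> be the first pair. If x = y z, then
  \<open>a * cen n b * y\<close> tends to zero in norm, while \<open>z * c\<close> times the rest
  stays bounded. A general \<open>x\<close> is a norm limit of sums of such products, and by
  \<open>h_mult_B\<close> the error stays small after multiplication by \<open>c\<close>.\<close>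

lemma t_cen_pair_prod:
  assumes a: "a \<in> A" and b: "b \<in> B" and ps: "set ps \<subseteq> A \<times> B" and ne: "ps \<noteq> []"
  shows "(\<lambda>n. t n (a * cen n b * pair_prod ps)) \<longlonglongrightarrow> 0"
proof -
  obtain x c qs where ps_eq: "ps = (x, c) # qs" using ne by (cases ps) auto
  have x: "x \<in> A" and c: "c \<in> B" and qs: "set qs \<subseteq> A \<times> B" using ps ps_eq by auto
  let ?g = "pair_prod qs"
  \<comment> \<open>The bound is on multiplication by \<open>?g\<close>, not on its norm: for an
    empty tail \<open>?g\<close> is 1, whose norm is not known to be bounded in
    \<open>n\<close>.\<close>
  obtain Cg where Cg: "Cg \<ge> 0" "\<And>n p. h n (p * ?g) \<le> h n p * Cg"
  proof (cases "qs = []")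
    case True
    then show thesis using that[of 1] by simp
  next
    case False
    then obtain C where C: "C \<ge> 0" "\<And>n. h n ?g \<le> C" using pair_prod_bounded qs by blast
    have "h n (p * ?g) \<le> h n p * C" for n p
      using h_mult_le[of n p ?g] mult_left_mono[OF C(2) h_nonneg] order_trans by blast
    then show thesis using that C(1) by blast
  qed
  obtain C1 where C1: "C1 \<ge> 0" "\<And>n. h n (a * cen n b) \<le> C1"
  proof -
    obtain C2 where C2: "C2 \<ge> 0" "\<And>n. h n (a * b) \<le> C2" using h_mult_B_bounded[OF a b] by blast
    obtain C3 where C3: "C3 \<ge> 0" "\<And>n. cmod (nt n b) \<le> C3" using nt_bounded[OF b] by blast
    obtain C4 where C4: "C4 \<ge> 0" "\<And>n. h n a \<le> C4" using h_bounded'[OF a] by blast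
    have "h n (a * cen n b) \<le> C2 + C3 * C4" for n
    proof -
      have "a * cen n b = a * b - nt n b *\<^sub>C a" by (simp add: cen_def algebra_simps mult_scaleC_right)
      then have "h n (a * cen n b) \<le> h n (a * b) + cmod (nt n b) * h n a" by (simp add: h_diff_scale_le)
      also have "\<dots> \<le> C2 + C3 * C4" using C2 C3 C4 h_nonneg by (intro add_mono mult_mono) auto
      finally show ?thesis .
    qed
    then show thesis using that[of "C2 + C3 * C4"] C2(1) C3(1) C4(1) by auto
  qed
  have cc: "c * star c \<in> B" by (intro B_mult B_star c)
  obtain C5 where C5: "C5 \<ge> 0" "\<And>n. cmod (nt n (c * star c)) \<le> C5" using nt_bounded[OF cc] by blast
  have prods: "(\<lambda>n. t n (a * cen n b * sum_products l * c * ?g)) \<longlonglongrightarrow> 0" if "set l \<subseteq> A \<times> A" for l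
    using that
  proof (induction l)
    case Nil
    then show ?case by (simp add: sum_products_def)
  next
    case (Cons yz l)
    then obtain y z where yz: "yz = (y, z)" "y \<in> A" "z \<in> A" by auto
    obtain C where C: "C \<ge> 0" "\<And>n. h n (pair_prod ((z, c) # qs)) \<le> C"
      using pair_prod_bounded[of "(z, c) # qs"] yz c qs by auto
    have "(\<lambda>n. t n (a * cen n b * y * (z * c * ?g))) \<longlonglongrightarrow> 0"
    proof (rule Lim_null_comparison)
      show "\<forall>\<^sub>F n in sequentially. norm (t n (a * cen n b * y * (z * c * ?g))) \<le> h n (a * cen n b * y) * C"
      proof (intro always_eventually allI)
        fix n
        have "norm (t n (a * cen n b * y * (z * c * ?g))) \<le> h n (a * cen n b * y) * h n (z * c * ?g)"
          by (rule t_mult_le)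
        also have "\<dots> \<le> h n (a * cen n b * y) * C"
          using C(2)[of n] by (intro mult_left_mono h_nonneg) (simp add: mult.assoc)
        finally show "norm (t n (a * cen n b * y * (z * c * ?g))) \<le> h n (a * cen n b * y) * C" .
      qed
      show "(\<lambda>n. h n (a * cen n b * y) * C) \<longlonglongrightarrow> 0"
        using tendsto_mult_right[OF h_cen[OF a yz(2) b], of C] by simp
    qed
    moreover have "a * cen n b * sum_products (yz # l) * c * ?g =
        a * cen n b * y * (z * c * ?g) + a * cen n b * sum_products l * c * ?g" for n
      by (simp add: sum_products_def yz algebra_simps)
    ultimately show ?case using Cons tendsto_add[where a = 0 and b = 0] by (fastforce simp: t_add)
  qed
  \<comment> \<open>The 1 pays for the sum of products, the other term for the error
    \<open>d\<close>, for which \<open>d * c\<close> has norm at most sqrt (1 + C5) e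
    eventually.\<close>
  define K where "K = 1 + C1 * sqrt (1 + C5) * Cg"
  have K: "K \<ge> 0" using C1(1) C5(1) Cg(1) by (simp add: K_def)
  have "(\<lambda>n. t n (a * cen n b * x * c * ?g)) \<longlonglongrightarrow> 0"
  proof (rule tendsto_zero_eventually_le[OF _ K])
    fix e :: real assume e: "e > 0"
    obtain l where l: "set l \<subseteq> A \<times> A" "\<forall>\<^sub>F n in sequentially. h n (x - sum_products l) \<le> e"
      using A_approx[OF x e] by blast
    define d where "d = x - sum_products l"
    have d: "d \<in> A" unfolding d_def by (intro A_diff x sum_products_mem l)
    have ev1: "\<forall>\<^sub>F n in sequentially. cmod (t n (a * cen n b * sum_products l * c * ?g)) < e"
      using tendstoD[OF prods[OF l(1)] e] by simp
    have ev2: "\<forall>\<^sub>F n in sequentially. cmod (t n (d * cen n (c * star c) * star d)) < e\<^sup>2"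
      using tendstoD[OF t_cen[OF d A_star[OF d] cc], of "e\<^sup>2"] e by simp
    show "\<forall>\<^sub>F n in sequentially. norm (t n (a * cen n b * x * c * ?g)) \<le> K * e"
      using ev1 ev2 l(2)
    proof eventually_elim
      case (elim n)
      have hd: "h n d \<le> e" using elim(3) by (simp add: d_def)
      have "(h n (d * c))\<^sup>2 \<le> cmod (t n (d * cen n (c * star c) * star d)) + cmod (nt n (c * star c)) * (h n d)\<^sup>2"
        by (rule h_mult_B[OF d c])
      also have "\<dots> \<le> e\<^sup>2 + C5 * e\<^sup>2"
        using elim(2) C5 hd h_nonneg by (intro add_mono mult_mono power_mono) auto
      also have "\<dots> = (sqrt (1 + C5) * e)\<^sup>2" using C5(1) by (simp add: power_mult_distrib algebra_simps)
      finally have hdc: "h n (d * c) \<le> sqrt (1 + C5) * e"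
        by (rule power2_le_imp_le) (use C5(1) e in auto)
      have "a * cen n b * x * c * ?g = a * cen n b * sum_products l * c * ?g + a * cen n b * (d * c * ?g)"
        by (simp add: d_def algebra_simps)
      then have "norm (t n (a * cen n b * x * c * ?g)) \<le>
          cmod (t n (a * cen n b * sum_products l * c * ?g)) + cmod (t n (a * cen n b * (d * c * ?g)))"
        by (simp add: t_add norm_triangle_ineq)
      also have "cmod (t n (a * cen n b * (d * c * ?g))) \<le> h n (a * cen n b) * h n (d * c * ?g)"
        by (rule t_mult_le)
      also have "\<dots> \<le> C1 * (sqrt (1 + C5) * e * Cg)"
      proof (intro mult_mono C1 h_nonneg)
        have "h n (d * c * ?g) \<le> h n (d * c) * Cg" by (rule Cg(2))
        also have "\<dots> \<le> sqrt (1 + C5) * e * Cg" by (intro mult_right_mono hdc Cg(1))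
        finally show "h n (d * c * ?g) \<le> sqrt (1 + C5) * e * Cg" .
      qed
      finally show ?case using elim(1) by (simp add: K_def algebra_simps)
    qed
  qed
  then show ?thesis by (simp add: ps_eq mult.assoc)
qed

lemma t_cen_product:
  assumes "y \<in> A" "z \<in> A" "b \<in> B"
  shows "(\<lambda>n. t n (y * z * cen n b)) \<longlonglongrightarrow> 0"
proof -
  have "t n (y * z * cen n b) = t n (z * cen n b * y)" for n
    using t_commute[of n y "z * cen n b"] by (simp add: mult.assoc)
  then show ?thesis using t_cen[OF assms(2,1,3)] by simp
qed

text \<open>Centering the first \<open>b\<close> replaces it by its normalized trace, after which
  \<open>a\<close> merges with the next element of \<open>A\<close>, and induction takes over. With
  a single pair there is no second element of \<open>A\<close> to enclose \<open>b\<close>; there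
  \<open>a\<close> itself must be a product, which is split cyclically.\<close>

theorem t_pair_prod:
  assumes "set ps \<subseteq> A \<times> B" "a \<in> A" "b \<in> B" "ps = [] \<Longrightarrow> \<exists>y\<in>A. \<exists>z\<in>A. a = y * z"
  shows "(\<lambda>n. t n (a * b * pair_prod ps) - t n (a * prod_list (map fst ps)) * nt n b * prod_list (map (nt n \<circ> snd) ps)) \<longlonglongrightarrow> 0"
  using assms
proof (induction ps arbitrary: a b)
  case Nil
  then obtain y z where yz: "y \<in> A" "z \<in> A" "a = y * z" by auto
  have "t n (a * b) - t n a * nt n b = t n (y * z * cen n b)" for n
    using split_cen[of a b 1 n] by (simp add: t_add t_scaleC yz(3))
  then show ?case using t_cen_product[OF yz(1,2) Nil(3)] by simp
next
  case (Cons xc ps)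
  obtain x c where xc: "xc = (x, c)" by fastforce
  have x: "x \<in> A" and c: "c \<in> B" and ps: "set ps \<subseteq> A \<times> B" using Cons.prems xc by auto
  let ?f = "\<lambda>n. t n (a * x * c * pair_prod ps) - t n (a * x * prod_list (map fst ps)) * nt n c * prod_list (map (nt n \<circ> snd) ps)"
  \<comment> \<open>The merged element \<open>a * x\<close> is a product, which is the side
    condition for the moment when the list runs out.\<close>
  have f: "?f \<longlonglongrightarrow> 0" by (rule Cons.IH) (use x c ps Cons.prems A_mult in auto)
  have "(\<lambda>n. nt n b * ?f n) \<longlonglongrightarrow> 0"
  proof -
    obtain C where "\<And>n. cmod (nt n b) \<le> C" using nt_bounded[OF Cons.prems(3)] by blast
    then have "\<forall>\<^sub>F n in sequentially. norm (nt n b * ?f n) \<le> C * norm (?f n)"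
      by (intro always_eventually allI) (simp add: norm_mult mult_right_mono)
    moreover have "(\<lambda>n. C * norm (?f n)) \<longlonglongrightarrow> 0"
      using tendsto_mult_left[OF tendsto_norm_zero[OF f], of C] by simp
    ultimately show ?thesis by (rule Lim_null_comparison)
  qed
  moreover have "(\<lambda>n. t n (a * cen n b * pair_prod (xc # ps))) \<longlonglongrightarrow> 0"
    by (rule t_cen_pair_prod) (use Cons.prems in auto)
  ultimately have "(\<lambda>n. t n (a * cen n b * pair_prod (xc # ps)) + nt n b * ?f n) \<longlonglongrightarrow> 0"
    using tendsto_add by fastforce
  moreover have "t n (a * cen n b * pair_prod (xc # ps)) + nt n b * ?f n =
      t n (a * b * pair_prod (xc # ps)) - t n (a * prod_list (map fst (xc # ps))) * nt n b * prod_list (map (nt n \<circ> snd) (xc # ps))" for n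
    by (subst split_cen[of a b _ n]) (simp add: t_add t_scaleC xc algebra_simps)
  ultimately show ?case by (simp only:)
qed

end

subsection \<open>Decay of the limit functional\<close>

text \<open>\<open>D\<close> models the ideal of polynomials all of whose words contain a letter of
  the first family. Convergence is asked of products of two elements only, which covers the squares
  behind \<open>lh\<close>.\<close>

locale convergent_on_ideal = trace_hs_sequence t h
  for t :: "nat \<Rightarrow> 'a::complex_star_algebra \<Rightarrow> complex" and h +
  fixes D :: "'a set"
  assumes D_diff: "p \<in> D \<Longrightarrow> q \<in> D \<Longrightarrow> p - q \<in> D" and D_zero: "0 \<in> D"
    and D_ideal: "p \<in> D \<Longrightarrow> q * p \<in> D" "p \<in> D \<Longrightarrow> p * q \<in> D" and D_star: "p \<in> D \<Longrightarrow> star p \<in> D"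
    and t_convergent: "p \<in> D \<Longrightarrow> q \<in> D \<Longrightarrow> convergent (\<lambda>n. t n (p * q))"
begin

definition lt :: "'a \<Rightarrow> complex" where "lt p = lim (\<lambda>n. t n p)"

definition lh :: "'a \<Rightarrow> real" where "lh p = lim (\<lambda>n. h n p)"

lemma lt: "p \<in> D \<Longrightarrow> q \<in> D \<Longrightarrow> (\<lambda>n. t n (p * q)) \<longlonglongrightarrow> lt (p * q)"
  unfolding lt_def using t_convergent by (simp add: convergent_LIMSEQ_iff)

lemma lh: assumes p: "p \<in> D" shows "(\<lambda>n. h n p) \<longlonglongrightarrow> lh p"
proof -
  have "(\<lambda>n. sqrt (Re (t n (star p * p)))) \<longlonglongrightarrow> sqrt (Re (lt (star p * p)))"
    by (intro tendsto_intros lt p D_star)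
  then have "(\<lambda>n. h n p) \<longlonglongrightarrow> sqrt (Re (lt (star p * p)))" by (simp add: t_star_mult h_nonneg)
  then show ?thesis unfolding lh_def by (simp add: limI)
qed

lemma lh_nonneg: "p \<in> D \<Longrightarrow> 0 \<le> lh p"
  by (rule LIMSEQ_le_const[OF lh]) (auto simp: h_nonneg)

lemma lt_mult_le: "p \<in> D \<Longrightarrow> q \<in> D \<Longrightarrow> cmod (lt (p * q)) \<le> lh p * lh q"
  by (rule LIMSEQ_le[OF tendsto_norm[OF lt] tendsto_mult[OF lh lh]]) (auto simp: t_mult_le)

lemma lh_mult_le: "p \<in> D \<Longrightarrow> q \<in> D \<Longrightarrow> lh (p * q) \<le> lh p * lh q"
  by (rule LIMSEQ_le[OF lh[OF D_ideal(1)] tendsto_mult[OF lh lh]]) (auto simp: h_mult_le)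

context
  fixes X :: 'a and C :: real
  assumes X: "X \<in> D" "star X = X" and C: "C > 0" "(lh X)\<^sup>2 \<le> C"
begin

text \<open>As C is at least the squared limit norm of \<open>X\<close>, the element
  \<open>damp\<close> is a contraction in the limit. The argument of \<open>nc_var_approx\<close> is
  repeated with the limit seminorm in place of a Hilbert space.\<close>

definition damp :: 'a where "damp = 1 - complex_of_real (1 / C) *\<^sub>C (X * X)"

lemma damp_commute: "damp * X = X * damp"
  by (simp add: damp_def algebra_simps mult_scaleC_left mult_scaleC_right)

lemma damp_pow_commute: "damp ^ J * X = X * damp ^ J"
proof (induction J)
  case (Suc J)
  have "damp ^ Suc J * X = damp * (damp ^ J * X)" by (simp add: mult.assoc)
  also have "\<dots> = damp * X * damp ^ J" unfolding Suc by (simp add: mult.assoc)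
  finally show ?case by (simp add: damp_commute mult.assoc)
qed simp

text \<open>The square is expanded at each \<open>n\<close> before passing to the limit. The quartic
  term is absorbed by \<open>lh_mult_le\<close>: the Hilbert-Schmidt norm of \<open>X\<close> serves
  as a bound for its operator norm.\<close>

lemma lh_damp:
  assumes V: "V \<in> D"
  shows "(lh (damp * V))\<^sup>2 \<le> (lh V)\<^sup>2 - 1 / C * (lh (X * V))\<^sup>2"
proof -
  let ?c = "complex_of_real (1 / C)"
  have "(h n (damp * V))\<^sup>2 = (h n V)\<^sup>2 - 2 / C * (h n (X * V))\<^sup>2 + 1 / C * (1 / C) * (h n (X * (X * V)))\<^sup>2" for n
  proof -
    have star_damp: "star damp = damp"
    proof -
      have star1: "star (1 :: 'a) = 1" using star_mult[of "star 1" "1 :: 'a"] by (simp add: star_star)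
      have "star (p - q) = star p - star q" for p q :: 'a using star_add[of "p - q" q] by simp
      then show ?thesis by (simp add: damp_def star1 star_scaleC star_mult X)
    qed
    have "star (damp * V) * (damp * V) = star V * (damp * (damp * V))"
      by (simp add: star_mult star_damp mult.assoc)
    also have "damp * (damp * V) = V - ?c *\<^sub>C (X * (X * V)) - ?c *\<^sub>C (X * (X * V)) + (?c * ?c) *\<^sub>C (X * (X * (X * (X * V))))"
    proof -
      have sd: "c *\<^sub>C (p - q) = c *\<^sub>C p - c *\<^sub>C q" for c and p q :: 'a
        using scaleC_add_right[of c "p - q" q] by simp
      have dv: "damp * W = W - ?c *\<^sub>C (X * (X * W))" for W
        by (simp add: damp_def left_diff_distrib mult_scaleC_left mult.assoc)
      show ?thesis unfolding dv
        by (simp add: right_diff_distrib mult_scaleC_right sd scaleC_scaleC)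
    qed
    also have "star V * \<dots> = star V * V - ?c *\<^sub>C (star (X * V) * (X * V)) - ?c *\<^sub>C (star (X * V) * (X * V))
        + (?c * ?c) *\<^sub>C (star (X * (X * V)) * (X * (X * V)))"
      by (simp add: right_diff_distrib distrib_left mult_scaleC_right star_mult X mult.assoc)
    finally have "complex_of_real ((h n (damp * V))\<^sup>2) = complex_of_real ((h n V)\<^sup>2)
        - ?c * complex_of_real ((h n (X * V))\<^sup>2) - ?c * complex_of_real ((h n (X * V))\<^sup>2)
        + ?c * ?c * complex_of_real ((h n (X * (X * V)))\<^sup>2)"
      unfolding t_star_mult[symmetric] by (simp add: t_diff t_add t_scaleC)
    then have "complex_of_real ((h n (damp * V))\<^sup>2) = complex_of_real ((h n V)\<^sup>2 - 2 / C * (h n (X * V))\<^sup>2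
        + 1 / C * (1 / C) * (h n (X * (X * V)))\<^sup>2)"
      by simp
    then show ?thesis by (simp only: of_real_eq_iff)
  qed
  then have "(\<lambda>n. (h n (damp * V))\<^sup>2) \<longlonglongrightarrow> (lh V)\<^sup>2 - 2 / C * (lh (X * V))\<^sup>2 + 1 / C * (1 / C) * (lh (X * (X * V)))\<^sup>2"
    by (simp only:) (intro tendsto_intros lh V D_ideal)
  moreover have "(\<lambda>n. (h n (damp * V))\<^sup>2) \<longlonglongrightarrow> (lh (damp * V))\<^sup>2"
    by (intro tendsto_intros lh D_ideal V)
  ultimately have "(lh (damp * V))\<^sup>2 = (lh V)\<^sup>2 - 2 / C * (lh (X * V))\<^sup>2 + 1 / C * (1 / C) * (lh (X * (X * V)))\<^sup>2"
    by (rule LIMSEQ_unique[rotated])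
  also have "1 / C * (1 / C) * (lh (X * (X * V)))\<^sup>2 \<le> 1 / C * (1 / C) * (C * (lh (X * V))\<^sup>2)"
  proof (intro mult_left_mono)
    have XV: "X * V \<in> D" by (intro D_ideal V)
    have "(lh (X * (X * V)))\<^sup>2 \<le> (lh X * lh (X * V))\<^sup>2"
      by (intro power_mono lh_mult_le X XV lh_nonneg D_ideal)
    also have "\<dots> \<le> C * (lh (X * V))\<^sup>2" unfolding power_mult_distrib by (intro mult_right_mono C) auto
    finally show "(lh (X * (X * V)))\<^sup>2 \<le> C * (lh (X * V))\<^sup>2" .
  qed (use C in auto)
  finally show ?thesis using C(1) by (simp add: field_simps)
qed

lemma lh_damp_pow_le: "V \<in> D \<Longrightarrow> lh (damp ^ J * V) \<le> lh V"
proof (induction J)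
  case (Suc J)
  have DV: "damp ^ J * V \<in> D" by (intro D_ideal Suc)
  have "(lh (damp * (damp ^ J * V)))\<^sup>2 \<le> (lh (damp ^ J * V))\<^sup>2 - 1 / C * (lh (X * (damp ^ J * V)))\<^sup>2"
    by (rule lh_damp[OF DV])
  also have "\<dots> \<le> (lh (damp ^ J * V))\<^sup>2" using C by simp
  finally have "lh (damp * (damp ^ J * V)) \<le> lh (damp ^ J * V)"
    by (rule power2_le_imp_le) (rule lh_nonneg[OF DV])
  then show ?case using Suc by (simp add: mult.assoc)
qed simp

text \<open>The squared seminorms of \<open>damp ^ J * V\<close> decrease to a limit, and C times
  their decrements dominate the squares in question.\<close>

lemma lh_damp_pow_tendsto:
  assumes V: "V \<in> D"
  shows "(\<lambda>J. lh (X * damp ^ J * V)) \<longlonglongrightarrow> 0"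
proof -
  define f where "f J = (lh (damp ^ J * V))\<^sup>2" for J
  have DV: "damp ^ J * V \<in> D" for J by (intro D_ideal V)
  have fq: "f (Suc J) \<le> f J - 1 / C * (lh (X * damp ^ J * V))\<^sup>2" for J
    unfolding f_def using lh_damp[OF DV[of J]] by (simp add: mult.assoc)
  have "f (Suc J) \<le> f J" for J
    using fq[of J] C by (smt (verit) divide_nonneg_nonneg mult_nonneg_nonneg zero_le_power2)
  then have "decseq f" by (rule decseq_SucI)
  moreover have "\<And>J. 0 \<le> f J" by (simp add: f_def)
  ultimately obtain l where l: "f \<longlonglongrightarrow> l" using decseq_convergent by blast
  then have "(\<lambda>J. f (Suc J)) \<longlonglongrightarrow> l" by (rule LIMSEQ_Suc)
  then have "(\<lambda>J. C * (f J - f (Suc J))) \<longlonglongrightarrow> C * (l - l)" using l by (intro tendsto_intros)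
  then have lim: "(\<lambda>J. C * (f J - f (Suc J))) \<longlonglongrightarrow> 0" by simp
  have "(\<lambda>J. (lh (X * damp ^ J * V))\<^sup>2) \<longlonglongrightarrow> 0"
  proof (rule tendsto_sandwich[OF _ _ tendsto_const lim])
    have "(lh (X * damp ^ J * V))\<^sup>2 \<le> C * (f J - f (Suc J))" for J
      using fq[of J] C by (simp add: field_simps)
    then show "\<forall>\<^sub>F J in sequentially. (lh (X * damp ^ J * V))\<^sup>2 \<le> C * (f J - f (Suc J))" by simp
  qed auto
  then show ?thesis by (simp add: tendsto_null_power)
qed

text \<open>\<open>X * damp ^ J\<close> is known to vanish only after multiplication by an element
  of \<open>D\<close>. Replacing the right-hand \<open>X\<close> by a sum of products y z supplies
  such an element y. Here the escape of mass into small eigenvalues is excluded.\<close>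

lemma lt_damp_tendsto:
  assumes approx: "\<And>e. e > 0 \<Longrightarrow> \<exists>l. set l \<subseteq> D \<times> D \<and> lh (X - sum_products l) \<le> e"
  shows "(\<lambda>J. lt (X * damp ^ J * X)) \<longlonglongrightarrow> 0"
proof (rule tendsto_zero_eventually_le[where K = "1 + lh X"])
  fix e :: real assume e: "e > 0"
  obtain l where l: "set l \<subseteq> D \<times> D" "lh (X - sum_products l) \<le> e" using approx[OF e] by blast
  have lt_sum: "lt (p * q + r * s) = lt (p * q) + lt (r * s)" if "p \<in> D" "q \<in> D" "r \<in> D" "s \<in> D" for p q r s
    unfolding lt_def[of "p * q + r * s"] t_add by (intro limI tendsto_add lt that)
  have sp: "set l \<subseteq> D \<times> D \<Longrightarrow> sum_products l \<in> D" for l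
  proof (induction l)
    case (Cons yz l)
    then obtain y z where yz: "yz = (y, z)" "y \<in> D" "z \<in> D" by auto
    have "y * z - (0 - sum_products l) \<in> D" using Cons yz by (intro D_diff D_ideal D_zero) auto
    then show ?case using yz by (simp add: sum_products_def)
  qed (simp add: sum_products_def D_zero)
  have XJ: "X * damp ^ J \<in> D" for J by (intro D_ideal X)
  have "(\<lambda>J. lt (X * damp ^ J * sum_products l)) \<longlonglongrightarrow> 0" using l(1)
  proof (induction l)
    case Nil
    then show ?case by (simp add: sum_products_def lt_def)
  next
    case (Cons yz l)
    then obtain y z where yz: "yz = (y, z)" "y \<in> D" "z \<in> D" "set l \<subseteq> D \<times> D" by auto
    have XJy: "X * damp ^ J * y \<in> D" for J by (intro D_ideal yz)
    have "(\<lambda>J. lt (X * damp ^ J * y * z)) \<longlonglongrightarrow> 0"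
    proof (rule Lim_null_comparison)
      show "\<forall>\<^sub>F J in sequentially. norm (lt (X * damp ^ J * y * z)) \<le> lh (X * damp ^ J * y) * lh z"
        using lt_mult_le[OF XJy yz(3)] by simp
      show "(\<lambda>J. lh (X * damp ^ J * y) * lh z) \<longlonglongrightarrow> 0"
        using tendsto_mult_right[OF lh_damp_pow_tendsto[OF yz(2)], of "lh z"] by simp
    qed
    moreover have "lt (X * damp ^ J * sum_products (yz # l)) =
        lt (X * damp ^ J * y * z) + lt (X * damp ^ J * sum_products l)" for J
      using lt_sum[OF XJy yz(3) XJ sp[OF yz(4)], of J J] by (simp add: sum_products_def yz(1) distrib_left mult.assoc)
    ultimately show ?case using Cons tendsto_add[where a = 0 and b = 0] by fastforce
  qed
  then have "\<forall>\<^sub>F J in sequentially. cmod (lt (X * damp ^ J * sum_products l)) < e"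
    using tendstoD[OF _ e] by fastforce
  then show "\<forall>\<^sub>F J in sequentially. norm (lt (X * damp ^ J * X)) \<le> (1 + lh X) * e"
  proof eventually_elim
    case (elim J)
    define d where "d = X - sum_products l"
    have d: "d \<in> D" unfolding d_def by (intro D_diff X sp l)
    have "lt (X * damp ^ J * X) = lt (X * damp ^ J * sum_products l) + lt (X * damp ^ J * d)"
      using lt_sum[OF XJ sp[OF l(1)] XJ d, of J J] by (simp add: d_def right_diff_distrib)
    \<comment> \<open>The approximation error must be uniform in \<open>J\<close>; it is, since
      damping keeps the left factor below \<open>lh X\<close>.\<close>
    moreover have "cmod (lt (X * damp ^ J * d)) \<le> lh X * e"
    proof -
      have "cmod (lt (X * damp ^ J * d)) \<le> lh (X * damp ^ J) * lh d" by (rule lt_mult_le[OF XJ d])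
      also have "\<dots> \<le> lh X * e"
        using lh_damp_pow_le[OF X(1), of J] l(2) lh_nonneg[OF d] lh_nonneg[OF X(1)]
        by (intro mult_mono) (auto simp: damp_pow_commute d_def)
      finally show ?thesis .
    qed
    ultimately show ?case
      using elim norm_triangle_ineq[of "lt (X * damp ^ J * sum_products l)" "lt (X * damp ^ J * d)"]
      by (simp add: algebra_simps)
  qed
qed (use lh_nonneg[OF X(1)] in simp)

end

end

section \<open>Eigenvalue sequences determined by power sums\<close>

text \<open>Both eigenvalue lists in one sequence, the nonnegative ones at even and the nonpositive
  ones at odd positions. Power sums and diagonal operators then need a single index, and the
  conditions survive pointwise limits.\<close>

definition sorted_spectrum :: "(nat \<Rightarrow> real) \<Rightarrow> bool" where
  "sorted_spectrum z \<longleftrightarrow> decseq (\<lambda>i. z (2 * i)) \<and> (\<forall>i. 0 \<le> z (2 * i)) \<and>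
     incseq (\<lambda>i. z (2 * i + 1)) \<and> (\<forall>i. z (2 * i + 1) \<le> 0)"

text \<open>Counting: if t = l' i exceeded l i, then by monotonicity \<open>l\<close> would take the
  value t only before \<open>i\<close>, where both sequences agree, while \<open>l'\<close> takes it
  once more at \<open>i\<close>.\<close>

lemma enumerates_nonneg_unique_le:
  assumes l: "enumerates_nonneg_eigenvalues m l" and l': "enumerates_nonneg_eigenvalues m l'"
    and eq: "\<And>j. j < i \<Longrightarrow> l j = l' j"
  shows "l' i \<le> l i"
proof (rule ccontr)
  assume less: "\<not> l' i \<le> l i"
  define t where "t = l' i"
  have t: "t > 0" "l i < t" using less l le_less_trans[of 0 "l i" "l' i"]
    by (auto simp: t_def enumerates_nonneg_eigenvalues_def)
  have "{j. l j = t} \<subseteq> {j. j < i \<and> l' j = t}"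
  proof safe
    fix j assume j: "t = l j"
    show ji: "j < i"
    proof (rule ccontr)
      assume "\<not> j < i"
      then have "l j \<le> l i" using l by (auto simp: enumerates_nonneg_eigenvalues_def decseq_def)
      then show False using t j by simp
    qed
    show "l' j = l j" using eq[OF ji] by simp
  qed
  moreover have fin: "finite {j. l' j = t}" "card {j. l' j = t} = card {j. l j = t}"
    using l l' t by (auto simp: enumerates_nonneg_eigenvalues_def)
  have "{j. j < i \<and> l' j = t} \<subset> {j. l' j = t}" by (auto simp: t_def)
  then have "card {j. j < i \<and> l' j = t} < card {j. l' j = t}" by (rule psubset_card_mono[OF fin(1)])
  ultimately show False using card_mono[of "{j. j < i \<and> l' j = t}" "{j. l j = t}"] fin(2) by simp
qed

lemma enumerates_nonneg_unique:
  assumes l: "enumerates_nonneg_eigenvalues m l" and l': "enumerates_nonneg_eigenvalues m l'"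
  shows "l = l'"
proof
  fix i show "l i = l' i"
  proof (induction i rule: less_induct)
    case (less i)
    show ?case
      using enumerates_nonneg_unique_le[OF l l', of i] enumerates_nonneg_unique_le[OF l' l, of i] less by force
  qed
qed

lemma enumerates_nonpos_uminus:
  "enumerates_nonpos_eigenvalues m l \<longleftrightarrow> enumerates_nonneg_eigenvalues (\<lambda>t. m (- t)) (\<lambda>i. - l i)"
proof -
  have "(\<forall>t<0. finite {i. l i = t} \<and> card {i. l i = t} = m t) \<longleftrightarrow>
      (\<forall>t>0. finite {i. - l i = t} \<and> card {i. - l i = t} = m (- t))"
  proof -
    have e: "{i. - l i = t} = {i. l i = - t}" for t by auto
    show ?thesis unfolding e by (metis neg_0_less_iff_less neg_less_0_iff_less minus_minus)
  qed
  then show ?thesis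
    by (simp add: enumerates_nonpos_eigenvalues_def enumerates_nonneg_eigenvalues_def incseq_def decseq_def)
qed

lemma enumerates_nonpos_unique:
  "enumerates_nonpos_eigenvalues m l \<Longrightarrow> enumerates_nonpos_eigenvalues m l' \<Longrightarrow> l = l'"
  unfolding enumerates_nonpos_uminus using enumerates_nonneg_unique by (fastforce dest: fun_cong)

lemma sorted_spectrum_enumerates:
  assumes z: "sorted_spectrum z" and m: "\<And>t. t \<noteq> 0 \<Longrightarrow> finite {k. z k = t} \<and> card {k. z k = t} = m t"
  shows "enumerates_nonneg_eigenvalues m (\<lambda>i. z (2 * i))"
    and "enumerates_nonpos_eigenvalues m (\<lambda>i. z (2 * i + 1))"
proof -
  have "finite {i. z (2 * i) = t} \<and> card {i. z (2 * i) = t} = m t" if t: "t > 0" for t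
  proof -
    have "{k. z k = t} = (\<lambda>i. 2 * i) ` {i. z (2 * i) = t}"
    proof safe
      fix k assume "t = z k"
      moreover have "even k"
      proof (rule ccontr)
        assume "odd k"
        then obtain i where "k = 2 * i + 1" by (rule oddE)
        then show False using z t \<open>t = z k\<close> by (auto simp: sorted_spectrum_def dest!: spec[of _ i])
      qed
      ultimately show "k \<in> (\<lambda>i. 2 * i) ` {i. z (2 * i) = z k}" by (auto elim!: evenE)
    qed
    moreover have "inj_on (\<lambda>i::nat. 2 * i) A" for A by (rule inj_onI) simp
    ultimately show ?thesis using m[of t] t by (simp add: card_image finite_image_iff)
  qed
  then show "enumerates_nonneg_eigenvalues m (\<lambda>i. z (2 * i))"
    using z by (simp add: enumerates_nonneg_eigenvalues_def sorted_spectrum_def)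
  have "finite {i. z (2 * i + 1) = t} \<and> card {i. z (2 * i + 1) = t} = m t" if t: "t < 0" for t
  proof -
    have "{k. z k = t} = (\<lambda>i. 2 * i + 1) ` {i. z (2 * i + 1) = t}"
    proof safe
      fix k assume "t = z k"
      moreover have "odd k"
      proof (rule ccontr)
        assume "\<not> odd k"
        then obtain i where "k = 2 * i" by (auto elim: evenE)
        then show False using z t \<open>t = z k\<close> by (auto simp: sorted_spectrum_def not_less[symmetric])
      qed
      ultimately show "k \<in> (\<lambda>i. 2 * i + 1) ` {i. z (2 * i + 1) = z k}" by (auto elim!: oddE)
    qed
    moreover have "inj_on (\<lambda>i::nat. 2 * i + 1) A" for A by (rule inj_onI) simp
    ultimately show ?thesis using m[of t] t by (simp add: card_image finite_image_iff)
  qed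
  then show "enumerates_nonpos_eigenvalues m (\<lambda>i. z (2 * i + 1))"
    using z by (simp add: enumerates_nonpos_eigenvalues_def sorted_spectrum_def)
qed

lemma sorted_spectrum_eigenvalues:
  assumes z: "sorted_spectrum z" and m: "\<And>t. t \<noteq> 0 \<Longrightarrow> finite {k. z k = t} \<and> card {k. z k = t} = m t"
  shows "nonneg_eigenvalues m i = z (2 * i)" "nonpos_eigenvalues m i = z (2 * i + 1)"
proof -
  have e: "enumerates_nonneg_eigenvalues m (\<lambda>i. z (2 * i))" "enumerates_nonpos_eigenvalues m (\<lambda>i. z (2 * i + 1))"
    by (rule sorted_spectrum_enumerates[OF z], use m in blast)+
  have "nonneg_eigenvalues m = (\<lambda>i. z (2 * i))"
    unfolding nonneg_eigenvalues_def by (rule the_equality, rule e(1)) (rule enumerates_nonneg_unique[OF _ e(1)])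
  then show "nonneg_eigenvalues m i = z (2 * i)" by simp
  have "nonpos_eigenvalues m = (\<lambda>i. z (2 * i + 1))"
    unfolding nonpos_eigenvalues_def by (rule the_equality, rule e(2)) (rule enumerates_nonpos_unique[OF _ e(2)])
  then show "nonpos_eigenvalues m i = z (2 * i + 1)" by simp
qed

text \<open>There are k div 2 + 1 positions of the parity of \<open>k\<close> up to
  \<open>k\<close>, each with a square at least as large. The factor 2 pays for disregarding the
  other parity.\<close>

lemma sorted_spectrum_sq_le:
  assumes z: "sorted_spectrum z" and s: "summable (\<lambda>k. (z k)\<^sup>2)" "(suminf (\<lambda>k. (z k)\<^sup>2)) \<le> K"
  shows "(z k)\<^sup>2 \<le> 2 * K / (k + 1)"
proof -
  define i where "i = k div 2"
  define f where "f j = 2 * j + k mod 2" for j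
  have k: "k = f i" by (simp add: f_def i_def)
  have inj: "inj_on f {..i}" by (rule inj_onI) (simp add: f_def)
  have mono: "(z k)\<^sup>2 \<le> (z (f j))\<^sup>2" if "j \<le> i" for j
  proof (cases "even k")
    case True
    then have "k = 2 * i" "f j = 2 * j" by (auto simp: i_def f_def)
    then show ?thesis using z that
      by (auto simp: sorted_spectrum_def decseq_def intro!: power_mono)
  next
    case False
    then have "k = 2 * i + 1" "f j = 2 * j + 1" by (auto simp: i_def f_def odd_iff_mod_2_eq_one)
    moreover have "z (2 * j + 1) \<le> z (2 * i + 1)" "z (2 * i + 1) \<le> 0"
      using z that by (auto simp: sorted_spectrum_def incseq_def)
    ultimately show ?thesis
      using power_mono[of "- z (2 * i + 1)" "- z (2 * j + 1)" 2] by simp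
  qed
  have "(i + 1) * (z k)\<^sup>2 = (\<Sum>j\<le>i. (z k)\<^sup>2)" by simp
  also have "\<dots> \<le> (\<Sum>j\<le>i. (z (f j))\<^sup>2)" by (intro sum_mono mono) auto
  also have "\<dots> = (\<Sum>k\<in>f ` {..i}. (z k)\<^sup>2)" by (simp add: sum.reindex[OF inj])
  also have "\<dots> \<le> (suminf (\<lambda>k. (z k)\<^sup>2))" by (intro sum_le_suminf s(1)) auto
  finally have "(i + 1) * (z k)\<^sup>2 \<le> K" using s(2) by simp
  moreover have "real (k + 1) \<le> 2 * (i + 1)" by (simp add: i_def)
  then have "real (k + 1) * (z k)\<^sup>2 \<le> 2 * (i + 1) * (z k)\<^sup>2" by (intro mult_right_mono) auto
  ultimately have "real (k + 1) * (z k)\<^sup>2 \<le> 2 * K" by (simp add: algebra_simps)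
  then show ?thesis by (simp add: field_simps)
qed

lemma sorted_spectrum_abs_le:
  assumes z: "sorted_spectrum z" and s: "summable (\<lambda>k. (z k)\<^sup>2)" "(suminf (\<lambda>k. (z k)\<^sup>2)) \<le> K"
  shows "\<bar>z k\<bar> \<le> sqrt (2 * K) * (real k + 1) powr (-1/2)"
proof -
  have K: "0 \<le> K" using s by (meson order_trans suminf_nonneg zero_le_power2)
  have "\<bar>z k\<bar> = sqrt ((z k)\<^sup>2)" by simp
  also have "\<dots> \<le> sqrt (2 * K / (k + 1))" by (intro real_sqrt_le_mono sorted_spectrum_sq_le[OF z s])
  also have "\<dots> = sqrt (2 * K) * (real k + 1) powr (-1/2)"
  proof -
    have "x powr (-1/2) = 1 / sqrt x" if "x > 0" for x :: real
      using powr_minus_divide[of x "1/2"] powr_half_sqrt[of x] that by simp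
    from this[of "real k + 1"] show ?thesis by (simp add: real_sqrt_divide add.commute)
  qed
  finally show ?thesis .
qed

lemma summable_powr_three_halves: "summable (\<lambda>k. (real k + 1) powr (-3/2))"
proof -
  have "summable (\<lambda>k. real k powr (-3/2))" by (simp add: summable_real_powr_iff)
  from summable_Suc_iff[THEN iffD2, OF this] show ?thesis by (simp add: add.commute)
qed

text \<open>For m >= 3 this majorant is summable in \<open>k\<close> and depends on the sequence
  only through \<open>K\<close>. Hence these power sums pass to limits, whereas the sum of squares
  may lose mass.\<close>

lemma sorted_spectrum_power_le:
  assumes z: "sorted_spectrum z" and s: "summable (\<lambda>k. (z k)\<^sup>2)" "(suminf (\<lambda>k. (z k)\<^sup>2)) \<le> K" and m: "m \<ge> 3"
  shows "\<bar>z k\<bar> ^ m \<le> sqrt (2 * K) ^ m * (real k + 1) powr (-3/2)"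
proof -
  have K: "0 \<le> K" using s by (meson order_trans suminf_nonneg zero_le_power2)
  have "\<bar>z k\<bar> ^ m \<le> (sqrt (2 * K) * (real k + 1) powr (-1/2)) ^ m"
    by (intro power_mono sorted_spectrum_abs_le[OF z s]) auto
  also have "\<dots> = sqrt (2 * K) ^ m * (real k + 1) powr (- (real m / 2))"
    by (simp add: power_mult_distrib powr_power)
  also have "\<dots> \<le> sqrt (2 * K) ^ m * (real k + 1) powr (-3/2)"
    using m K by (intro mult_left_mono powr_mono) auto
  finally show ?thesis .
qed

lemma summable_sq_bounded:
  fixes l :: "nat \<Rightarrow> real"
  assumes "summable (\<lambda>k. (l k)\<^sup>2)"
  obtains R where "R > 0" "\<And>k. \<bar>l k\<bar> \<le> R"
proof -
  have "(\<lambda>k. (l k)\<^sup>2) \<longlonglongrightarrow> 0" by (rule summable_LIMSEQ_zero[OF assms])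
  then have "(\<lambda>k. sqrt ((l k)\<^sup>2)) \<longlonglongrightarrow> sqrt 0" by (rule tendsto_real_sqrt)
  then have "(\<lambda>k. \<bar>l k\<bar>) \<longlonglongrightarrow> 0" by simp
  then have "Bseq (\<lambda>k. \<bar>l k\<bar>)" using convergent_imp_Bseq convergentI by blast
  then show thesis using that by (auto simp: Bseq_def)
qed

lemma sq_mult_power: "m \<ge> 2 \<Longrightarrow> x\<^sup>2 * x ^ (m - 2) = x ^ m" for x :: real
  by (metis le_add_diff_inverse power_add)

lemma summable_sq_times:
  fixes l :: "nat \<Rightarrow> real"
  assumes s: "summable (\<lambda>k. (l k)\<^sup>2)" and g: "continuous_on UNIV g"
  shows "summable (\<lambda>k. (l k)\<^sup>2 * g (l k))"
proof -
  obtain R where R: "R > 0" "\<And>k. \<bar>l k\<bar> \<le> R" using summable_sq_bounded[OF s] by blast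
  have "bounded (g ` {-R..R})"
    by (intro compact_imp_bounded compact_continuous_image continuous_on_subset[OF g]) auto
  then obtain G where "\<forall>y\<in>g ` {-R..R}. norm y \<le> G" unfolding bounded_iff by blast
  then have G: "\<And>s. s \<in> {-R..R} \<Longrightarrow> \<bar>g s\<bar> \<le> G" by auto
  show ?thesis
  proof (rule summable_comparison_test')
    show "summable (\<lambda>k. (l k)\<^sup>2 * G)" using s by (rule summable_mult2)
    fix k
    have "\<bar>g (l k)\<bar> \<le> G" using R(2)[of k] by (intro G) auto
    then show "norm ((l k)\<^sup>2 * g (l k)) \<le> (l k)\<^sup>2 * G" by (simp add: abs_mult mult_left_mono)
  qed
qed

lemma finite_level:
  fixes l :: "nat \<Rightarrow> real"
  assumes s: "summable (\<lambda>k. (l k)\<^sup>2)" and t: "t \<noteq> 0"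
  shows "finite {k. l k = t}"
proof -
  have "\<forall>\<^sub>F k in sequentially. (l k)\<^sup>2 < t\<^sup>2"
    by (rule order_tendstoD(2)[OF summable_LIMSEQ_zero[OF s]]) (use t in simp)
  then obtain N where N: "\<And>k. k \<ge> N \<Longrightarrow> (l k)\<^sup>2 < t\<^sup>2" by (auto simp: eventually_sequentially)
  have "{k. l k = t} \<subseteq> {..<N}" using N by (force simp: not_le[symmetric])
  then show ?thesis by (rule finite_subset) simp
qed

text \<open>The peak \<open>(1 - (s - t)\<^sup>2 / d\<^sup>2)\<^sup>J\<close> concentrates at \<open>s = t\<close> as \<open>J\<close> grows, so the power sums
  determine the multiplicity of \<open>t\<close>.\<close>

lemma peak_sum_tendsto:
  fixes l :: "nat \<Rightarrow> real"
  assumes s: "summable (\<lambda>k. (l k)\<^sup>2)" and t: "t \<noteq> 0" and d: "\<And>k. \<bar>l k - t\<bar> \<le> d" "d > 0"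
  shows "(\<lambda>J. suminf (\<lambda>k. l k ^ 4 * (1 - (l k - t)\<^sup>2 / d\<^sup>2) ^ J)) \<longlonglongrightarrow> t ^ 4 * card {k. l k = t}"
proof -
  let ?g = "\<lambda>k. 1 - (l k - t)\<^sup>2 / d\<^sup>2"
  have g: "0 \<le> ?g k" "?g k \<le> 1" "l k \<noteq> t \<Longrightarrow> ?g k < 1" for k
  proof -
    have "(l k - t)\<^sup>2 \<le> d\<^sup>2" using d(1)[of k] by (metis abs_ge_zero power2_abs power_mono)
    then show "0 \<le> ?g k" using d(2) by simp
    show "?g k \<le> 1" by simp
    show "l k \<noteq> t \<Longrightarrow> ?g k < 1" using d(2) by simp
  qed
  have s4: "summable (\<lambda>k. l k ^ 4)"
    using summable_sq_times[OF s, of "\<lambda>x. x\<^sup>2"] by (simp add: continuous_intros flip: power_add)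
  have "(\<lambda>J. suminf (\<lambda>k. l k ^ 4 * ?g k ^ J)) \<longlonglongrightarrow> (suminf (\<lambda>k. if l k = t then t ^ 4 else 0))"
  proof (rule tannerys_theorem[THEN conjunct2, THEN conjunct2])
    show "(\<lambda>J. l k ^ 4 * ?g k ^ J) \<longlonglongrightarrow> (if l k = t then t ^ 4 else 0)" for k
    proof (cases "l k = t")
      case False
      then have "(\<lambda>J. ?g k ^ J) \<longlonglongrightarrow> 0" using g[of k] by (intro LIMSEQ_power_zero) auto
      from tendsto_mult_left[OF this, of "l k ^ 4"] False show ?thesis by simp
    qed simp
    show "\<forall>\<^sub>F (k, J) in sequentially \<times>\<^sub>F sequentially. norm (l k ^ 4 * ?g k ^ J) \<le> l k ^ 4"
    proof (intro always_eventually allI)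
      fix kJ :: "nat \<times> nat"
      obtain k J where kJ: "kJ = (k, J)" by fastforce
      have "norm (l k ^ 4 * ?g k ^ J) = l k ^ 4 * ?g k ^ J"
        using g(1)[of k] by (simp add: abs_mult)
      also have "\<dots> \<le> l k ^ 4 * 1" using g[of k] by (intro mult_left_mono power_le_one) auto
      finally show "case kJ of (k, J) \<Rightarrow> norm (l k ^ 4 * ?g k ^ J) \<le> l k ^ 4" by (simp add: kJ)
    qed
  qed (use s4 in auto)
  also have "(suminf (\<lambda>k. if l k = t then t ^ 4 else 0)) = (\<Sum>k\<in>{k. l k = t}. t ^ 4)"
    by (subst suminf_finite[OF finite_level[OF s t]]) auto
  finally show ?thesis by (simp add: mult.commute)
qed

text \<open>Multiplying out one quadratic factor never lowers the exponent, so only power sums with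
  m >= 3 occur. This is why the peak carries the weight l^4, whose even exponent also keeps the
  terms nonnegative.\<close>

lemma peak_sum_eq:
  fixes l l' :: "nat \<Rightarrow> real"
  assumes s: "summable (\<lambda>k. (l k)\<^sup>2)" "summable (\<lambda>k. (l' k)\<^sup>2)"
    and eq: "\<And>m. m \<ge> 3 \<Longrightarrow> (suminf (\<lambda>k. l k ^ m)) = (suminf (\<lambda>k. l' k ^ m))" and m: "m \<ge> 3"
  shows "(suminf (\<lambda>k. l k ^ m * (a + b * l k + c * (l k)\<^sup>2) ^ J)) = (suminf (\<lambda>k. l' k ^ m * (a + b * l' k + c * (l' k)\<^sup>2) ^ J))"
  using m
proof (induction J arbitrary: m)
  case 0
  then show ?case using eq by simp
next
  case (Suc J)
  define F where "F l m k = l k ^ m * (a + b * l k + c * (l k)\<^sup>2) ^ J" for l :: "nat \<Rightarrow> real" and m k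
  have sF: "summable (F l m)" if "summable (\<lambda>k. (l k)\<^sup>2)" "m \<ge> 3" for l m
  proof -
    have "F l m = (\<lambda>k. (l k)\<^sup>2 * (l k ^ (m - 2) * (a + b * l k + c * (l k)\<^sup>2) ^ J))"
      using that(2) by (auto simp: F_def mult.assoc[symmetric] sq_mult_power)
    then show ?thesis using summable_sq_times[OF that(1), of "\<lambda>x. x ^ (m - 2) * (a + b * x + c * x\<^sup>2) ^ J"]
      by (simp add: continuous_intros)
  qed
  have step: "(suminf (\<lambda>k. l k ^ m * (a + b * l k + c * (l k)\<^sup>2) ^ Suc J)) =
      a * suminf (F l m) + b * suminf (F l (Suc m)) + c * suminf (F l (Suc (Suc m)))"
    if l: "summable (\<lambda>k. (l k)\<^sup>2)" for l
  proof -
    note sm = sF[OF l, of m] sF[OF l, of "Suc m"] sF[OF l, of "Suc (Suc m)"]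
    have "l k ^ m * (a + b * l k + c * (l k)\<^sup>2) ^ Suc J = a * F l m k + b * F l (Suc m) k + c * F l (Suc (Suc m)) k" for k
      by (simp add: F_def algebra_simps power2_eq_square)
    then have "(suminf (\<lambda>k. l k ^ m * (a + b * l k + c * (l k)\<^sup>2) ^ Suc J)) =
        (suminf (\<lambda>k. a * F l m k + b * F l (Suc m) k + c * F l (Suc (Suc m)) k))" by simp
    also have "\<dots> = a * suminf (F l m) + b * suminf (F l (Suc m)) + c * suminf (F l (Suc (Suc m)))"
      using sm Suc.prems
      by (subst suminf_add[symmetric] suminf_mult[symmetric] | intro summable_add summable_mult | simp)+
    finally show ?thesis .
  qed
  have "suminf (F l m') = suminf (F l' m')" if "m' \<ge> 3" for m'
    using Suc.IH[OF that] by (simp add: F_def[abs_def])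
  then show ?case unfolding step[OF s(1)] step[OF s(2)] using Suc.prems by simp
qed

lemma sorted_spectrum_unique:
  assumes z: "sorted_spectrum l" "sorted_spectrum l'"
    and s: "summable (\<lambda>k. (l k)\<^sup>2)" "summable (\<lambda>k. (l' k)\<^sup>2)"
    and eq: "\<And>m. m \<ge> 3 \<Longrightarrow> (suminf (\<lambda>k. l k ^ m)) = (suminf (\<lambda>k. l' k ^ m))"
  shows "l = l'"
proof -
  obtain R where R: "R > 0" "\<And>k. \<bar>l k\<bar> \<le> R" using summable_sq_bounded[OF s(1)] by blast
  obtain R' where R': "R' > 0" "\<And>k. \<bar>l' k\<bar> \<le> R'" using summable_sq_bounded[OF s(2)] by blast
  have card: "card {k. l k = t} = card {k. l' k = t}" if t: "t \<noteq> 0" for t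
  proof -
    \<comment> \<open>Large enough to bound the distance of every term of both sequences from
      \<open>t\<close>, so that the peak stays between 0 and 1 on them.\<close>
    define d where "d = R + R' + \<bar>t\<bar>"
    have d: "d > 0" "\<bar>l k - t\<bar> \<le> d" "\<bar>l' k - t\<bar> \<le> d" for k
      unfolding d_def using R(1) R'(1) R(2)[of k] R'(2)[of k] by linarith+
    have q: "1 - (x - t)\<^sup>2 / d\<^sup>2 = (1 - t\<^sup>2 / d\<^sup>2) + 2 * t / d\<^sup>2 * x + (- 1 / d\<^sup>2) * x\<^sup>2" for x
      by (simp add: power2_diff diff_divide_distrib add_divide_distrib algebra_simps)
    have eqJ: "(suminf (\<lambda>k. l k ^ 4 * (1 - (l k - t)\<^sup>2 / d\<^sup>2) ^ J)) = (suminf (\<lambda>k. l' k ^ 4 * (1 - (l' k - t)\<^sup>2 / d\<^sup>2) ^ J))" for J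
      unfolding q by (rule peak_sum_eq[OF s eq]) auto
    have "t ^ 4 * card {k. l k = t} = t ^ 4 * card {k. l' k = t}"
      by (rule LIMSEQ_unique[OF peak_sum_tendsto[OF s(1) t d(2,1), unfolded eqJ] peak_sum_tendsto[OF s(2) t d(3,1)]])
    then show ?thesis using t by simp
  qed
  have m: "finite {k. l k = t} \<and> card {k. l k = t} = card {k. l k = t}"
    "finite {k. l' k = t} \<and> card {k. l' k = t} = card {k. l k = t}" if "t \<noteq> 0" for t
    using finite_level[OF s(1) that] finite_level[OF s(2) that] card[OF that] by auto
  note e = sorted_spectrum_eigenvalues[OF z(1) m(1)] sorted_spectrum_eigenvalues[OF z(2) m(2)]
  show ?thesis
  proof
    fix k show "l k = l' k"
      by (cases "even k") (use e in \<open>auto elim!: evenE oddE\<close>)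
  qed
qed

lemma tendsto_if_subsequences:
  fixes f :: "nat \<Rightarrow> 'b::metric_space"
  assumes "\<And>r :: nat \<Rightarrow> nat. strict_mono r \<Longrightarrow> \<exists>s :: nat \<Rightarrow> nat. strict_mono s \<and> (\<lambda>n. f (r (s n))) \<longlonglongrightarrow> l"
  shows "f \<longlonglongrightarrow> l"
proof (rule ccontr)
  assume "\<not> f \<longlonglongrightarrow> l"
  then obtain e where e: "e > 0" "\<not> (\<forall>\<^sub>F n in sequentially. dist (f n) l < e)"
    unfolding tendsto_iff by blast
  then have "infinite {n. \<not> dist (f n) l < e}"
    by (simp add: eventually_cofinite[symmetric] cofinite_eq_sequentially)
  then obtain r :: "nat \<Rightarrow> nat" where r: "strict_mono r" "\<And>n. r n \<in> {n. \<not> dist (f n) l < e}"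
    using infinite_enumerate by blast
  obtain s where "(\<lambda>n. f (r (s n))) \<longlonglongrightarrow> l" using assms[OF r(1)] by blast
  then have "\<forall>\<^sub>F n in sequentially. dist (f (r (s n))) l < e" using e(1) by (simp add: tendsto_iff)
  then show False using r(2) by (auto simp: eventually_sequentially)
qed

text \<open>\<open>c m J\<close> stands for the limit of the sums of z^m (1 - z^2 / C)^J. Only the
  case \<open>J = 0\<close> is given as a limit; \<open>rec\<close> encodes the expansion of one
  factor, and \<open>decay\<close> is a tightness condition on the squares.\<close>

locale spectrum_sequence =
  fixes Z :: "nat \<Rightarrow> nat \<Rightarrow> real" and c :: "nat \<Rightarrow> nat \<Rightarrow> real" and C :: real
  assumes sorted: "\<And>n. sorted_spectrum (Z n)" and summ: "\<And>n. summable (\<lambda>k. (Z n k)\<^sup>2)"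
    and lim: "\<And>m. m \<ge> 2 \<Longrightarrow> (\<lambda>n. suminf (\<lambda>k. Z n k ^ m)) \<longlonglongrightarrow> c m 0"
    and rec: "\<And>m J. m \<ge> 2 \<Longrightarrow> c m (Suc J) = c m J - c (m + 2) J / C"
    and decay: "(\<lambda>J. c 2 J) \<longlonglongrightarrow> 0"
begin

text \<open>A diagonal argument provides a pointwise limit. Its power sums are right for m >= 3 by
  dominated convergence and not too large for m = 2. The defect at m = 2 is the same for all
  \<open>J\<close>, and \<open>decay\<close> forces it to vanish.\<close>

lemma subsequence_limit:
  assumes r: "strict_mono (r :: nat \<Rightarrow> nat)"
  shows "\<exists>s l. strict_mono (s :: nat \<Rightarrow> nat) \<and> sorted_spectrum l \<and> summable (\<lambda>k. (l k)\<^sup>2) \<and>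
    (\<forall>m\<ge>2. (suminf (\<lambda>k. l k ^ m)) = c m 0) \<and> (\<forall>k. (\<lambda>n. Z (r (s n)) k) \<longlonglongrightarrow> l k)"
proof -
  obtain K where K': "\<And>n. norm (suminf (\<lambda>k. (Z n k)\<^sup>2)) \<le> K"
    using BseqE[OF convergent_imp_Bseq[OF convergentI[OF lim[of 2, OF order_refl]]]] by blast
  have K: "suminf (\<lambda>k. (Z n k)\<^sup>2) \<le> K" for n using K'[of n] by simp
  note sK = sorted summ K
  have bd: "Z n k \<in> {- sqrt (2 * K) .. sqrt (2 * K)}" for n k
  proof -
    have "0 \<le> K" using suminf_nonneg[OF summ[of n]] K[of n] by simp
    have "\<bar>Z n k\<bar> \<le> sqrt (2 * K) * (real k + 1) powr (-1/2)" by (rule sorted_spectrum_abs_le[OF sK])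
    also have "\<dots> \<le> sqrt (2 * K) * 1"
      using \<open>0 \<le> K\<close> powr_mono[of "-1/2" 0 "real k + 1"] by (intro mult_left_mono) auto
    finally show ?thesis by auto
  qed
  interpret subseqs "\<lambda>k s. convergent (\<lambda>n. Z (r (s n)) k)"
  proof
    fix k and s :: "nat \<Rightarrow> nat"
    obtain r' l where "strict_mono (r' :: nat \<Rightarrow> nat)" "((\<lambda>n. Z (r (s n)) k) \<circ> r') \<longlonglongrightarrow> l"
      using seq_compactE[OF compact_imp_seq_compact[OF compact_Icc], of "\<lambda>n. Z (r (s n)) k"] bd by metis
    then show "\<exists>r'. strict_mono r' \<and> convergent (\<lambda>n. Z (r ((s \<circ> r') n)) k)"
      by (auto simp: o_def convergent_def)
  qed
  have "convergent (\<lambda>n. Z (r (diagseq n)) k)" for k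
  proof -
    have "convergent (\<lambda>n. Z (r ((diagseq \<circ> (+) (Suc k)) n)) k)"
    proof (rule diagseq_holds)
      fix n and s r' :: "nat \<Rightarrow> nat"
      assume "strict_mono r'" "convergent (\<lambda>k. Z (r (s k)) n)"
      from convergent_subseq_convergent[OF this(2,1)] show "convergent (\<lambda>k. Z (r ((s \<circ> r') k)) n)"
        by (simp add: o_def)
    qed
    then obtain a where "(\<lambda>n. Z (r (diagseq (n + Suc k))) k) \<longlonglongrightarrow> a"
      by (auto simp: convergent_def o_def add.commute)
    then have "(\<lambda>n. Z (r (diagseq n)) k) \<longlonglongrightarrow> a" by (rule LIMSEQ_offset)
    then show ?thesis by (rule convergentI)
  qed
  then have l_lim: "(\<lambda>n. Z (r (diagseq n)) k) \<longlonglongrightarrow> lim (\<lambda>n. Z (r (diagseq n)) k)" for k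
    by (simp only: convergent_LIMSEQ_iff)
  define l where "l k = lim (\<lambda>n. Z (r (diagseq n)) k)" for k
  have l: "(\<lambda>n. Z (r (diagseq n)) k) \<longlonglongrightarrow> l k" for k using l_lim by (simp only: l_def)
  define X where "X n = Z (r (diagseq n))" for n
  have X: "sorted_spectrum (X n)" "summable (\<lambda>k. (X n k)\<^sup>2)" "(suminf (\<lambda>k. (X n k)\<^sup>2)) \<le> K"
    "(\<lambda>n. X n k) \<longlonglongrightarrow> l k" for n k using sK l by (auto simp: X_def)
  have Xlim: "(\<lambda>n. suminf (\<lambda>k. X n k ^ m)) \<longlonglongrightarrow> c m 0" if "m \<ge> 2" for m
    using LIMSEQ_subseq_LIMSEQ[OF LIMSEQ_subseq_LIMSEQ[OF lim[OF that] r] subseq_diagseq] by (simp add: o_def X_def)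
  have lsorted: "sorted_spectrum l"
    unfolding sorted_spectrum_def decseq_def incseq_def
  proof (intro conjI allI impI)
    fix i j :: nat assume "i \<le> j"
    then have "X n (2 * j) \<le> X n (2 * i)" "X n (2 * i + 1) \<le> X n (2 * j + 1)" for n
      using X(1)[of n] by (auto simp: sorted_spectrum_def decseq_def incseq_def)
    then show "l (2 * j) \<le> l (2 * i)" "l (2 * i + 1) \<le> l (2 * j + 1)"
      by (auto intro!: LIMSEQ_le[OF X(4) X(4)])
  next
    fix i
    have "0 \<le> X n (2 * i)" "X n (2 * i + 1) \<le> 0" for n using X(1)[of n] by (auto simp: sorted_spectrum_def)
    then show "0 \<le> l (2 * i)" "l (2 * i + 1) \<le> 0"
      by (auto intro!: LIMSEQ_le_const[OF X(4)] LIMSEQ_le_const2[OF X(4)])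
  qed
  have fatou: "(\<Sum>k<N. (l k)\<^sup>2) \<le> c 2 0" for N
  proof (rule LIMSEQ_le)
    show "(\<lambda>n. \<Sum>k<N. (X n k)\<^sup>2) \<longlonglongrightarrow> (\<Sum>k<N. (l k)\<^sup>2)" by (intro tendsto_intros X)
    show "(\<lambda>n. suminf (\<lambda>k. (X n k)\<^sup>2)) \<longlonglongrightarrow> c 2 0" by (rule Xlim) simp
  qed (auto intro!: sum_le_suminf X)
  have ls: "summable (\<lambda>k. (l k)\<^sup>2)"
  proof (rule bounded_imp_summable)
    show "(\<Sum>k\<le>n. (l k)\<^sup>2) \<le> c 2 0" for n using fatou[of "Suc n"] by (simp only: lessThan_Suc_atMost)
  qed simp
  have l2: "(suminf (\<lambda>k. (l k)\<^sup>2)) \<le> c 2 0" by (rule suminf_le_const[OF ls fatou])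
  have l3: "(suminf (\<lambda>k. l k ^ m)) = c m 0" if m: "m \<ge> 3" for m
  proof -
    have "(\<lambda>n. suminf (\<lambda>k. X n k ^ m)) \<longlonglongrightarrow> (suminf (\<lambda>k. l k ^ m))"
    proof (rule tannerys_theorem[THEN conjunct2, THEN conjunct2])
      show "(\<lambda>n. X n k ^ m) \<longlonglongrightarrow> l k ^ m" for k by (intro tendsto_intros X)
      show "\<forall>\<^sub>F (k, n) in sequentially \<times>\<^sub>F sequentially. norm (X n k ^ m) \<le> sqrt (2 * K) ^ m * (real k + 1) powr (-3/2)"
        using sorted_spectrum_power_le[OF X(1,2,3) m] by (intro always_eventually) (auto simp: power_abs)
    qed (use summable_powr_three_halves in \<open>auto intro: summable_mult\<close>)
    then show ?thesis using Xlim[of m] m LIMSEQ_unique by auto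
  qed
  define S where "S m J = (suminf (\<lambda>k. l k ^ m * (1 - (l k)\<^sup>2 / C) ^ J))" for m J
  have sumS: "summable (\<lambda>k. l k ^ m * (1 - (l k)\<^sup>2 / C) ^ J)" if "m \<ge> 2" for m J
  proof -
    have "(\<lambda>k. l k ^ m * (1 - (l k)\<^sup>2 / C) ^ J) = (\<lambda>k. (l k)\<^sup>2 * (l k ^ (m - 2) * (1 - (l k)\<^sup>2 / C) ^ J))"
      using that by (auto simp: mult.assoc[symmetric] sq_mult_power)
    moreover have "continuous_on UNIV (\<lambda>x :: real. x ^ (m - 2) * (1 - x\<^sup>2 / C) ^ J)"
      unfolding divide_inverse by (intro continuous_intros)
    ultimately show ?thesis using summable_sq_times[OF ls] by simp
  qed
  have Srec: "S m (Suc J) = S m J - S (m + 2) J / C" if "m \<ge> 2" for m J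
  proof -
    have "S m J - S (m + 2) J / C = (suminf (\<lambda>k. l k ^ m * (1 - (l k)\<^sup>2 / C) ^ J - l k ^ (m + 2) * (1 - (l k)\<^sup>2 / C) ^ J / C))"
      unfolding S_def using that
      by (subst suminf_divide[symmetric, OF sumS], simp, subst suminf_diff[OF sumS summable_divide[OF sumS]]) auto
    also have "\<dots> = S m (Suc J)" unfolding S_def
      by (intro arg_cong[of _ _ suminf] ext) (simp add: power_add power2_eq_square algebra_simps)
    finally show ?thesis by simp
  qed
  have Sc: "S m J = c m J" if "m \<ge> 3" for m J
    using that
  proof (induction J arbitrary: m)
    case 0
    then show ?case by (simp add: S_def l3)
  next
    case (Suc J)
    then show ?case using rec[of m J] Srec[of m J] by simp
  qed
  \<comment> \<open>The recursion subtracts terms with exponent 4, on which \<open>c\<close> and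
    \<open>S\<close> agree already.\<close>
  have diff: "c 2 J - S 2 J = c 2 0 - S 2 0" for J
    by (induction J) (simp_all add: rec[OF order_refl] Srec[OF order_refl] Sc)
  have "c 2 0 - S 2 0 \<le> 0"
  proof (rule LIMSEQ_le_const[OF LIMSEQ_subseq_LIMSEQ[OF decay, of "\<lambda>j. 2 * j"]])
    show "strict_mono (\<lambda>j::nat. 2 * j)" by (rule strict_monoI) simp
    \<comment> \<open>Only even powers are used, since 1 - l^2 / C may be negative.\<close>
    have "0 \<le> S 2 (2 * j)" for j unfolding S_def
      by (intro suminf_nonneg sumS) (auto simp: power_mult)
    then have "c 2 0 - S 2 0 \<le> c 2 (2 * j)" for j using diff[of "2 * j"] by (simp add: algebra_simps)
    then show "\<exists>N. \<forall>n\<ge>N. c 2 0 - S 2 0 \<le> (c 2 \<circ> (\<lambda>j. 2 * j)) n" by simp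
  qed
  then have "(suminf (\<lambda>k. (l k)\<^sup>2)) = c 2 0" using l2 by (simp add: S_def)
  then have "(suminf (\<lambda>k. l k ^ m)) = c m 0" if "m \<ge> 2" for m
    using l3[of m] that by (cases "m = 2") auto
  then show ?thesis using subseq_diagseq lsorted ls l by blast
qed

theorem spectrum_limit:
  "\<exists>l. sorted_spectrum l \<and> summable (\<lambda>k. (l k)\<^sup>2) \<and> (\<forall>m\<ge>2. (suminf (\<lambda>k. l k ^ m)) = c m 0)"
  using subsequence_limit[OF strict_mono_id] by blast

theorem spectrum_tendsto:
  assumes l: "sorted_spectrum l" "summable (\<lambda>k. (l k)\<^sup>2)" "\<And>m. m \<ge> 2 \<Longrightarrow> (suminf (\<lambda>k. l k ^ m)) = c m 0"
  shows "(\<lambda>n. Z n k) \<longlonglongrightarrow> l k"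
proof (rule tendsto_if_subsequences)
  fix r :: "nat \<Rightarrow> nat" assume "strict_mono r"
  then obtain s l' where s: "strict_mono (s :: nat \<Rightarrow> nat)" "sorted_spectrum l'" "summable (\<lambda>k. (l' k)\<^sup>2)"
    "\<And>m. m \<ge> 2 \<Longrightarrow> (suminf (\<lambda>k. l' k ^ m)) = c m 0" "\<And>k. (\<lambda>n. Z (r (s n)) k) \<longlonglongrightarrow> l' k"
    using subsequence_limit by metis
  have "l' = l" by (rule sorted_spectrum_unique[OF s(2) l(1) s(3) l(2)]) (simp add: s(4) l(3))
  then show "\<exists>s. strict_mono (s :: nat \<Rightarrow> nat) \<and> (\<lambda>n. Z (r (s n)) k) \<longlonglongrightarrow> l k" using s by blast
qed

end

subsection \<open>Evaluation in star-algebras\<close>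

lemma alg_word_add: "alg_word f (u + w) = alg_word f u * alg_word f w"
  unfolding alg_word_def by (rule word_value_add) (auto simp: mult.assoc)

lemma alg_word_0 [simp]: "alg_word f 0 = 1"
  by (simp add: alg_word_def word_value_def zero_nc_word_def)

lemma alg_word_Cons: "alg_word f (Word (l # ls)) = (case l of Var v \<Rightarrow> f v | Adj v \<Rightarrow> star (f v)) * alg_word f (Word ls)"
  by (simp add: alg_word_def word_value_def)

lemma star_one [simp]: "star (1 :: 'a::complex_star_algebra) = 1"
  using star_mult[of "star 1" "1 :: 'a"] by (simp add: star_star)

lemma star_diff: "star (p - q) = star p - star q" for p q :: "'a::complex_star_algebra"
  using star_add[of "p - q" q] by simp

lemma alg_word_letter: "alg_word f (Word [l]) = (case l of Var v \<Rightarrow> f v | Adj v \<Rightarrow> star (f v))"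
  using alg_word_0[of f] by (simp add: alg_word_Cons zero_nc_word_def)

lemma alg_word_invol: "alg_word f (invol w) = star (alg_word f w)"
proof (cases w)
  case (Word ls)
  show ?thesis unfolding Word
  proof (induction ls)
    case Nil
    then show ?case by (simp add: zero_nc_word_def[symmetric])
  next
    case (Cons l ls)
    have "invol (Word (l # ls)) = invol (Word ls) + Word [flip_letter l]"
      by (simp add: invol_nc_word_def plus_nc_word_def)
    moreover have "alg_word f (Word [flip_letter l]) = star (case l of Var v \<Rightarrow> f v | Adj v \<Rightarrow> star (f v))"
      unfolding alg_word_letter by (cases l) (simp_all add: star_star)
    ultimately show ?case by (simp add: alg_word_add Cons alg_word_Cons[of f l] star_mult)
  qed
qed

lemma alg_eval_superset:
  "finite S \<Longrightarrow> Poly_Mapping.keys p \<subseteq> S \<Longrightarrow> alg_eval f p = (\<Sum>w\<in>S. Poly_Mapping.lookup p w *\<^sub>C alg_word f w)"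
  unfolding alg_eval_def by (intro sum.mono_neutral_left) (auto simp: in_keys_iff scaleC_zero_left)

lemma alg_eval_add: "alg_eval f (p + q) = alg_eval f p + alg_eval f q"
proof -
  let ?S = "Poly_Mapping.keys p \<union> Poly_Mapping.keys q"
  have "Poly_Mapping.keys (p + q) \<subseteq> ?S" by (rule Poly_Mapping.keys_add)
  then show ?thesis
    by (simp add: alg_eval_superset[of ?S] lookup_add scaleC_add_left sum.distrib)
qed

lemma alg_eval_single: "alg_eval f (Poly_Mapping.single w c) = c *\<^sub>C alg_word f w"
  by (simp add: alg_eval_def scaleC_zero_left)

lemma alg_eval_zero [simp]: "alg_eval f 0 = 0"
  by (simp add: alg_eval_def)

lemma alg_eval_diff: "alg_eval f (p - q) = alg_eval f p - alg_eval f q"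
  using alg_eval_add[of f "p - q" q] by simp

lemma alg_eval_mult: "alg_eval f (p * q) = alg_eval f p * alg_eval f q"
proof (induction p rule: poly_mapping_single_induct)
  case (single u a)
  show ?case
  proof (induction q rule: poly_mapping_single_induct)
    case (single w b)
    show ?case
      by (simp add: mult_single alg_eval_single alg_word_add mult_scaleC_left mult_scaleC_right scaleC_scaleC mult.commute)
  qed (simp add: distrib_left alg_eval_add)
qed (simp add: distrib_right alg_eval_add)

lemma alg_eval_scaleC: "alg_eval f (c *\<^sub>C p) = c *\<^sub>C alg_eval f p"
proof (induction p rule: poly_mapping_single_induct)
  case (single w a)
  show ?case by (simp add: scaleC_single alg_eval_single scaleC_complex_def scaleC_scaleC)
next
  case (add p q)
  have "c *\<^sub>C (p + q) = c *\<^sub>C p + c *\<^sub>C q" by (rule scaleC_add_right)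
  then show ?case by (simp add: alg_eval_add add scaleC_add_right)
qed

lemma alg_eval_star: "alg_eval f (star p) = star (alg_eval f p)"
proof (induction p rule: poly_mapping_single_induct)
  case (single w a)
  show ?case by (simp add: star_single alg_eval_single alg_word_invol star_scaleC star_complex_def)
qed (simp add: star_add alg_eval_add)

lemma alg_eval_one [simp]: "alg_eval f 1 = 1"
  using alg_eval_single[of f 0 1] by (simp add: scaleC_one)

lemma alg_eval_pow: "alg_eval f (p ^ k) = alg_eval f p ^ k"
  by (induction k) (simp_all add: alg_eval_mult)

subsection \<open>Words in two families of variables\<close>

definition wordA :: "'k nc_word \<Rightarrow> ('k + 'l) nc_word" where
  "wordA w = Word (map (map_letter Inl) (letters w))"

definition wordB :: "'l nc_word \<Rightarrow> ('k + 'l) nc_word" where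
  "wordB w = Word (map (map_letter Inr) (letters w))"

lemma wordA_0 [simp]: "wordA 0 = 0" and wordB_0 [simp]: "wordB 0 = 0"
  by (simp_all add: wordA_def wordB_def zero_nc_word_def)

lemma wordA_add: "wordA (u + w) = wordA u + wordA w" and wordB_add: "wordB (u' + w') = wordB u' + wordB w'"
  by (simp_all add: wordA_def wordB_def plus_nc_word_def)

lemma map_letter_flip: "map_letter f (flip_letter l) = flip_letter (map_letter f l)"
  by (cases l) simp_all

lemma wordA_invol: "wordA (invol w) = invol (wordA w)" and wordB_invol: "wordB (invol w') = invol (wordB w')"
  by (simp_all add: wordA_def wordB_def invol_nc_word_def rev_map map_letter_flip o_def)

fun letter_A :: "('k + 'l) letter \<Rightarrow> bool" where
  "letter_A (Var (Inl i)) = True" | "letter_A (Adj (Inl i)) = True"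
| "letter_A (Var (Inr i)) = False" | "letter_A (Adj (Inr i)) = False"

lemma letter_A_Inl [simp]: "letter_A (map_letter Inl l)"
  and letter_A_Inr [simp]: "\<not> letter_A (map_letter Inr l')"
  by (cases l; simp) (cases l'; simp)

lemma letter_A_iff: "letter_A l \<longleftrightarrow> (\<exists>l'. l = map_letter Inl l')"
  and not_letter_A_iff: "\<not> letter_A l \<longleftrightarrow> (\<exists>l'. l = map_letter Inr l')"
proof -
  have "(\<exists>l'. l = map_letter Inl l') \<or> (\<exists>l'. l = map_letter Inr l')"
  proof (cases l)
    case (Var v)
    then show ?thesis by (cases v) (auto intro: exI[of _ "Var _"])
  next
    case (Adj v)
    then show ?thesis by (cases v) (auto intro: exI[of _ "Adj _"])
  qed
  then show "letter_A l \<longleftrightarrow> (\<exists>l'. l = map_letter Inl l')" "\<not> letter_A l \<longleftrightarrow> (\<exists>l'. l = map_letter Inr l')"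
    by auto
qed

definition count_A :: "('k + 'l) nc_word \<Rightarrow> nat" where
  "count_A w = length (filter letter_A (letters w))"

lemma count_A_0 [simp]: "count_A 0 = 0"
  by (simp add: count_A_def zero_nc_word_def)

lemma count_A_add [simp]: "count_A (u + w) = count_A u + count_A w"
  by (simp add: count_A_def plus_nc_word_def)

lemma count_A_wordA: "count_A (wordA w) = length (letters w)"
  by (simp add: count_A_def wordA_def filter_map o_def)

lemma count_A_wordB [simp]: "count_A (wordB w) = 0"
  by (simp add: count_A_def wordB_def filter_map o_def)

lemma count_A_invol [simp]: "count_A (invol w) = count_A w"
proof -
  have "letter_A (flip_letter l) = letter_A l" for l :: "('a + 'b) letter"
    by (cases l rule: letter_A.cases) simp_all
  then show ?thesis by (simp add: count_A_def invol_nc_word_def rev_filter[symmetric] filter_map o_def)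
qed

lemma count_A_wordA_pos: "w \<noteq> 0 \<Longrightarrow> count_A (wordA w) \<ge> 1"
  by (cases w) (auto simp: count_A_wordA zero_nc_word_def Suc_le_eq)

definition pair_word :: "('k nc_word \<times> 'l nc_word) list \<Rightarrow> ('k + 'l) nc_word" where
  "pair_word ps = sum_list (map (\<lambda>(\<alpha>, \<beta>). wordA \<alpha> + wordB \<beta>) ps)"

lemma pair_word_Nil [simp]: "pair_word [] = 0"
  and pair_word_Cons [simp]: "pair_word ((\<alpha>, \<beta>) # ps) = wordA \<alpha> + wordB \<beta> + pair_word ps"
  and pair_word_append: "pair_word (ps @ qs) = pair_word ps + pair_word qs"
  by (simp_all add: pair_word_def add.assoc)

definition letter_pairs :: "('k nc_word \<times> 'l nc_word) list \<Rightarrow> bool" where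
  "letter_pairs ps \<longleftrightarrow> (\<forall>(\<alpha>, \<beta>)\<in>set ps. \<exists>l. \<alpha> = Word [l])"

text \<open>Each letter of the first kind is paired with the possibly empty word of the second kind
  behind it; \<open>\<beta>\<close> is what precedes the first such letter.\<close>

lemma word_decompose:
  "\<exists>\<beta> ps. w = wordB \<beta> + pair_word ps \<and> letter_pairs ps \<and> length ps = count_A w"
proof (cases w)
  case (Word ls)
  have "\<exists>\<beta> ps. Word ls = wordB \<beta> + pair_word ps \<and> letter_pairs ps \<and> length ps = count_A (Word ls)"
  proof (induction ls)
    case Nil
    then show ?case by (intro exI[of _ 0] exI[of _ "[]"]) (simp add: letter_pairs_def zero_nc_word_def[symmetric])
  next
    case (Cons l ls)
    then obtain \<beta> ps where IH: "Word ls = wordB \<beta> + pair_word ps" "letter_pairs ps" "length ps = count_A (Word ls)"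
      by blast
    have split: "Word (l # ls) = Word [l] + Word ls" by (simp add: plus_nc_word_def)
    show ?case
    proof (cases "letter_A l")
      case True
      then obtain l' where l': "l = map_letter Inl l'" using letter_A_iff by blast
      have "Word [l] = wordA (Word [l'])" by (simp add: wordA_def l')
      then have "Word (l # ls) = wordB 0 + pair_word ((Word [l'], \<beta>) # ps)"
        unfolding split IH(1) by (simp add: add.assoc)
      moreover have "length ((Word [l'], \<beta>) # ps) = count_A (Word (l # ls))" using IH(3) True by (simp add: count_A_def)
      moreover have "letter_pairs ((Word [l'], \<beta>) # ps)" using IH(2) by (auto simp: letter_pairs_def)
      ultimately show ?thesis by blast
    next
      case False
      then obtain l' where l': "l = map_letter Inr l'" using not_letter_A_iff by blast
      have "Word [l] = wordB (Word [l'])" by (simp add: wordB_def l')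
      then have "Word (l # ls) = wordB (Word [l'] + \<beta>) + pair_word ps"
        unfolding split IH(1) by (simp add: wordB_add add.assoc)
      moreover have "length ps = count_A (Word (l # ls))" using IH(3) False by (simp add: count_A_def)
      ultimately show ?thesis using IH(2) by blast
    qed
  qed
  then show ?thesis unfolding Word .
qed

lemma pair_word_add_wordB:
  "ps \<noteq> [] \<Longrightarrow> letter_pairs ps \<Longrightarrow> \<exists>ps'. pair_word ps + wordB \<beta> = pair_word ps' \<and> letter_pairs ps' \<and> length ps' = length ps"
proof (induction ps)
  case (Cons ab ps)
  obtain a b where ab: "ab = (a, b)" by fastforce
  show ?case
  proof (cases "ps = []")
    case True
    then show ?thesis using Cons.prems
      by (intro exI[of _ "[(a, b + \<beta>)]"]) (auto simp: ab wordB_add add.assoc letter_pairs_def)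
  next
    case False
    then obtain ps' where "pair_word ps + wordB \<beta> = pair_word ps'" "letter_pairs ps'" "length ps' = length ps"
      using Cons by (auto simp: letter_pairs_def)
    then show ?thesis using Cons.prems
      by (intro exI[of _ "(a, b) # ps'"]) (auto simp: ab add.assoc letter_pairs_def)
  qed
qed simp

text \<open>Cyclically, a word with at least two letters of the first kind is a product of pairs.  Both parts
  \<open>us\<close> and \<open>qs\<close> contain such a letter, since a tracial weight need only be invariant under
  cyclic permutation of factors from its domain.\<close>

definition rotates_to :: "('k + 'l) nc_word \<Rightarrow> ('k nc_word \<times> 'l nc_word) list \<Rightarrow> bool" where
  "rotates_to w rs \<longleftrightarrow> letter_pairs rs \<and> length rs \<ge> 2 \<and>
     (\<exists>\<beta> us qs. us \<noteq> [] \<and> qs \<noteq> [] \<and> letter_pairs us \<and> letter_pairs qs \<and> w = wordB \<beta> + pair_word us + pair_word qs \<and>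
        pair_word qs + (wordB \<beta> + pair_word us) = pair_word rs)"

text \<open>The cut comes after the first pair, and the leading word is absorbed by the last pair of
  the remainder. A second letter of the first kind makes the remainder nonempty.\<close>

lemma ex_rotates_to:
  assumes "count_A w \<ge> 2"
  shows "\<exists>rs. rotates_to w rs"
proof -
  obtain \<beta> ps where ps: "w = wordB \<beta> + pair_word ps" "letter_pairs ps" "length ps = count_A w"
    using word_decompose by blast
  obtain a b qs where qs: "ps = (a, b) # qs" "qs \<noteq> []"
    using ps(3) assms by (cases ps; cases "tl ps") auto
  have lp: "letter_pairs qs" "letter_pairs [(a, b)]" using ps(2) qs by (auto simp: letter_pairs_def)
  obtain qs' where qs': "pair_word qs + wordB \<beta> = pair_word qs'" "letter_pairs qs'" "length qs' = length qs"
    using pair_word_add_wordB[OF qs(2) lp(1)] by blast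
  have "rotates_to w (qs' @ [(a, b)])"
    unfolding rotates_to_def
  proof (intro conjI exI)
    show "pair_word qs + (wordB \<beta> + pair_word [(a, b)]) = pair_word (qs' @ [(a, b)])"
      by (simp add: pair_word_append qs'(1)[symmetric] add.assoc)
    show "length (qs' @ [(a, b)]) \<ge> 2" using qs'(3) qs(2) by (cases qs) auto
  qed (use lp qs' qs ps(1) in \<open>auto simp: letter_pairs_def add.assoc\<close>)
  then show ?thesis by blast
qed

lemma word_value_wordA: "word_value mul unit adj (case_sum a b) (wordA w) = word_value mul unit adj a w"
  and word_value_wordB: "word_value mul unit adj (case_sum a b) (wordB w') = word_value mul unit adj b w'"
proof -
  have "(case map_letter Inl l of Var v \<Rightarrow> case_sum a b v | Adj v \<Rightarrow> adj (case_sum a b v)) =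
      (case l of Var v \<Rightarrow> a v | Adj v \<Rightarrow> adj (a v))" for l
    by (cases l) simp_all
  then show "word_value mul unit adj (case_sum a b) (wordA w) = word_value mul unit adj a w"
    by (simp add: word_value_def wordA_def o_def)
  have "(case map_letter Inr l of Var v \<Rightarrow> case_sum a b v | Adj v \<Rightarrow> adj (case_sum a b v)) =
      (case l of Var v \<Rightarrow> b v | Adj v \<Rightarrow> adj (b v))" for l
    by (cases l) simp_all
  then show "word_value mul unit adj (case_sum a b) (wordB w') = word_value mul unit adj b w'"
    by (simp add: word_value_def wordB_def o_def)
qed

lemma alg_word_wordA: "alg_word (case_sum a b) (wordA w) = alg_word a w"
  and alg_word_wordB: "alg_word (case_sum a b) (wordB w') = alg_word b w'"
  unfolding alg_word_def by (rule word_value_wordA word_value_wordB)+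

lemma alg_word_var: "alg_word nc_var w = Poly_Mapping.single w 1"
proof (cases w)
  case (Word ls)
  show ?thesis unfolding Word
  proof (induction ls)
    case Nil
    then show ?case by (simp add: zero_nc_word_def[symmetric])
  next
    case (Cons l ls)
    have "(case l of Var v \<Rightarrow> nc_var v | Adj v \<Rightarrow> star (nc_var v)) = Poly_Mapping.single (Word [l]) (1 :: complex)"
      by (cases l) (simp_all add: nc_var_def star_single invol_nc_word_def star_complex_def)
    then show ?case by (simp add: alg_word_Cons Cons mult_single plus_nc_word_def)
  qed
qed

lemma case_sum_nc_var: "case_sum (\<lambda>i. nc_var (Inl i)) (\<lambda>i. nc_var (Inr i)) = (nc_var :: 'k + 'l \<Rightarrow> ('k + 'l) nc_poly)"
  by (rule ext) (simp split: sum.split)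

lemma alg_word_var_A: "alg_word (\<lambda>i. nc_var (Inl i) :: ('k + 'l) nc_poly) w = Poly_Mapping.single (wordA w) 1"
  using alg_word_wordA[of "\<lambda>i. nc_var (Inl i) :: ('k + 'l) nc_poly" "\<lambda>i. nc_var (Inr i)" w]
  unfolding case_sum_nc_var alg_word_var by (rule sym)

lemma alg_word_var_B: "alg_word (\<lambda>i. nc_var (Inr i) :: ('k + 'l) nc_poly) w = Poly_Mapping.single (wordB w) 1"
  using alg_word_wordB[of "\<lambda>i. nc_var (Inl i)" "\<lambda>i. nc_var (Inr i) :: ('k + 'l) nc_poly" w]
  unfolding case_sum_nc_var alg_word_var by (rule sym)

subsection \<open>Cyclically monotone models\<close>

lemma star_subalgebra_generated: "star_subalgebra (generated_star_algebra X)"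
  unfolding star_subalgebra_def generated_star_algebra_def by blast

lemma generated_star_algebra_base: "x \<in> X \<Longrightarrow> x \<in> generated_star_algebra X"
  by (auto simp: generated_star_algebra_def)

lemma generated_star_algebra_minimal: "star_subalgebra S \<Longrightarrow> X \<subseteq> S \<Longrightarrow> generated_star_algebra X \<subseteq> S"
  by (auto simp: generated_star_algebra_def)

lemma alg_word_mem:
  assumes S: "star_subalgebra S" and f: "\<And>v. f v \<in> S" and w: "w \<noteq> 0 \<or> 1 \<in> S"
  shows "alg_word f w \<in> S"
proof (cases w)
  case (Word ls)
  have l: "(case l of Var v \<Rightarrow> f v | Adj v \<Rightarrow> star (f v)) \<in> S" for l
    using S f by (cases l) (auto simp: star_subalgebra_def)
  have "ls \<noteq> [] \<or> 1 \<in> S \<Longrightarrow> alg_word f (Word ls) \<in> S"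
  proof (induction ls)
    case Nil
    then show ?case by (simp add: zero_nc_word_def[symmetric])
  next
    case (Cons k ls)
    show ?case
    proof (cases "ls = []")
      case True
      then show ?thesis using l by (simp add: alg_word_letter)
    next
      case False
      then show ?thesis using Cons l S by (simp add: alg_word_Cons star_subalgebra_def)
    qed
  qed
  then show ?thesis using w by (auto simp: Word zero_nc_word_def)
qed

definition pair_value :: "('k nc_word \<Rightarrow> complex) \<Rightarrow> ('l nc_word \<Rightarrow> complex) \<Rightarrow> ('k nc_word \<times> 'l nc_word) list \<Rightarrow> complex" where
  "pair_value mA mB rs = mA (sum_list (map fst rs)) * prod_list (map (\<lambda>(\<alpha>, \<beta>). mB \<beta>) rs)"

text \<open>One rotation is chosen once and for all. Its value is identified both with the limit of
  the traces and with the value in an arbitrary model, so independence of the choice need not be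
  verified by combinatorics.\<close>

definition cyclic_value :: "('k nc_word \<Rightarrow> complex) \<Rightarrow> ('l nc_word \<Rightarrow> complex) \<Rightarrow> ('k + 'l) nc_word \<Rightarrow> complex" where
  "cyclic_value mA mB w = pair_value mA mB (SOME rs. rotates_to w rs)"

lemma cyclic_value_rotates: "count_A w \<ge> 2 \<Longrightarrow> \<exists>rs. rotates_to w rs \<and> cyclic_value mA mB w = pair_value mA mB rs"
  unfolding cyclic_value_def using someI_ex[OF ex_rotates_to] by blast

text \<open>The word splits into two factors from \<open>D\<close>, which the weight allows to be
  swapped; the swapped product has the form to which independence applies. The assumption
  \<open>mB 0 = 1\<close> accounts for empty words between adjacent letters.\<close>

lemma model_word_value:
  assumes model: "cyclic_monotone_model mA mB D \<omega> \<tau> a b" and mB0: "mB 0 = 1" and w: "count_A w \<ge> 2"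
  shows "alg_word (case_sum a b) w \<in> D \<and> \<omega> (alg_word (case_sum a b) w) = cyclic_value mA mB w"
proof -
  obtain rs where rot: "rotates_to w rs" and val: "cyclic_value mA mB w = pair_value mA mB rs"
    using cyclic_value_rotates[OF w] by blast
  obtain \<beta> us qs where d: "letter_pairs rs" "length rs \<ge> 2" "us \<noteq> []" "qs \<noteq> []" "letter_pairs us" "letter_pairs qs"
    "w = wordB \<beta> + pair_word us + pair_word qs" "pair_word qs + (wordB \<beta> + pair_word us) = pair_word rs"
    using rot unfolding rotates_to_def by blast
  let ?f = "case_sum a b"
  let ?A = "generated_star_algebra (range a)" and ?B = "generated_star_algebra (insert 1 (range b))"
  have tr: "tracial_weight D \<omega>" and np: "nc_probability_space \<tau>" and cm: "cyclically_monotone D \<omega> \<tau> ?A ?B"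
    and mA: "\<And>w. w \<noteq> 0 \<Longrightarrow> \<omega> (alg_word a w) = mA w" and mB: "\<And>w. w \<noteq> 0 \<Longrightarrow> \<tau> (alg_word b w) = mB w"
    using model by (auto simp: cyclic_monotone_model_def cyclically_monotone_families_def alg_moments_def)
  have \<tau>1: "\<tau> 1 = 1" using np by (simp add: nc_probability_space_def)
  have mB': "\<tau> (alg_word b w) = mB w" for w by (cases "w = 0") (simp_all add: \<tau>1 mB0 mB)
  define F where "F = map (\<lambda>(\<alpha>, \<beta>). (alg_word a \<alpha>, alg_word b \<beta>))"
  have Amem: "alg_word a \<alpha> \<in> ?A" if "\<alpha> \<noteq> 0" for \<alpha>
    using that by (intro alg_word_mem star_subalgebra_generated generated_star_algebra_base) auto
  have Bmem: "alg_word b \<gamma> \<in> ?B" for \<gamma>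
    by (intro alg_word_mem star_subalgebra_generated generated_star_algebra_base disjI2) auto
  have F: "set (F ps) \<subseteq> ?A \<times> ?B" "alg_word ?f (pair_word ps) = pair_prod (F ps)" if "letter_pairs ps" for ps
  proof -
    show "set (F ps) \<subseteq> ?A \<times> ?B"
      using that Amem Bmem by (fastforce simp: F_def letter_pairs_def zero_nc_word_def)
    show "alg_word ?f (pair_word ps) = pair_prod (F ps)"
      by (induction ps) (auto simp: F_def alg_word_add alg_word_wordA alg_word_wordB)
  qed
  have mem: "\<beta>0 * pair_prod ps \<in> D" and cmv: "\<omega> (pair_prod ps) = \<omega> (prod_list (map fst ps)) * prod_list (map (\<lambda>(\<alpha>, \<beta>). \<tau> \<beta>) ps)"
    if "\<beta>0 \<in> ?B" "ps \<noteq> []" "set ps \<subseteq> ?A \<times> ?B" for \<beta>0 ps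
    using cm that unfolding cyclically_monotone_def by blast+
  have uD: "alg_word ?f (wordB \<beta> + pair_word us) \<in> D"
    unfolding alg_word_add alg_word_wordB F(2)[OF d(5)]
    by (intro mem Bmem F d) (use d in \<open>simp add: F_def\<close>)
  have qD: "alg_word ?f (pair_word qs) \<in> D"
  proof -
    have "1 * pair_prod (F qs) \<in> D"
      by (intro mem F d generated_star_algebra_base) (use d in \<open>auto simp: F_def\<close>)
    then show ?thesis by (simp add: F(2)[OF d(6)])
  qed
  have "\<omega> (alg_word ?f w) = \<omega> (alg_word ?f (wordB \<beta> + pair_word us) * alg_word ?f (pair_word qs))"
    unfolding d(7) by (simp only: alg_word_add)
  also have "\<dots> = \<omega> (alg_word ?f (pair_word qs) * alg_word ?f (wordB \<beta> + pair_word us))"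
    using tr uD qD by (auto simp: tracial_weight_def)
  also have "\<dots> = \<omega> (pair_prod (F rs))"
    unfolding alg_word_add[symmetric] d(8) F(2)[OF d(1)] ..
  also have "\<dots> = \<omega> (prod_list (map fst (F rs))) * prod_list (map (\<lambda>(\<alpha>, \<beta>). \<tau> \<beta>) (F rs))"
    by (rule cmv[OF generated_star_algebra_base]) (use d F in \<open>auto simp: F_def\<close>)
  also have "prod_list (map fst (F rs)) = alg_word a (sum_list (map fst rs))"
    by (induction rs) (auto simp: F_def alg_word_add)
  also have "\<omega> \<dots> = mA (sum_list (map fst rs))"
  proof (rule mA)
    obtain r rs' where rs: "rs = r # rs'" using d(2) by (cases rs) auto
    have "fst r \<noteq> 0" using d(1) unfolding rs by (auto simp: letter_pairs_def zero_nc_word_def)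
    then show "sum_list (map fst rs) \<noteq> 0" by (simp add: rs nc_word_add_eq_0)
  qed
  also have "map (\<lambda>(\<alpha>, \<beta>). \<tau> \<beta>) (F rs) = map (\<lambda>(\<alpha>, \<beta>). mB \<beta>) rs"
    by (auto simp: F_def mB')
  finally have "\<omega> (alg_word ?f w) = cyclic_value mA mB w" by (simp add: val pair_value_def)
  moreover have "alg_word ?f w \<in> D"
    using tr uD qD unfolding d(7) alg_word_add[of ?f _ "pair_word qs"] by (auto simp: tracial_weight_def star_subalgebra_def)
  ultimately show ?thesis by blast
qed

lemma model_poly_value:
  assumes model: "cyclic_monotone_model mA mB D \<omega> \<tau> a b" and mB0: "mB 0 = 1"
    and p: "p \<in> polys_on {w. count_A w \<ge> 2}"
  shows "\<omega> (alg_eval (case_sum a b) p) = nc_lin (cyclic_value mA mB) p"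
proof -
  have tr: "tracial_weight D \<omega>" using model by (simp add: cyclic_monotone_model_def)
  then have sub: "star_subalgebra D" and add: "\<And>x y. x \<in> D \<Longrightarrow> y \<in> D \<Longrightarrow> \<omega> (x + y) = \<omega> x + \<omega> y"
    and sc: "\<And>c x. x \<in> D \<Longrightarrow> \<omega> (c *\<^sub>C x) = c * \<omega> x"
    by (auto simp: tracial_weight_def)
  note D = sub[unfolded star_subalgebra_def]
  have "alg_eval (case_sum a b) p \<in> D \<and> \<omega> (alg_eval (case_sum a b) p) = nc_lin (cyclic_value mA mB) p"
    using p
  proof (induction rule: polys_on_induct)
    case (single w c)
    then show ?case using model_word_value[OF model mB0, of w] D sc by (simp add: alg_eval_single)
  next
    case (add p q)
    then show ?case using D \<open>\<And>x y. x \<in> D \<Longrightarrow> y \<in> D \<Longrightarrow> \<omega> (x + y) = \<omega> x + \<omega> y\<close> by (simp add: alg_eval_add nc_lin_add)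
  next
    case zero
    have "\<omega> 0 = 0" using sc[of 0 0] D by (simp add: scaleC_zero)
    then show ?case using D by simp
  qed
  then show ?thesis by blast
qed

subsection \<open>Eigenvalues of Hermitian matrices\<close>

lemma upper_triangular_pow:
  fixes B :: "'a::comm_ring_1 mat"
  assumes B: "B \<in> carrier_mat n n" and ut: "\<And>i j. j < i \<Longrightarrow> i < n \<Longrightarrow> B $$ (i, j) = 0"
  shows "i < n \<Longrightarrow> j \<le> i \<Longrightarrow> (B ^\<^sub>m p) $$ (i, j) = (if i = j then (B $$ (i, i)) ^ p else 0)"
proof (induction p arbitrary: i j)
  case 0
  then show ?case using B by auto
next
  case (Suc p)
  have Bp: "B ^\<^sub>m p \<in> carrier_mat n n" using B by simp
  have "(B ^\<^sub>m Suc p) $$ (i, j) = (\<Sum>l<n. (B ^\<^sub>m p) $$ (i, l) * B $$ (l, j))"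
    using Suc.prems by (simp add: scalar_prod_def lessThan_atLeast0 carrier_matD[OF Bp] carrier_matD[OF B])
  also have "\<dots> = (\<Sum>l<n. if l = i then (if i = j then (B $$ (i, i)) ^ Suc p else 0) else 0)"
  proof (intro sum.cong refl)
    fix l assume l: "l \<in> {..<n}"
    show "(B ^\<^sub>m p) $$ (i, l) * B $$ (l, j) = (if l = i then (if i = j then (B $$ (i, i)) ^ Suc p else 0) else 0)"
    proof (cases l i rule: linorder_cases)
      case less
      then show ?thesis using Suc.IH[of i l] Suc.prems by simp
    next
      case equal
      then show ?thesis using Suc.IH[of i i] Suc.prems ut[of j i] by (auto simp: mult.commute)
    next
      case greater
      then show ?thesis using ut[of j l] Suc.prems l by simp
    qed
  qed
  also have "\<dots> = (if i = j then (B $$ (i, i)) ^ Suc p else 0)" using Suc.prems by simp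
  finally show ?case .
qed

lemma hermitian_root_real:
  fixes X :: "complex mat"
  assumes X: "X \<in> carrier_mat n n" and herm: "mat_adjoint X = X"
    and root: "poly (char_poly X) a = 0"
  shows "a \<in> \<real>"
proof -
  have "eigenvalue X a" using root eigenvalue_root_char_poly[OF X] by simp
  then obtain v where v: "v \<in> carrier_vec n" "v \<noteq> 0\<^sub>v n" "X *\<^sub>v v = a \<cdot>\<^sub>v v"
    using X by (auto simp: eigenvalue_def eigenvector_def)
  let ?f = "\<lambda>i. v $ i"
  have s: "sq_norm n ?f \<noteq> 0"
  proof
    assume "sq_norm n ?f = 0"
    then have "v = 0\<^sub>v n" using sq_norm_eq_0[of n ?f] v(1) by (intro eq_vecI) auto
    then show False using v(2) by simp
  qed
  have Xv: "(\<Sum>j<n. X $$ (i, j) * v $ j) = a * v $ i" if "i < n" for i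
    using arg_cong[OF v(3), of "\<lambda>w. w $ i"] that X v(1)
    by (simp add: scalar_prod_def lessThan_atLeast0)
  have "mat_form n X ?f ?f = (\<Sum>i<n. cnj (v $ i) * (\<Sum>j<n. X $$ (i, j) * v $ j))"
    unfolding mat_form_def by (simp add: sum_distrib_left mult.assoc)
  also have "\<dots> = (\<Sum>i<n. a * (v $ i * cnj (v $ i)))"
    by (rule sum.cong[OF refl]) (simp add: Xv)
  also have "\<dots> = a * of_real (sq_norm n ?f)"
    unfolding sq_norm_def of_real_sum complex_norm_square by (simp add: sum_distrib_left)
  finally have e: "mat_form n X ?f ?f = a * of_real (sq_norm n ?f)" .
  have "cnj (mat_form n X ?f ?f) = mat_form n X ?f ?f"
    using mat_form_adjoint[OF X, of ?f ?f] herm by simp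
  then have "cnj a = a" using s by (simp add: e)
  then show ?thesis by (metis Reals_cnj_iff)
qed

text \<open>A Schur triangular form suffices: its diagonal gives the characteristic polynomial as
  well as the traces of all powers. Symmetry enters through the reality of the roots.\<close>

lemma hermitian_spectrum:
  fixes X :: "complex mat"
  assumes X: "X \<in> carrier_mat n n" and herm: "mat_adjoint X = X"
  obtains es :: "real list" where "char_poly X = (\<Prod>a\<leftarrow>es. [:- complex_of_real a, 1:])"
    "\<And>p. mat_Tr (X ^\<^sub>m p) = complex_of_real (\<Sum>a\<leftarrow>es. a ^ p)"
proof -
  obtain as where as: "char_poly X = (\<Prod>a\<leftarrow>as. [:- a, 1:])" using char_poly_factorized[OF X] by blast
  obtain B where B: "B \<in> carrier_mat n n" "upper_triangular B" "similar_mat X B"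
    using schur_decomposition_exists[OF X as] by blast
  have cp: "char_poly X = (\<Prod>a\<leftarrow>diag_mat B. [:- a, 1:])"
    using char_poly_similar[OF B(3)] char_poly_upper_triangular[OF B(1,2)] by simp
  obtain P Q where wit: "similar_mat_wit X B P Q" using B(3) by (auto simp: similar_mat_def)
  have PQ: "P \<in> carrier_mat n n" "Q \<in> carrier_mat n n" "Q * P = 1\<^sub>m n"
    using similar_mat_witD2[OF X wit] by auto
  have "a \<in> \<real>" if "a \<in> set (diag_mat B)" for a
  proof (rule hermitian_root_real[OF X herm])
    show "poly (char_poly X) a = 0" unfolding cp
      using that by (induction "diag_mat B" arbitrary: B) (auto simp: poly_prod_list prod_list_zero_iff)
  qed
  then have re: "map (\<lambda>a. complex_of_real (Re a)) (diag_mat B) = diag_mat B"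
    by (intro map_idI) (auto elim: Reals_cases)
  define es where "es = map Re (diag_mat B)"
  have es: "map complex_of_real es = diag_mat B" using re by (simp add: es_def o_def)
  show thesis
  proof (rule that[of es])
    show "char_poly X = (\<Prod>a\<leftarrow>es. [:- complex_of_real a, 1:])"
      unfolding cp es[symmetric] by (simp add: o_def)
    fix p
    have Bp: "B ^\<^sub>m p \<in> carrier_mat n n" using B(1) by simp
    have "X ^\<^sub>m p = P * B ^\<^sub>m p * Q" by (rule similar_mat_wit_pow_id[OF wit])
    then have "mat_Tr (X ^\<^sub>m p) = mat_Tr (Q * (P * B ^\<^sub>m p))"
      using mat_Tr_commute[OF mult_carrier_mat[OF PQ(1) Bp] PQ(2)] by simp
    also have "Q * (P * B ^\<^sub>m p) = Q * P * B ^\<^sub>m p" by (rule assoc_mult_mat[OF PQ(2,1) Bp, symmetric])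
    also have "\<dots> = B ^\<^sub>m p" unfolding PQ(3) left_mult_one_mat[OF Bp] ..
    also have "mat_Tr (B ^\<^sub>m p) = (\<Sum>i<n. (B $$ (i, i)) ^ p)"
      unfolding mat_Tr_def using upper_triangular_pow[OF B(1)] B
      by (intro sum.cong) (auto simp: carrier_matD[OF Bp] carrier_matD[OF B(1)] upper_triangularD[OF B(2)])
    also have "\<dots> = (\<Sum>a\<leftarrow>diag_mat B. a ^ p)"
      using B(1) by (simp add: diag_mat_def o_def interv_sum_list_conv_sum_set_nat lessThan_atLeast0)
    also have "\<dots> = complex_of_real (\<Sum>a\<leftarrow>es. a ^ p)"
      unfolding es[symmetric] by (induction es) simp_all
    finally show "mat_Tr (X ^\<^sub>m p) = complex_of_real (\<Sum>a\<leftarrow>es. a ^ p)" .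
  qed
qed

lemma order_prod_linear_factors:
  "Polynomial.order (complex_of_real t) (\<Prod>a\<leftarrow>es. [:- complex_of_real a, 1:]) = count_list es t"
proof (induction es)
  case Nil
  then show ?case by (simp add: order_0I)
next
  case (Cons a es)
  have nz: "(\<Prod>a\<leftarrow>es. [:- complex_of_real a, 1:]) \<noteq> 0" by (auto simp: prod_list_zero_iff)
  have "Polynomial.order (complex_of_real t) [:- complex_of_real a, 1:] = (if a = t then 1 else 0)"
    using order_power_n_n[of "complex_of_real a" 1] by (auto intro!: order_0I)
  then show ?case using nz Cons by (simp add: order_mult del: mult_pCons_left)
qed

lemma card_nth_default:
  assumes "t \<noteq> (0::real)"
  shows "finite {i. nth_default 0 xs i = t}" "card {i. nth_default 0 xs i = t} = count_list xs t"
proof -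
  have e: "{i. nth_default 0 xs i = t} = {i. i < length xs \<and> xs ! i = t}"
    using assms by (auto simp: nth_default_def)
  show "finite {i. nth_default 0 xs i = t}" unfolding e by simp
  show "card {i. nth_default 0 xs i = t} = count_list xs t"
    unfolding e count_list_eq_length_filter length_filter_conv_card by (intro arg_cong[of _ _ card]) auto
qed

lemma sum_nth_default:
  assumes "f 0 = (0::real)" "length xs \<le> N"
  shows "(\<Sum>i<N. f (nth_default 0 xs i)) = (\<Sum>a\<leftarrow>xs. f a)"
proof -
  have "(\<Sum>i<N. f (nth_default 0 xs i)) = (\<Sum>i<length xs. f (nth_default 0 xs i))"
    using assms by (intro sum.mono_neutral_right) (auto simp: nth_default_def)
  also have "\<dots> = (\<Sum>i<length xs. f (xs ! i))" by (simp add: nth_default_def)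
  finally show ?thesis by (simp add: sum_list_sum_nth lessThan_atLeast0)
qed

lemma list_sorted_spectrum:
  fixes es :: "real list"
  obtains z where "sorted_spectrum z" "\<And>t. t \<noteq> 0 \<Longrightarrow> finite {k. z k = t} \<and> card {k. z k = t} = count_list es t"
    "\<And>p. p \<ge> 1 \<Longrightarrow> (\<lambda>k. z k ^ p) sums (\<Sum>a\<leftarrow>es. a ^ p)"
proof -
  \<comment> \<open>Zero eigenvalues are discarded: they contribute to no power sum with p >= 1 and
    return as the padding of \<open>nth_default\<close>.\<close>
  define xs where "xs = rev (sort (filter (\<lambda>a. 0 < a) es))"
  define ys where "ys = sort (filter (\<lambda>a. a < 0) es)"
  define z where "z k = (if even k then nth_default 0 xs (k div 2) else nth_default 0 ys (k div 2))" for k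
  have z1: "z (2 * i) = nth_default 0 xs i" and z2: "z (2 * i + 1) = nth_default 0 ys i" for i
    by (simp_all add: z_def)
  have xpos: "0 < xs ! i" if "i < length xs" for i
    using nth_mem[OF that] by (auto simp: xs_def)
  have yneg: "ys ! i < 0" if "i < length ys" for i
    using nth_mem[OF that] by (auto simp: ys_def)
  have sx: "xs ! j \<le> xs ! i" if "i \<le> j" "j < length xs" for i j
    using that unfolding xs_def by (simp add: rev_nth sorted_nth_mono)
  have sy: "ys ! i \<le> ys ! j" if "i \<le> j" "j < length ys" for i j
    using that unfolding ys_def by (simp add: sorted_nth_mono)
  have sorted: "sorted_spectrum z"
    unfolding sorted_spectrum_def z1 z2 decseq_def incseq_def
    using sx sy xpos yneg by (auto simp: nth_default_def less_imp_le)
  have cx: "count_list xs t = (if 0 < t then count_list es t else 0)" for t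
  proof -
    have "count_list xs t = count (mset (filter (\<lambda>a. 0 < a) es)) t" by (simp add: xs_def count_mset[symmetric])
    then show ?thesis by (simp add: count_mset[symmetric])
  qed
  have cy: "count_list ys t = (if t < 0 then count_list es t else 0)" for t
  proof -
    have "count_list ys t = count (mset (filter (\<lambda>a. a < 0) es)) t" by (simp add: ys_def count_mset[symmetric])
    then show ?thesis by (simp add: count_mset[symmetric])
  qed
  have count: "finite {k. z k = t} \<and> card {k. z k = t} = count_list es t" if t: "t \<noteq> 0" for t
  proof -
    have "{k. z k = t} = (\<lambda>i. 2 * i) ` {i. nth_default 0 xs i = t} \<union> (\<lambda>i. 2 * i + 1) ` {i. nth_default 0 ys i = t}"
    proof (intro Set.set_eqI iffI)
      fix k assume "k \<in> {k. z k = t}"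
      then show "k \<in> (\<lambda>i. 2 * i) ` {i. nth_default 0 xs i = t} \<union> (\<lambda>i. 2 * i + 1) ` {i. nth_default 0 ys i = t}"
        by (cases "even k") (auto simp: z_def elim!: evenE oddE)
    next
      fix k assume "k \<in> (\<lambda>i. 2 * i) ` {i. nth_default 0 xs i = t} \<union> (\<lambda>i. 2 * i + 1) ` {i. nth_default 0 ys i = t}"
      then show "k \<in> {k. z k = t}" using z1 z2 by auto
    qed
    moreover have "card ((\<lambda>i. 2 * i) ` {i. nth_default 0 xs i = t} \<union> (\<lambda>i. 2 * i + 1) ` {i. nth_default 0 ys i = t})
        = count_list xs t + count_list ys t"
    proof (subst card_Un_disjoint)
      show "(\<lambda>i. 2 * i) ` {i. nth_default 0 xs i = t} \<inter> (\<lambda>i. 2 * i + 1) ` {i. nth_default 0 ys i = t} = {}"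
        by auto presburger
      have "inj_on (\<lambda>i::nat. 2 * i) A" "inj_on (\<lambda>i::nat. 2 * i + 1) A" for A by (auto intro: inj_onI)
      then show "card ((\<lambda>i. 2 * i) ` {i. nth_default 0 xs i = t}) + card ((\<lambda>i. 2 * i + 1) ` {i. nth_default 0 ys i = t})
          = count_list xs t + count_list ys t"
        by (simp add: card_image card_nth_default[OF t])
    qed (use card_nth_default[OF t] in auto)
    ultimately show ?thesis using card_nth_default(1)[OF t] t by (simp add: cx cy)
  qed
  have sums: "(\<lambda>k. z k ^ p) sums (\<Sum>a\<leftarrow>es. a ^ p)" if p: "p \<ge> 1" for p
  proof -
    define N where "N = length xs + length ys"
    have perm: "(\<Sum>a\<leftarrow>us. a ^ p) = (\<Sum>a\<leftarrow>vs. a ^ p)" if "mset us = mset vs" for us vs :: "real list"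
    proof -
      have "sum_mset (mset (map (\<lambda>a. a ^ p) us)) = sum_mset (mset (map (\<lambda>a. a ^ p) vs))"
        unfolding mset_map that ..
      then show ?thesis by (simp only: sum_mset_sum_list)
    qed
    have split: "(\<Sum>k<2 * N. z k ^ p) = (\<Sum>i<N. z (2 * i) ^ p + z (2 * i + 1) ^ p)" for N
      by (induction N) simp_all
    have "(\<lambda>k. z k ^ p) sums (\<Sum>k<2 * N. z k ^ p)"
    proof (rule sums_finite)
      fix k assume "k \<notin> {..<2 * N}"
      then have "k div 2 \<ge> N" by auto
      then show "z k ^ p = 0" using p by (simp add: z_def nth_default_def N_def)
    qed simp
    also have "(\<Sum>k<2 * N. z k ^ p) = (\<Sum>a\<leftarrow>xs. a ^ p) + (\<Sum>a\<leftarrow>ys. a ^ p)"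
      unfolding split z1 z2 sum.distrib using p
      by (subst (1 2) sum_nth_default[where f = "\<lambda>a. a ^ p"]) (auto simp: N_def)
    also have "(\<Sum>a\<leftarrow>xs. a ^ p) = (\<Sum>a\<leftarrow>filter (\<lambda>a. 0 < a) es. a ^ p)"
      by (rule perm) (simp add: xs_def)
    also have "(\<Sum>a\<leftarrow>ys. a ^ p) = (\<Sum>a\<leftarrow>filter (\<lambda>a. a < 0) es. a ^ p)"
      by (rule perm) (simp add: ys_def)
    also have "(\<Sum>a\<leftarrow>filter (\<lambda>a. 0 < a) es. a ^ p) + (\<Sum>a\<leftarrow>filter (\<lambda>a. a < 0) es. a ^ p) = (\<Sum>a\<leftarrow>es. a ^ p)"
      using p by (induction es) auto
    finally show ?thesis .
  qed
  show thesis by (rule that[OF sorted count sums])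
qed

subsection \<open>Diagonal operators\<close>

definition ell2_unit :: "nat \<Rightarrow> ell2" where
  "ell2_unit k = Abs_ell2 (\<lambda>n. if n = k then 1 else 0)"

lemma ell2_nth_unit: "ell2_nth (ell2_unit k) n = (if n = k then 1 else 0)"
proof -
  have "summable (\<lambda>n. (cmod (if n = k then 1 else 0))\<^sup>2)"
    by (rule summable_finite[of "{k}"]) auto
  then show ?thesis by (simp add: ell2_unit_def Abs_ell2_inverse)
qed

lemma cinner_unit_left: "cinner (ell2_unit k) v = ell2_nth v k"
  unfolding cinner_ell2_def by (subst suminf_finite[of "{k}"]) (auto simp: ell2_nth_unit)

lemma ell2_eqI: "(\<And>k. ell2_nth v k = ell2_nth w k) \<Longrightarrow> v = w"
  by (metis ell2_nth_inject ext)

lemma ell2_nth_sum: "ell2_nth (\<Sum>i\<in>I. f i) k = (\<Sum>i\<in>I. ell2_nth (f i) k)"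
  unfolding cinner_unit_left[symmetric] by (rule cinner_sum_right)

lemma ell2_nth_scaleC: "ell2_nth (c *\<^sub>C v) k = c * ell2_nth v k"
  by (simp add: scaleC_ell2.rep_eq)

lemma inj_ell2_unit: "inj ell2_unit"
  by (rule injI) (metis ell2_nth_unit zero_neq_one)

lemma orthonormal_basis_ell2: "orthonormal_basis (range ell2_unit)"
  unfolding orthonormal_basis_def
proof (intro conjI ballI)
  fix e f assume "e \<in> range ell2_unit" "f \<in> range ell2_unit"
  then show "cinner e f = (if e = f then 1 else 0)"
    using inj_ell2_unit by (auto simp: cinner_unit_left ell2_nth_unit inj_def)
next
  have "v \<in> closure (cspan (range ell2_unit))" for v
    unfolding closure_approachable
  proof (intro allI impI)
    fix e :: real assume e: "e > 0"
    have "(\<lambda>K. suminf (\<lambda>n. (cmod (ell2_nth v (n + K)))\<^sup>2)) \<longlonglongrightarrow> 0"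
      by (rule suminf_exist_split2[OF ell2_summable])
    then have "\<forall>\<^sub>F K in sequentially. suminf (\<lambda>n. (cmod (ell2_nth v (n + K)))\<^sup>2) < e\<^sup>2"
      using e by (intro order_tendstoD(2)) auto
    then obtain K where K: "suminf (\<lambda>n. (cmod (ell2_nth v (n + K)))\<^sup>2) < e\<^sup>2"
      by (meson eventually_happens' sequentially_bot)
    define w where "w = (\<Sum>k<K. ell2_nth v k *\<^sub>C ell2_unit k)"
    have w: "w \<in> cspan (range ell2_unit)"
      unfolding w_def cspan_def by (intro cvs.span_sum cvs.span_scale cvs.span_base) auto
    have nth: "ell2_nth (v - w) n = (if n < K then 0 else ell2_nth v n)" for n
      by (auto simp: minus_ell2.rep_eq w_def ell2_nth_sum ell2_nth_scaleC ell2_nth_unit if_distrib cong: if_cong)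
    have "(norm (v - w))\<^sup>2 = suminf (\<lambda>n. (cmod (ell2_nth (v - w) (n + K)))\<^sup>2) + (\<Sum>n<K. (cmod (ell2_nth (v - w) n))\<^sup>2)"
      unfolding norm_ell2_sq by (rule suminf_split_initial_segment[OF ell2_summable])
    also have "\<dots> < e\<^sup>2" using K by (simp add: nth)
    finally have "norm (v - w) < e" by (rule power2_less_imp_less) (use e in simp)
    then show "\<exists>y\<in>cspan (range ell2_unit). dist y v < e" using w by (auto simp: dist_norm norm_minus_commute)
  qed
  then show "closure (cspan (range ell2_unit)) = UNIV" by auto
qed

text \<open>The entries are the intended ones as soon as \<open>l\<close> is bounded, which makes
  the sequence square summable; hence the bound \<open>R\<close> in the facts below.\<close>

definition diag_op :: "(nat \<Rightarrow> real) \<Rightarrow> ell2 \<Rightarrow> ell2" where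
  "diag_op l v = Abs_ell2 (\<lambda>n. of_real (l n) * ell2_nth v n)"

lemma ell2_nth_diag:
  assumes R: "\<And>k. \<bar>l k\<bar> \<le> R"
  shows "ell2_nth (diag_op l v) n = of_real (l n) * ell2_nth v n"
proof -
  have "summable (\<lambda>n. (cmod (of_real (l n) * ell2_nth v n))\<^sup>2)"
  proof (rule summable_comparison_test')
    show "summable (\<lambda>n. R\<^sup>2 * (cmod (ell2_nth v n))\<^sup>2)" by (intro summable_mult ell2_summable)
    fix n
    have "\<bar>l n\<bar>\<^sup>2 \<le> R\<^sup>2" using R[of n] by (intro power_mono) auto
    then show "norm ((cmod (of_real (l n) * ell2_nth v n))\<^sup>2) \<le> R\<^sup>2 * (cmod (ell2_nth v n))\<^sup>2"
      by (simp add: norm_mult power_mult_distrib mult_right_mono)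
  qed
  then show ?thesis by (simp add: diag_op_def Abs_ell2_inverse)
qed

lemma norm_diag_le:
  assumes R: "\<And>k. \<bar>l k\<bar> \<le> R"
  shows "norm (diag_op l v) \<le> R * norm v"
proof (rule power2_le_imp_le)
  have R0: "0 \<le> R" using R[of 0] by linarith
  have "(norm (diag_op l v))\<^sup>2 = suminf (\<lambda>n. (cmod (ell2_nth (diag_op l v) n))\<^sup>2)" by (rule norm_ell2_sq)
  also have "\<dots> \<le> suminf (\<lambda>n. R\<^sup>2 * (cmod (ell2_nth v n))\<^sup>2)"
  proof (intro suminf_le summable_mult ell2_summable)
    fix n
    have "\<bar>l n\<bar>\<^sup>2 \<le> R\<^sup>2" using R[of n] by (intro power_mono) auto
    then show "(cmod (ell2_nth (diag_op l v) n))\<^sup>2 \<le> R\<^sup>2 * (cmod (ell2_nth v n))\<^sup>2"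
      by (simp add: ell2_nth_diag[of l R, OF R] norm_mult power_mult_distrib mult_right_mono)
  qed
  also have "\<dots> = (R * norm v)\<^sup>2"
    unfolding power_mult_distrib norm_ell2_sq by (rule suminf_mult[OF ell2_summable])
  finally show "(norm (diag_op l v))\<^sup>2 \<le> (R * norm v)\<^sup>2" .
  show "0 \<le> R * norm v" using R0 by simp
qed

lemma bounded_clinear_diag:
  assumes R: "\<And>k. \<bar>l k\<bar> \<le> R"
  shows "bounded_clinear (diag_op l)"
  by (rule bounded_clinearI[where K = R])
    (auto intro!: ell2_eqI norm_diag_le[of l R, OF R] simp: ell2_nth_diag[of l R, OF R] plus_ell2.rep_eq scaleC_ell2.rep_eq algebra_simps)

lemma selfadjoint_diag:
  assumes R: "\<And>k. \<bar>l k\<bar> \<le> R"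
  shows "selfadjoint_op (diag_op l)"
proof -
  have "cadjoint (diag_op l) = diag_op l"
  proof (rule cadjoint_unique[OF orthonormal_basis_ell2])
    show "cinner (diag_op l x) y = cinner x (diag_op l y)" for x y
      unfolding cinner_ell2_def ell2_nth_diag[of l R, OF R] by (simp add: mult_ac)
  qed
  then show ?thesis by (simp add: selfadjoint_op_def bounded_clinear_diag[of l R, OF R])
qed

lemma diag_unit:
  assumes R: "\<And>k. \<bar>l k\<bar> \<le> R"
  shows "diag_op l (ell2_unit k) = of_real (l k) *\<^sub>C ell2_unit k"
  by (rule ell2_eqI) (simp add: ell2_nth_diag[of l R, OF R] ell2_nth_scaleC ell2_nth_unit)

lemma norm_ell2_unit [simp]: "norm (ell2_unit k) = 1"
proof -
  have "complex_of_real ((norm (ell2_unit k))\<^sup>2) = 1"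
    by (simp add: cinner_self[symmetric] cinner_unit_left ell2_nth_unit del: of_real_power)
  then show ?thesis by (simp add: power2_eq_1_iff del: of_real_power) (metis norm_ge_zero not_one_le_zero neg_0_le_iff_le le_minus_one_simps(3))
qed

lemma hilbert_schmidt_diag:
  assumes s: "summable (\<lambda>k. (l k)\<^sup>2)"
  shows "hilbert_schmidt (diag_op l)"
proof -
  obtain R where R: "R > 0" "\<And>k. \<bar>l k\<bar> \<le> R" using summable_sq_bounded[OF s] by blast
  have "(\<lambda>k. (l k)\<^sup>2) summable_on UNIV" using s by (subst summable_on_UNIV_nonneg_real_iff) auto
  then have "(\<lambda>e. (norm (diag_op l e))\<^sup>2) summable_on range ell2_unit"
    by (subst summable_on_reindex[OF inj_ell2_unit]) (simp add: o_def diag_unit[of l R, OF R(2)] norm_scaleC)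
  then show ?thesis
    unfolding hilbert_schmidt_def using bounded_clinear_diag[of l R, OF R(2)] orthonormal_basis_ell2 by blast
qed

lemma diag_funpow:
  assumes R: "\<And>k. \<bar>l k\<bar> \<le> R"
  shows "(diag_op l ^^ p) = diag_op (\<lambda>k. l k ^ p)"
proof -
  have Rp: "\<bar>l k ^ p\<bar> \<le> R ^ p" for k p using R[of k] by (simp add: power_abs power_mono)
  show ?thesis
  proof (induction p)
    case 0
    have "ell2_nth (diag_op (\<lambda>k. 1) v) k = ell2_nth v k" for v k
      using ell2_nth_diag[of "\<lambda>k. 1" 1] by simp
    then show ?case by (auto intro!: ell2_eqI)
  next
    case (Suc p)
    show ?case
      unfolding funpow.simps Suc
      by (auto intro!: ell2_eqI simp: ell2_nth_diag[of l R, OF R] ell2_nth_diag[of "\<lambda>k. l k ^ p", OF Rp] ell2_nth_diag[of "\<lambda>k. l k * l k ^ p", OF Rp[of _ "Suc p", simplified]])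
  qed
qed

text \<open>\<open>op_trace\<close> sums over an unspecified basis, so the sums over basis vectors
  and over coordinates are exchanged. Parseval for the coordinate vectors gives 1 for each inner
  sum, and summability of the absolute values of \<open>l\<close> justifies the exchange.\<close>

lemma op_trace_diag:
  assumes s: "summable (\<lambda>k. \<bar>l k\<bar>)"
  shows "op_trace (diag_op l) = of_real (suminf l)"
proof -
  define E where "E = (SOME E :: ell2 set. orthonormal_basis E)"
  have E: "orthonormal_basis E" unfolding E_def by (rule someI[of orthonormal_basis, OF orthonormal_basis_ell2])
  have "(\<lambda>k. \<bar>l k\<bar>) \<longlonglongrightarrow> 0" by (rule summable_LIMSEQ_zero[OF s])
  then have "Bseq (\<lambda>k. \<bar>l k\<bar>)" using convergent_imp_Bseq convergentI by blast
  then obtain R where R: "\<And>k. \<bar>l k\<bar> \<le> R" by (auto simp: Bseq_def)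
  let ?f = "\<lambda>k e. of_real (l k) * of_real ((cmod (ell2_nth e k))\<^sup>2) :: complex"
  have pars: "((\<lambda>e. (cmod (ell2_nth e k))\<^sup>2) has_sum 1) E" for k
  proof -
    have "cmod (cinner e (ell2_unit k)) = cmod (ell2_nth e k)" for e
      by (metis cinner_commute cinner_unit_left complex_mod_cnj)
    then show ?thesis using parseval[OF E, of "ell2_unit k"] by simp
  qed
  have inner1: "((\<lambda>e. ?f k e) has_sum of_real (l k)) E" for k
    using has_sum_cmult_right[OF has_sum_of_real[OF pars[of k]], of "of_real (l k)"] by simp
  have inner2: "((\<lambda>k. ?f k e) has_sum cinner e (diag_op l e)) UNIV" for e
  proof (rule norm_summable_imp_has_sum)
    have "summable (\<lambda>k. R * (cmod (ell2_nth e k))\<^sup>2)" by (intro summable_mult ell2_summable)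
    then show "summable (\<lambda>k. norm (?f k e))"
      by (rule summable_comparison_test') (use R in \<open>simp add: norm_mult norm_power mult_right_mono\<close>)
    have "?f k e = cnj (ell2_nth e k) * ell2_nth (diag_op l e) k" for k
      unfolding ell2_nth_diag[of l R, OF R] complex_norm_square by (simp add: mult_ac)
    then show "(\<lambda>k. ?f k e) sums cinner e (diag_op l e)"
      unfolding cinner_ell2_def by (simp only: summable_sums[OF ell2_summable_cinner])
  qed
  have "(\<lambda>(k, e). \<bar>l k\<bar> * (cmod (ell2_nth e k))\<^sup>2) summable_on (UNIV \<times> E)"
  proof (rule summable_on_SigmaI)
    show "((\<lambda>e. case (k, e) of (k, e) \<Rightarrow> \<bar>l k\<bar> * (cmod (ell2_nth e k))\<^sup>2) has_sum \<bar>l k\<bar>) E" for k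
      using has_sum_cmult_right[OF pars[of k], of "\<bar>l k\<bar>"] by simp
    show "(\<lambda>k. \<bar>l k\<bar>) summable_on UNIV" using s by (subst summable_on_UNIV_nonneg_real_iff) auto
  qed auto
  then have "(\<lambda>ke. norm ((\<lambda>(k, e). ?f k e) ke)) summable_on (UNIV \<times> E)"
    by (rule summable_on_cong[THEN iffD2, rotated]) (auto simp: norm_mult norm_power)
  then have "(\<lambda>(k, e). ?f k e) summable_on (UNIV \<times> E)"
    by (rule abs_summable_summable)
  from infsum_swap_banach[OF this]
  have "infsum (\<lambda>e. infsum (\<lambda>k. ?f k e) UNIV) E = infsum (\<lambda>k. infsum (\<lambda>e. ?f k e) E) UNIV" by simp
  also have "(\<lambda>k. infsum (\<lambda>e. ?f k e) E) = (\<lambda>k. of_real (l k))" using infsumI[OF inner1] by blast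
  also have "(\<lambda>e. infsum (\<lambda>k. ?f k e) UNIV) = (\<lambda>e. cinner e (diag_op l e))" using infsumI[OF inner2] by blast
  also have "infsum (\<lambda>k. complex_of_real (l k)) UNIV = of_real (suminf l)"
  proof (rule infsumI, rule norm_summable_imp_has_sum)
    show "summable (\<lambda>k. norm (complex_of_real (l k)))" using s by simp
    show "(\<lambda>k. complex_of_real (l k)) sums of_real (suminf l)"
      by (rule sums_of_real) (rule summable_sums[OF summable_rabs_cancel[OF s]])
  qed
  finally show ?thesis unfolding op_trace_def E_def[symmetric] .
qed

lemma op_trace_diag_pow:
  assumes s: "summable (\<lambda>k. (l k)\<^sup>2)" and p: "p \<ge> 2"
  shows "op_trace (diag_op l ^^ p) = of_real (suminf (\<lambda>k. l k ^ p))"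
proof -
  obtain R where R: "R > 0" "\<And>k. \<bar>l k\<bar> \<le> R" using summable_sq_bounded[OF s] by blast
  have "(\<lambda>k. \<bar>l k ^ p\<bar>) = (\<lambda>k. (l k)\<^sup>2 * \<bar>l k\<bar> ^ (p - 2))"
    using sq_mult_power[OF p, of "\<bar>l _\<bar>"] by (auto simp: power_abs fun_eq_iff)
  then have "summable (\<lambda>k. \<bar>l k ^ p\<bar>)"
    using summable_sq_times[OF s, of "\<lambda>x. \<bar>x\<bar> ^ (p - 2)"] by (simp add: continuous_intros)
  then show ?thesis unfolding diag_funpow[of l R, OF R(2)] by (rule op_trace_diag)
qed

lemma op_multiplicity_diag:
  assumes s: "summable (\<lambda>k. (l k)\<^sup>2)" and t: "t \<noteq> 0"
  shows "op_multiplicity (diag_op l) t = card {k. l k = t}"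
proof -
  obtain R where R: "R > 0" "\<And>k. \<bar>l k\<bar> \<le> R" using summable_sq_bounded[OF s] by blast
  let ?K = "{k. l k = t}"
  have fin: "finite ?K" by (rule finite_level[OF s t])
  have eig: "diag_op l x = complex_of_real t *\<^sub>C x \<longleftrightarrow> (\<forall>k. l k \<noteq> t \<longrightarrow> ell2_nth x k = 0)" for x
  proof -
    have "diag_op l x = complex_of_real t *\<^sub>C x \<longleftrightarrow> (\<forall>k. ell2_nth (diag_op l x) k = ell2_nth (complex_of_real t *\<^sub>C x) k)"
      using ell2_eqI by metis
    then show ?thesis by (auto simp: ell2_nth_diag[of l R, OF R(2)] ell2_nth_scaleC)
  qed
  have "{x. diag_op l x = complex_of_real t *\<^sub>C x} = cvs.span (ell2_unit ` ?K)"
  proof (intro Set.set_eqI iffI)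
    fix x assume "x \<in> {x. diag_op l x = complex_of_real t *\<^sub>C x}"
    then have x: "l k \<noteq> t \<Longrightarrow> ell2_nth x k = 0" for k using eig by auto
    have "x = (\<Sum>k\<in>?K. ell2_nth x k *\<^sub>C ell2_unit k)"
      by (rule ell2_eqI) (use x fin in \<open>auto simp: ell2_nth_sum ell2_nth_scaleC ell2_nth_unit if_distrib cong: if_cong\<close>)
    then show "x \<in> cvs.span (ell2_unit ` ?K)"
      by (metis (no_types, lifting) cvs.span_base cvs.span_scale cvs.span_sum imageI)
  next
    fix x assume "x \<in> cvs.span (ell2_unit ` ?K)"
    then show "x \<in> {x. diag_op l x = complex_of_real t *\<^sub>C x}"
      unfolding mem_Collect_eq eig
      by (induction rule: cvs.span_induct_alt)
        (auto simp: zero_ell2.rep_eq plus_ell2.rep_eq ell2_nth_scaleC ell2_nth_unit split: if_splits)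
  qed
  moreover have "cvs.independent (ell2_unit ` ?K)"
  proof (rule cvs.independent_if_scalars_zero)
    fix f x assume sum: "(\<Sum>x\<in>ell2_unit ` ?K. f x *\<^sub>C x) = 0" and x: "x \<in> ell2_unit ` ?K"
    have "cinner x (\<Sum>x\<in>ell2_unit ` ?K. f x *\<^sub>C x) = f x"
      using cinner_orthonormal_sum[OF orthonormal_basis_orthonormal[OF orthonormal_basis_ell2], of "ell2_unit ` ?K" x f] fin x
      by auto
    then show "f x = 0" unfolding sum by simp
  qed (use fin in simp)
  ultimately have "op_multiplicity (diag_op l) t = card (ell2_unit ` ?K)"
    unfolding op_multiplicity_def cdim_def by (simp add: cvs.dim_eq_card_independent)
  then show ?thesis by (simp add: card_image[OF inj_on_subset[OF inj_ell2_unit]])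
qed

section \<open>The limit functional of a fixed realization\<close>

text \<open>What a single realization has to satisfy; no randomness is left in this locale.
  Convergence is required at words only and extended linearly below.\<close>

locale good_sequence = trace_hs_sequence t h
  for t :: "nat \<Rightarrow> ('k + 'l) nc_poly \<Rightarrow> complex" and h +
  fixes mA :: "'k nc_word \<Rightarrow> complex" and y :: "'l \<Rightarrow> 'c::complex_star_algebra" and \<tau>\<^sub>0 :: "'c \<Rightarrow> complex"
  assumes t_star: "t n (star p) = cnj (t n p)"
    and np: "nc_probability_space \<tau>\<^sub>0"
    and limA: "w \<noteq> 0 \<Longrightarrow> (\<lambda>n. t n (Poly_Mapping.single (wordA w) 1)) \<longlonglongrightarrow> mA w"
    and limB: "(\<lambda>n. t n (Poly_Mapping.single (wordB w') 1) / of_nat (Suc n)) \<longlonglongrightarrow> \<tau>\<^sub>0 (alg_word y w')"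
    and centered: "u \<noteq> 0 \<Longrightarrow> v \<noteq> 0 \<Longrightarrow>
      (\<lambda>n. t n (Poly_Mapping.single (wordA u) 1 *
        (Poly_Mapping.single (wordB w') 1 - (t n (Poly_Mapping.single (wordB w') 1) / of_nat (Suc n)) *\<^sub>C 1) *
        Poly_Mapping.single (wordA v) 1)) \<longlonglongrightarrow> 0 \<and>
      (\<lambda>n. h n (Poly_Mapping.single (wordA u) 1 *
        (Poly_Mapping.single (wordB w') 1 - (t n (Poly_Mapping.single (wordB w') 1) / of_nat (Suc n)) *\<^sub>C 1) *
        Poly_Mapping.single (wordA v) 1)) \<longlonglongrightarrow> 0"
    and approx: "e > 0 \<Longrightarrow> \<exists>Y\<in>nonconst_polys. \<exists>Z\<in>nonconst_polys.
      Re (nc_lin mA (star (nc_var i - Y * Z) * (nc_var i - Y * Z))) < e"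
begin

abbreviation mB :: "'l nc_word \<Rightarrow> complex" where "mB w \<equiv> \<tau>\<^sub>0 (alg_word y w)"

abbreviation polysA :: "('k + 'l) nc_poly set" where "polysA \<equiv> polys_on (wordA ` (- {0}))"

abbreviation polysB :: "('k + 'l) nc_poly set" where "polysB \<equiv> polys_on (range wordB)"

text \<open>Setting the first family to zero is a unital star-homomorphism, so \<open>\<tau>\<close>
  inherits the properties of \<open>\<tau>\<^sub>0\<close> on the entire free algebra. On
  \<open>polysB\<close> it is the limit of the normalized traces.\<close>

definition \<tau> :: "('k + 'l) nc_poly \<Rightarrow> complex" where
  "\<tau> p = \<tau>\<^sub>0 (alg_eval (case_sum (\<lambda>_. 0) y) p)"

definition embA :: "'k nc_poly \<Rightarrow> ('k + 'l) nc_poly" where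
  "embA = alg_eval (\<lambda>i. nc_var (Inl i))"

lemma \<tau>0_add: "\<tau>\<^sub>0 (p + q) = \<tau>\<^sub>0 p + \<tau>\<^sub>0 q" and \<tau>0_scaleC: "\<tau>\<^sub>0 (c *\<^sub>C p) = c * \<tau>\<^sub>0 p"
  and \<tau>0_star: "\<tau>\<^sub>0 (star p) = cnj (\<tau>\<^sub>0 p)" and \<tau>0_commute: "\<tau>\<^sub>0 (p * q) = \<tau>\<^sub>0 (q * p)"
  and \<tau>0_pos: "\<tau>\<^sub>0 (star p * p) \<in> \<real>\<^sub>\<ge>\<^sub>0" and \<tau>0_one: "\<tau>\<^sub>0 1 = 1"
  using np by (auto simp: nc_probability_space_def tracial_weight_def)

lemma \<tau>0_zero: "\<tau>\<^sub>0 0 = 0" using \<tau>0_add[of 0 0] by simp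

lemma \<tau>_add: "\<tau> (p + q) = \<tau> p + \<tau> q" and \<tau>_scaleC: "\<tau> (c *\<^sub>C p) = c * \<tau> p"
  by (simp_all add: \<tau>_def alg_eval_add alg_eval_scaleC \<tau>0_add \<tau>0_scaleC)

lemma \<tau>_wordB: "\<tau> (Poly_Mapping.single (wordB w) c) = c * mB w"
  by (simp add: \<tau>_def alg_eval_single alg_word_wordB \<tau>0_scaleC)

lemma embA_single: "embA (Poly_Mapping.single w c) = Poly_Mapping.single (wordA w) c"
  unfolding embA_def alg_eval_single alg_word_var_A by (simp add: scaleC_single scaleC_complex_def)

lemma embA_var: "embA (nc_var i) = nc_var (Inl i)"
  by (simp add: nc_var_def embA_single wordA_def)

lemma embA_polysA: "p \<in> nonconst_polys \<Longrightarrow> embA p \<in> polysA"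
proof (induction rule: polys_on_induct)
  case (single w c)
  then show ?case unfolding embA_single by (intro polys_on_single) auto
next
  case (add p q)
  then show ?case by (simp add: embA_def alg_eval_add polys_on_add)
qed (simp add: embA_def)

lemma single_scale: "Poly_Mapping.single w c = c *\<^sub>C Poly_Mapping.single w (1 :: complex)"
  by (simp add: scaleC_single scaleC_complex_def)

lemma lim_embA: "p \<in> nonconst_polys \<Longrightarrow> (\<lambda>n. t n (embA p)) \<longlonglongrightarrow> nc_lin mA p"
proof (induction rule: polys_on_induct)
  case (single w c)
  then have "(\<lambda>n. c * t n (Poly_Mapping.single (wordA w) 1)) \<longlonglongrightarrow> c * mA w" by (intro tendsto_intros limA) auto
  then show ?case by (subst embA_single, subst single_scale) (simp add: t_scaleC)
next
  case (add p q)
  then show ?case by (simp add: embA_def alg_eval_add t_add nc_lin_add tendsto_add)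
qed (simp add: embA_def)

lemma polysA_cases: "a \<in> polysA \<Longrightarrow> \<exists>p\<in>nonconst_polys. a = embA p"
proof (induction rule: polys_on_induct)
  case (single w c)
  then obtain u where "w = wordA u" "u \<noteq> 0" by auto
  then show ?case by (intro bexI[of _ "Poly_Mapping.single u c"] polys_on_single) (auto simp: embA_single)
next
  case (add p q)
  then obtain p' q' where "p' \<in> nonconst_polys" "q' \<in> nonconst_polys" "p = embA p'" "q = embA q'" by blast
  then show ?case by (intro bexI[of _ "p' + q'"] polys_on_add) (auto simp: embA_def alg_eval_add)
next
  case zero
  show ?case by (intro bexI[of _ 0]) (auto simp: embA_def)
qed

lemma lim_polysB: "b \<in> polysB \<Longrightarrow> (\<lambda>n. t n b / of_nat (Suc n)) \<longlonglongrightarrow> \<tau> b"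
proof (induction rule: polys_on_induct)
  case (single w c)
  then obtain u where u: "w = wordB u" by auto
  have "(\<lambda>n. c * (t n (Poly_Mapping.single (wordB u) 1) / of_nat (Suc n))) \<longlonglongrightarrow> c * mB u" by (intro tendsto_intros limB)
  then show ?case unfolding u \<tau>_wordB by (subst single_scale) (simp add: t_scaleC)
next
  case (add p q)
  then show ?case unfolding t_add add_divide_distrib \<tau>_add by (intro tendsto_add)
next
  case zero
  show ?case by (simp add: \<tau>_def \<tau>0_zero)
qed

text \<open>Trace and norm are bundled so that one induction extends both convergences from words to
  polynomials.\<close>

definition null :: "(nat \<Rightarrow> ('k + 'l) nc_poly) \<Rightarrow> bool" where
  "null X \<longleftrightarrow> (\<lambda>n. t n (X n)) \<longlonglongrightarrow> 0 \<and> (\<lambda>n. h n (X n)) \<longlonglongrightarrow> 0"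

lemma null_add: "null X \<Longrightarrow> null Y \<Longrightarrow> null (\<lambda>n. X n + Y n)"
proof -
  assume XY: "null X" "null Y"
  have "(\<lambda>n. h n (X n + Y n)) \<longlonglongrightarrow> 0"
  proof (rule tendsto_sandwich[OF _ _ tendsto_const])
    show "(\<lambda>n. h n (X n) + h n (Y n)) \<longlonglongrightarrow> 0" using XY tendsto_add_zero by (auto simp: null_def)
  qed (auto simp: h_nonneg h_add_le)
  moreover have "(\<lambda>n. t n (X n + Y n)) \<longlonglongrightarrow> 0" using XY tendsto_add_zero by (auto simp: null_def t_add)
  ultimately show ?thesis by (simp add: null_def)
qed

lemma null_scaleC: "null X \<Longrightarrow> null (\<lambda>n. c *\<^sub>C X n)"
  unfolding null_def t_scaleC h_scaleC by (auto intro: tendsto_mult_right_zero)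

lemma null_zero: "null (\<lambda>n. 0)"
  using h_scaleC[of _ 0 0] by (simp add: null_def scaleC_zero_left)

definition center :: "nat \<Rightarrow> ('k + 'l) nc_poly \<Rightarrow> ('k + 'l) nc_poly" where
  "center n b = b - (t n b / of_nat (Suc n)) *\<^sub>C 1"

lemma center_add: "center n (p + q) = center n p + center n q"
  by (simp add: center_def t_add add_divide_distrib scaleC_add_left)

lemma center_scaleC: "center n (c *\<^sub>C p) = c *\<^sub>C center n p"
proof -
  have "c *\<^sub>C (p - q) = c *\<^sub>C p - c *\<^sub>C q" for q :: "('k + 'l) nc_poly"
    using scaleC_add_right[of c "p - q" q] by simp
  then show ?thesis by (simp add: center_def t_scaleC scaleC_scaleC)
qed

lemma center_zero: "center n 0 = 0"
  by (simp add: center_def scaleC_zero_left)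

lemma null_centered:
  assumes "a \<in> polysA" "a' \<in> polysA" "b \<in> polysB"
  shows "null (\<lambda>n. a * center n b * a')"
  using assms(3)
proof (induction rule: polys_on_induct)
  case (single w c)
  then obtain w' where w': "w = wordB w'" by auto
  let ?b = "Poly_Mapping.single (wordB w') 1"
  have "null (\<lambda>n. a * center n ?b * a')" using assms(1)
  proof (induction rule: polys_on_induct)
    case (single u d)
    then obtain u' where u': "u = wordA u'" "u' \<noteq> 0" by auto
    let ?a = "Poly_Mapping.single (wordA u') 1"
    have "null (\<lambda>n. ?a * center n ?b * a')" using assms(2)
    proof (induction rule: polys_on_induct)
      case (single v f)
      then obtain v' where v': "v = wordA v'" "v' \<noteq> 0" by auto
      have "null (\<lambda>n. ?a * center n ?b * Poly_Mapping.single (wordA v') 1)"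
        unfolding null_def center_def by (rule centered[OF u'(2) v'(2)])
      from null_scaleC[OF this, of f] show ?case
        unfolding v'(1) by (subst single_scale) (simp add: mult_scaleC_right)
    qed (auto simp: distrib_left null_zero intro: null_add)
    from null_scaleC[OF this, of d] show ?case
      unfolding u'(1) by (subst single_scale) (simp add: mult_scaleC_left)
  qed (auto simp: distrib_right null_zero intro: null_add)
  from null_scaleC[OF this, of c] show ?case
    unfolding w' by (subst single_scale) (simp add: center_scaleC mult_scaleC_left mult_scaleC_right)
next
  case (add p q)
  then show ?case by (auto simp: center_add distrib_left distrib_right intro: null_add)
qed (simp add: center_zero null_zero)

lemma polysA_mult: "p \<in> polysA \<Longrightarrow> q \<in> polysA \<Longrightarrow> p * q \<in> polysA"
  by (rule polys_on_mult) (auto simp: wordA_add[symmetric] nc_word_add_eq_0)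

lemma polysA_star: "p \<in> polysA \<Longrightarrow> star p \<in> polysA"
  by (rule polys_on_star) (auto simp: wordA_invol[symmetric] invol_nc_word_eq_0)

lemma polysB_mult: "p \<in> polysB \<Longrightarrow> q \<in> polysB \<Longrightarrow> p * q \<in> polysB"
  by (rule polys_on_mult) (auto simp: wordB_add[symmetric])

lemma polysB_star: "p \<in> polysB \<Longrightarrow> star p \<in> polysB"
  by (rule polys_on_star) (auto simp: wordB_invol[symmetric])

lemma h_zero: "h n 0 = 0"
  using h_scaleC[of n 0 0] by (simp add: scaleC_zero_left)

lemma h_embA_small:
  assumes d: "d \<in> nonconst_polys" "Re (nc_lin mA (star d * d)) < e\<^sup>2" and e: "e > 0"
  shows "\<forall>\<^sub>F n in sequentially. h n (embA d) \<le> e"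
proof -
  have "star d * d \<in> nonconst_polys" by (intro nonconst_polys_mult d)
  then have "(\<lambda>n. Re (t n (embA (star d * d)))) \<longlonglongrightarrow> Re (nc_lin mA (star d * d))"
    by (intro tendsto_intros lim_embA)
  moreover have "Re (t n (embA (star d * d))) = (h n (embA d))\<^sup>2" for n
    by (simp add: embA_def alg_eval_mult alg_eval_star t_star_mult)
  ultimately have "\<forall>\<^sub>F n in sequentially. (h n (embA d))\<^sup>2 < e\<^sup>2"
    using d(2) order_tendstoD(2) by fastforce
  then show ?thesis
    by (rule eventually_mono) (use e in \<open>auto intro: power_less_imp_less_base less_imp_le\<close>)
qed

lemma sum_products_append: "sum_products (l @ l') = sum_products l + sum_products l'"
  by (simp add: sum_products_def)

text \<open>Words of length at least two already are products. A single letter is approximated by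
  means of \<open>approx\<close>, and its adjoint by the adjoint product, with the factors in
  reverse order.\<close>

lemma polysA_approx:
  assumes "a \<in> polysA" "e > 0"
  shows "\<exists>l. set l \<subseteq> polysA \<times> polysA \<and> (\<forall>\<^sub>F n in sequentially. h n (a - sum_products l) \<le> e)"
  using assms
proof (induction arbitrary: e rule: polys_on_induct)
  case (single w c)
  then obtain w' where w': "w = wordA w'" "w' \<noteq> 0" by auto
  obtain l ls where ls: "letters w' = l # ls" using w'(2) by (cases w'; cases "letters w'") (auto simp: zero_nc_word_def)
  have w'_eq: "w' = Word [l] + Word ls" using ls by (cases w') (simp add: plus_nc_word_def)
  have nz: "Word [l] \<noteq> (0 :: 'k nc_word)" by (simp add: zero_nc_word_def)
  show ?case
  proof (cases "ls = []")
    case False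
    then have "Word ls \<noteq> (0 :: 'k nc_word)" by (simp add: zero_nc_word_def)
    then have "set [(Poly_Mapping.single (wordA (Word [l])) c, Poly_Mapping.single (wordA (Word ls)) 1)] \<subseteq> polysA \<times> polysA"
      using nz by (auto intro!: polys_on_single)
    moreover have "Poly_Mapping.single w c - sum_products [(Poly_Mapping.single (wordA (Word [l])) c, Poly_Mapping.single (wordA (Word ls)) 1)] = 0"
      by (simp add: sum_products_def mult_single w'(1) w'_eq wordA_add)
    ultimately show ?thesis using single(2) h_zero
      by (intro exI[of _ "[(Poly_Mapping.single (wordA (Word [l])) c, Poly_Mapping.single (wordA (Word ls)) 1)]"]) simp
  next
    case True
    obtain i where i: "l = Var i \<or> l = Adj i" by (cases l) auto
    \<comment> \<open>The added 1 keeps the quotient meaningful for \<open>c = 0\<close>.\<close>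
    define e' where "e' = e / (cmod c + 1)"
    have e': "e' > 0" using single(2) by (simp add: e'_def add_nonneg_pos)
    then obtain Y Z where YZ: "Y \<in> nonconst_polys" "Z \<in> nonconst_polys"
      "Re (nc_lin mA (star (nc_var i - Y * Z) * (nc_var i - Y * Z))) < e'\<^sup>2" using approx[of "e'\<^sup>2" i] by auto
    define d where "d = nc_var i - Y * Z"
    have d: "d \<in> nonconst_polys" unfolding d_def by (intro polys_on_diff nc_var_nonconst nonconst_polys_mult YZ)
    have ev: "\<forall>\<^sub>F n in sequentially. h n (embA d) \<le> e'"
      by (rule h_embA_small[OF d _ e']) (use YZ(3) in \<open>simp add: d_def\<close>)
    have "\<exists>k\<in>{[(c *\<^sub>C embA Y, embA Z)], [(c *\<^sub>C star (embA Z), star (embA Y))]}.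
        \<forall>n. h n (Poly_Mapping.single w c - sum_products k) = cmod c * h n (embA d)"
    proof (cases "l = Var i")
      case True
      then have "Poly_Mapping.single w c = c *\<^sub>C embA (nc_var i)"
        unfolding embA_var w'(1) w'_eq \<open>ls = []\<close> by (simp add: nc_var_def wordA_def plus_nc_word_def scaleC_single scaleC_complex_def)
      then have "Poly_Mapping.single w c - sum_products [(c *\<^sub>C embA Y, embA Z)] = c *\<^sub>C embA (nc_var i) - c *\<^sub>C embA (Y * Z)"
        by (simp add: sum_products_def mult_scaleC_left embA_def alg_eval_mult)
      also have "\<dots> = c *\<^sub>C embA d"
        using scaleC_add_right[of c "embA d" "embA (Y * Z)"] by (simp add: d_def embA_def alg_eval_diff)
      finally show ?thesis by (simp add: h_scaleC)
    next
      case False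
      then have "l = Adj i" using i by simp
      then have "Poly_Mapping.single w c = c *\<^sub>C star (embA (nc_var i))"
        unfolding embA_var w'(1) w'_eq \<open>ls = []\<close>
        by (simp add: nc_var_def wordA_def plus_nc_word_def scaleC_single scaleC_complex_def star_single invol_nc_word_def star_complex_def)
      then have "Poly_Mapping.single w c - sum_products [(c *\<^sub>C star (embA Z), star (embA Y))] =
          c *\<^sub>C star (embA (nc_var i)) - c *\<^sub>C star (embA (Y * Z))"
        by (simp add: sum_products_def mult_scaleC_left embA_def alg_eval_mult star_mult)
      also have "\<dots> = c *\<^sub>C star (embA d)"
        using scaleC_add_right[of c "star (embA d)" "star (embA (Y * Z))"] by (simp add: d_def embA_def alg_eval_diff star_diff)
      finally show ?thesis by (simp add: h_scaleC h_star)
    qed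
    then obtain k where k: "k \<in> {[(c *\<^sub>C embA Y, embA Z)], [(c *\<^sub>C star (embA Z), star (embA Y))]}"
      "\<And>n. h n (Poly_Mapping.single w c - sum_products k) = cmod c * h n (embA d)" by blast
    have "set k \<subseteq> polysA \<times> polysA"
      using k(1) YZ by (auto intro!: polys_on_scaleC embA_polysA polysA_star)
    moreover have "\<forall>\<^sub>F n in sequentially. h n (Poly_Mapping.single w c - sum_products k) \<le> e"
      using ev
    proof (rule eventually_mono)
      fix n assume "h n (embA d) \<le> e'"
      then have "cmod c * h n (embA d) \<le> cmod c * e'" by (intro mult_left_mono) auto
      also have "\<dots> \<le> (cmod c + 1) * e'" using e' by (intro mult_right_mono) auto
      also have "\<dots> = e" using add_nonneg_pos[of "cmod c" 1] by (simp add: e'_def)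
      finally show "h n (Poly_Mapping.single w c - sum_products k) \<le> e" unfolding k(2) .
    qed
    ultimately show ?thesis by blast
  qed
next
  case (add p q)
  have "e / 2 > 0" using add.prems by simp
  then obtain l l' where l: "set l \<subseteq> polysA \<times> polysA" "\<forall>\<^sub>F n in sequentially. h n (p - sum_products l) \<le> e / 2"
    "set l' \<subseteq> polysA \<times> polysA" "\<forall>\<^sub>F n in sequentially. h n (q - sum_products l') \<le> e / 2"
    using add.IH by meson
  have "\<forall>\<^sub>F n in sequentially. h n (p + q - sum_products (l @ l')) \<le> e"
    using l(2,4)
  proof eventually_elim
    case (elim n)
    have eq: "p + q - sum_products (l @ l') = (p - sum_products l) + (q - sum_products l')"
      by (simp add: sum_products_append)
    show ?case unfolding eq
      using h_add_le[of n "p - sum_products l" "q - sum_products l'"] elim by linarith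
  qed
  then show ?case using l(1,3) by (intro exI[of _ "l @ l'"]) auto
next
  case zero
  then show ?case using h_zero by (intro exI[of _ "[]"]) (simp add: sum_products_def)
qed

sublocale asymptotically_cyclic_monotone t h polysA polysB
proof
  fix a assume a: "a \<in> polysA"
  then obtain p where p: "p \<in> nonconst_polys" "a = embA p" using polysA_cases by blast
  have "(\<lambda>n. t n (embA (star p * p))) \<longlonglongrightarrow> nc_lin mA (star p * p)"
    by (intro lim_embA nonconst_polys_mult p)
  then obtain C where C: "\<And>n. cmod (t n (embA (star p * p))) \<le> C" using tendsto_cmod_bounded by blast
  have "(h n a)\<^sup>2 \<le> C" for n
    using C[of n] by (simp add: p(2) embA_def alg_eval_mult alg_eval_star t_star_mult norm_power h_nonneg)
  then show "\<exists>C. \<forall>n. h n a \<le> C" using real_le_rsqrt by blast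
next
  fix b assume "b \<in> polysB"
  then show "\<exists>C. \<forall>n. cmod (t n b / of_nat (Suc n)) \<le> C" using tendsto_cmod_bounded lim_polysB by blast
next
  fix a a' b assume "a \<in> polysA" "a' \<in> polysA" "b \<in> polysB"
  from null_centered[OF this]
  show "(\<lambda>n. t n (a * (b - (t n b / of_nat (Suc n)) *\<^sub>C 1) * a')) \<longlonglongrightarrow> 0"
    "(\<lambda>n. h n (a * (b - (t n b / of_nat (Suc n)) *\<^sub>C 1) * a')) \<longlonglongrightarrow> 0"
    by (auto simp: null_def center_def)
qed (auto intro: polysA_mult polysA_star polysB_mult polysB_star polys_on_diff polysA_approx)

lemma nt_tendsto: "b \<in> polysB \<Longrightarrow> (\<lambda>n. nt n b) \<longlonglongrightarrow> \<tau> b"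
  unfolding nt_def by (rule lim_polysB)

lemma prod_nt_tendsto:
  "set bs \<subseteq> polysB \<Longrightarrow> (\<lambda>n. prod_list (map (nt n) bs)) \<longlonglongrightarrow> prod_list (map \<tau> bs)"
  by (induction bs) (auto intro!: tendsto_mult nt_tendsto)

text \<open>The factorization rule of cyclic monotone independence as a limit of traces.
  \<open>L\<close> stays a parameter because the limit of the first factor is known in different
  forms at the places of use.\<close>

lemma pair_prod_tendsto:
  assumes ps: "set ps \<subseteq> polysA \<times> polysB"
    and ne: "length ps \<ge> 2 \<or> (\<exists>y\<in>polysA. \<exists>z\<in>polysA. \<exists>b. ps = [(y * z, b)])"
    and lim: "(\<lambda>n. t n (prod_list (map fst ps))) \<longlonglongrightarrow> L"
  shows "(\<lambda>n. t n (pair_prod ps)) \<longlonglongrightarrow> L * prod_list (map (\<lambda>(\<alpha>, \<beta>). \<tau> \<beta>) ps)"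
proof -
  obtain a b qs where ps_eq: "ps = (a, b) # qs" using ne by (cases ps) auto
  have c: "(\<lambda>n. t n (a * b * pair_prod qs) - t n (a * prod_list (map fst qs)) * nt n b * prod_list (map (nt n \<circ> snd) qs)) \<longlonglongrightarrow> 0"
  proof (rule t_pair_prod)
    show "\<exists>y\<in>polysA. \<exists>z\<in>polysA. a = y * z" if "qs = []"
      using ne that ps_eq by auto
  qed (use ps ps_eq in auto)
  have d: "(\<lambda>n. t n (prod_list (map fst ps)) * prod_list (map (nt n) (map snd ps))) \<longlonglongrightarrow> L * prod_list (map \<tau> (map snd ps))"
    by (intro tendsto_mult lim prod_nt_tendsto) (use ps in auto)
  have sum: "(\<lambda>n. (t n (a * b * pair_prod qs) - t n (a * prod_list (map fst qs)) * nt n b * prod_list (map (nt n \<circ> snd) qs))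
      + t n (prod_list (map fst ps)) * prod_list (map (nt n) (map snd ps))) \<longlonglongrightarrow> 0 + L * prod_list (map \<tau> (map snd ps))"
    by (rule tendsto_add[OF c d])
  have eq: "(t n (a * b * pair_prod qs) - t n (a * prod_list (map fst qs)) * nt n b * prod_list (map (nt n \<circ> snd) qs))
      + t n (prod_list (map fst ps)) * prod_list (map (nt n) (map snd ps)) = t n (pair_prod ps)" for n
    by (simp add: ps_eq mult.assoc o_def)
  have m: "map (\<lambda>(\<alpha>, \<beta>). \<tau> \<beta>) ps = map \<tau> (map snd ps)" by auto
  show ?thesis using sum unfolding eq m by (simp only: add_0_left)
qed

abbreviation cv :: "('k + 'l) nc_word \<Rightarrow> complex" where "cv \<equiv> cyclic_value mA mB"

text \<open>Matrix traces allow the rotation at every \<open>n\<close>, so the limit may be computed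
  at the rotated word, where \<open>pair_prod_tendsto\<close> applies.\<close>

lemma lim_word:
  assumes w: "count_A w \<ge> 2"
  shows "(\<lambda>n. t n (Poly_Mapping.single w 1)) \<longlonglongrightarrow> cv w"
proof -
  obtain rs where rot: "rotates_to w rs" and val: "cv w = pair_value mA mB rs"
    using cyclic_value_rotates[OF w] by blast
  obtain u r where d: "letter_pairs rs" "length rs \<ge> 2" "w = u + r" "r + u = pair_word rs"
    using rot unfolding rotates_to_def by (metis add.assoc)
  define F where "F = map (\<lambda>(\<alpha>, \<beta>). (Poly_Mapping.single (wordA \<alpha> :: ('k + 'l) nc_word) (1 :: complex),
      Poly_Mapping.single (wordB \<beta> :: ('k + 'l) nc_word) (1 :: complex)))"
  have F: "set (F ps) \<subseteq> polysA \<times> polysB" if "letter_pairs ps" for ps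
    using that by (fastforce simp: F_def letter_pairs_def zero_nc_word_def intro!: polys_on_single)
  have Fp: "pair_prod (F ps) = Poly_Mapping.single (pair_word ps) 1" for ps
    by (induction ps) (auto simp: F_def mult_single)
  have Ff: "prod_list (map fst (F ps)) = Poly_Mapping.single (wordA (sum_list (map fst ps))) 1" for ps
    by (induction ps) (auto simp: F_def mult_single wordA_add)
  have nz: "sum_list (map fst rs) \<noteq> 0"
  proof -
    obtain r' rs' where rs: "rs = r' # rs'" using d(2) by (cases rs) auto
    have "fst r' \<noteq> 0" using d(1) unfolding rs by (auto simp: letter_pairs_def zero_nc_word_def)
    then show ?thesis by (simp add: rs nc_word_add_eq_0)
  qed
  have "(\<lambda>n. t n (pair_prod (F rs))) \<longlonglongrightarrow> mA (sum_list (map fst rs)) * prod_list (map (\<lambda>(\<alpha>, \<beta>). \<tau> \<beta>) (F rs))"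
  proof (rule pair_prod_tendsto[OF F[OF d(1)]])
    show "length (F rs) \<ge> 2 \<or> (\<exists>y\<in>polysA. \<exists>z\<in>polysA. \<exists>b. F rs = [(y * z, b)])" using d(2) by (simp add: F_def)
    show "(\<lambda>n. t n (prod_list (map fst (F rs)))) \<longlonglongrightarrow> mA (sum_list (map fst rs))"
      unfolding Ff by (rule limA[OF nz])
  qed
  moreover have "map (\<lambda>(\<alpha>, \<beta>). \<tau> \<beta>) (F rs) = map (\<lambda>(\<alpha>, \<beta>). mB \<beta>) rs"
    by (auto simp: F_def \<tau>_wordB)
  moreover have "t n (Poly_Mapping.single w 1) = t n (pair_prod (F rs))" for n
  proof -
    have "t n (Poly_Mapping.single w 1) = t n (Poly_Mapping.single u 1 * Poly_Mapping.single r 1)"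
      by (simp add: d(3) mult_single)
    also have "\<dots> = t n (Poly_Mapping.single r 1 * Poly_Mapping.single u 1)" by (rule t_commute)
    also have "\<dots> = t n (pair_prod (F rs))" by (simp add: Fp mult_single d(4))
    finally show ?thesis .
  qed
  ultimately show ?thesis by (simp add: val pair_value_def)
qed

abbreviation polys2 :: "('k + 'l) nc_poly set" where "polys2 \<equiv> polys_on {w. count_A w \<ge> 2}"

abbreviation polys1 :: "('k + 'l) nc_poly set" where "polys1 \<equiv> polys_on {w. count_A w \<ge> 1}"

lemma lim_polys2: "p \<in> polys2 \<Longrightarrow> (\<lambda>n. t n p) \<longlonglongrightarrow> nc_lin cv p"
proof (induction rule: polys_on_induct)
  case (single w c)
  have "(\<lambda>n. c * t n (Poly_Mapping.single w 1)) \<longlonglongrightarrow> c * cv w" using single by (intro tendsto_intros lim_word) auto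
  then show ?case by (subst single_scale) (simp add: t_scaleC nc_lin_scaleC)
next
  case (add p q)
  then show ?case by (simp add: t_add nc_lin_add tendsto_add)
qed simp

lemma polys1_mult2: "p \<in> polys1 \<Longrightarrow> q \<in> polys1 \<Longrightarrow> p * q \<in> polys2"
  by (rule polys_on_mult) auto

lemma polys1_ideal: "p \<in> polys1 \<Longrightarrow> q * p \<in> polys1" "p \<in> polys1 \<Longrightarrow> p * q \<in> polys1"
  using polys_on_mult[of q UNIV p "{w. count_A w \<ge> 1}" "{w. count_A w \<ge> 1}"]
    polys_on_mult[of p "{w. count_A w \<ge> 1}" q UNIV "{w. count_A w \<ge> 1}"]
  by (auto simp: polys_on_def)

lemma polys1_star: "p \<in> polys1 \<Longrightarrow> star p \<in> polys1"
  by (rule polys_on_star) auto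

sublocale convergent_on_ideal t h polys1
  by unfold_locales
    (assumption | rule polys_on_diff polys_on_zero polys1_ideal polys1_star convergentI[OF lim_polys2[OF polys1_mult2]])+

lemma lt_polys2: "p \<in> polys2 \<Longrightarrow> lt p = nc_lin cv p"
  unfolding lt_def by (rule limI[OF lim_polys2])

lemma polysA_polys1: "p \<in> polysA \<Longrightarrow> p \<in> polys1"
  by (erule polys_on_mono) (use count_A_wordA_pos in auto)

lemma lh_le: "p \<in> polys1 \<Longrightarrow> \<forall>\<^sub>F n in sequentially. h n p \<le> e \<Longrightarrow> lh p \<le> e"
  by (rule tendsto_upperbound[OF lh]) auto

lemma lh_add_le: "p \<in> polys1 \<Longrightarrow> q \<in> polys1 \<Longrightarrow> lh (p + q) \<le> lh p + lh q"
  by (rule LIMSEQ_le[OF lh[OF polys_on_add] tendsto_add[OF lh lh]]) (auto simp: h_add_le)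

lemma lh_zero: "lh 0 = 0"
  by (simp add: lh_def h_zero)

text \<open>Up to rotation the squared norm is the trace of two pairs with first components
  \<open>star d\<close> and \<open>d\<close>, so its limit factorizes. In the limit,
  \<open>b\<close> and \<open>b'\<close> thus act boundedly, with moments of \<open>\<tau>\<close>
  as constants.\<close>

lemma lh_sandwich:
  assumes d: "d \<in> polysA" and b: "b \<in> polysB" "b' \<in> polysB"
  shows "(lh (b * d * b'))\<^sup>2 \<le> cmod (\<tau> (star b * b) * \<tau> (b' * star b')) * (lh d)\<^sup>2"
proof -
  have bdb: "b * d * b' \<in> polys1" by (intro polys1_ideal polysA_polys1 d)
  let ?ps = "[(star d, star b * b), (d, b' * star b')]"
  have L: "(\<lambda>n. t n (prod_list (map fst ?ps))) \<longlonglongrightarrow> of_real ((lh d)\<^sup>2)"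
    unfolding list.map fst_conv prod_list.Cons prod_list.Nil mult_1_right t_star_mult
    by (intro tendsto_intros lh polysA_polys1 d)
  have "(\<lambda>n. t n (pair_prod ?ps)) \<longlonglongrightarrow> of_real ((lh d)\<^sup>2) * prod_list (map (\<lambda>(\<alpha>, \<beta>). \<tau> \<beta>) ?ps)"
    by (rule pair_prod_tendsto[OF _ _ L]) (use d b in \<open>auto intro: polysA_star polysB_mult polysB_star\<close>)
  moreover have "t n (pair_prod ?ps) = of_real ((h n (b * d * b'))\<^sup>2)" for n
  proof -
    have "t n (pair_prod ?ps) = t n ((star d * (star b * b) * d * b') * star b')" by (simp add: mult.assoc)
    also have "\<dots> = t n (star b' * (star d * (star b * b) * d * b'))" by (rule t_commute)
    also have "\<dots> = t n (star (b * d * b') * (b * d * b'))" by (simp add: star_mult mult.assoc)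
    finally show ?thesis by (simp add: t_star_mult)
  qed
  moreover have "(\<lambda>n. complex_of_real ((h n (b * d * b'))\<^sup>2)) \<longlonglongrightarrow> of_real ((lh (b * d * b'))\<^sup>2)"
    by (intro tendsto_intros lh bdb)
  ultimately have "complex_of_real ((lh (b * d * b'))\<^sup>2) = of_real ((lh d)\<^sup>2) * (\<tau> (star b * b) * \<tau> (b' * star b'))"
    using LIMSEQ_unique by fastforce
  then have "cmod (complex_of_real ((lh (b * d * b'))\<^sup>2)) = cmod (of_real ((lh d)\<^sup>2) * (\<tau> (star b * b) * \<tau> (b' * star b')))"
    by (rule arg_cong)
  then show ?thesis by (simp add: norm_mult norm_power mult.commute del: of_real_power)
qed

text \<open>A word with two letters of the first kind splits into two factors at once. A word with
  one such letter is \<open>b * a * b'\<close>: here \<open>a\<close> is approximated by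
  \<open>polysA_approx\<close>, and \<open>lh_sandwich\<close> carries the error through
  \<open>b\<close> and \<open>b'\<close>.\<close>

lemma polys1_approx:
  assumes "p \<in> polys1" "e > 0"
  shows "\<exists>l. set l \<subseteq> polys1 \<times> polys1 \<and> p - sum_products l \<in> polys1 \<and> lh (p - sum_products l) \<le> e"
  using assms
proof (induction arbitrary: e rule: polys_on_induct)
  case (single w c)
  obtain \<beta> ps where w: "w = wordB \<beta> + pair_word ps" "letter_pairs ps" "length ps = count_A w"
    using word_decompose by blast
  obtain \<alpha> \<beta>' qs where ps: "ps = (\<alpha>, \<beta>') # qs" using w(3) single by (cases ps) auto
  obtain l where l: "\<alpha> = Word [l]" using w(2) ps by (auto simp: letter_pairs_def)
  define a :: "('k + 'l) nc_poly" where "a = Poly_Mapping.single (wordA \<alpha>) 1"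
  define b :: "('k + 'l) nc_poly" where "b = Poly_Mapping.single (wordB \<beta>) c"
  define b' :: "('k + 'l) nc_poly" where "b' = Poly_Mapping.single (wordB \<beta>' + pair_word qs) 1"
  have weq: "Poly_Mapping.single w c = b * a * b'"
    by (simp add: a_def b_def b'_def mult_single w(1) ps add.assoc)
  have a: "a \<in> polysA" unfolding a_def l by (intro polys_on_single) (auto simp: zero_nc_word_def)
  show ?case
  proof (cases "qs = []")
    case False
    then have "b' \<in> polys1"
    proof -
      obtain q qs' where q: "qs = q # qs'" using False by (cases qs) auto
      have "count_A w = 1 + count_A (wordB \<beta>' + pair_word qs)"
        by (simp add: w(1) ps l count_A_wordA)
      then have "count_A (wordB \<beta>' + pair_word qs) \<ge> 1" using w(3) ps q by simp
      then show ?thesis unfolding b'_def by (intro polys_on_single) simp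
    qed
    then have "set [(b * a, b')] \<subseteq> polys1 \<times> polys1" using polys1_ideal polysA_polys1[OF a] by auto
    moreover have "Poly_Mapping.single w c - sum_products [(b * a, b')] = 0" by (simp add: weq sum_products_def)
    ultimately show ?thesis using single lh_zero by (intro exI[of _ "[(b * a, b')]"]) simp
  next
    case True
    have bB: "b \<in> polysB" "b' \<in> polysB" unfolding b_def b'_def True by (auto intro: polys_on_single)
    define K where "K = cmod (\<tau> (star b * b) * \<tau> (b' * star b'))"
    \<comment> \<open>Chosen so that K e'^2 is at most (K + 1)^2 e'^2 = e^2.\<close>
    define e' where "e' = e / (K + 1)"
    have K: "0 \<le> K" by (simp add: K_def)
    have e': "e' > 0" using single K by (simp add: e'_def)
    obtain k where k: "set k \<subseteq> polysA \<times> polysA" "\<forall>\<^sub>F n in sequentially. h n (a - sum_products k) \<le> e'"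
      using polysA_approx[OF a e'] by blast
    define d where "d = a - sum_products k"
    have d: "d \<in> polysA" unfolding d_def by (intro polys_on_diff a sum_products_mem k)
    have "lh d \<le> e'" unfolding d_def[symmetric] using k(2) by (intro lh_le polysA_polys1 d) (simp add: d_def)
    have "(lh (b * d * b'))\<^sup>2 \<le> K * (lh d)\<^sup>2" unfolding K_def by (rule lh_sandwich[OF d bB])
    also have "\<dots> \<le> (K + 1)\<^sup>2 * e'\<^sup>2"
      using \<open>lh d \<le> e'\<close> K lh_nonneg[OF polysA_polys1[OF d]]
      by (intro mult_mono power_mono) (auto simp: power2_eq_square algebra_simps)
    also have "\<dots> = e\<^sup>2" using K by (simp add: e'_def power_divide)
    finally have le: "lh (b * d * b') \<le> e" by (rule power2_le_imp_le) (use single in simp)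
    define k' where "k' = map (\<lambda>(y, z). (b * y, z * b')) k"
    have "sum_products k' = b * sum_products k * b'"
      unfolding k'_def sum_products_def by (induction k) (auto simp: algebra_simps)
    then have eq: "Poly_Mapping.single w c - sum_products k' = b * d * b'" by (simp add: weq d_def algebra_simps)
    have "b * y \<in> polys1 \<and> z * b' \<in> polys1" if "(y, z) \<in> set k" for y z
    proof -
      have "y \<in> polysA" "z \<in> polysA" using subsetD[OF k(1) that] by blast+
      then show ?thesis by (intro conjI polys1_ideal polysA_polys1)
    qed
    then have "set k' \<subseteq> polys1 \<times> polys1" unfolding k'_def by auto
    moreover have "b * d * b' \<in> polys1" by (intro polys1_ideal polysA_polys1 d)
    ultimately show ?thesis using le unfolding eq[symmetric] by blast
  qed
next
  case (add p q)
  have "e / 2 > 0" using add.prems by simp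
  then obtain l l' where l: "set l \<subseteq> polys1 \<times> polys1" "lh (p - sum_products l) \<le> e / 2"
    "set l' \<subseteq> polys1 \<times> polys1" "lh (q - sum_products l') \<le> e / 2"
    and mem: "p - sum_products l \<in> polys1" "q - sum_products l' \<in> polys1"
    using add.IH by meson
  have eq: "p + q - sum_products (l @ l') = (p - sum_products l) + (q - sum_products l')"
    by (simp add: sum_products_append)
  have "lh (p + q - sum_products (l @ l')) \<le> e" unfolding eq using lh_add_le[OF mem] l(2,4) by linarith
  moreover have "p + q - sum_products (l @ l') \<in> polys1" unfolding eq by (intro polys_on_add mem)
  ultimately show ?case using l(1,3) by (intro exI[of _ "l @ l'"]) auto
next
  case zero
  then show ?case using lh_zero by (intro exI[of _ "[]"]) (simp add: sum_products_def)
qed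

end

text \<open>The values at words with a single letter of the first kind are prescribed rather than
  obtained as limits: the hypotheses give no control of the trace norm there.\<close>

definition single_value :: "('k nc_word \<Rightarrow> complex) \<Rightarrow> ('l nc_word \<Rightarrow> complex) \<Rightarrow> ('k + 'l) nc_word \<Rightarrow> complex" where
  "single_value mA mB w =
     mA (Word (map (inv_into UNIV (map_letter Inl)) (filter letter_A (letters w)))) *
     mB (Word (map (inv_into UNIV (map_letter Inr))
       (filter (Not \<circ> letter_A) (dropWhile (Not \<circ> letter_A) (letters w)) @ takeWhile (Not \<circ> letter_A) (letters w))))"

lemma inj_map_letter: "inj f \<Longrightarrow> inj (map_letter f)"
  by (rule letter.inj_map)

text \<open>The letters of the second kind are read cyclically, beginning behind the letter of the
  first kind; hence the order \<open>v + u\<close>.\<close>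

lemma single_value:
  "single_value mA mB (wordB u + wordA (Word [l]) + wordB v) = mA (Word [l]) * mB (v + u)"
proof -
  have A: "inv_into UNIV (map_letter Inl) (map_letter Inl k) = k" for k :: "'a letter"
    by (intro inv_f_f inj_map_letter) simp
  have B: "inv_into UNIV (map_letter Inr) (map_letter Inr k) = k" for k :: "'b letter"
    by (intro inv_f_f inj_map_letter) simp
  have u: "filter letter_A (map (map_letter Inr) ks) = ([] :: ('a + 'b) letter list)" for ks
    by (induction ks) auto
  have d: "dropWhile (Not \<circ> letter_A) (map (map_letter Inr) ks @ map_letter Inl l # r) = map_letter Inl l # (r :: ('a + 'b) letter list)" for ks r
    by (induction ks) auto
  have t: "takeWhile (Not \<circ> letter_A) (map (map_letter Inr) ks @ map_letter Inl l # r) = (map (map_letter Inr) ks :: ('a + 'b) letter list)" for ks r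
    by (induction ks) auto
  have f: "filter (Not \<circ> letter_A) (map (map_letter Inr) ks) = (map (map_letter Inr) ks :: ('a + 'b) letter list)" for ks
    by (induction ks) auto
  show ?thesis
    by (simp add: single_value_def wordA_def wordB_def plus_nc_word_def u d t f A B o_def[of _ "map_letter _"])
qed

lemma count_A_one_decompose:
  assumes "count_A w = 1"
  shows "\<exists>u l v. w = wordB u + wordA (Word [l]) + wordB v"
proof -
  obtain u ps where *: "w = wordB u + pair_word ps" "letter_pairs ps" "length ps = 1"
    using word_decompose[of w] assms by auto
  then obtain a v where "ps = [(a, v)]" by (auto simp: length_Suc_conv)
  then show ?thesis using * by (auto simp: letter_pairs_def add.assoc)
qed

definition monotone_value :: "('k nc_word \<Rightarrow> complex) \<Rightarrow> ('l nc_word \<Rightarrow> complex) \<Rightarrow> ('k + 'l) nc_word \<Rightarrow> complex" where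
  "monotone_value mA mB w = (if count_A w \<ge> 2 then cyclic_value mA mB w else single_value mA mB w)"

text \<open>The numbers \<open>c m J\<close> of \<open>spectrum_sequence\<close>, computed from
  values at words; \<open>J = 0\<close> gives the power sums.\<close>

definition damped_moment :: "('v nc_word \<Rightarrow> complex) \<Rightarrow> 'v nc_poly \<Rightarrow> real \<Rightarrow> nat \<Rightarrow> nat \<Rightarrow> real" where
  "damped_moment \<phi> X C m J = Re (nc_lin \<phi> (X ^ m * (1 - complex_of_real (1 / C) *\<^sub>C (X * X)) ^ J))"

lemma nc_lin_diff: "nc_lin \<phi> (p - q) = nc_lin \<phi> p - nc_lin \<phi> q"
  using nc_lin_add[of \<phi> "p - q" q] by simp

lemma damped_moment_Suc: "damped_moment \<phi> X C m (Suc J) = damped_moment \<phi> X C m J - damped_moment \<phi> X C (m + 2) J / C"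
proof -
  define q where "q = 1 - complex_of_real (1 / C) *\<^sub>C (X * X)"
  have "X ^ m * q ^ Suc J = X ^ m * q * q ^ J" by (simp add: mult.assoc)
  also have "X ^ m * q = X ^ m - complex_of_real (1 / C) *\<^sub>C X ^ (m + 2)"
    by (simp only: q_def right_diff_distrib mult_scaleC_right power_add power2_eq_square mult_1_right)
  finally have eq: "X ^ m * q ^ Suc J = X ^ m * q ^ J - complex_of_real (1 / C) *\<^sub>C (X ^ (m + 2) * q ^ J)"
    by (simp add: left_diff_distrib mult_scaleC_left)
  show ?thesis unfolding damped_moment_def q_def[symmetric] eq
    by (simp add: nc_lin_diff nc_lin_scaleC)
qed

section \<open>A cyclically monotone model on the free algebra\<close>

context good_sequence
begin

abbreviation \<omega> :: "('k + 'l) nc_poly \<Rightarrow> complex" where "\<omega> \<equiv> nc_lin (monotone_value mA mB)"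

lemma \<omega>_polys2: "p \<in> polys2 \<Longrightarrow> \<omega> p = nc_lin cv p"
  unfolding nc_lin_def by (intro sum.cong) (auto simp: polys_on_def monotone_value_def)

lemma lim_\<omega>: "p \<in> polys2 \<Longrightarrow> (\<lambda>n. t n p) \<longlonglongrightarrow> \<omega> p"
  using lim_polys2 by (simp add: \<omega>_polys2)

lemma \<omega>_star_mult: assumes p: "p \<in> polys1" shows "\<omega> (star p * p) = of_real ((lh p)\<^sup>2)"
proof (rule LIMSEQ_unique[OF lim_\<omega>[OF polys1_mult2[OF polys1_star[OF p] p]]])
  show "(\<lambda>n. t n (star p * p)) \<longlonglongrightarrow> of_real ((lh p)\<^sup>2)" unfolding t_star_mult by (intro tendsto_intros lh p)
qed

lemma \<omega>_commute: assumes "p \<in> polys1" "q \<in> polys1" shows "\<omega> (p * q) = \<omega> (q * p)"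
proof (rule LIMSEQ_unique[OF lim_\<omega>[OF polys1_mult2[OF assms]]])
  show "(\<lambda>n. t n (p * q)) \<longlonglongrightarrow> \<omega> (q * p)" unfolding t_commute[of _ p q] by (intro lim_\<omega> polys1_mult2 assms)
qed

text \<open>The symmetry is read off from the matrices whose traces converge to \<open>mA\<close>,
  since the locale knows \<open>mA\<close> only as a limit.\<close>

lemma mA_invol: assumes w: "w \<noteq> 0" shows "mA (invol w) = cnj (mA w)"
proof (rule LIMSEQ_unique[OF limA])
  show "invol w \<noteq> 0" using w by (simp add: invol_nc_word_eq_0)
  have "t n (Poly_Mapping.single (wordA (invol w)) 1) = cnj (t n (Poly_Mapping.single (wordA w) 1))" for n
    unfolding t_star[symmetric] by (simp add: star_single wordA_invol star_complex_def)
  then show "(\<lambda>n. t n (Poly_Mapping.single (wordA (invol w)) 1)) \<longlonglongrightarrow> cnj (mA w)"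
    using tendsto_cnj[OF limA[OF w]] by simp
qed

lemma cv_invol: assumes w: "count_A w \<ge> 2" shows "cv (invol w) = cnj (cv w)"
proof (rule LIMSEQ_unique[OF lim_word])
  show "count_A (invol w) \<ge> 2" using w by simp
  have "t n (Poly_Mapping.single (invol w) 1) = cnj (t n (Poly_Mapping.single w 1))" for n
    unfolding t_star[symmetric] by (simp add: star_single star_complex_def)
  then show "(\<lambda>n. t n (Poly_Mapping.single (invol w) 1)) \<longlonglongrightarrow> cnj (cv w)"
    using tendsto_cnj[OF lim_word[OF w]] by simp
qed

lemma monotone_value_invol:
  assumes "count_A w \<ge> 1"
  shows "monotone_value mA mB (invol w) = cnj (monotone_value mA mB w)"
proof (cases "count_A w \<ge> 2")
  case True
  then show ?thesis by (simp add: monotone_value_def cv_invol)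
next
  case False
  then have 1: "count_A w = 1" using assms by simp
  then obtain u l v where w: "w = wordB u + wordA (Word [l]) + wordB v" using count_A_one_decompose by blast
  have "invol w = wordB (invol v) + wordA (Word [flip_letter l]) + wordB (invol u)"
    by (simp add: w invol_add wordB_invol wordA_invol[symmetric] add.assoc) (simp add: invol_nc_word_def)
  then have "monotone_value mA mB (invol w) = mA (Word [flip_letter l]) * mB (invol (v + u))"
    using 1 single_value[of mA mB "invol v" "flip_letter l" "invol u"]
    by (simp add: monotone_value_def invol_add count_A_wordA)
  also have "mA (Word [flip_letter l]) = cnj (mA (Word [l]))"
    using mA_invol[of "Word [l]"] by (simp add: invol_nc_word_def zero_nc_word_def)
  also have "mB (invol (v + u)) = cnj (mB (v + u))" by (simp add: alg_word_invol \<tau>0_star)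
  finally show ?thesis using 1 single_value[of mA mB u l v] by (simp add: monotone_value_def w)
qed

lemma \<omega>_star: "p \<in> polys1 \<Longrightarrow> \<omega> (star p) = cnj (\<omega> p)"
proof (induction rule: polys_on_induct)
  case (single w c)
  then show ?case by (simp add: star_single star_complex_def monotone_value_invol)
qed (simp_all add: star_add star_zero nc_lin_add)

text \<open>A product of two elements of \<open>polys1\<close> has two letters of the first kind in
  each word, so positivity and traciality are limits of the same facts for matrices. Only
  compatibility with the adjoint meets words with one such letter;
  \<open>monotone_value_invol\<close> settles it from the prescribed values.\<close>

lemma tracial_weight_\<omega>: "tracial_weight polys1 \<omega>"
  unfolding tracial_weight_def star_subalgebra_def
proof (intro conjI ballI allI)
  fix p q :: "('k + 'l) nc_poly" and c :: complex assume pq: "p \<in> polys1" "q \<in> polys1"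
  show "p + q \<in> polys1" "p * q \<in> polys1" "c *\<^sub>C p \<in> polys1" "star p \<in> polys1"
    by (intro polys_on_add polys1_ideal polys_on_scaleC polys1_star pq)+
  show "\<omega> (p + q) = \<omega> p + \<omega> q" "\<omega> (c *\<^sub>C p) = c * \<omega> p" by (rule nc_lin_add nc_lin_scaleC)+
  show "\<omega> (star p * p) \<in> \<real>\<^sub>\<ge>\<^sub>0" unfolding \<omega>_star_mult[OF pq(1)] by (simp del: of_real_power)
  show "\<omega> (star p) = cnj (\<omega> p)" by (rule \<omega>_star[OF pq(1)])
  show "\<omega> (p * q) = \<omega> (q * p)" by (rule \<omega>_commute[OF pq])
qed simp

lemma nc_probability_space_\<tau>: "nc_probability_space \<tau>"
  unfolding nc_probability_space_def tracial_weight_def star_subalgebra_def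
  by (auto simp: \<tau>_def \<tau>0_one alg_eval_add alg_eval_scaleC alg_eval_mult alg_eval_star \<tau>0_add \<tau>0_scaleC \<tau>0_star
      \<tau>0_pos intro: \<tau>0_commute)

lemma \<omega>_wordA: assumes w: "w \<noteq> 0" shows "\<omega> (Poly_Mapping.single (wordA w) 1) = mA w"
proof (cases "count_A (wordA w :: ('k + 'l) nc_word) \<ge> 2")
  case True
  show ?thesis
    by (rule LIMSEQ_unique[OF lim_\<omega> limA[OF w]]) (use True in \<open>simp add: polys_on_single\<close>)
next
  case False
  then have "length (letters w) = 1" using count_A_wordA_pos[OF w, where ?'b = 'l] by (simp add: count_A_wordA)
  then obtain l where l: "w = Word [l]" by (cases w) (auto simp: length_Suc_conv)
  show ?thesis using False single_value[of mA mB 0 l 0] by (simp add: l monotone_value_def \<tau>0_one)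
qed

text \<open>The rule for a single pair. If \<open>u'\<close> has at least two letters it is itself a
  product, and the limit theorem applies; for one letter the rule holds by the choice of
  \<open>single_value\<close>.\<close>

lemma \<omega>_mult: "p \<in> polysA \<Longrightarrow> q \<in> polysB \<Longrightarrow> \<omega> (p * q) = \<omega> p * \<tau> q"
proof (induction rule: polys_on_induct)
  case (single u c)
  then obtain u' where u: "u = wordA u'" "u' \<noteq> 0" by auto
  have "\<omega> (Poly_Mapping.single (wordA u') 1 * q) = mA u' * \<tau> q" using single(2)
  proof (induction rule: polys_on_induct)
    case (single v d)
    then obtain v' where v: "v = wordB v'" by auto
    have "\<omega> (Poly_Mapping.single (wordA u') 1 * Poly_Mapping.single (wordB v') 1) = mA u' * mB v'"
    proof (cases "length (letters u') \<ge> 2")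
      case True
      then obtain k l ls where kls: "u' = Word [k] + Word (l # ls)"
        by (cases u'; cases "letters u'"; cases "tl (letters u')") (auto simp: plus_nc_word_def)
      define a where "a = Poly_Mapping.single (wordA (Word [k]) :: ('k + 'l) nc_word) (1 :: complex)"
      define a' where "a' = Poly_Mapping.single (wordA (Word (l # ls)) :: ('k + 'l) nc_word) (1 :: complex)"
      have aa: "a \<in> polysA" "a' \<in> polysA" unfolding a_def a'_def by (auto intro!: polys_on_single simp: zero_nc_word_def)
      have uaa: "Poly_Mapping.single (wordA u') 1 = a * a'" by (simp add: kls a_def a'_def mult_single wordA_add)
      define b where "b = Poly_Mapping.single (wordB v' :: ('k + 'l) nc_word) (1 :: complex)"
      have b: "b \<in> polysB" unfolding b_def by (auto intro!: polys_on_single)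
      have "(\<lambda>n. t n (pair_prod [(a * a', b)])) \<longlonglongrightarrow> mA u' * prod_list (map (\<lambda>(\<alpha>, \<beta>). \<tau> \<beta>) [(a * a', b)])"
      proof (rule pair_prod_tendsto)
        show "(\<lambda>n. t n (prod_list (map fst [(a * a', b)]))) \<longlonglongrightarrow> mA u'" using limA[OF u(2)] by (simp add: uaa)
      qed (use aa b polysA_mult in auto)
      moreover have "a * a' * b \<in> polys2"
        unfolding mult.assoc[of a] by (intro polys1_mult2 polys1_ideal(2)[of a' b] polysA_polys1 aa)
      ultimately have "\<omega> (a * a' * b) = mA u' * \<tau> b" using LIMSEQ_unique lim_\<omega> by fastforce
      then show ?thesis by (simp add: uaa b_def \<tau>_wordB)
    next
      case False
      then have "length (letters u') = 1" using u(2) by (cases u'; cases "letters u'") (auto simp: zero_nc_word_def Suc_le_eq)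
      then obtain l where l: "u' = Word [l]" by (cases u') (auto simp: length_Suc_conv)
      have "count_A (wordA u' + wordB v' :: ('k + 'l) nc_word) = 1" by (simp add: l count_A_wordA)
      then show ?thesis using single_value[of mA mB 0 l v'] by (simp add: l monotone_value_def mult_single)
    qed
    moreover have "\<omega> (Poly_Mapping.single (wordA u') 1 * Poly_Mapping.single (wordB v') d) =
        d * \<omega> (Poly_Mapping.single (wordA u') 1 * Poly_Mapping.single (wordB v') 1)" by (simp add: mult_single)
    ultimately show ?case by (simp add: v \<tau>_wordB)
  next
    case (add p q)
    then show ?case by (simp add: distrib_left nc_lin_add \<tau>_add)
  next
    case zero
    then show ?case by (simp add: \<tau>_def \<tau>0_zero)
  qed
  then have "\<omega> (c *\<^sub>C (Poly_Mapping.single (wordA u') 1 * q)) = c * mA u' * \<tau> q" by (simp only: nc_lin_scaleC mult.assoc)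
  then show ?case using \<omega>_wordA[OF u(2)]
    by (simp add: u(1) mult_scaleC_left[symmetric] scaleC_single scaleC_complex_def)
qed (simp_all add: distrib_right nc_lin_add)

lemma star_subalgebra_polysA: "star_subalgebra polysA"
  by (auto simp: star_subalgebra_def polys_on_add polysA_mult polys_on_scaleC polysA_star)

lemma star_subalgebra_polysB: "star_subalgebra polysB"
  by (auto simp: star_subalgebra_def polys_on_add polysB_mult polys_on_scaleC polysB_star)

lemma single_wordA_var: "nc_var (Inl i) = Poly_Mapping.single (wordA (Word [Var i])) (1 :: complex)"
  and single_wordB_var: "nc_var (Inr j) = Poly_Mapping.single (wordB (Word [Var j])) (1 :: complex)"
  by (simp_all add: nc_var_def wordA_def wordB_def)

lemma prod_list_polysA: "as \<noteq> [] \<Longrightarrow> set as \<subseteq> polysA \<Longrightarrow> prod_list as \<in> polysA"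
proof (induction as)
  case (Cons a as)
  then show ?case by (cases "as = []") (auto intro: polysA_mult)
qed simp

lemma \<omega>_pair_prod:
  assumes ps: "ps \<noteq> []" "set ps \<subseteq> polysA \<times> polysB"
  shows "\<omega> (pair_prod ps) = \<omega> (prod_list (map fst ps)) * prod_list (map (\<lambda>(\<alpha>, \<beta>). \<tau> \<beta>) ps)"
proof -
  obtain a b qs where ps_eq: "ps = (a, b) # qs" using ps(1) by (cases ps) auto
  have ab: "a \<in> polysA" "b \<in> polysB" "set qs \<subseteq> polysA \<times> polysB" using ps(2) by (auto simp: ps_eq)
  show ?thesis
  proof (cases "qs = []")
    case True
    then show ?thesis using \<omega>_mult[OF ab(1,2)] by (simp add: ps_eq)
  next
    case False
    then obtain a' b' rs where qs: "qs = (a', b') # rs" by (cases qs) auto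
    have a': "a' \<in> polysA" using ab(3) by (auto simp: qs)
    have len: "length ps \<ge> 2" by (simp add: ps_eq qs)
    have "prod_list (map fst qs) \<in> polysA" by (rule prod_list_polysA) (use False ab(3) in auto)
    then have m: "prod_list (map fst ps) \<in> polys2"
      unfolding ps_eq by (auto intro: polys1_mult2 polysA_polys1 ab)
    have "pair_prod qs \<in> polys1" 
      unfolding qs list.map prod_list.Cons prod.case by (intro polys1_ideal(2) polysA_polys1 a')
    then have m': "pair_prod ps \<in> polys2"
      unfolding ps_eq list.map prod_list.Cons prod.case
      by (intro polys1_mult2 polys1_ideal(2)[of a b] polysA_polys1[OF ab(1)])
    show ?thesis
      by (rule LIMSEQ_unique[OF lim_\<omega>[OF m'] pair_prod_tendsto[OF ps(2) _ lim_\<omega>[OF m]]]) (use len in simp)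
  qed
qed

text \<open>The variables themselves are the independent families. The algebras that they generate
  lie inside \<open>polysA\<close> and \<open>polysB\<close>, where the factorization is
  \<open>\<omega>_pair_prod\<close>.\<close>

theorem cyclic_monotone_model:
  "cyclic_monotone_model mA (alg_moments \<tau>\<^sub>0 y) polys1 \<omega> \<tau> (\<lambda>i. nc_var (Inl i)) (\<lambda>j. nc_var (Inr j))"
  unfolding cyclic_monotone_model_def
proof (intro conjI nc_probability_space_\<tau> tracial_weight_\<omega> allI impI)
  fix w :: "'k nc_word" assume "w \<noteq> 0"
  then show "alg_moments \<omega> (\<lambda>i. nc_var (Inl i)) w = mA w"
    unfolding alg_moments_def alg_word_var_A by (rule \<omega>_wordA)
next
  fix w :: "'l nc_word"
  show "alg_moments \<tau> (\<lambda>j. nc_var (Inr j)) w = alg_moments \<tau>\<^sub>0 y w"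
    unfolding alg_moments_def alg_word_var_B \<tau>_wordB by simp
next
  let ?a = "\<lambda>i. nc_var (Inl i) :: ('k + 'l) nc_poly" and ?b = "\<lambda>j. nc_var (Inr j) :: ('k + 'l) nc_poly"
  have a: "range ?a \<subseteq> polysA" unfolding single_wordA_var by (auto intro!: polys_on_single simp: zero_nc_word_def)
  have b: "range ?b \<subseteq> polysB" unfolding single_wordB_var by (auto intro!: polys_on_single)
  have one: "1 \<in> polysB" using polys_on_single[of 0 "range wordB" 1] rangeI[of wordB 0] by simp
  note A = generated_star_algebra_minimal[OF star_subalgebra_polysA a]
  have B: "generated_star_algebra (insert 1 (range ?b)) \<subseteq> polysB"
    by (rule generated_star_algebra_minimal[OF star_subalgebra_polysB]) (use b one in auto)
  show "cyclically_monotone_families polys1 \<omega> \<tau> ?a ?b"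
    unfolding cyclically_monotone_families_def cyclically_monotone_def
  proof (intro conjI star_subalgebra_generated generated_star_algebra_base ballI allI impI)
    show "range ?a \<subseteq> polys1" using a polysA_polys1 by blast
  next
    fix \<beta>0 ps assume *: "ps \<noteq> [] \<and> set ps \<subseteq> generated_star_algebra (range ?a) \<times> generated_star_algebra (insert 1 (range ?b))"
    then have ps: "ps \<noteq> []" "set ps \<subseteq> polysA \<times> polysB" using A B by auto
    then obtain p b qs where "ps = (p, b) # qs" "p \<in> polysA" by (cases ps) auto
    have "\<beta>0 * (p * b * pair_prod qs) \<in> polys1"
      by (intro polys1_ideal(1)[where q = \<beta>0] polys1_ideal(2) polysA_polys1) fact
    then show "\<beta>0 * pair_prod ps \<in> polys1" using \<open>ps = (p, b) # qs\<close> by simp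
    show "\<omega> (pair_prod ps) = \<omega> (prod_list (map fst ps)) * prod_list (map (\<lambda>(\<alpha>, \<beta>). \<tau> \<beta>) ps)"
      by (rule \<omega>_pair_prod[OF ps])
  qed simp
qed

lemma polys1_power: "X \<in> polys1 \<Longrightarrow> m \<ge> 1 \<Longrightarrow> X ^ m \<in> polys1"
  by (cases m) (simp_all only: power_Suc polys1_ideal)

lemma polys1_power2: "X \<in> polys1 \<Longrightarrow> m \<ge> 2 \<Longrightarrow> X ^ m \<in> polys2"
  using polys1_mult2[OF polys1_power[of X 1] polys1_power[of X "m - 1"]] power_add[of X 1 "m - 1"] by simp

text \<open>The constant is one more than the limit of Tr X^2, which makes it positive and no
  smaller than the squared limit norm of \<open>X\<close>, as damping requires.\<close>

lemma damped_moment_tendsto: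
  assumes X: "X \<in> polys1" "star X = X"
  shows "(\<lambda>J. damped_moment cv X (1 + Re (nc_lin cv (X * X))) 2 J) \<longlonglongrightarrow> 0"
proof -
  define C where "C = 1 + Re (nc_lin cv (X * X))"
  have "nc_lin cv (X * X) = of_real ((lh X)\<^sup>2)"
    using \<omega>_star_mult[OF X(1)] \<omega>_polys2[OF polys1_mult2[OF X(1) X(1)]] by (simp add: X(2))
  then have C: "C > 0" "(lh X)\<^sup>2 \<le> C" by (simp_all add: C_def add_pos_nonneg)
  have lim: "(\<lambda>J. lt (X * damp X C ^ J * X)) \<longlonglongrightarrow> 0"
    by (rule lt_damp_tendsto[OF X C]) (use polys1_approx[OF X(1)] in blast)
  have "X * damp X C ^ J * X = X ^ 2 * damp X C ^ J" for J
    by (simp add: damp_pow_commute[OF X C] mult.assoc power2_eq_square)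
  moreover have "X * damp X C ^ J * X \<in> polys2" for J
    by (intro polys1_mult2 polys1_ideal(2) X)
  ultimately have "Re (lt (X * damp X C ^ J * X)) = damped_moment cv X C 2 J" for J
    by (simp add: lt_polys2 damped_moment_def damp_def[OF X C])
  then show ?thesis using tendsto_Re[OF lim] by (simp add: C_def)
qed

end

section \<open>Random matrices and the almost sure statement\<close>

instance letter :: (countable) countable
  by countable_datatype

text \<open>Words are countable, so convergence for all triples of words holds off a single null
  set.\<close>

instance nc_word :: (countable) countable
  by countable_datatype

lemma alg_word_kill_A:
  "alg_word (case_sum (\<lambda>_. 0) (\<lambda>j. nc_var (Inr j))) w =
     (if count_A w = 0 then Poly_Mapping.single w 1 else 0 :: ('k + 'l) nc_poly)"
proof (cases w)
  case (Word ls)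
  show ?thesis unfolding Word
  proof (induction ls)
    case Nil
    then show ?case by (simp add: zero_nc_word_def[symmetric])
  next
    case (Cons l ls)
    show ?case
    proof (cases "letter_A l")
      case True
      then obtain k where "l = map_letter Inl k" using letter_A_iff by blast
      then show ?thesis by (cases k) (auto simp: alg_word_Cons count_A_def star_zero)
    next
      case False
      then obtain k where k: "l = map_letter Inr k" using not_letter_A_iff by blast
      have "(case l of Var v \<Rightarrow> case_sum (\<lambda>_. 0) (\<lambda>j. nc_var (Inr j)) v
          | Adj v \<Rightarrow> star (case_sum (\<lambda>_. 0) (\<lambda>j. nc_var (Inr j)) v)) = (Poly_Mapping.single (Word [l]) 1 :: ('k + 'l) nc_poly)"
        by (cases k) (simp_all add: k nc_var_def star_single invol_nc_word_def star_complex_def)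
      moreover have "count_A (Word (l # ls)) = count_A (Word ls)" using False by (simp add: count_A_def)
      ultimately show ?thesis by (simp add: alg_word_Cons Cons mult_single plus_nc_word_def)
    qed
  qed
qed

lemma lookup_alg_eval_kill_A:
  "Poly_Mapping.lookup (alg_eval (case_sum (\<lambda>_. 0) (\<lambda>j. nc_var (Inr j))) (p :: ('k + 'l) nc_poly)) w =
     (if count_A w = 0 then Poly_Mapping.lookup p w else 0)"
proof (induction p rule: poly_mapping_single_induct)
  case (single u c)
  show ?case
    by (auto simp: alg_eval_single alg_word_kill_A lookup_scaleC lookup_single scaleC_complex_def when_def scaleC_zero)
qed (auto simp: alg_eval_add lookup_add)

text \<open>Setting the first family to zero removes the words that contain one of its letters and
  fixes all others, so the coefficients of the latter must vanish.\<close>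

lemma polys1_if_vanishing:
  fixes P :: "('k + 'l) nc_poly"
  assumes "alg_eval (case_sum (\<lambda>_. 0) (\<lambda>j. nc_var (Inr j))) P = (0 :: ('k + 'l) nc_poly)"
  shows "P \<in> polys_on {w. count_A w \<ge> 1}"
proof (rule polys_onI, rule subsetI, rule CollectI, rule ccontr)
  fix w assume w: "w \<in> Poly_Mapping.keys P" "\<not> 1 \<le> count_A w"
  then show False using lookup_alg_eval_kill_A[of P w] assms by (simp add: in_keys_iff)
qed

lemma star_power_selfadjoint: "star X = X \<Longrightarrow> star (X ^ m) = X ^ m" for X :: "'a::complex_star_algebra"
  by (induction m) (simp_all add: star_mult power_commutes)

lemma mat_word_wordA: "mat_word n (case_sum a b) (wordA w) = mat_word n a w"
  and mat_word_wordB: "mat_word n (case_sum a b) (wordB w') = mat_word n b w'"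
  unfolding mat_word_def by (rule word_value_wordA word_value_wordB)+

lemma unitary_conj_carrier: "W \<in> unitary_mats n \<Longrightarrow> b \<in> carrier_mat n n \<Longrightarrow> W * b * mat_adjoint W \<in> carrier_mat n n"
  by (auto simp: unitary_mats_def intro!: mult_carrier_mat[of _ n n])

lemma unitary_conj_add:
  assumes W: "W \<in> unitary_mats n" and b: "b \<in> carrier_mat n n" "b' \<in> carrier_mat n n"
  shows "W * (b + b') * mat_adjoint W = W * b * mat_adjoint W + W * b' * mat_adjoint W"
proof -
  have c: "W \<in> carrier_mat n n" "mat_adjoint W \<in> carrier_mat n n" using W by (auto simp: unitary_mats_def)
  show ?thesis unfolding mult_add_distrib_mat[OF c(1) b]
    by (rule add_mult_distrib_mat[OF mult_carrier_mat[OF c(1) b(1)] mult_carrier_mat[OF c(1) b(2)] c(2)])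
qed

lemma unitary_conj_smult:
  assumes W: "W \<in> unitary_mats n" and b: "b \<in> carrier_mat n n"
  shows "W * (c \<cdot>\<^sub>m b) * mat_adjoint W = c \<cdot>\<^sub>m (W * b * mat_adjoint W)"
proof -
  have c: "W \<in> carrier_mat n n" "mat_adjoint W \<in> carrier_mat n n" using W by (auto simp: unitary_mats_def)
  show ?thesis unfolding mult_smult_distrib[OF c(1) b]
    by (rule mult_smult_assoc_mat[OF mult_carrier_mat[OF c(1) b] c(2)])
qed

lemma unitary_conj_one: "W \<in> unitary_mats n \<Longrightarrow> W * 1\<^sub>m n * mat_adjoint W = 1\<^sub>m n"
  by (auto simp: unitary_mats_def)

lemma mat_word_unitary_conj:
  assumes W: "W \<in> unitary_mats n" and b: "\<And>j. b j \<in> carrier_mat n n"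
  shows "mat_word n (\<lambda>j. W * b j * mat_adjoint W) w = W * mat_word n b w * mat_adjoint W"
proof (cases w)
  case (Word ls)
  have c: "W * b j * mat_adjoint W \<in> carrier_mat n n" for j by (rule unitary_conj_carrier[OF W b])
  have W': "W \<in> carrier_mat n n" using W by (auto simp: unitary_mats_def)
  show ?thesis unfolding Word
  proof (induction ls)
    case Nil
    then show ?case
      using mat_word_zero[of b n, OF b] mat_word_zero[of "\<lambda>j. W * b j * mat_adjoint W" n, OF c] unitary_conj_one[OF W]
      by (simp add: zero_nc_word_def)
  next
    case (Cons l ls)
    let ?L = "case l of Var v \<Rightarrow> b v | Adj v \<Rightarrow> mat_adjoint (b v)"
    have L: "?L \<in> carrier_mat n n" by (rule mat_letter_carrier) (rule b)
    have "(case l of Var v \<Rightarrow> W * b v * mat_adjoint W | Adj v \<Rightarrow> mat_adjoint (W * b v * mat_adjoint W)) =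
        W * ?L * mat_adjoint W"
      by (cases l) (simp_all add: unitary_conj_adjoint[OF W' b])
    then show ?case
      unfolding mat_word_Cons[of b n, OF b] mat_word_Cons[of "\<lambda>j. W * b j * mat_adjoint W" n, OF c] Cons
      using unitary_conj_mult[OF W L mat_word_carrier[of b n, OF b]] by simp
  qed
qed

definition conj_family :: "('k \<Rightarrow> complex mat) \<Rightarrow> ('l \<Rightarrow> complex mat) \<Rightarrow> complex mat \<Rightarrow> 'k + 'l \<Rightarrow> complex mat" where
  "conj_family a b W = case_sum a (\<lambda>j. W * b j * mat_adjoint W)"

lemma conj_family_carrier:
  "(\<And>i. a i \<in> carrier_mat n n) \<Longrightarrow> (\<And>j. b j \<in> carrier_mat n n) \<Longrightarrow> W \<in> unitary_mats n \<Longrightarrow>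
     conj_family a b W v \<in> carrier_mat n n"
  by (auto simp: conj_family_def intro: unitary_conj_carrier split: sum.split)

lemma smult_one_mat [simp]: "(1 :: complex) \<cdot>\<^sub>m X = X"
  by (rule eq_matI) auto

lemma trace_hs_sequence_mat_eval:
  assumes f: "\<And>n v. f n v \<in> carrier_mat (Suc n) (Suc n)"
  shows "trace_hs_sequence (\<lambda>n p. mat_Tr (mat_eval (Suc n) (f n) p)) (\<lambda>n p. hs_norm (mat_eval (Suc n) (f n) p))"
proof
  fix n :: nat and p q :: "'a nc_poly" and c :: complex
  note F = f[of n]
  note c = mat_eval_carrier[of "f n", OF F]
  show "mat_Tr (mat_eval (Suc n) (f n) (p + q)) = mat_Tr (mat_eval (Suc n) (f n) p) + mat_Tr (mat_eval (Suc n) (f n) q)"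
    "mat_Tr (mat_eval (Suc n) (f n) (c *\<^sub>C p)) = c * mat_Tr (mat_eval (Suc n) (f n) p)"
    unfolding mat_Tr_mat_eval[of "f n", OF F] by (rule nc_lin_add nc_lin_scaleC)+
  show "mat_Tr (mat_eval (Suc n) (f n) (p * q)) = mat_Tr (mat_eval (Suc n) (f n) (q * p))"
    unfolding mat_eval_mult[of "f n", OF F] by (rule mat_Tr_commute[OF c c])
  show "cmod (mat_Tr (mat_eval (Suc n) (f n) (p * q))) \<le> hs_norm (mat_eval (Suc n) (f n) p) * hs_norm (mat_eval (Suc n) (f n) q)"
    "hs_norm (mat_eval (Suc n) (f n) (p * q)) \<le> hs_norm (mat_eval (Suc n) (f n) p) * hs_norm (mat_eval (Suc n) (f n) q)"
    unfolding mat_eval_mult[of "f n", OF F] by (rule mat_Tr_mult_le[OF c c] hs_norm_mult[OF c c])+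
  show "hs_norm (mat_eval (Suc n) (f n) (p + q)) \<le> hs_norm (mat_eval (Suc n) (f n) p) + hs_norm (mat_eval (Suc n) (f n) q)"
    unfolding mat_eval_add[of "f n", OF F] by (rule hs_norm_add[OF c c])
  show "hs_norm (mat_eval (Suc n) (f n) (c *\<^sub>C p)) = cmod c * hs_norm (mat_eval (Suc n) (f n) p)"
    unfolding mat_eval_scaleC[of "f n", OF F] by (rule hs_norm_smult)
  show "hs_norm (mat_eval (Suc n) (f n) (star p)) = hs_norm (mat_eval (Suc n) (f n) p)"
    unfolding mat_eval_star[of "f n", OF F] by (rule hs_norm_adjoint)
  show "mat_Tr (mat_eval (Suc n) (f n) (star p * p)) = complex_of_real ((hs_norm (mat_eval (Suc n) (f n) p))\<^sup>2)"
    unfolding mat_eval_mult[of "f n", OF F] mat_eval_star[of "f n", OF F] by (rule mat_Tr_adjoint_mult[OF c])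
qed simp

lemma mat_Tr_adjoint: "X \<in> carrier_mat n n \<Longrightarrow> mat_Tr (mat_adjoint X) = cnj (mat_Tr X)"
  by (auto simp: mat_Tr_def)

lemma mat_Tr_one [simp]: "mat_Tr (1\<^sub>m n) = of_nat n"
  by (simp add: mat_Tr_def)

lemma hs_norm_one: "(hs_norm (1\<^sub>m n))\<^sup>2 = real n"
proof -
  have "complex_of_real ((hs_norm (1\<^sub>m n))\<^sup>2) = of_real (real n)"
    unfolding mat_Tr_adjoint_mult[OF one_carrier_mat, of n, symmetric] by simp
  then show ?thesis by (simp only: of_real_eq_iff)
qed

text \<open>The data of the theorem apart from \<open>P\<close>. Stage \<open>n\<close> of the
  abstract sequences will be matrix size \<open>Suc n\<close>, which skips the empty size 0.\<close>

locale haar_conjugation =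
  fixes A :: "nat \<Rightarrow> 'k::finite \<Rightarrow> complex mat"
    and B :: "nat \<Rightarrow> 'l::finite \<Rightarrow> complex mat"
    and M :: "'w measure"
    and U :: "nat \<Rightarrow> 'w \<Rightarrow> complex mat"
    and x :: "'k \<Rightarrow> 'h \<Rightarrow> 'h::complex_hilbert_space"
    and y :: "'l \<Rightarrow> 'c::complex_star_algebra"
    and \<tau>\<^sub>0 :: "'c \<Rightarrow> complex"
  assumes A: "n \<ge> 1 \<Longrightarrow> A n i \<in> carrier_mat n n"
    and B: "n \<ge> 1 \<Longrightarrow> B n j \<in> carrier_mat n n"
    and M: "prob_space M"
    and U: "n \<ge> 1 \<Longrightarrow> haar_unitary M n (U n)"
    and tc: "trace_class (x i)"
    and lim_A: "converges_in_distribution (\<lambda>n. mat_moments mat_Tr n (A n)) (op_moments x)"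
    and np: "nc_probability_space \<tau>\<^sub>0"
    and lim_B: "converges_in_distribution (\<lambda>n. mat_moments mat_tr n (B n)) (alg_moments \<tau>\<^sub>0 y)"
begin

abbreviation wA :: "nat \<Rightarrow> 'k nc_word \<Rightarrow> complex mat" where "wA n \<equiv> mat_word (Suc n) (A (Suc n))"

abbreviation wB :: "nat \<Rightarrow> 'l nc_word \<Rightarrow> complex mat" where "wB n \<equiv> mat_word (Suc n) (B (Suc n))"

abbreviation f :: "'w \<Rightarrow> nat \<Rightarrow> 'k + 'l \<Rightarrow> complex mat" where
  "f \<xi> n \<equiv> conj_family (A (Suc n)) (B (Suc n)) (U (Suc n) \<xi>)"

abbreviation t :: "'w \<Rightarrow> nat \<Rightarrow> ('k + 'l) nc_poly \<Rightarrow> complex" where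
  "t \<xi> n p \<equiv> mat_Tr (mat_eval (Suc n) (f \<xi> n) p)"

abbreviation h :: "'w \<Rightarrow> nat \<Rightarrow> ('k + 'l) nc_poly \<Rightarrow> real" where
  "h \<xi> n p \<equiv> hs_norm (mat_eval (Suc n) (f \<xi> n) p)"

text \<open>Unitary conjugation preserves traces, so the centering constants are deterministic and
  can be formed from \<open>B\<close> alone.\<close>

definition cB :: "nat \<Rightarrow> 'l nc_word \<Rightarrow> complex" where
  "cB n w = mat_Tr (wB n w) / of_nat (Suc n)"

definition b0 :: "nat \<Rightarrow> 'l nc_word \<Rightarrow> complex mat" where
  "b0 n w = wB n w + (- cB n w) \<cdot>\<^sub>m 1\<^sub>m (Suc n)"

lemma A': "A (Suc n) i \<in> carrier_mat (Suc n) (Suc n)" and B': "B (Suc n) j \<in> carrier_mat (Suc n) (Suc n)"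
  by (auto intro: A B)

lemmas wA_carrier = mat_word_carrier[of "A (Suc n)" "Suc n" for n, OF A']
  and wB_carrier = mat_word_carrier[of "B (Suc n)" "Suc n" for n, OF B']

lemma b0_carrier: "b0 n w \<in> carrier_mat (Suc n) (Suc n)"
  unfolding b0_def by (intro add_carrier_mat smult_carrier_mat one_carrier_mat)

lemma U_mem: "\<xi> \<in> space M \<Longrightarrow> U (Suc n) \<xi> \<in> unitary_mats (Suc n)"
  by (rule haar_unitary_mem[OF U]) auto

lemma f_carrier: "\<xi> \<in> space M \<Longrightarrow> f \<xi> n v \<in> carrier_mat (Suc n) (Suc n)"
  by (intro conj_family_carrier A' B' U_mem)

lemma tendsto_wA: "u \<noteq> 0 \<Longrightarrow> (\<lambda>n. mat_Tr (wA n u)) \<longlonglongrightarrow> op_moments x u"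
  using lim_A LIMSEQ_Suc unfolding converges_in_distribution_def mat_moments_def by fastforce

lemma tendsto_cB: "(\<lambda>n. cB n w) \<longlonglongrightarrow> \<tau>\<^sub>0 (alg_word y w)"
proof (cases "w = 0")
  case True
  have "cB n w = 1" for n unfolding cB_def True mat_word_zero[of "B (Suc n)", OF B'] by (simp del: of_nat_Suc)
  then show ?thesis using np by (simp add: True nc_probability_space_def)
next
  case False
  then have "(\<lambda>n. mat_tr (mat_word n (B n) w)) \<longlonglongrightarrow> \<tau>\<^sub>0 (alg_word y w)"
    using lim_B unfolding converges_in_distribution_def mat_moments_def alg_moments_def by blast
  from LIMSEQ_Suc[OF this] show ?thesis
    using carrier_matD(1)[OF wB_carrier] by (simp only: mat_tr_def cB_def)
qed

text \<open>The squared norm is the trace at the word \<open>invol u + u\<close>, hence a convergent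
  sequence.\<close>

lemma wA_bounded:
  assumes u: "u \<noteq> 0"
  shows "\<exists>C\<ge>0. \<forall>n. hs_norm (wA n u) \<le> C"
proof -
  have "invol u + u \<noteq> 0" using u by (simp add: nc_word_add_eq_0)
  then obtain C where C: "\<And>n. cmod (mat_Tr (wA n (invol u + u))) \<le> C"
    using tendsto_cmod_bounded[OF tendsto_wA] by blast
  have "(hs_norm (wA n u))\<^sup>2 \<le> C" for n
  proof -
    have "mat_Tr (wA n (invol u + u)) = of_real ((hs_norm (wA n u))\<^sup>2)"
      unfolding mat_word_add[of "A (Suc n)", OF A'] mat_word_invol[of "A (Suc n)", OF A']
      by (rule mat_Tr_adjoint_mult[OF wA_carrier])
    then show ?thesis using C[of n] by (simp add: norm_power)
  qed
  then have "\<forall>n. hs_norm (wA n u) \<le> sqrt C" using real_le_rsqrt by blast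
  moreover have "0 \<le> sqrt C" using calculation hs_norm_nonneg order_trans by blast
  ultimately show ?thesis by blast
qed

text \<open>The squared norm of \<open>wB n w\<close> is \<open>Suc n\<close> times a convergent
  normalized moment, and subtracting a bounded multiple of the identity keeps that order.\<close>

lemma b0_bounded: "\<exists>C. 0 \<le> C \<and> (\<forall>n. (hs_norm (b0 n w))\<^sup>2 \<le> C * real (Suc n))"
proof -
  obtain C where C: "\<And>n. cmod (cB n (invol w + w)) \<le> C" using tendsto_cmod_bounded[OF tendsto_cB] by blast
  obtain K where K: "\<And>n. cmod (cB n w) \<le> K" using tendsto_cmod_bounded[OF tendsto_cB] by blast
  have C0: "0 \<le> C" using C[of 0] norm_ge_zero order_trans by blast
  have "(hs_norm (b0 n w))\<^sup>2 \<le> (2 * C + 2 * K\<^sup>2) * Suc n" for n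
  proof -
    have "mat_Tr (wB n (invol w + w)) = of_real ((hs_norm (wB n w))\<^sup>2)"
      unfolding mat_word_add[of "B (Suc n)", OF B'] mat_word_invol[of "B (Suc n)", OF B']
      by (rule mat_Tr_adjoint_mult[OF wB_carrier])
    then have "cmod (cB n (invol w + w)) = (hs_norm (wB n w))\<^sup>2 / Suc n"
      by (simp add: cB_def norm_divide norm_power del: of_nat_Suc)
    then have 1: "(hs_norm (wB n w))\<^sup>2 \<le> C * Suc n" using C[of n] by (simp add: divide_le_eq del: of_nat_Suc)
    have "(cmod (cB n w) * hs_norm (1\<^sub>m (Suc n)))\<^sup>2 \<le> K\<^sup>2 * Suc n"
      unfolding power_mult_distrib hs_norm_one using K[of n] by (intro mult_right_mono power_mono) auto
    moreover have "hs_norm (b0 n w) \<le> hs_norm (wB n w) + cmod (cB n w) * hs_norm (1\<^sub>m (Suc n))"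
      unfolding b0_def using hs_norm_add[OF wB_carrier smult_carrier_mat[OF one_carrier_mat], of n w "- cB n w"]
      by (simp add: hs_norm_smult)
    then have "(hs_norm (b0 n w))\<^sup>2 \<le> (hs_norm (wB n w) + cmod (cB n w) * hs_norm (1\<^sub>m (Suc n)))\<^sup>2"
      by (intro power_mono) auto
    moreover have "(a + b)\<^sup>2 \<le> 2 * a\<^sup>2 + 2 * b\<^sup>2" for a b :: real
      using sum_squares_bound[of a b] by (simp add: power2_sum)
    ultimately show ?thesis using 1 by (smt (verit) distrib_right mult.assoc)
  qed
  moreover have "0 \<le> 2 * C + 2 * K\<^sup>2" using C0 by simp
  ultimately show ?thesis by blast
qed

lemma mat_Tr_add: "X \<in> carrier_mat n n \<Longrightarrow> Y \<in> carrier_mat n n \<Longrightarrow> mat_Tr (X + Y) = mat_Tr X + mat_Tr Y"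
  and mat_Tr_smult: "X \<in> carrier_mat n n \<Longrightarrow> mat_Tr (c \<cdot>\<^sub>m X) = c * mat_Tr X"
  by (auto simp: mat_Tr_def sum.distrib sum_distrib_left)

lemma b0_trace: "mat_Tr (b0 n w) = 0"
proof -
  have "mat_Tr (b0 n w) = mat_Tr (wB n w) + - cB n w * of_nat (Suc n)"
    unfolding b0_def mat_Tr_add[OF wB_carrier smult_carrier_mat[OF one_carrier_mat]] mat_Tr_smult[OF one_carrier_mat]
    by simp
  then show ?thesis by (simp add: cB_def del: of_nat_Suc)
qed

text \<open>The one property of a realization that is random; all other requirements of
  \<open>good_sequence\<close> concern the deterministic data.\<close>

definition good :: "'w \<Rightarrow> bool" where
  "good \<xi> \<longleftrightarrow> \<xi> \<in> space M \<and> (\<forall>u v w. u \<noteq> 0 \<longrightarrow> v \<noteq> 0 \<longrightarrow>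
     (\<lambda>n. mat_Tr (wA n u * (U (Suc n) \<xi> * b0 n w * mat_adjoint (U (Suc n) \<xi>)) * wA n v)) \<longlonglongrightarrow> 0 \<and>
     (\<lambda>n. hs_norm (wA n u * (U (Suc n) \<xi> * b0 n w * mat_adjoint (U (Suc n) \<xi>)) * wA n v)) \<longlonglongrightarrow> 0)"

lemma AE_good: "AE \<xi> in M. good \<xi>"
proof -
  have "AE \<xi> in M. u \<noteq> 0 \<longrightarrow> v \<noteq> 0 \<longrightarrow>
     (\<lambda>n. mat_Tr (wA n u * (U (Suc n) \<xi> * b0 n w * mat_adjoint (U (Suc n) \<xi>)) * wA n v)) \<longlonglongrightarrow> 0 \<and>
     (\<lambda>n. hs_norm (wA n u * (U (Suc n) \<xi> * b0 n w * mat_adjoint (U (Suc n) \<xi>)) * wA n v)) \<longlonglongrightarrow> 0" for u v w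
  proof (cases "u \<noteq> 0 \<and> v \<noteq> 0")
    case True
    obtain C1 where C1: "C1 \<ge> 0" "\<And>n. hs_norm (wA n u) \<le> C1" using wA_bounded[of u] True by blast
    obtain C2 where C2: "C2 \<ge> 0" "\<And>n. hs_norm (wA n v) \<le> C2" using wA_bounded[of v] True by blast
    obtain C3 where C3: "C3 \<ge> 0" "\<And>n. (hs_norm (b0 n w))\<^sup>2 \<le> C3 * real (Suc n)" using b0_bounded by blast
    have "AE \<xi> in M. (\<lambda>n. mat_Tr (wA n u * (U (Suc n) \<xi> * b0 n w * mat_adjoint (U (Suc n) \<xi>)) * wA n v)) \<longlonglongrightarrow> 0 \<and>
       (\<lambda>n. hs_norm (wA n u * (U (Suc n) \<xi> * b0 n w * mat_adjoint (U (Suc n) \<xi>)) * wA n v)) \<longlonglongrightarrow> 0"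
    \<comment> \<open>One constant has to bound all three sequences, hence the sum.\<close>
    proof (rule haar_centered_AE_tendsto[OF M, where U = "\<lambda>n. U (Suc n)" and C = "C1 + C2 + C3"])
      show "hs_norm (wA n u) \<le> C1 + C2 + C3" "hs_norm (wA n v) \<le> C1 + C2 + C3" for n
        using C1 C2 C3(1) by (smt (verit))+
      show "(hs_norm (b0 n w))\<^sup>2 \<le> (C1 + C2 + C3) * real (Suc n)" for n
        by (rule order_trans[OF C3(2)]) (use C1 C2 in \<open>intro mult_right_mono, auto\<close>)
    qed (auto intro: U b0_carrier b0_trace wA_carrier)
    then show ?thesis by (rule AE_mp) simp
  qed auto
  then have "AE \<xi> in M. \<forall>u v w. u \<noteq> 0 \<longrightarrow> v \<noteq> 0 \<longrightarrow>
     (\<lambda>n. mat_Tr (wA n u * (U (Suc n) \<xi> * b0 n w * mat_adjoint (U (Suc n) \<xi>)) * wA n v)) \<longlonglongrightarrow> 0 \<and>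
     (\<lambda>n. hs_norm (wA n u * (U (Suc n) \<xi> * b0 n w * mat_adjoint (U (Suc n) \<xi>)) * wA n v)) \<longlonglongrightarrow> 0"
    unfolding AE_all_countable by blast
  then show ?thesis using AE_space unfolding good_def by eventually_elim blast
qed

lemma ex_good: "\<exists>\<xi>. good \<xi>"
  using AE_good eventually_happens' prob_space.ae_filter_bot[OF M] by blast

lemma mat_eval_wordA:
  assumes \<xi>: "\<xi> \<in> space M"
  shows "mat_eval (Suc n) (f \<xi> n) (Poly_Mapping.single (wordA u) 1) = wA n u"
  unfolding mat_eval_single[of "f \<xi> n", OF f_carrier[OF \<xi>]] by (simp add: conj_family_def mat_word_wordA)

lemma mat_eval_wordB:
  assumes \<xi>: "\<xi> \<in> space M"
  shows "mat_eval (Suc n) (f \<xi> n) (Poly_Mapping.single (wordB w) 1) = U (Suc n) \<xi> * wB n w * mat_adjoint (U (Suc n) \<xi>)"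
  unfolding mat_eval_single[of "f \<xi> n", OF f_carrier[OF \<xi>]]
  by (simp add: conj_family_def mat_word_wordB mat_word_unitary_conj[OF U_mem[OF \<xi>] B'])

lemma t_wordB: "\<xi> \<in> space M \<Longrightarrow> t \<xi> n (Poly_Mapping.single (wordB w) 1) / of_nat (Suc n) = cB n w"
  unfolding mat_eval_wordB cB_def by (simp only: mat_Tr_unitary_conj[OF U_mem wB_carrier])

lemma mat_eval_centered:
  assumes \<xi>: "\<xi> \<in> space M"
  shows "mat_eval (Suc n) (f \<xi> n) (Poly_Mapping.single (wordA u) 1 *
      (Poly_Mapping.single (wordB w) 1 - (t \<xi> n (Poly_Mapping.single (wordB w) 1) / of_nat (Suc n)) *\<^sub>C 1) *
      Poly_Mapping.single (wordA v) 1) =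
    wA n u * (U (Suc n) \<xi> * b0 n w * mat_adjoint (U (Suc n) \<xi>)) * wA n v"
proof -
  note F = f_carrier[OF \<xi>, of n]
  note W = U_mem[OF \<xi>, of n]
  have "U (Suc n) \<xi> * b0 n w * mat_adjoint (U (Suc n) \<xi>) =
      U (Suc n) \<xi> * wB n w * mat_adjoint (U (Suc n) \<xi>) + (- cB n w) \<cdot>\<^sub>m 1\<^sub>m (Suc n)"
    unfolding b0_def unitary_conj_add[OF W wB_carrier smult_carrier_mat[OF one_carrier_mat]]
      unitary_conj_smult[OF W one_carrier_mat] unitary_conj_one[OF W] ..
  then show ?thesis
    unfolding t_wordB[OF \<xi>]
    unfolding mat_eval_mult[of "f \<xi> n", OF F] mat_eval_wordA[OF \<xi>] diff_scaleC_eq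
      mat_eval_add[of "f \<xi> n", OF F] mat_eval_scaleC[of "f \<xi> n", OF F] mat_eval_wordB[OF \<xi>] mat_eval_one[of "f \<xi> n", OF F]
    by simp
qed

lemma good_sequence:
  assumes "good \<xi>"
  shows "good_sequence (t \<xi>) (h \<xi>) (op_moments x) y \<tau>\<^sub>0"
proof -
  have \<xi>: "\<xi> \<in> space M" and lim: "\<And>u v w. u \<noteq> 0 \<Longrightarrow> v \<noteq> 0 \<Longrightarrow>
     (\<lambda>n. mat_Tr (wA n u * (U (Suc n) \<xi> * b0 n w * mat_adjoint (U (Suc n) \<xi>)) * wA n v)) \<longlonglongrightarrow> 0 \<and>
     (\<lambda>n. hs_norm (wA n u * (U (Suc n) \<xi> * b0 n w * mat_adjoint (U (Suc n) \<xi>)) * wA n v)) \<longlonglongrightarrow> 0"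
    using assms unfolding good_def by blast+
  note F = f_carrier[OF \<xi>]
  interpret trace_hs_sequence "t \<xi>" "h \<xi>" by (rule trace_hs_sequence_mat_eval) (rule F)
  obtain E0 :: "'h set" where "orthonormal_basis E0" using tc unfolding trace_class_def by blast
  then have E: "orthonormal_basis (SOME E :: 'h set. orthonormal_basis E)" by (rule someI)
  interpret X: trace_class_tuple x "SOME E. orthonormal_basis E"
    by unfold_locales (use tc E in auto)
  show ?thesis
  proof
    fix n :: nat and p :: "('k + 'l) nc_poly"
    show "t \<xi> n (star p) = cnj (t \<xi> n p)"
      unfolding mat_eval_star[of "f \<xi> n", OF F] by (rule mat_Tr_adjoint[OF mat_eval_carrier[of "f \<xi> n", OF F]])
  next
    fix u :: "'k nc_word" assume "u \<noteq> 0"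
    then show "(\<lambda>n. t \<xi> n (Poly_Mapping.single (wordA u) 1)) \<longlonglongrightarrow> op_moments x u"
      unfolding mat_eval_wordA[OF \<xi>] by (rule tendsto_wA)
  next
    fix w show "(\<lambda>n. t \<xi> n (Poly_Mapping.single (wordB w) 1) / of_nat (Suc n)) \<longlonglongrightarrow> \<tau>\<^sub>0 (alg_word y w)"
      unfolding t_wordB[OF \<xi>] by (rule tendsto_cB)
  next
    fix u v :: "'k nc_word" and w assume "u \<noteq> 0" "v \<noteq> 0"
    from lim[OF this, of w, folded mat_eval_centered[OF \<xi>]]
    show "(\<lambda>n. t \<xi> n (Poly_Mapping.single (wordA u) 1 *
        (Poly_Mapping.single (wordB w) 1 - (t \<xi> n (Poly_Mapping.single (wordB w) 1) / of_nat (Suc n)) *\<^sub>C 1) *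
        Poly_Mapping.single (wordA v) 1)) \<longlonglongrightarrow> 0 \<and>
      (\<lambda>n. h \<xi> n (Poly_Mapping.single (wordA u) 1 *
        (Poly_Mapping.single (wordB w) 1 - (t \<xi> n (Poly_Mapping.single (wordB w) 1) / of_nat (Suc n)) *\<^sub>C 1) *
        Poly_Mapping.single (wordA v) 1)) \<longlonglongrightarrow> 0" .
  next
    fix e :: real and i assume "e > 0"
    then show "\<exists>Y\<in>nonconst_polys. \<exists>Z\<in>nonconst_polys.
        Re (nc_lin (op_moments x) (star (nc_var i - Y * Z) * (nc_var i - Y * Z))) < e"
      by (rule X.nc_var_approx)
  qed (rule np)
qed

lemma spectrum:
  assumes \<xi>: "\<xi> \<in> space M" and P: "star P = P"
  shows "\<exists>z. sorted_spectrum z \<and>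
    (\<forall>s. s \<noteq> 0 \<longrightarrow> finite {k. z k = s} \<and> card {k. z k = s} = mat_multiplicity (mat_eval (Suc n) (f \<xi> n) P) s) \<and>
    (\<forall>p\<ge>1. (\<lambda>k. z k ^ p) sums Re (t \<xi> n (P ^ p)))"
proof -
  note F = f_carrier[OF \<xi>, of n]
  have "mat_adjoint (mat_eval (Suc n) (f \<xi> n) P) = mat_eval (Suc n) (f \<xi> n) P"
    unfolding mat_eval_star[of "f \<xi> n", OF F, symmetric] P ..
  from hermitian_spectrum[OF mat_eval_carrier[of "f \<xi> n", OF F] this]
  obtain es :: "real list" where es: "char_poly (mat_eval (Suc n) (f \<xi> n) P) = (\<Prod>a\<leftarrow>es. [:- complex_of_real a, 1:])"
    "\<And>p. mat_Tr (mat_eval (Suc n) (f \<xi> n) P ^\<^sub>m p) = complex_of_real (\<Sum>a\<leftarrow>es. a ^ p)" by blast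
  obtain z where z: "sorted_spectrum z" "\<And>t. t \<noteq> 0 \<Longrightarrow> finite {k. z k = t} \<and> card {k. z k = t} = count_list es t"
    "\<And>p. p \<ge> 1 \<Longrightarrow> (\<lambda>k. z k ^ p) sums (\<Sum>a\<leftarrow>es. a ^ p)" using list_sorted_spectrum[of es] by blast
  have m: "mat_multiplicity (mat_eval (Suc n) (f \<xi> n) P) s = count_list es s" for s
    unfolding mat_multiplicity_def es(1) by (rule order_prod_linear_factors)
  have r: "Re (t \<xi> n (P ^ p)) = (\<Sum>a\<leftarrow>es. a ^ p)" for p
    unfolding mat_eval_pow[of "f \<xi> n", OF F] es(2) by (rule Re_complex_of_real)
  show ?thesis
  proof (intro exI[of _ z] conjI allI impI)
    show "sorted_spectrum z" by (rule z(1))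
    show "finite {k. z k = s}" "card {k. z k = s} = mat_multiplicity (mat_eval (Suc n) (f \<xi> n) P) s" if "s \<noteq> 0" for s
      unfolding m using z(2)[OF that] by blast+
    show "(\<lambda>k. z k ^ p) sums Re (t \<xi> n (P ^ p))" if "1 \<le> p" for p
      unfolding r by (rule z(3)[OF that])
  qed
qed

end

theorem corollary4p4:
  fixes A :: "nat \<Rightarrow> 'k::finite \<Rightarrow> complex mat"
    and B :: "nat \<Rightarrow> 'l::finite \<Rightarrow> complex mat"
    and M :: "'w measure"
    and U :: "nat \<Rightarrow> 'w \<Rightarrow> complex mat"
    and x :: "'k \<Rightarrow> 'h \<Rightarrow> 'h::{complex_hilbert_space, second_countable_topology}"
    and y :: "'l \<Rightarrow> 'c::complex_star_algebra"
    and \<tau>\<^sub>0 :: "'c \<Rightarrow> complex"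
    and P :: "('k + 'l) nc_poly"
  assumes "\<And>n i. n \<ge> 1 \<Longrightarrow> A n i \<in> carrier_mat n n"
    and "\<And>n j. n \<ge> 1 \<Longrightarrow> B n j \<in> carrier_mat n n"
    and "prob_space M"
    and "\<And>n. n \<ge> 1 \<Longrightarrow> haar_unitary M n (U n)"
    and "\<And>i. trace_class (x i)"
    and "converges_in_distribution (\<lambda>n. mat_moments mat_Tr n (A n)) (op_moments x)"
    and "nc_probability_space \<tau>\<^sub>0"
    and "converges_in_distribution (\<lambda>n. mat_moments mat_tr n (B n)) (alg_moments \<tau>\<^sub>0 y)"
    and "star P = P"
    and "alg_eval (case_sum (\<lambda>_. 0) (\<lambda>j. nc_var (Inr j))) P = (0 :: ('k + 'l) nc_poly)"
  shows "\<exists>L :: ell2 \<Rightarrow> ell2. selfadjoint_op L \<and> hilbert_schmidt L \<and>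
    (AE \<xi> in M. converges_in_eigenvalues
       (\<lambda>n. mat_multiplicity (mat_eval n
          (case_sum (A n) (\<lambda>j. U n \<xi> * B n j * mat_adjoint (U n \<xi>))) P))
       (op_multiplicity L)) \<and>
    (\<exists>D \<omega> \<tau> (a :: 'k \<Rightarrow> ('k + 'l) nc_poly) (b :: 'l \<Rightarrow> ('k + 'l) nc_poly).
       cyclic_monotone_model (op_moments x) (alg_moments \<tau>\<^sub>0 y) D \<omega> \<tau> a b \<and>
         (\<forall>p\<ge>2. op_trace (L ^^ p) = \<omega> (alg_eval (case_sum a b) P ^ p))) \<and>
    (\<forall>D \<omega> \<tau> (a :: 'k \<Rightarrow> 'd::complex_star_algebra) (b :: 'l \<Rightarrow> 'd).
       cyclic_monotone_model (op_moments x) (alg_moments \<tau>\<^sub>0 y) D \<omega> \<tau> a b \<longrightarrow>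
         (\<forall>p\<ge>2. op_trace (L ^^ p) = \<omega> (alg_eval (case_sum a b) P ^ p)))"
proof -
  interpret haar_conjugation A B M U x y \<tau>\<^sub>0
    by (rule haar_conjugation.intro) (fact assms)+
  define cv where "cv = cyclic_value (op_moments x) (alg_moments \<tau>\<^sub>0 y)"
  have P: "P \<in> polys_on {w. count_A w \<ge> 1}" by (rule polys1_if_vanishing) fact
  \<comment> \<open>The constant of \<open>damped_moment_tendsto\<close>. It involves
    \<open>cv\<close> only, so it is the same for every realization.\<close>
  define C where "C = 1 + Re (nc_lin cv (P * P))"
  have mB: "alg_moments \<tau>\<^sub>0 y 0 = 1" using \<open>nc_probability_space \<tau>\<^sub>0\<close> by (simp add: alg_moments_def nc_probability_space_def)
  have seq: "\<exists>Z. spectrum_sequence Z (damped_moment cv P C) C \<and>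
      (\<forall>n s. s \<noteq> 0 \<longrightarrow> finite {k. Z n k = s} \<and> card {k. Z n k = s} = mat_multiplicity (mat_eval (Suc n) (f \<xi> n) P) s)"
    if g: "good \<xi>" for \<xi>
  proof -
    have \<xi>: "\<xi> \<in> space M" using g by (simp add: good_def)
    interpret G: good_sequence "t \<xi>" "h \<xi>" "op_moments x" y \<tau>\<^sub>0 by (rule good_sequence[OF g])
    have cv: "cv = G.cv" by (simp add: cv_def alg_moments_def[abs_def])
    have "\<forall>n. \<exists>z. sorted_spectrum z \<and>
      (\<forall>s. s \<noteq> 0 \<longrightarrow> finite {k. z k = s} \<and> card {k. z k = s} = mat_multiplicity (mat_eval (Suc n) (f \<xi> n) P) s) \<and>
      (\<forall>p\<ge>1. (\<lambda>k. z k ^ p) sums Re (t \<xi> n (P ^ p)))"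
      using spectrum[OF \<xi> \<open>star P = P\<close>] by blast
    from choice[OF this] obtain Z where Z: "\<And>n. sorted_spectrum (Z n)"
      "\<And>n s. s \<noteq> 0 \<Longrightarrow> finite {k. Z n k = s} \<and> card {k. Z n k = s} = mat_multiplicity (mat_eval (Suc n) (f \<xi> n) P) s"
      "\<And>n p. p \<ge> 1 \<Longrightarrow> (\<lambda>k. Z n k ^ p) sums Re (t \<xi> n (P ^ p))" by blast
    have "spectrum_sequence Z (damped_moment cv P C) C"
    proof
      show "sorted_spectrum (Z n)" for n by (rule Z(1))
      show "summable (\<lambda>k. (Z n k)\<^sup>2)" for n using Z(3)[of 2 n] by (auto simp: sums_iff)
      show "(\<lambda>n. suminf (\<lambda>k. Z n k ^ m)) \<longlonglongrightarrow> damped_moment cv P C m 0" if m: "m \<ge> 2" for m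
      proof -
        have "suminf (\<lambda>k. Z n k ^ m) = Re (t \<xi> n (P ^ m))" for n using Z(3)[of m n] m by (simp add: sums_iff)
        moreover have "(\<lambda>n. Re (t \<xi> n (P ^ m))) \<longlonglongrightarrow> Re (nc_lin cv (P ^ m))"
          unfolding cv by (intro tendsto_Re G.lim_polys2 G.polys1_power2 P m)
        ultimately show ?thesis by (simp add: damped_moment_def)
      qed
      show "damped_moment cv P C m (Suc J) = damped_moment cv P C m J - damped_moment cv P C (m + 2) J / C" for m J
        by (rule damped_moment_Suc)
      show "(\<lambda>J. damped_moment cv P C 2 J) \<longlonglongrightarrow> 0"
        unfolding C_def cv by (rule G.damped_moment_tendsto[OF P \<open>star P = P\<close>])
    qed
    then show ?thesis using Z(2) by blast
  qed
  \<comment> \<open>One good realization suffices to find the limiting eigenvalues: the numbers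
    \<open>damped_moment cv P C\<close> do not depend on it, so by \<open>spectrum_tendsto\<close>
    the same \<open>l\<close> is the limit for all good realizations.\<close>
  obtain \<xi>\<^sub>0 where \<xi>0: "good \<xi>\<^sub>0" using ex_good by blast
  interpret G: good_sequence "t \<xi>\<^sub>0" "h \<xi>\<^sub>0" "op_moments x" y \<tau>\<^sub>0 by (rule good_sequence[OF \<xi>0])
  have cv: "cv = G.cv" by (simp add: cv_def alg_moments_def[abs_def])
  obtain Z0 where "spectrum_sequence Z0 (damped_moment cv P C) C" using seq[OF \<xi>0] by blast
  from spectrum_sequence.spectrum_limit[OF this] obtain l where l: "sorted_spectrum l" "summable (\<lambda>k. (l k)\<^sup>2)"
    "\<And>m. m \<ge> 2 \<Longrightarrow> suminf (\<lambda>k. l k ^ m) = damped_moment cv P C m 0" by blast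
  obtain R where R: "\<And>k. \<bar>l k\<bar> \<le> R" using summable_sq_bounded[OF l(2)] by blast
  define L where "L = diag_op l"
  have L_mult: "finite {k. l k = s} \<and> card {k. l k = s} = op_multiplicity L s" if "s \<noteq> 0" for s
    using finite_level[OF l(2) that] op_multiplicity_diag[OF l(2) that] by (simp add: L_def)
  have conv: "converges_in_eigenvalues
       (\<lambda>n. mat_multiplicity (mat_eval n (case_sum (A n) (\<lambda>j. U n \<xi> * B n j * mat_adjoint (U n \<xi>))) P))
       (op_multiplicity L)" if g: "good \<xi>" for \<xi>
  proof -
    obtain Z where Z: "spectrum_sequence Z (damped_moment cv P C) C"
      "\<And>n s. s \<noteq> 0 \<Longrightarrow> finite {k. Z n k = s} \<and> card {k. Z n k = s} = mat_multiplicity (mat_eval (Suc n) (f \<xi> n) P) s"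
      using seq[OF g] by blast
    interpret spectrum_sequence Z "damped_moment cv P C" C by (rule Z(1))
    have lim: "(\<lambda>n. Z n k) \<longlonglongrightarrow> l k" for k by (rule spectrum_tendsto[OF l])
    have Zn: "nonneg_eigenvalues (mat_multiplicity (mat_eval (Suc n) (f \<xi> n) P)) i = Z n (2 * i)"
      "nonpos_eigenvalues (mat_multiplicity (mat_eval (Suc n) (f \<xi> n) P)) i = Z n (2 * i + 1)" for n i
      by (rule sorted_spectrum_eigenvalues[OF sorted], rule Z(2), assumption)+
    have Ln: "nonneg_eigenvalues (op_multiplicity L) i = l (2 * i)"
      "nonpos_eigenvalues (op_multiplicity L) i = l (2 * i + 1)" for i
      by (rule sorted_spectrum_eigenvalues[OF l(1)], rule L_mult, assumption)+
    note e = Zn[unfolded conj_family_def] Ln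
    show ?thesis unfolding converges_in_eigenvalues_def
    proof (intro conjI allI)
      fix i
      \<comment> \<open>The index starts at size 0, of which nothing is known; a shift by one leaves
        the sizes \<open>Suc n\<close> treated above.\<close>
      show "(\<lambda>n. nonneg_eigenvalues (mat_multiplicity (mat_eval n (case_sum (A n) (\<lambda>j. U n \<xi> * B n j * mat_adjoint (U n \<xi>))) P)) i)
          \<longlonglongrightarrow> nonneg_eigenvalues (op_multiplicity L) i"
        by (rule LIMSEQ_imp_Suc) (simp only: e lim)
      show "(\<lambda>n. nonpos_eigenvalues (mat_multiplicity (mat_eval n (case_sum (A n) (\<lambda>j. U n \<xi> * B n j * mat_adjoint (U n \<xi>))) P)) i)
          \<longlonglongrightarrow> nonpos_eigenvalues (op_multiplicity L) i"
        by (rule LIMSEQ_imp_Suc) (simp only: e lim)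
    qed
  qed
  have P2: "P ^ p \<in> polys_on {w. count_A w \<ge> 2}" if "p \<ge> 2" for p by (rule G.polys1_power2[OF P that])
  have trace: "op_trace (L ^^ p) = nc_lin cv (P ^ p)" if p: "p \<ge> 2" for p
  proof -
    \<comment> \<open>Selfadjointness of \<open>P\<close> makes these values real, so that the real
      parts kept by \<open>damped_moment\<close> lose nothing.\<close>
    have "cnj (nc_lin cv (P ^ p)) = nc_lin cv (star (P ^ p))"
      using G.\<omega>_star[OF G.polys1_power[OF P, of p]] G.\<omega>_polys2[OF P2[OF p]] p
      by (simp add: cv star_power_selfadjoint[OF \<open>star P = P\<close>])
    then have "nc_lin cv (P ^ p) \<in> \<real>" by (simp add: star_power_selfadjoint[OF \<open>star P = P\<close>] Reals_cnj_iff)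
    then have "nc_lin cv (P ^ p) = of_real (Re (nc_lin cv (P ^ p)))" by (simp add: of_real_Re)
    then show ?thesis by (simp add: L_def op_trace_diag_pow[OF l(2) p] l(3)[OF p] damped_moment_def)
  qed
  show ?thesis
  proof (intro exI[of _ L] conjI)
    show "selfadjoint_op L" "hilbert_schmidt L"
      unfolding L_def by (rule selfadjoint_diag[of l R, OF R] hilbert_schmidt_diag[OF l(2)])+
    show "AE \<xi> in M. converges_in_eigenvalues
       (\<lambda>n. mat_multiplicity (mat_eval n (case_sum (A n) (\<lambda>j. U n \<xi> * B n j * mat_adjoint (U n \<xi>))) P))
       (op_multiplicity L)"
      using AE_good by (rule AE_mp) (simp add: conv)
    \<comment> \<open>Existence is witnessed by the free algebra with the limit functional of the
      realization \<open>\<xi>\<^sub>0\<close>. That every other model gives the same numbers holds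
      because independence fixes the values at all words of \<open>P ^ p\<close> for p >= 2.\<close>
    note val = model_poly_value[OF G.cyclic_monotone_model mB P2]
    show "\<exists>D \<omega> \<tau> (a :: 'k \<Rightarrow> ('k + 'l) nc_poly) (b :: 'l \<Rightarrow> ('k + 'l) nc_poly).
       cyclic_monotone_model (op_moments x) (alg_moments \<tau>\<^sub>0 y) D \<omega> \<tau> a b \<and>
         (\<forall>p\<ge>2. op_trace (L ^^ p) = \<omega> (alg_eval (case_sum a b) P ^ p))"
      using G.cyclic_monotone_model val
      by (intro exI conjI) (assumption, simp add: trace cv_def alg_eval_pow)
    show "\<forall>D \<omega> \<tau> (a :: 'k \<Rightarrow> 'd::complex_star_algebra) (b :: 'l \<Rightarrow> 'd).
       cyclic_monotone_model (op_moments x) (alg_moments \<tau>\<^sub>0 y) D \<omega> \<tau> a b \<longrightarrow>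
         (\<forall>p\<ge>2. op_trace (L ^^ p) = \<omega> (alg_eval (case_sum a b) P ^ p))"
      by (intro allI impI) (subst trace, assumption, unfold alg_eval_pow[symmetric] cv_def,
        rule model_poly_value[where mB = "alg_moments \<tau>\<^sub>0 y", OF _ mB P2, symmetric])
  qed
qed

end
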